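(* Let $n\ge 2$, $1\le p<\infty$, $l\in\mathbb{N}$ and let $\phi$ be a function from $\mathbb{R}^+$ to $\mathbb{R}^+$. Let $\Omega=\{(\bar x,y)\in\mathbb{R}^n : \psi(\bar x)<y\}$ be a special Lipschitz domain of $\mathbb{R}^n$ with Lipschitz bound $M$ (the Lipschitz constant of $\psi:\mathbb{R}^{n-1}\to\mathbb{R}$). Let $T:W^{l,p}(\Omega)\to W^{l,p}(\mathbb{R}^n)$ be Stein's extension operator for $\Omega$ (as defined in the context). Then there exists $C>0$ depending only on $n$, $l$ and $M$ such that $$\|D^\alpha Tf\|_{M^{\phi,\delta}_p(\mathbb{R}^n)}\le C\sum_{|\beta|=|\alpha|}\|D^\beta f\|_{M^{\phi,\delta}_p(\Omega)}$$ for all $f\in W^{l,p}(\Omega)$, all $\delta>0$, and all $\alpha\in\mathbb{N}_0^n$ with $|\alpha|\le l$.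
   Context: Notation: $\mathbb{R}^+=(0,\infty)$, $\mathbb{N}_0=\mathbb{N}\cup\{0\}$; points of $\mathbb{R}^n$ ($n\ge2$) are written $(\bar x,y)$ with $\bar x\in\mathbb{R}^{n-1}$, $y\in\mathbb{R}$; $B_r(x)$ is the open ball of center $x$ and radius $r$. Sobolev space: $W^{l,p}(\Omega)$ is the space of $f\in L^p(\Omega)$ with weak derivatives $D^\alpha f\in L^p(\Omega)$ for all $|\alpha|\le l$, with norm $\|f\|_{W^{l,p}(\Omega)}=\sum_{0\le|\alpha|\le l}\|D^\alpha f\|_{L^p(\Omega)}$. Morrey norm: for an open set $\Omega\subset\mathbb{R}^n$, $\phi:\mathbb{R}^+\to\mathbb{R}^+$, $\delta>0$ and $f\in L^p_{loc}(\Omega)$, $$\|f\|_{M^{\phi,\delta}_p(\Omega)}:=\sup_{x\in\Omega,\,0<r<\delta}\left(\frac{1}{\phi(r)}\int_{B_r(x)\cap\Omega}|f(y)|^p\,dy\right)^{1/p}\in[0,\infty].$$ Special Lipschitz domain: a set $\Omega=\{(\bar x,y)\in\mathbb{R}^n:\psi(\bar x)<y\}$ with $\psi:\mathbb{R}^{n-1}\to\mathbb{R}$ Lipschitz continuous; its Lipschitz bound $M$ is the Lipschitz constant of $\psi$. Regularized distance: $\Delta\in C^\infty(\mathbb{R}^n\setminus\bar\Omega)$ is a fixed function such that, for all $x\in\mathbb{R}^n\setminus\bar\Omega$, $c_1 d(x,\bar\Omega)\le\Delta(x)\le c_2 d(x,\bar\Omega)$ and $|D^\alpha\Delta(x)|\le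 B_\alpha d(x,\bar\Omega)^{1-|\alpha|}$ for all $\alpha\in\mathbb{N}_0^n$, where $d(x,\bar\Omega)$ is the Euclidean distance and $c_1,c_2,B_\alpha>0$ are fixed constants independent of $x$ and $\Omega$. Moreover $c_3>0$ is a fixed constant depending only on $M$ such that $c_3\Delta(\bar x,y)\ge\psi(\bar x)-y$ for all $(\bar x,y)\in\mathbb{R}^n\setminus\bar\Omega$. (Such $\Delta$ and $c_3$ exist.) Put $\delta^*(\bar x,y)=2c_3\Delta(\bar x,y)$. Function $\tau$: a fixed continuous function $\tau:[1,\infty)\to\mathbb{R}$ (chosen once and for all) with $\tau(\lambda)=O(\lambda^{-N})$ as $\lambda\to\infty$ for every $N>0$, $\int_1^\infty\tau(\lambda)\,d\lambda=1$ and $\int_1^\infty\lambda^k\tau(\lambda)\,d\lambda=0$ for every integer $k\ge1$. Stein's extension operator: let $C_b^\infty(\bar\Omega)$ be the set of $f\in C^\infty(\bar\Omega)$ with $D^\alpha f$ bounded for all $\alpha\in\mathbb{N}_0^n$. For $f\in C_b^\infty(\bar\Omega)$ define $$Tf(\bar x,y)=\begin{cases} f(\bar x,y), & y\ge\psi(\bar x),\\ \int_1^\infty f(\bar x,y+\lambda\delta^*(\bar x,y))\,\tau(\lambda)\,d\lambda, & y<\psi(\bar x).\end{cases}$$ By Stein's theorem, $Tf\in C^\infty(\mathbb{R}^n)$ and $\|Tf\|_{W^{l,p}(\mathbb{R}^n)}\le S\|f\|_{W^{l,p}(\Omega)}$ with $S$ depending only on $n,l,M$, and $T$ admits a unique linear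 continuous extension from $C_b^\infty(\bar\Omega)\cap W^{l,p}(\Omega)$ to a map $T:W^{l,p}(\Omega)\to W^{l,p}(\mathbb{R}^n)$. For $1\le p<\infty$ it is given as follows: let $\Gamma=\{(\bar x,y)\in\mathbb{R}^n: M|\bar x|<|y|,\ y<0\}$ and let $\eta\in C_c^\infty(\mathbb{R}^n)$ be non-negative with $\int_{\mathbb{R}^n}\eta=1$ and support contained in $\Gamma$; for $f\in W^{l,p}(\Omega)$ and $\varepsilon>0$ put $f_\varepsilon(x)=\int_{\mathbb{R}^n}f(x-\varepsilon y)\eta(y)\,dy$, which is well defined for $x$ in a neighbourhood of $\bar\Omega$ and belongs to $C_b^\infty(\bar\Omega)\cap W^{l,p}(\Omega)$; then $Tf$ is the limit of $Tf_\varepsilon$ in $W^{l,p}(\mathbb{R}^n)$ as $\varepsilon\to0$. *)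

theory Defs
  imports "HOL-Analysis.Analysis" "HOL-Library.Landau_Symbols"
begin

section \<open>Multi-indices and smooth functions\<close>

text \<open>A multi-index counts derivatives in each of the coordinate directions, that is, the
  elements of \<^term>\<open>Basis\<close>; it is set to zero elsewhere so that multi-indices are unique.\<close>

definition multi_indices :: "('a::euclidean_space \<Rightarrow> nat) set" where
  "multi_indices = {\<alpha>. \<forall>b. b \<notin> Basis \<longrightarrow> \<alpha> b = 0}"

definition mi_order :: "('a::euclidean_space \<Rightarrow> nat) \<Rightarrow> nat" where
  "mi_order \<alpha> = (\<Sum>b\<in>Basis. \<alpha> b)"

lemma finite_multi_indices_le: "finite {\<alpha> \<in> multi_indices. mi_order \<alpha> \<le> k}"
proof (rule finite_subset)
  show "{\<alpha> \<in> multi_indices. mi_order \<alpha> \<le> k} \<subseteq>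
      {\<alpha> :: 'a \<Rightarrow> nat. \<forall>b. (b \<in> Basis \<longrightarrow> \<alpha> b \<in> {..k}) \<and> (b \<notin> Basis \<longrightarrow> \<alpha> b = 0)}"
  proof (intro subsetI CollectI allI conjI impI)
    fix \<alpha> :: "'a \<Rightarrow> nat" and b :: 'a
    assume "\<alpha> \<in> {\<alpha> \<in> multi_indices. mi_order \<alpha> \<le> k}" "b \<in> Basis"
    moreover from \<open>b \<in> Basis\<close> have "\<alpha> b \<le> mi_order \<alpha>"
      unfolding mi_order_def by (intro member_le_sum) auto
    ultimately show "\<alpha> b \<in> {..k}" by simp
  qed (simp add: multi_indices_def)
qed (intro finite_set_of_finite_funs; simp)

lemma finite_multi_indices_eq: "finite {\<alpha> \<in> multi_indices. mi_order \<alpha> = k}"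
  by (rule finite_subset[OF _ finite_multi_indices_le[of k]]) auto

text \<open>For open \<open>S\<close>: \<open>f\<close> is smooth on \<open>S\<close> and \<open>D \<alpha>\<close> is its classical partial derivative of
  multi-index \<open>\<alpha>\<close>.\<close>

definition smooth_partials ::
    "'a::euclidean_space set \<Rightarrow> ('a \<Rightarrow> real) \<Rightarrow> (('a \<Rightarrow> nat) \<Rightarrow> 'a \<Rightarrow> real) \<Rightarrow> bool" where
  "smooth_partials S f D \<longleftrightarrow>
     (\<forall>x\<in>S. D (\<lambda>_. 0) x = f x) \<and>
     (\<forall>\<alpha>\<in>multi_indices. continuous_on S (D \<alpha>) \<and>
       (\<forall>b\<in>Basis. \<forall>x\<in>S.
         ((\<lambda>t. D \<alpha> (x + t *\<^sub>R b)) has_real_derivative D (\<alpha>(b := Suc (\<alpha> b))) x) (at 0)))"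

text \<open>The functions in \<open>C\<^sup>\<infinity>(closure S)\<close>, for open \<open>S\<close>, all of whose derivatives are bounded.\<close>

definition Cb_infty_closure :: "'a::euclidean_space set \<Rightarrow> ('a \<Rightarrow> real) set" where
  "Cb_infty_closure S = {f. \<exists>D. smooth_partials S f D \<and>
     (\<forall>x\<in>closure S. D (\<lambda>_. 0) x = f x) \<and>
     (\<forall>\<alpha>\<in>multi_indices. continuous_on (closure S) (D \<alpha>) \<and> bounded (D \<alpha> ` closure S))}"

section \<open>Sobolev spaces and Morrey norms\<close>

text \<open>Functions on a subset of \<open>'a\<close> are represented by total functions whose values outside the
  subset are irrelevant.\<close>

definition ennreal_powr :: "ennreal \<Rightarrow> real \<Rightarrow> ennreal" where
  "ennreal_powr x a = (if x = \<infinity> then \<infinity> else ennreal (enn2real x powr a))"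

definition Lp_norm :: "real \<Rightarrow> 'a::euclidean_space set \<Rightarrow> ('a \<Rightarrow> real) \<Rightarrow> ennreal" where
  "Lp_norm p S f = ennreal_powr (\<integral>\<^sup>+x\<in>S. ennreal (\<bar>f x\<bar> powr p) \<partial>lebesgue) (1 / p)"

definition Lp_space :: "real \<Rightarrow> 'a::euclidean_space set \<Rightarrow> ('a \<Rightarrow> real) set" where
  "Lp_space p S = {f \<in> borel_measurable (lebesgue_on S). Lp_norm p S f < \<infinity>}"

definition locally_integrable :: "'a::euclidean_space set \<Rightarrow> ('a \<Rightarrow> real) \<Rightarrow> bool" where
  "locally_integrable S f \<longleftrightarrow> (\<forall>K. compact K \<and> K \<subseteq> S \<longrightarrow> set_integrable lebesgue K f)"

definition has_weak_deriv ::
    "'a::euclidean_space set \<Rightarrow> ('a \<Rightarrow> nat) \<Rightarrow> ('a \<Rightarrow> real) \<Rightarrow> ('a \<Rightarrow> real) \<Rightarrow> bool" where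
  "has_weak_deriv S \<alpha> f g \<longleftrightarrow> locally_integrable S f \<and> locally_integrable S g \<and>
     (\<forall>h D. smooth_partials UNIV h D \<and> compact (closure {x. h x \<noteq> 0}) \<and> closure {x. h x \<noteq> 0} \<subseteq> S \<longrightarrow>
        (LINT x:S|lebesgue. f x * D \<alpha> x) =
        (- 1) ^ mi_order \<alpha> * (LINT x:S|lebesgue. g x * h x))"

text \<open>Determined up to a null subset of \<open>S\<close>, if it exists.\<close>

definition weak_deriv ::
    "'a::euclidean_space set \<Rightarrow> ('a \<Rightarrow> nat) \<Rightarrow> ('a \<Rightarrow> real) \<Rightarrow> 'a \<Rightarrow> real" where
  "weak_deriv S \<alpha> f = (SOME g. has_weak_deriv S \<alpha> f g)"

definition sobolev :: "nat \<Rightarrow> real \<Rightarrow> 'a::euclidean_space set \<Rightarrow> ('a \<Rightarrow> real) set" where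
  "sobolev l p S = {f \<in> Lp_space p S.
     \<forall>\<alpha>\<in>multi_indices. mi_order \<alpha> \<le> l \<longrightarrow> (\<exists>g\<in>Lp_space p S. has_weak_deriv S \<alpha> f g)}"

definition sobolev_norm ::
    "nat \<Rightarrow> real \<Rightarrow> 'a::euclidean_space set \<Rightarrow> ('a \<Rightarrow> real) \<Rightarrow> ennreal" where
  "sobolev_norm l p S f =
     (\<Sum>\<alpha> | \<alpha> \<in> multi_indices \<and> mi_order \<alpha> \<le> l. Lp_norm p S (weak_deriv S \<alpha> f))"

definition morrey_norm ::
    "(real \<Rightarrow> real) \<Rightarrow> real \<Rightarrow> real \<Rightarrow> 'a::euclidean_space set \<Rightarrow> ('a \<Rightarrow> real) \<Rightarrow> ennreal" where
  "morrey_norm \<phi> \<delta> p S f =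
     (SUP (x, r) \<in> S \<times> {0<..<\<delta>}.
        ennreal_powr (ennreal (1 / \<phi> r) *
          (\<integral>\<^sup>+y\<in>ball x r \<inter> S. ennreal (\<bar>f y\<bar> powr p) \<partial>lebesgue)) (1 / p))"

section \<open>Stein's extension operator\<close>

text \<open>Points \<open>(x, y)\<close> of n-dimensional Euclidean space, \<open>n = CARD('m) + 1 \<ge> 2\<close>, are elements
  of \<^typ>\<open>(real^'m) \<times> real\<close>, whose norm is the Euclidean one.\<close>

definition special_domain :: "(real^'m \<Rightarrow> real) \<Rightarrow> ((real^'m) \<times> real) set" where
  "special_domain \<psi> = {(x, y). \<psi> x < y}"

definition regularized_distance ::
    "real \<Rightarrow> real \<Rightarrow> (('a::euclidean_space \<Rightarrow> nat) \<Rightarrow> real) \<Rightarrow> 'a set \<Rightarrow> ('a \<Rightarrow> real) \<Rightarrow> bool" where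
  "regularized_distance c1 c2 B S \<Delta> \<longleftrightarrow>
     (\<forall>x. x \<notin> closure S \<longrightarrow>
        c1 * infdist x (closure S) \<le> \<Delta> x \<and> \<Delta> x \<le> c2 * infdist x (closure S)) \<and>
     (\<exists>D. smooth_partials (- closure S) \<Delta> D \<and>
       (\<forall>\<alpha>\<in>multi_indices. \<forall>x. x \<notin> closure S \<longrightarrow>
          \<bar>D \<alpha> x\<bar> \<le> B \<alpha> * infdist x (closure S) powi (1 - int (mi_order \<alpha>))))"

definition stein_kernel :: "(real \<Rightarrow> real) \<Rightarrow> bool" where
  "stein_kernel \<tau> \<longleftrightarrow> continuous_on {1..} \<tau> \<and>
     (\<forall>N>0. \<tau> \<in> O[at_top](\<lambda>s. s powr - N)) \<and>
     (LINT s:{1..}|lborel. \<tau> s) = 1 \<and>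
     (\<forall>k::nat\<ge>1. (LINT s:{1..}|lborel. s ^ k * \<tau> s) = 0)"

definition stein_formula ::
    "(real^'m \<Rightarrow> real) \<Rightarrow> ((real^'m) \<times> real \<Rightarrow> real) \<Rightarrow> (real \<Rightarrow> real) \<Rightarrow>
     ((real^'m) \<times> real \<Rightarrow> real) \<Rightarrow> (real^'m) \<times> real \<Rightarrow> real" where
  "stein_formula \<psi> \<delta>\<^sub>s \<tau> f = (\<lambda>(x, y).
     if \<psi> x \<le> y then f (x, y)
     else LINT s:{1..}|lborel. f (x, y + s * \<delta>\<^sub>s (x, y)) * \<tau> s)"

text \<open>\<open>T\<close> is the linear continuous extension of the above from the smooth functions to the
  Sobolev space.  Elements of Sobolev spaces are determined up to null sets only; that \<open>T\<close>
  respects this follows from linearity and continuity.  Since the smooth functions are dense for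
  \<open>1 \<le> p < \<infinity>\<close>, \<open>T f\<close> is determined up to a null set.\<close>

definition stein_operator ::
    "nat \<Rightarrow> real \<Rightarrow> (real^'m \<Rightarrow> real) \<Rightarrow> ((real^'m) \<times> real \<Rightarrow> real) \<Rightarrow> (real \<Rightarrow> real) \<Rightarrow>
     (((real^'m) \<times> real \<Rightarrow> real) \<Rightarrow> ((real^'m) \<times> real \<Rightarrow> real)) \<Rightarrow> bool" where
  "stein_operator l p \<psi> \<delta>\<^sub>s \<tau> T \<longleftrightarrow>
     (let \<Omega> = special_domain \<psi> in
       (\<forall>f \<in> sobolev l p \<Omega>. T f \<in> sobolev l p UNIV) \<and>
       (\<forall>f \<in> sobolev l p \<Omega>. \<forall>g \<in> sobolev l p \<Omega>. \<forall>a b.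
          AE z in lebesgue. T (\<lambda>z. a * f z + b * g z) z = a * T f z + b * T g z) \<and>
       (\<exists>K::real. \<forall>f \<in> sobolev l p \<Omega>.
          sobolev_norm l p UNIV (T f) \<le> ennreal K * sobolev_norm l p \<Omega> f) \<and>
       (\<forall>f \<in> Cb_infty_closure \<Omega> \<inter> sobolev l p \<Omega>.
          AE z in lebesgue. T f z = stein_formula \<psi> \<delta>\<^sub>s \<tau> f z))"

end

theory Submission
  imports Defs
begin

text \<open>Below the graph, repeated differentiation of \<open>T f\<close> produces integrals
  \<open>a(x) \<integral> \<kappa>(\<lambda>) D\<^sup>\<beta>f(x, y + \<lambda> \<delta>\<^sup>*) d\<lambda>\<close>. Whenever the coefficient is not constant, all moments of \<open>\<kappa>\<close>
  vanish, so an integration by parts in \<open>\<lambda>\<close> gains a factor \<open>\<delta>\<^sup>*\<close> and a vertical derivative. Hence every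
  term can be kept with \<open>|\<beta>| = |\<alpha>|\<close> and a coefficient that is bounded uniformly in the domain.
  Substituting in the vertical variable bounds these terms by averages, with weight \<open>s\<close> to the power
  \<open>-(n + 2)\<close>, of \<open>D\<^sup>\<beta>f\<close> over the reflected points \<open>(x, \<psi>(x) + s (\<psi>(x) - y))\<close>. The reflection maps a ball
  of radius \<open>r\<close> into one of radius \<open>C s r\<close>, which is covered by \<open>O(s\<^sup>n)\<close> balls of radius \<open>r\<close> centred in
  \<open>\<Omega>\<close>; Jensen's inequality then gives the estimate for smooth functions ball by ball, with the same
  \<open>\<phi>(r)\<close>. Mollification inside the cone preserves the bounds on balls, and the general case follows
  from the continuity of \<open>T\<close>. The graph is a null set and weak derivatives are unique, so smoothness
  of \<open>T f\<close> across it is not needed.\<close>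

subsection \<open>Bump functions\<close>

text \<open>The constant has to serve all p, all \<phi> and all domains with the same M. As \<phi>
  is arbitrary, different radii cannot be compared: every step keeps r and pays with a number of
  balls, whose centres must lie in \<Omega> because only such balls occur on the right. As p is
  arbitrary, constants are carried as p-th powers of numbers independent of p, at the price of crude
  inequalities. As the domain is arbitrary, the differentiated formula is handled symbolically: a
  finite list of terms, with coefficients polynomial in the derivatives of an unspecified distance,
  is fixed first, and the geometry is inserted afterwards. The obstacle is that \<tau> has integral
  1, so integrating by parts against it leaves a boundary term. This does no harm: differentiating
  the moving point y + \<lambda> \<open>\<delta>\<^sup>*\<close> brings down a factor \<lambda>, and
  \<lambda> \<tau>(\<lambda>) has only vanishing moments, while terms that still contain \<tau> have
  constant coefficients. The exponent n + 2 spends n powers of s on the number of covering balls and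
  leaves an integrable inverse square.\<close>

definition smooth_seq :: "(nat \<Rightarrow> real \<Rightarrow> real) \<Rightarrow> bool" where
  "smooth_seq u \<longleftrightarrow> (\<forall>k t. (u k has_real_derivative u (Suc k) t) (at t))"

text \<open>This class is closed under differentiation, so one recursion on polynomials describes
  all derivatives of exp (-1/t) continued by zero.\<close>

definition flat_fun :: "real poly \<Rightarrow> real \<Rightarrow> real" where
  "flat_fun q t = (if t \<le> 0 then 0 else poly q (inverse t) * exp (- inverse t))"

lemma poly_times_exp_neg_tendsto_0:
  "((\<lambda>s. poly q s * exp (- s)) \<longlongrightarrow> (0::real)) at_top"
proof -
  have "((\<lambda>s. \<Sum>i\<le>degree q. coeff q i * (s ^ i / exp s)) \<longlongrightarrow> (\<Sum>i\<le>degree q. coeff q i * 0)) at_top"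
    by (intro tendsto_sum tendsto_mult tendsto_const tendsto_power_div_exp_0)
  moreover have "(\<lambda>s. \<Sum>i\<le>degree q. coeff q i * (s ^ i / exp s)) = (\<lambda>s. poly q s * exp (- s))"
    by (auto simp: poly_altdef sum_distrib_right exp_minus divide_inverse mult.assoc)
  ultimately show ?thesis by simp
qed

text \<open>With u = 1/t one has u' = -u^2, so q(u) exp(-u) has the derivative u^2 (q - q')(u)
  exp(-u); this is the factor \<open>[:0,0,1:]\<close>. At 0 the right difference quotient tends to
  0 because the exponential beats every polynomial.\<close>

lemma flat_fun_has_derivative:
  "(flat_fun q has_real_derivative flat_fun ([:0,0,1:] * (q - pderiv q)) t) (at t)"
proof -
  consider "t < 0" | "t = 0" | "t > 0" by linarith
  then show ?thesis
  proof cases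
    case 1
    have "(flat_fun q has_real_derivative 0) (at t)"
      by (rule has_field_derivative_transform_within_open[of "\<lambda>_. 0" 0 t "{..<0}"])
         (use 1 in \<open>auto simp: flat_fun_def\<close>)
    with 1 show ?thesis by (simp add: flat_fun_def)
  next
    case 2
    have r: "((\<lambda>y. flat_fun q y / y) \<longlongrightarrow> 0) (at_right 0)"
    proof -
      \<comment> \<open>Dividing by y raises the degree by one: q(1/y) / y is the value of
        \<open>[:0,1:] * q\<close> at 1/y.\<close>
      have "((\<lambda>y. poly ([:0,1:] * q) (inverse y) * exp (- inverse y)) \<longlongrightarrow> (0::real)) (at_right 0)"
        by (rule filterlim_compose[OF poly_times_exp_neg_tendsto_0 filterlim_inverse_at_top_right])
      moreover have "eventually (\<lambda>y::real. poly ([:0,1:] * q) (inverse y) * exp (- inverse y) = flat_fun q y / y) (at_right 0)"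
        unfolding eventually_at_filter by (intro always_eventually) (auto simp: flat_fun_def field_simps)
      ultimately show ?thesis by (rule Lim_transform_eventually)
    qed
    have l: "((\<lambda>y. flat_fun q y / y) \<longlongrightarrow> 0) (at_left 0)"
    proof (rule Lim_transform_eventually[OF tendsto_const])
      show "eventually (\<lambda>y::real. 0 = flat_fun q y / y) (at_left 0)"
        unfolding eventually_at_filter by (intro always_eventually) (auto simp: flat_fun_def)
    qed
    have "((\<lambda>y. flat_fun q y / y) \<longlongrightarrow> 0) (at 0)"
      using l r filterlim_split_at by blast
    with 2 show ?thesis by (simp add: has_field_derivative_iff flat_fun_def)
  next
    case 3
    have "((\<lambda>t. poly q (inverse t) * exp (- inverse t)) has_real_derivative
        flat_fun ([:0,0,1:] * (q - pderiv q)) t) (at t)"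
      using 3 by (auto intro!: derivative_eq_intros simp: flat_fun_def field_simps power2_eq_square)
    then show ?thesis
      by (rule has_field_derivative_transform_within_open[of _ _ _ "{0<..}"])
         (use 3 in \<open>auto simp: flat_fun_def\<close>)
  qed
qed

definition flat_seq :: "nat \<Rightarrow> real \<Rightarrow> real" where
  "flat_seq k = flat_fun (((\<lambda>q. [:0,0,1:] * (q - pderiv q)) ^^ k) 1)"

lemma smooth_seq_flat_seq: "smooth_seq flat_seq"
  unfolding smooth_seq_def flat_seq_def using flat_fun_has_derivative by simp

lemma flat_seq_0: "flat_seq 0 t = (if t \<le> 0 then 0 else exp (- inverse t))"
  by (simp add: flat_seq_def flat_fun_def)

lemma smooth_seq_affine:
  assumes "smooth_seq u"
  shows "smooth_seq (\<lambda>k t. c ^ k * u k (c * t + d))"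
  unfolding smooth_seq_def
proof (intro allI)
  fix k t
  have "(u k has_real_derivative u (Suc k) (c * t + d)) (at (c * t + d))"
    using assms by (simp add: smooth_seq_def)
  then have "((\<lambda>t. u k (c * t + d)) has_real_derivative u (Suc k) (c * t + d) * c) (at t)"
    by (rule DERIV_chain2) (auto intro!: derivative_eq_intros)
  then show "((\<lambda>t. c ^ k * u k (c * t + d)) has_real_derivative c ^ Suc k * u (Suc k) (c * t + d)) (at t)"
    by (auto intro!: derivative_eq_intros)
qed

text \<open>The product rule without binomial coefficients: each step decides which factor receives
  the next derivative and records this by shifting its sequence.\<close>

fun leibniz :: "nat \<Rightarrow> (nat \<Rightarrow> real \<Rightarrow> real) \<Rightarrow> (nat \<Rightarrow> real \<Rightarrow> real) \<Rightarrow> real \<Rightarrow> real" where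
  "leibniz 0 u v = (\<lambda>t. u 0 t * v 0 t)"
| "leibniz (Suc k) u v = (\<lambda>t. leibniz k (\<lambda>i. u (Suc i)) v t + leibniz k u (\<lambda>i. v (Suc i)) t)"

lemma smooth_seq_leibniz:
  assumes "smooth_seq u" "smooth_seq v"
  shows "smooth_seq (\<lambda>k. leibniz k u v)"
proof -
  have "(leibniz k u v has_real_derivative leibniz (Suc k) u v t) (at t)"
    if "smooth_seq u" "smooth_seq v" for k t u v
    using that
  proof (induction k arbitrary: u v)
    case 0
    then have u: "(u 0 has_real_derivative u (Suc 0) t) (at t)"
      and v: "(v 0 has_real_derivative v (Suc 0) t) (at t)" by (auto simp: smooth_seq_def)
    show ?case using DERIV_mult[OF u v] by (simp add: mult.commute)
  next
    case (Suc k)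
    have "smooth_seq (\<lambda>i. u (Suc i))" "smooth_seq (\<lambda>i. v (Suc i))"
      using Suc.prems by (auto simp: smooth_seq_def)
    with Suc show ?case
      by (subst leibniz.simps(2), subst leibniz.simps(2)) (intro DERIV_add Suc.IH)
  qed
  with assms show ?thesis by (auto simp: smooth_seq_def)
qed

text \<open>Along a line in direction b only the factor belonging to b varies, the others being
  constants.\<close>

lemma smooth_partials_prod:
  fixes U :: "'a::euclidean_space \<Rightarrow> nat \<Rightarrow> real \<Rightarrow> real"
  assumes "\<And>i. i \<in> Basis \<Longrightarrow> smooth_seq (U i)"
  shows "smooth_partials UNIV (\<lambda>x. \<Prod>i\<in>Basis. U i 0 (x \<bullet> i)) (\<lambda>\<alpha> x. \<Prod>i\<in>Basis. U i (\<alpha> i) (x \<bullet> i))"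
  unfolding smooth_partials_def
proof (intro conjI ballI)
  have cU: "continuous_on UNIV (U i k)" if "i \<in> Basis" for i k
    using assms[OF that] unfolding smooth_seq_def
    by (meson DERIV_isCont continuous_at_imp_continuous_on)
  fix \<alpha> :: "'a \<Rightarrow> nat" assume "\<alpha> \<in> multi_indices"
  show "continuous_on UNIV (\<lambda>x. \<Prod>i\<in>Basis. U i (\<alpha> i) (x \<bullet> i))"
    by (intro continuous_on_prod continuous_on_compose2[OF cU] continuous_intros) auto
  fix b x :: 'a assume b: "b \<in> Basis"
  have eq: "(\<Prod>i\<in>Basis. U i (\<alpha>' i) ((x + t *\<^sub>R b) \<bullet> i)) =
      U b (\<alpha>' b) (x \<bullet> b + t) * (\<Prod>i\<in>Basis-{b}. U i (\<alpha>' i) (x \<bullet> i))" for t \<alpha>'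
  proof -
    have "(x + t *\<^sub>R b) \<bullet> i = x \<bullet> i" if "i \<in> Basis - {b}" for i
      using that b by (auto simp: inner_add_left inner_not_same_Basis)
    then have "(\<Prod>i\<in>Basis-{b}. U i (\<alpha>' i) ((x + t *\<^sub>R b) \<bullet> i)) = (\<Prod>i\<in>Basis-{b}. U i (\<alpha>' i) (x \<bullet> i))"
      by (intro prod.cong) auto
    then show ?thesis
      using b by (subst prod.remove[OF finite_Basis b]) (simp add: inner_add_left)
  qed
  have "(U b (\<alpha> b) has_real_derivative U b (Suc (\<alpha> b)) (x \<bullet> b + 0)) (at (x \<bullet> b + 0))"
    using assms[OF b] by (simp add: smooth_seq_def)
  then have "((\<lambda>t. U b (\<alpha> b) (x \<bullet> b + t)) has_real_derivative U b (Suc (\<alpha> b)) (x \<bullet> b + 0) * 1) (at 0)"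
    by (rule DERIV_chain2) (auto intro!: derivative_eq_intros)
  then have "((\<lambda>t. U b (\<alpha> b) (x \<bullet> b + t)) has_real_derivative U b (Suc (\<alpha> b)) (x \<bullet> b)) (at 0)"
    by simp
  then have "((\<lambda>t. U b (\<alpha> b) (x \<bullet> b + t) * (\<Prod>i\<in>Basis-{b}. U i (\<alpha> i) (x \<bullet> i))) has_real_derivative
      U b (Suc (\<alpha> b)) (x \<bullet> b) * (\<Prod>i\<in>Basis-{b}. U i (\<alpha> i) (x \<bullet> i))) (at 0)"
    by (rule DERIV_cmult_right)
  moreover have "(\<Prod>i\<in>Basis. U i ((\<alpha>(b := Suc (\<alpha> b))) i) (x \<bullet> i)) =
      U b (Suc (\<alpha> b)) (x \<bullet> b) * (\<Prod>i\<in>Basis-{b}. U i (\<alpha> i) (x \<bullet> i))"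
  proof -
    have "(\<Prod>i\<in>Basis-{b}. U i ((\<alpha>(b := Suc (\<alpha> b))) i) (x \<bullet> i)) = (\<Prod>i\<in>Basis-{b}. U i (\<alpha> i) (x \<bullet> i))"
      by (intro prod.cong) auto
    then show ?thesis using eq[of "\<alpha>(b := Suc (\<alpha> b))" 0] by simp
  qed
  ultimately show "((\<lambda>t. \<Prod>i\<in>Basis. U i (\<alpha> i) ((x + t *\<^sub>R b) \<bullet> i)) has_real_derivative
      (\<Prod>i\<in>Basis. U i ((\<alpha>(b := Suc (\<alpha> b))) i) (x \<bullet> i))) (at 0)"
    unfolding eq by simp
qed auto

text \<open>The parameter \<open>k\<close> makes the bumps converge to the indicator of the box.\<close>

definition box_bump :: "'a::euclidean_space \<Rightarrow> 'a \<Rightarrow> nat \<Rightarrow> 'a \<Rightarrow> real" where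
  "box_bump a b k x =
     (\<Prod>i\<in>Basis. flat_seq 0 (real k * (x \<bullet> i - a \<bullet> i)) * flat_seq 0 (real k * (b \<bullet> i - x \<bullet> i)))"

lemma box_bump_smooth: "\<exists>D. smooth_partials UNIV (box_bump a b k) D"
proof -
  define u where "u i j t = real k ^ j * flat_seq j (real k * t + (- real k * (a \<bullet> i)))" for i :: 'a and j t
  define v where "v i j t = (- real k) ^ j * flat_seq j (- real k * t + (real k * (b \<bullet> i)))" for i :: 'a and j t
  have "smooth_seq (u i)" "smooth_seq (v i)" for i
    unfolding u_def v_def by (rule smooth_seq_affine[OF smooth_seq_flat_seq])+
  from smooth_partials_prod[of "\<lambda>i j. leibniz j (u i) (v i)", OF smooth_seq_leibniz[OF this]]
  show ?thesis
    by (auto simp: box_bump_def[abs_def] u_def v_def algebra_simps intro!: exI)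
qed

lemma box_bump_nonneg: "0 \<le> box_bump a b k x"
  unfolding box_bump_def by (intro prod_nonneg) (auto simp: flat_seq_0)

lemma flat_seq_0_le_1: "flat_seq 0 t \<le> 1"
  by (simp add: flat_seq_0)

lemma box_bump_le_1: "box_bump a b k x \<le> 1"
  unfolding box_bump_def by (intro prod_le_1 conjI mult_le_one flat_seq_0_le_1) (auto simp: flat_seq_0)

lemma box_bump_eq_0: 
  assumes "x \<notin> box a b" shows "box_bump a b k x = 0"
proof -
  obtain i where i: "i \<in> Basis" "x \<bullet> i \<le> a \<bullet> i \<or> b \<bullet> i \<le> x \<bullet> i"
    using assms by (force simp: box_def)
  then have "flat_seq 0 (real k * (x \<bullet> i - a \<bullet> i)) * flat_seq 0 (real k * (b \<bullet> i - x \<bullet> i)) = 0"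
    by (auto simp: flat_seq_0 mult_nonneg_nonpos mult_le_0_iff)
  with i show ?thesis unfolding box_bump_def by (auto intro!: prod_zero simp del: mult_eq_0_iff)
qed

lemma box_bump_pos:
  assumes "x \<in> box a b" "k > 0" shows "box_bump a b k x > 0"
  unfolding box_bump_def using assms
  by (intro prod_pos) (auto simp: flat_seq_0 box_def not_le mult_le_0_iff)

lemma box_bump_support: "closure {x. box_bump a b k x \<noteq> 0} \<subseteq> cbox a b"
proof (rule closure_minimal)
  show "{x. box_bump a b k x \<noteq> 0} \<subseteq> cbox a b"
    using box_bump_eq_0[of _ a b k] box_subset_cbox[of a b] by blast
qed (rule closed_cbox)

text \<open>Inside the box every factor is exp (-1 / (k c)) with a fixed c > 0. Together with the
  bound by 1 this makes smooth test functions converge boundedly to the indicator of an open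
  box.\<close>

lemma box_bump_tendsto: "(\<lambda>k. box_bump a b k x) \<longlonglongrightarrow> indicator (box a b) x"
proof (cases "x \<in> box a b")
  case True
  have *: "(\<lambda>k. flat_seq 0 (real k * c)) \<longlonglongrightarrow> 1" if "c > 0" for c
  proof -
    have "filterlim (\<lambda>k. real k * c) at_top sequentially"
      using filterlim_tendsto_pos_mult_at_top[OF tendsto_const that filterlim_real_sequentially]
      by (simp add: mult.commute)
    then have "(\<lambda>k. inverse (real k * c)) \<longlonglongrightarrow> 0"
      by (rule tendsto_inverse_0_at_top)
    then have "(\<lambda>k. exp (- inverse (real k * c))) \<longlonglongrightarrow> exp (-0)"
      by (intro tendsto_intros)
    then have "(\<lambda>k. exp (- inverse (real k * c))) \<longlonglongrightarrow> 1" by simp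
    then show ?thesis
      by (rule Lim_transform_eventually)
         (use that in \<open>auto simp: flat_seq_0 eventually_sequentially mult_le_0_iff intro!: exI[of _ 1]\<close>)
  qed
  have "(\<lambda>k. box_bump a b k x) \<longlonglongrightarrow> (\<Prod>i\<in>(Basis::'a set). 1 * 1)"
    unfolding box_bump_def using True
    by (intro tendsto_prod tendsto_mult *) (auto simp: box_def)
  with True show ?thesis by simp
next
  case False
  then show ?thesis using box_bump_eq_0[OF False] by simp
qed

subsection \<open>Uniqueness of weak derivatives\<close>

lemma smooth_partials_continuous:
  assumes "smooth_partials S h D" shows "continuous_on S h"
proof -
  have "continuous_on S (D (\<lambda>_. 0))" "\<And>x. x \<in> S \<Longrightarrow> D (\<lambda>_. 0) x = h x"
    using assms by (auto simp: smooth_partials_def multi_indices_def)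
  then show ?thesis using continuous_on_cong[of S S "D (\<lambda>_. 0)" h] by simp
qed

lemma locally_integrable_mult:
  fixes g h :: "'a::euclidean_space \<Rightarrow> real"
  assumes g: "locally_integrable S g" and h: "continuous_on UNIV h"
    and K: "compact K" "K \<subseteq> S" and 0: "\<And>x. x \<notin> K \<Longrightarrow> h x = 0"
  shows "set_integrable lebesgue S (\<lambda>x. g x * h x)"
proof -
  have gK: "integrable lebesgue (\<lambda>x. indicator K x *\<^sub>R g x)"
    using g K by (simp add: locally_integrable_def set_integrable_def)
  have "bounded (h ` K)"
    using K h by (intro compact_imp_bounded compact_continuous_image) (auto intro: continuous_on_subset)
  then obtain C where C: "\<And>x. x \<in> K \<Longrightarrow> \<bar>h x\<bar> \<le> C"
    by (auto simp: bounded_iff)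
  have hm: "h \<in> borel_measurable lebesgue"
    using borel_measurable_continuous_onI[OF h] by (simp add: measurable_completion)
  have "integrable lebesgue (\<lambda>x. h x * (indicator K x *\<^sub>R g x))"
  proof (rule Bochner_Integration.integrable_bound[where f = "\<lambda>x. C * (indicator K x *\<^sub>R g x)"])
    show "integrable lebesgue (\<lambda>x. C * (indicator K x *\<^sub>R g x))" using gK by simp
    show "(\<lambda>x. h x * (indicator K x *\<^sub>R g x)) \<in> borel_measurable lebesgue"
      using hm borel_measurable_integrable[OF gK] by measurable
    show "AE x in lebesgue. norm (h x * (indicator K x *\<^sub>R g x)) \<le> norm (C * (indicator K x *\<^sub>R g x))"
      using C by (intro always_eventually) (force simp: indicator_def abs_mult intro!: mult_right_mono)
  qed
  moreover have "(\<lambda>x. h x * (indicator K x *\<^sub>R g x)) = (\<lambda>x. indicator S x *\<^sub>R (g x * h x))"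
    using K 0 by (auto simp: indicator_def fun_eq_iff)
  ultimately show ?thesis by (simp add: set_integrable_def)
qed

lemma locally_integrable_mult_test:
  assumes "locally_integrable S g" "smooth_partials UNIV h D"
    "compact (closure {x. h x \<noteq> 0})" "closure {x. h x \<noteq> 0} \<subseteq> S"
  shows "set_integrable lebesgue S (\<lambda>x. g x * h x)"
  using assms closure_subset[of "{x. h x \<noteq> 0}"]
  by (intro locally_integrable_mult[where K="closure {x. h x \<noteq> 0}"] smooth_partials_continuous) auto

text \<open>The fundamental lemma of the calculus of variations. Testing with the bumps and passing
  to the limit shows that g has integral zero over every box with closure in S; Lebesgue
  differentiation over cubes then recovers g almost everywhere.\<close>

lemma locally_integrable_test_0_imp_AE_0:
  fixes g :: "'a::euclidean_space \<Rightarrow> real"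
  assumes S: "open S" and g: "locally_integrable S g"
    and 0: "\<And>h D. \<lbrakk>smooth_partials UNIV h D; compact (closure {x. h x \<noteq> 0});
        closure {x. h x \<noteq> 0} \<subseteq> S\<rbrakk> \<Longrightarrow> (LINT x:S|lebesgue. g x * h x) = 0"
  shows "AE x in lebesgue. x \<in> S \<longrightarrow> g x = 0"
proof -
  have gK: "set_integrable lebesgue (cbox a b) g" if "cbox a b \<subseteq> S" for a b
    using g that by (simp add: locally_integrable_def)
  have box0: "(LINT x:box a b|lebesgue. g x) = 0" if ab: "cbox a b \<subseteq> S" for a b
  proof -
    have gi: "integrable lebesgue (\<lambda>x. indicator (cbox a b) x *\<^sub>R g x)"
      using gK[OF ab] by (simp add: set_integrable_def)
    have eq: "(\<lambda>x. indicator S x *\<^sub>R (g x * box_bump a b k x)) =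
        (\<lambda>x. box_bump a b k x * (indicator (cbox a b) x *\<^sub>R g x))" for k
      using ab box_subset_cbox[of a b] box_bump_eq_0[of _ a b k] by (fastforce simp: indicator_def fun_eq_iff)
    have eq': "(\<lambda>x. indicator (box a b) x * (indicator (cbox a b) x *\<^sub>R g x)) = (\<lambda>x. indicator (box a b) x *\<^sub>R g x)"
      using box_subset_cbox[of a b] by (auto simp: indicator_def fun_eq_iff)
    have bm: "box_bump a b k \<in> borel_measurable lebesgue" for k
    proof -
      obtain D where "smooth_partials UNIV (box_bump a b k) D" using box_bump_smooth by blast
      from borel_measurable_continuous_onI[OF smooth_partials_continuous[OF this]]
      show ?thesis by (simp add: measurable_completion)
    qed
    have "(\<lambda>k. integral\<^sup>L lebesgue (\<lambda>x. box_bump a b k x * (indicator (cbox a b) x *\<^sub>R g x)))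
        \<longlonglongrightarrow> integral\<^sup>L lebesgue (\<lambda>x. indicator (box a b) x * (indicator (cbox a b) x *\<^sub>R g x))"
    proof (rule integral_dominated_convergence[where w = "\<lambda>x. norm (indicator (cbox a b) x *\<^sub>R g x)"])
      show "integrable lebesgue (\<lambda>x. norm (indicat_real (cbox a b) x *\<^sub>R g x))" using gi by (rule integrable_norm)
      have gm: "(\<lambda>x. indicator (cbox a b) x *\<^sub>R g x) \<in> borel_measurable lebesgue" using gi by auto
      show "(\<lambda>x. indicator (box a b) x * (indicator (cbox a b) x *\<^sub>R g x)) \<in> borel_measurable lebesgue"
        using gm by (intro borel_measurable_times borel_measurable_indicator) auto
      show "(\<lambda>x. box_bump a b k x * (indicator (cbox a b) x *\<^sub>R g x)) \<in> borel_measurable lebesgue" for k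
        using gm bm by (intro borel_measurable_times)
      show "AE x in lebesgue. (\<lambda>k. box_bump a b k x * (indicator (cbox a b) x *\<^sub>R g x))
          \<longlonglongrightarrow> indicator (box a b) x * (indicator (cbox a b) x *\<^sub>R g x)"
        by (intro always_eventually allI tendsto_mult box_bump_tendsto tendsto_const)
      show "AE x in lebesgue. norm (box_bump a b k x * (indicator (cbox a b) x *\<^sub>R g x))
          \<le> norm (indicator (cbox a b) x *\<^sub>R g x)" for k
      proof (intro always_eventually allI)
        fix x
        have "\<bar>box_bump a b k x\<bar> \<le> 1" using box_bump_nonneg[of a b k x] box_bump_le_1[of a b k x] by simp
        from mult_right_mono[OF this norm_ge_zero[of "indicator (cbox a b) x *\<^sub>R g x"]]
        show "norm (box_bump a b k x * (indicator (cbox a b) x *\<^sub>R g x)) \<le> norm (indicator (cbox a b) x *\<^sub>R g x)"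
          by (simp only: real_norm_def abs_mult mult_1)
      qed
    qed
    moreover have "integral\<^sup>L lebesgue (\<lambda>x. box_bump a b k x * (indicator (cbox a b) x *\<^sub>R g x)) = 0" for k
    proof -
      obtain D where D: "smooth_partials UNIV (box_bump a b k) D" using box_bump_smooth by blast
      have sup: "closure {x. box_bump a b k x \<noteq> 0} \<subseteq> cbox a b" by (rule box_bump_support)
      then have "compact (closure {x. box_bump a b k x \<noteq> 0})"
        by (meson bounded_cbox bounded_subset closed_closure compact_eq_bounded_closed)
      from 0[OF D this] sup ab show ?thesis
        by (simp only: set_lebesgue_integral_def eq)
    qed
    ultimately show ?thesis unfolding eq' set_lebesgue_integral_def
      by (simp only: LIMSEQ_const_iff)
  qed
  have AE_box: "AE x in lebesgue. x \<in> box c d \<longrightarrow> g x = 0" if cd: "cbox c d \<subseteq> S" for c d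
  proof -
    define G where "G x = indicator (cbox c d) x * g x" for x
    have G: "G absolutely_integrable_on UNIV"
      using gK[OF cd] by (simp add: set_integrable_def G_def[abs_def])
    then have "G integrable_on cbox a b" for a b
      using integrable_on_subcbox set_lebesgue_integral_eq_integral(1) by blast
    then obtain N where N: "negligible N" and d: "\<And>x e. \<lbrakk>x \<notin> N; 0 < e\<rbrakk> \<Longrightarrow>
        \<exists>d>0. \<forall>h. 0 < h \<and> h < d \<longrightarrow> norm (integral (cbox x (x + h *\<^sub>R One)) G /\<^sub>R h ^ DIM('a) - G x) < e"
      by (rule integrable_ccontinuous_explicit) blast
    have "G x = 0" if x: "x \<in> box c d" "x \<notin> N" for x
    proof (rule ccontr)
      assume "G x \<noteq> 0"
      then obtain e where e: "e > 0" "\<And>h. 0 < h \<and> h < e \<Longrightarrow>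
          norm (integral (cbox x (x + h *\<^sub>R One)) G /\<^sub>R h ^ DIM('a) - G x) < norm (G x)"
        using d[OF x(2), of "norm (G x)"] by auto
      \<comment> \<open>The cubes have x as their lower corner, so only the upper faces of the box,
        at distance at least m, limit their side h.\<close>
      define m where "m = Min ((\<lambda>i. d \<bullet> i - x \<bullet> i) ` Basis)"
      have m: "m > 0" "\<And>i. i \<in> Basis \<Longrightarrow> m \<le> d \<bullet> i - x \<bullet> i"
        using x by (auto simp: m_def box_def)
      define h where "h = min m e / 2"
      have h: "0 < h" "h < e" "h < m" using m e by (auto simp: h_def)
      have sub: "cbox x (x + h *\<^sub>R One) \<subseteq> cbox c d"
      proof
        fix y assume y: "y \<in> cbox x (x + h *\<^sub>R One)"
        show "y \<in> cbox c d" unfolding mem_box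
        proof
          fix i :: 'a assume i: "i \<in> Basis"
          with y have "x \<bullet> i \<le> y \<bullet> i" "y \<bullet> i \<le> x \<bullet> i + h" 
            by (auto simp: mem_box inner_add_left)
          moreover have "c \<bullet> i < x \<bullet> i" using x i by (simp add: box_def)
          ultimately show "c \<bullet> i \<le> y \<bullet> i \<and> y \<bullet> i \<le> d \<bullet> i"
            using m(2)[OF i] h by linarith
        qed
      qed
      have "integral (cbox x (x + h *\<^sub>R One)) G = integral (box x (x + h *\<^sub>R One)) G"
        by (simp add: integral_open_interval)
      also have "\<dots> = integral (box x (x + h *\<^sub>R One)) g"
      proof (intro integral_cong)
        fix y assume "y \<in> box x (x + h *\<^sub>R One)"
        with sub box_subset_cbox have "y \<in> cbox c d" by blast
        then show "G y = g y" by (simp add: G_def)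
      qed
      also have "\<dots> = (LINT y:box x (x + h *\<^sub>R One)|lebesgue. g y)"
      proof (rule set_lebesgue_integral_eq_integral(2)[symmetric])
        show "set_integrable lebesgue (box x (x + h *\<^sub>R One)) g"
          by (rule set_integrable_subset[OF gK[of x "x + h *\<^sub>R One"]])
             (use order_trans[OF sub cd] box_subset_cbox[of x "x + h *\<^sub>R One"] in auto)
      qed
      also have "\<dots> = 0" using sub cd by (intro box0) auto
      finally show False using e(2)[of h] h by simp
    qed
    moreover have "G x = g x" if "x \<in> box c d" for x
      using that box_subset_cbox[of c d] by (auto simp: G_def)
    ultimately have "g x = 0" if "x \<in> box c d" "x \<notin> N" for x
      using that by metis
    then show ?thesis
      using N by (intro AE_I'[of N]) (auto simp: negligible_iff_null_sets)
  qed
  \<comment> \<open>Countably many boxes exhaust S by Lindelof, so their exceptional null sets still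
    form a null set.\<close>
  obtain \<D> where \<D>: "countable \<D>" "\<And>X. X \<in> \<D> \<Longrightarrow> \<exists>a b. cbox a b \<subseteq> S \<and> X = box a b" "\<Union>\<D> = S"
  proof -
    let ?B = "{box a b |a b :: 'a. cbox a b \<subseteq> S}"
    have "\<And>X. X \<in> ?B \<Longrightarrow> open X" by (auto intro: open_box)
    from Lindelof[OF this] obtain \<D> where D: "\<D> \<subseteq> ?B" "countable \<D>" "\<Union>\<D> = \<Union>?B" by blast
    have "\<Union>?B = S"
    proof (intro equalityI subsetI)
      fix x assume "x \<in> S"
      then obtain a b where "cbox a b \<subseteq> S" "x \<in> box a b"
        using S by (meson open_contains_cbox)
      then show "x \<in> \<Union>?B" by blast
    qed (use box_subset_cbox in blast)
    with D have "\<Union>\<D> = S" by simp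
    with D show ?thesis by (intro that[of \<D>]) blast+
  qed
  have "AE x in lebesgue. \<forall>X\<in>\<D>. x \<in> X \<longrightarrow> g x = 0"
    unfolding AE_ball_countable[OF \<D>(1)] using \<D>(2) AE_box by blast
  then show ?thesis using \<D>(3) by (auto elim!: eventually_mono)
qed

lemma has_weak_derivD:
  assumes "has_weak_deriv S \<alpha> f g" "smooth_partials UNIV h D"
    "compact (closure {x. h x \<noteq> 0})" "closure {x. h x \<noteq> 0} \<subseteq> S"
  shows "(LINT x:S|lebesgue. f x * D \<alpha> x) = (- 1) ^ mi_order \<alpha> * (LINT x:S|lebesgue. g x * h x)"
  using assms unfolding has_weak_deriv_def by blast

text \<open>This makes \<open>weak_deriv\<close>, which is an arbitrary choice, computable: any weak
  derivative found by other means agrees with it almost everywhere on S.\<close>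

lemma has_weak_deriv_unique:
  fixes f :: "'a::euclidean_space \<Rightarrow> real"
  assumes S: "open S" and g: "has_weak_deriv S \<alpha> f g" "has_weak_deriv S \<alpha> f g'"
  shows "AE x in lebesgue. x \<in> S \<longrightarrow> g x = g' x"
proof -
  have "AE x in lebesgue. x \<in> S \<longrightarrow> g x - g' x = 0"
  proof (rule locally_integrable_test_0_imp_AE_0[OF S])
    have l: "locally_integrable S g" "locally_integrable S g'"
      using g by (auto simp: has_weak_deriv_def)
    then show "locally_integrable S (\<lambda>x. g x - g' x)"
      unfolding locally_integrable_def using set_integral_diff(1) by blast
    fix h D assume h: "smooth_partials UNIV h D" "compact (closure {x. h x \<noteq> 0})" "closure {x. h x \<noteq> 0} \<subseteq> S"
    have "(- 1) ^ mi_order \<alpha> * (LINT x:S|lebesgue. g x * h x) = (- 1) ^ mi_order \<alpha> * (LINT x:S|lebesgue. g' x * h x)"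
      using has_weak_derivD[OF g(1) h] has_weak_derivD[OF g(2) h] by (rule trans[OF sym])
    then have "(LINT x:S|lebesgue. g x * h x) = (LINT x:S|lebesgue. g' x * h x)" by simp
    then show "(LINT x:S|lebesgue. (g x - g' x) * h x) = 0"
      using set_integral_diff(2)[OF locally_integrable_mult_test[OF l(1) h] locally_integrable_mult_test[OF l(2) h]]
      by (simp add: algebra_simps)
  qed
  then show ?thesis by (auto elim!: eventually_mono)
qed

subsection \<open>Classical and weak derivatives\<close>

lemma zero_multi_index [simp]: "(\<lambda>_. 0) \<in> multi_indices"
  by (simp add: multi_indices_def)

lemma multi_index_upd_Suc [simp]:
  "\<alpha> \<in> multi_indices \<Longrightarrow> b \<in> Basis \<Longrightarrow> \<alpha>(b := k) \<in> multi_indices"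
  by (auto simp: multi_indices_def)

lemma multi_index_add [simp]:
  "\<alpha> \<in> multi_indices \<Longrightarrow> \<beta> \<in> multi_indices \<Longrightarrow> (\<lambda>b. \<alpha> b + \<beta> b) \<in> multi_indices"
  by (auto simp: multi_indices_def)

lemma mi_order_0 [simp]: "mi_order (\<lambda>_. 0) = 0"
  by (simp add: mi_order_def)

lemma mi_order_upd_Suc [simp]:
  assumes "b \<in> Basis" shows "mi_order (\<alpha>(b := Suc (\<alpha> b))) = Suc (mi_order \<alpha>)"
proof -
  have "(\<Sum>i\<in>Basis-{b}. (\<alpha>(b := Suc (\<alpha> b))) i) = (\<Sum>i\<in>Basis-{b}. \<alpha> i)"
    by (intro sum.cong) auto
  with assms show ?thesis by (simp add: mi_order_def sum.remove[OF finite_Basis assms])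
qed

text \<open>Every multi-index is reached from 0 by adding one derivative at a time, which matches
  the recursion in \<open>smooth_partials\<close>.\<close>

lemma multi_index_induct [consumes 1, case_names zero Suc]:
  fixes \<alpha> :: "'a::euclidean_space \<Rightarrow> nat"
  assumes \<alpha>: "\<alpha> \<in> multi_indices" and 0: "P (\<lambda>_. 0)"
    and Suc: "\<And>\<alpha> b. \<alpha> \<in> multi_indices \<Longrightarrow> b \<in> Basis \<Longrightarrow> P \<alpha> \<Longrightarrow> P (\<alpha>(b := Suc (\<alpha> b)))"
  shows "P \<alpha>"
  using \<alpha>
proof (induction "mi_order \<alpha>" arbitrary: \<alpha>)
  case 0
  then have "\<alpha> = (\<lambda>_. 0)" by (auto simp: mi_order_def multi_indices_def fun_eq_iff)
  with assms(2) show ?case by simp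
next
  case (Suc n)
  then have "mi_order \<alpha> \<noteq> 0" by simp
  then obtain b where b: "b \<in> Basis" "\<alpha> b \<noteq> 0" unfolding mi_order_def by (auto simp: sum_eq_0_iff)
  define \<gamma> where "\<gamma> = \<alpha>(b := \<alpha> b - 1)"
  have \<alpha>_eq: "\<alpha> = \<gamma>(b := Suc (\<gamma> b))" using b by (auto simp: \<gamma>_def)
  have \<gamma>: "\<gamma> \<in> multi_indices" using Suc.prems b by (simp add: \<gamma>_def)
  have "mi_order \<alpha> = Suc (mi_order \<gamma>)" using b by (subst \<alpha>_eq) simp
  then have "P \<gamma>" using Suc \<gamma> by simp
  then show ?case using assms(3)[OF \<gamma> b(1)] \<alpha>_eq by simp
qed

lemma smooth_partialsD:
  assumes "smooth_partials S f D" "x \<in> S"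
  shows "D (\<lambda>_. 0) x = f x"
    and "\<lbrakk>\<alpha> \<in> multi_indices; b \<in> Basis\<rbrakk> \<Longrightarrow>
      ((\<lambda>t. D \<alpha> (x + t *\<^sub>R b)) has_real_derivative D (\<alpha>(b := Suc (\<alpha> b))) x) (at 0)"
  using assms by (auto simp: smooth_partials_def)

lemma smooth_partials_continuous_on:
  "smooth_partials S f D \<Longrightarrow> \<alpha> \<in> multi_indices \<Longrightarrow> continuous_on S (D \<alpha>)"
  by (auto simp: smooth_partials_def)

lemma smooth_partials_shift:
  fixes S :: "'a::euclidean_space set"
  assumes "smooth_partials S f D" "\<alpha> \<in> multi_indices"
  shows "smooth_partials S (D \<alpha>) (\<lambda>\<beta>. D (\<lambda>b. \<alpha> b + \<beta> b))"
  unfolding smooth_partials_def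
proof (intro conjI ballI)
  fix \<beta> :: "'a \<Rightarrow> nat" and b x :: 'a assume "\<beta> \<in> multi_indices" "b \<in> Basis" "x \<in> S"
  moreover have "(\<lambda>i. \<alpha> i + \<beta> i)(b := Suc (\<alpha> b + \<beta> b)) = (\<lambda>i. \<alpha> i + (\<beta>(b := Suc (\<beta> b))) i)"
    by auto
  ultimately show "((\<lambda>t. D (\<lambda>i. \<alpha> i + \<beta> i) (x + t *\<^sub>R b)) has_real_derivative
      D (\<lambda>i. \<alpha> i + (\<beta>(b := Suc (\<beta> b))) i) x) (at 0)"
    using smooth_partialsD(2)[OF assms(1), of x "\<lambda>i. \<alpha> i + \<beta> i" b] assms(2) by simp
qed (auto intro!: smooth_partials_continuous_on[OF assms(1)] simp: assms(2))

lemma eventually_line_in_open: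
  fixes x b :: "'a::real_normed_vector"
  assumes "open U" "x \<in> U"
  shows "\<exists>T. open T \<and> 0 \<in> T \<and> (\<forall>t\<in>T. x + t *\<^sub>R b \<in> U)"
proof -
  have "open ((\<lambda>t. x + t *\<^sub>R b) -` U)"
    by (rule open_vimage[OF assms(1)]) (intro continuous_intros)
  moreover have "0 \<in> (\<lambda>t. x + t *\<^sub>R b) -` U" using assms(2) by simp
  ultimately show ?thesis by (intro exI[of _ "(\<lambda>t. x + t *\<^sub>R b) -` U"]) blast
qed

lemma line_derivative_eq_0:
  fixes u :: "'a::real_normed_vector \<Rightarrow> real"
  assumes "open U" "x \<in> U" "\<And>y. y \<in> U \<Longrightarrow> u y = 0"
  shows "((\<lambda>t. u (x + t *\<^sub>R b)) has_real_derivative 0) (at 0)"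
proof -
  obtain T where T: "open T" "0 \<in> T" "\<And>t. t \<in> T \<Longrightarrow> x + t *\<^sub>R b \<in> U"
    using eventually_line_in_open[OF assms(1,2)] by metis
  show ?thesis
    by (rule has_field_derivative_transform_within_open[of "\<lambda>_. 0" 0 0 T, OF _ T(1,2)])
       (simp_all add: assms(3)[OF T(3)])
qed

text \<open>Openness of U keeps a short segment in direction b inside U, where the function being
  differentiated is already known to vanish.\<close>

lemma smooth_partials_eq_0:
  assumes "smooth_partials S h D" "open U" "U \<subseteq> S" "\<And>x. x \<in> U \<Longrightarrow> h x = 0"
    and "\<alpha> \<in> multi_indices" "x \<in> U"
  shows "D \<alpha> x = 0"
  using assms(5,6)
proof (induction arbitrary: x rule: multi_index_induct)
  case zero
  then have "x \<in> S" using assms(3) by blast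
  from trans[OF smooth_partialsD(1)[OF assms(1) this] assms(4)[OF zero]] show ?case .
next
  case (Suc \<alpha> b)
  have d: "((\<lambda>t. D \<alpha> (x + t *\<^sub>R b)) has_real_derivative D (\<alpha>(b := Suc (\<alpha> b))) x) (at 0)"
    by (rule smooth_partialsD(2)[OF assms(1) _ Suc(1,2)]) (use Suc(4) assms(3) in blast)
  have d0: "((\<lambda>t. D \<alpha> (x + t *\<^sub>R b)) has_real_derivative 0) (at 0)"
    by (rule line_derivative_eq_0[OF assms(2) Suc(4) Suc(3)])
  from DERIV_unique[OF d d0] show ?case .
qed

lemma smooth_partials_support:
  assumes "smooth_partials UNIV h D" "\<alpha> \<in> multi_indices"
  shows "closure {x. D \<alpha> x \<noteq> 0} \<subseteq> closure {x. h x \<noteq> 0}"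
proof (rule closure_minimal)
  have "D \<alpha> x = 0" if "x \<in> - closure {x. h x \<noteq> 0}" for x
  proof (rule smooth_partials_eq_0[OF assms(1) _ _ _ assms(2) that])
    show "h y = 0" if "y \<in> - closure {x. h x \<noteq> 0}" for y
      using that closure_subset[of "{x. h x \<noteq> 0}"] by auto
  qed (auto simp: open_Compl)
  then show "{x. D \<alpha> x \<noteq> 0} \<subseteq> closure {x. h x \<noteq> 0}" by (metis (mono_tags, lifting) ComplI mem_Collect_eq subsetI)
qed simp

section \<open>Integration by parts along coordinate lines\<close>

lemma compactly_supported_integrable:
  fixes v :: "'a::euclidean_space \<Rightarrow> real"
  assumes "continuous_on UNIV v" "compact K" "\<And>x. x \<notin> K \<Longrightarrow> v x = 0"
  shows "integrable lborel v"
proof -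
  have "integrable lborel (\<lambda>x. indicator K x *\<^sub>R v x)"
    by (intro borel_integrable_compact assms(2) continuous_on_subset[OF assms(1)] subset_UNIV)
  also have "(\<lambda>x. indicator K x *\<^sub>R v x) = v" using assms(3) by (auto simp: indicator_def fun_eq_iff)
  finally show ?thesis .
qed

lemma integral_lborel_translate:
  fixes v :: "'a::euclidean_space \<Rightarrow> real"
  assumes "v \<in> borel_measurable borel"
  shows "(LINT x|lborel. v (c + x)) = (LINT x|lborel. v x)"
proof -
  have "(LINT x|lborel. v x) = (LINT x|distr lborel borel ((+) c). v x)"
    by (simp only: lborel_distr_plus)
  also have "\<dots> = (LINT x|lborel. v (c + x))"
    using assms by (subst integral_distr) auto
  finally show ?thesis by simp
qed

lemma line_has_derivative_at:
  fixes v :: "'a::real_normed_vector \<Rightarrow> real"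
  assumes "((\<lambda>t. v ((x + s *\<^sub>R b) + t *\<^sub>R b)) has_real_derivative v') (at 0)"
  shows "((\<lambda>t. v (x + t *\<^sub>R b)) has_real_derivative v') (at s)"
proof -
  have "((\<lambda>t. v (x + (s + t) *\<^sub>R b)) has_real_derivative v') (at 0)"
    using assms by (simp add: scaleR_add_left add.assoc)
  then have "((\<lambda>t. v (x + t *\<^sub>R b)) has_real_derivative v') (at (0 + s))"
    by (subst DERIV_shift) (simp only: add.commute[of s])
  then show ?thesis by simp
qed

text \<open>The difference quotients of v have integral zero by translation invariance, and they
  converge to v' with a common bound from the mean value theorem.\<close>

lemma integral_line_derivative_eq_0:
  fixes v v' :: "'a::euclidean_space \<Rightarrow> real"
  assumes v: "continuous_on UNIV v" and v': "continuous_on UNIV v'"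
    and der: "\<And>x. ((\<lambda>t. v (x + t *\<^sub>R b)) has_real_derivative v' x) (at 0)"
    and K: "compact K" "\<And>x. x \<notin> K \<Longrightarrow> v x = 0" "\<And>x. x \<notin> K \<Longrightarrow> v' x = 0"
  shows "(LINT x|lborel. v' x) = 0"
proof -
  have "bounded (v' ` K)"
    by (intro compact_imp_bounded compact_continuous_image continuous_on_subset[OF v'] K(1) subset_UNIV)
  then obtain C where C: "\<And>x. x \<in> K \<Longrightarrow> \<bar>v' x\<bar> \<le> C" by (auto simp: bounded_iff)
  have C': "\<bar>v' x\<bar> \<le> \<bar>C\<bar>" for x
    using C[of x] K(3)[of x] by (cases "x \<in> K") auto
  obtain R where R: "K \<subseteq> cball 0 R"
    using bounded_subset_ballD[OF compact_imp_bounded[OF K(1)], of 0] ball_subset_cball by blast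
  define q where "q n x = (v (inverse (real (Suc n)) *\<^sub>R b + x) - v x) / inverse (real (Suc n))" for n x
  have vi: "integrable lborel v" by (rule compactly_supported_integrable[OF v K(1,2)])
  have vm: "v \<in> borel_measurable borel" using v by (rule borel_measurable_continuous_onI)
  have vti: "integrable lborel (\<lambda>x. v (c + x))" for c
  proof -
    have "integrable (distr lborel borel ((+) c)) v" using vi by (simp only: lborel_distr_plus)
    then show ?thesis using vm by (subst (asm) integrable_distr_eq) auto
  qed
  have "(\<lambda>n. LINT x|lborel. q n x) \<longlonglongrightarrow> (LINT x|lborel. v' x)"
  \<comment> \<open>The increments are at most 1, so the quotients are supported in the ball around
    K enlarged by \<open>norm b\<close>.\<close>
  proof (rule integral_dominated_convergence[where w = "\<lambda>x. \<bar>C\<bar> * indicator (cball (0::'a) (R + norm b)) x"])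
    show "v' \<in> borel_measurable lborel" using borel_measurable_continuous_onI[OF v'] by simp
    show "q n \<in> borel_measurable lborel" for n
      unfolding q_def using vti vi by (intro borel_measurable_divide borel_measurable_diff) auto
    show "integrable lborel (\<lambda>x. \<bar>C\<bar> * indicator (cball (0::'a) (R + norm b)) x)"
      using emeasure_bounded_finite[OF bounded_cball, of "0::'a" "R + norm b"]
      by (intro integrable_mult_right integrable_real_indicator) auto
    show "AE x in lborel. (\<lambda>n. q n x) \<longlonglongrightarrow> v' x"
    proof (intro always_eventually allI)
      fix x
      have "((\<lambda>h. (v (x + h *\<^sub>R b) - v x) / h) \<longlongrightarrow> v' x) (at 0)"
        using der[of x] by (simp add: has_field_derivative_iff)
      moreover have "filterlim (\<lambda>n. inverse (real (Suc n))) (at 0) sequentially"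
        using LIMSEQ_inverse_real_of_nat by (auto simp: filterlim_at)
      ultimately show "(\<lambda>n. q n x) \<longlonglongrightarrow> v' x"
        unfolding q_def by (subst add.commute) (rule filterlim_compose)
    qed
    show "AE x in lborel. norm (q n x) \<le> \<bar>C\<bar> * indicator (cball 0 (R + norm b)) x" for n
    proof (intro always_eventually allI)
      fix x
      let ?h = "inverse (real (Suc n))"
      have h: "?h > 0" "?h \<le> 1" by (auto simp: inverse_le_1_iff)
      show "norm (q n x) \<le> \<bar>C\<bar> * indicator (cball 0 (R + norm b)) x"
      proof (cases "x \<in> cball 0 (R + norm b)")
        case True
        have "\<exists>z>0. z < ?h \<and> v (x + ?h *\<^sub>R b) - v (x + 0 *\<^sub>R b) = (?h - 0) * v' (x + z *\<^sub>R b)"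
          using h line_has_derivative_at[OF der] by (intro MVT2) auto
        then obtain z where "v (x + ?h *\<^sub>R b) - v x = ?h * v' (x + z *\<^sub>R b)" by auto
        then have "q n x = v' (x + z *\<^sub>R b)" using h by (simp add: q_def add.commute)
        with True C' show ?thesis by simp
      next
        case False
        then have x: "norm x > R + norm b" by simp
        have "norm (?h *\<^sub>R b) \<le> norm b" using h by (simp add: mult_left_le_one_le)
        then have "norm (?h *\<^sub>R b + x) > R" using x norm_triangle_ineq4[of "?h *\<^sub>R b + x" "?h *\<^sub>R b"] by simp
        moreover have "norm x > R" using x norm_ge_zero[of b] by linarith
        moreover have "y \<notin> K" if "norm y > R" for y
          using R that by (meson mem_cball_0 not_le subsetD)
        ultimately have "?h *\<^sub>R b + x \<notin> K" "x \<notin> K" by blast+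
        then show ?thesis using K(2) by (simp add: q_def)
      qed
    qed
  qed
  moreover have "(LINT x|lborel. q n x) = 0" for n
    unfolding q_def using vi vti integral_lborel_translate[OF vm]
    by (simp only: Bochner_Integration.integral_divide_zero Bochner_Integration.integral_diff) simp
  ultimately show ?thesis by (simp add: LIMSEQ_const_iff)
qed

lemma continuous_imp_locally_integrable:
  fixes f :: "'a::euclidean_space \<Rightarrow> real"
  assumes "continuous_on S f" shows "locally_integrable S f"
  unfolding locally_integrable_def set_integrable_def
proof (intro allI impI)
  fix K assume "compact K \<and> K \<subseteq> S"
  then have "integrable lborel (\<lambda>x. indicator K x *\<^sub>R f x)"
    using continuous_on_subset[OF assms] by (intro borel_integrable_compact) auto
  then show "integrable lebesgue (\<lambda>x. indicat_real K x *\<^sub>R f x)"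
    by (simp add: integrable_completion)
qed

text \<open>The product u w, set to 0 off K, is continuous on the whole space because S and the
  complement of K are open and cover it. Its line derivative has integral zero, and the product rule
  gives the claim.\<close>

lemma integration_by_parts_line:
  fixes u u' w w' :: "'a::euclidean_space \<Rightarrow> real"
  assumes S: "open S" and u: "continuous_on S u" "continuous_on S u'"
    and w: "continuous_on UNIV w" "continuous_on UNIV w'"
    and du: "\<And>x. x \<in> S \<Longrightarrow> ((\<lambda>t. u (x + t *\<^sub>R b)) has_real_derivative u' x) (at 0)"
    and dw: "\<And>x. ((\<lambda>t. w (x + t *\<^sub>R b)) has_real_derivative w' x) (at 0)"
    and K: "compact K" "K \<subseteq> S" "\<And>x. x \<notin> K \<Longrightarrow> w x = 0" "\<And>x. x \<notin> K \<Longrightarrow> w' x = 0"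
  shows "(LINT x:S|lebesgue. u x * w' x) = - (LINT x:S|lebesgue. u' x * w x)"
proof -
  define v where "v x = (if x \<in> K then u x * w x else 0)" for x
  define v' where "v' x = (if x \<in> K then u x * w' x + u' x * w x else 0)" for x
  have cont: "continuous_on UNIV (\<lambda>x. if x \<in> K then q x else 0)"
    if "continuous_on S q" "\<And>x. x \<notin> K \<Longrightarrow> q x = 0" for q :: "'a \<Rightarrow> real"
  proof -
    have "continuous_on S (\<lambda>x. if x \<in> K then q x else 0)"
      using that by (subst continuous_on_cong[of S S _ q]) auto
    moreover have "continuous_on (- K) (\<lambda>x. if x \<in> K then q x else 0)"
      by (subst continuous_on_cong[of "-K" "-K" _ "\<lambda>_. 0"]) auto
    ultimately have "continuous_on (S \<union> - K) (\<lambda>x. if x \<in> K then q x else 0)"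
      using S K(1) by (intro continuous_on_open_Un) (auto simp: open_Compl compact_imp_closed)
    moreover have "S \<union> - K = UNIV" using K by blast
    ultimately show ?thesis by simp
  qed
  have w_on: "continuous_on S w" "continuous_on S w'" using w continuous_on_subset by blast+
  have "(LINT x|lborel. v' x) = 0"
  proof (rule integral_line_derivative_eq_0[where v = v and K = K])
    show "continuous_on UNIV v" unfolding v_def
      by (rule cont[OF continuous_on_mult[OF u(1) w_on(1)]]) (simp add: K)
    show "continuous_on UNIV v'" unfolding v'_def
      by (rule cont[OF continuous_on_add[OF continuous_on_mult[OF u(1) w_on(2)] continuous_on_mult[OF u(2) w_on(1)]]])
         (simp add: K)
    fix x
    show "((\<lambda>t. v (x + t *\<^sub>R b)) has_real_derivative v' x) (at 0)"
    proof (cases "x \<in> K")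
      case True
      obtain T where T: "open T" "0 \<in> T" "\<forall>t\<in>T. x + t *\<^sub>R b \<in> S"
        using eventually_line_in_open[OF S, of x b] True K(2) by blast
      have "((\<lambda>t. u (x + t *\<^sub>R b) * w (x + t *\<^sub>R b)) has_real_derivative
          u' x * w (x + 0 *\<^sub>R b) + w' x * u (x + 0 *\<^sub>R b)) (at 0)"
        using True K(2) by (intro DERIV_mult[OF du dw]) blast
      then have "((\<lambda>t. v (x + t *\<^sub>R b)) has_real_derivative
          u' x * w (x + 0 *\<^sub>R b) + w' x * u (x + 0 *\<^sub>R b)) (at 0)"
        by (rule has_field_derivative_transform_within_open[OF _ T(1,2)]) (simp add: v_def K(3))
      with True show ?thesis by (simp add: v'_def algebra_simps)
    next
      case False
      then have "((\<lambda>t. v (x + t *\<^sub>R b)) has_real_derivative 0) (at 0)"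
        using K(1) by (intro line_derivative_eq_0[of "- K" x v b]) (auto simp: v_def open_Compl compact_imp_closed)
      with False show ?thesis by (simp add: v'_def)
    qed
  qed (auto simp: v_def v'_def K)
  moreover have "v' \<in> borel_measurable borel" unfolding v'_def
    by (rule borel_measurable_continuous_onI, rule
        cont[OF continuous_on_add[OF continuous_on_mult[OF u(1) w_on(2)] continuous_on_mult[OF u(2) w_on(1)]]])
       (simp add: K)
  ultimately have "(LINT x|lebesgue. v' x) = 0" by (simp add: integral_completion)
  also have "v' = (\<lambda>x. indicator S x *\<^sub>R (u x * w' x + u' x * w x))"
  proof
    fix x
    show "v' x = indicator S x *\<^sub>R (u x * w' x + u' x * w x)"
      using K(2) by (cases "x \<in> K") (auto simp: v'_def K(3,4))
  qed
  finally have "(LINT x:S|lebesgue. u x * w' x + u' x * w x) = 0"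
    by (simp add: set_lebesgue_integral_def)
  moreover have "set_integrable lebesgue S (\<lambda>x. u x * w' x)" "set_integrable lebesgue S (\<lambda>x. u' x * w x)"
    by (rule locally_integrable_mult[OF continuous_imp_locally_integrable _ K(1,2)]; fact)+
  ultimately show ?thesis by (simp add: set_integral_add(2))
qed

lemma has_weak_deriv_0: "locally_integrable S f \<Longrightarrow> has_weak_deriv S (\<lambda>_. 0) f f"
  unfolding has_weak_deriv_def
  by (auto simp: smooth_partials_def)

text \<open>One integration by parts against G raises the order by one. G and G' enter only through
  continuity and the derivative along b, so the lemma also applies to formulas that come without a
  family of all their partial derivatives.\<close>

lemma has_weak_deriv_Suc:
  fixes f G G' :: "'a::euclidean_space \<Rightarrow> real"
  assumes "open S" and \<alpha>: "\<alpha> \<in> multi_indices" and b: "b \<in> Basis" and f: "has_weak_deriv S \<alpha> f G"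
    and G: "continuous_on S G" and G': "continuous_on S G'"
    and der: "\<And>x. x \<in> S \<Longrightarrow> ((\<lambda>t. G (x + t *\<^sub>R b)) has_real_derivative G' x) (at 0)"
  shows "has_weak_deriv S (\<alpha>(b := Suc (\<alpha> b))) f G'"
  unfolding has_weak_deriv_def
proof (intro conjI allI impI)
  show "locally_integrable S f" using f by (simp add: has_weak_deriv_def)
  show "locally_integrable S G'" using G' by (rule continuous_imp_locally_integrable)
  fix h D assume "smooth_partials UNIV h D \<and> compact (closure {x. h x \<noteq> 0}) \<and> closure {x. h x \<noteq> 0} \<subseteq> S"
  then have h: "smooth_partials UNIV h D" "compact (closure {x. h x \<noteq> 0})" "closure {x. h x \<noteq> 0} \<subseteq> S" by auto
  \<comment> \<open>The derivative along b of a test function is again a test function; e is its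
    multi-index.\<close>
  define e :: "'a \<Rightarrow> nat" where "e = (\<lambda>_. 0)(b := Suc 0)"
  have e: "e \<in> multi_indices" using b by (simp add: e_def)
  have sup: "closure {x. D e x \<noteq> 0} \<subseteq> closure {x. h x \<noteq> 0}" by (rule smooth_partials_support[OF h(1) e])
  have he: "smooth_partials UNIV (D e) (\<lambda>\<beta>. D (\<lambda>b. e b + \<beta> b))" by (rule smooth_partials_shift[OF h(1) e])
  have "(\<lambda>i. e i + \<alpha> i) = \<alpha>(b := Suc (\<alpha> b))" by (auto simp: e_def)
  moreover have "compact (closure {x. D e x \<noteq> 0})"
    using compact_Int_closed[OF h(2) closed_closure[of "{x. D e x \<noteq> 0}"]] sup by (simp add: Int_absorb1)
  ultimately have "(LINT x:S|lebesgue. f x * D (\<alpha>(b := Suc (\<alpha> b))) x) =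
      (- 1) ^ mi_order \<alpha> * (LINT x:S|lebesgue. G x * D e x)"
    using has_weak_derivD[OF f he] sup h(3) by simp
  also have "(LINT x:S|lebesgue. G x * D e x) = - (LINT x:S|lebesgue. G' x * h x)"
  proof (rule integration_by_parts_line[OF assms(1) G G' _ _ der _ h(2,3)])
    show "continuous_on UNIV h" using smooth_partials_continuous h(1) .
    show "continuous_on UNIV (D e)" using smooth_partials_continuous_on[OF h(1) e] .
    show "((\<lambda>t. h (x + t *\<^sub>R b)) has_real_derivative D e x) (at 0)" for x
    proof -
      have "h = D (\<lambda>_. 0)" using smooth_partialsD(1)[OF h(1)] by auto
      then show ?thesis using smooth_partialsD(2)[OF h(1), of x "\<lambda>_. 0" b] b by (simp add: e_def)
    qed
    show "h x = 0" if "x \<notin> closure {x. h x \<noteq> 0}" for x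
      using that closure_subset[of "{x. h x \<noteq> 0}"] by blast
    show "D e x = 0" if "x \<notin> closure {x. h x \<noteq> 0}" for x
      using that sup closure_subset[of "{x. D e x \<noteq> 0}"] by blast
  qed
  finally show "(LINT x:S|lebesgue. f x * D (\<alpha>(b := Suc (\<alpha> b))) x) =
      (- 1) ^ mi_order (\<alpha>(b := Suc (\<alpha> b))) * (LINT x:S|lebesgue. G' x * h x)"
    using b by (simp del: fun_upd_apply)
qed

lemma smooth_partials_imp_has_weak_deriv:
  fixes f :: "'a::euclidean_space \<Rightarrow> real"
  assumes S: "open S" and f: "smooth_partials S f D" and \<alpha>: "\<alpha> \<in> multi_indices"
  shows "has_weak_deriv S \<alpha> f (D \<alpha>)"
  using \<alpha>
proof (induction rule: multi_index_induct)
  case zero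
  have "has_weak_deriv S (\<lambda>_. 0) f f"
    by (intro has_weak_deriv_0 continuous_imp_locally_integrable smooth_partials_continuous[OF f])
  moreover have "(LINT x:S|lebesgue. f x * h x) = (LINT x:S|lebesgue. D (\<lambda>_. 0) x * h x)" for h
    using smooth_partialsD(1)[OF f] unfolding set_lebesgue_integral_def
    by (intro Bochner_Integration.integral_cong) (auto simp: indicator_def)
  ultimately show ?case
    using continuous_imp_locally_integrable[OF smooth_partials_continuous_on[OF f]]
    by (simp add: has_weak_deriv_def)
next
  case (Suc \<alpha> b)
  show ?case
    by (rule has_weak_deriv_Suc[OF S Suc(1,2,3) smooth_partials_continuous_on[OF f]
          smooth_partials_continuous_on[OF f] smooth_partialsD(2)[OF f]])
       (use Suc(1,2) multi_index_upd_Suc in blast)+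
qed

lemma has_weak_deriv_lin:
  fixes f f' :: "'a::euclidean_space \<Rightarrow> real"
  assumes f: "has_weak_deriv S \<alpha> f g" "has_weak_deriv S \<alpha> f' g'" and \<alpha>: "\<alpha> \<in> multi_indices"
  shows "has_weak_deriv S \<alpha> (\<lambda>x. a * f x + c * f' x) (\<lambda>x. a * g x + c * g' x)"
  unfolding has_weak_deriv_def
proof (intro conjI allI impI)
  have l: "locally_integrable S f" "locally_integrable S g" "locally_integrable S f'" "locally_integrable S g'"
    using f by (auto simp: has_weak_deriv_def)
  then show "locally_integrable S (\<lambda>x. a * f x + c * f' x)" "locally_integrable S (\<lambda>x. a * g x + c * g' x)"
    unfolding locally_integrable_def by (auto intro!: set_integral_add(1))
  fix h D assume "smooth_partials UNIV h D \<and> compact (closure {x. h x \<noteq> 0}) \<and> closure {x. h x \<noteq> 0} \<subseteq> S"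
  then have h: "smooth_partials UNIV h D" "compact (closure {x. h x \<noteq> 0})" "closure {x. h x \<noteq> 0} \<subseteq> S" by auto
  have i: "set_integrable lebesgue S (\<lambda>x. q x * D \<alpha> x)" if "locally_integrable S q" for q
  proof (rule locally_integrable_mult[OF that _ h(2,3)])
    show "continuous_on UNIV (D \<alpha>)" using smooth_partials_continuous_on[OF h(1) \<alpha>] .
    show "D \<alpha> x = 0" if "x \<notin> closure {x. h x \<noteq> 0}" for x
      using that smooth_partials_support[OF h(1) \<alpha>] closure_subset[of "{x. D \<alpha> x \<noteq> 0}"] by blast
  qed
  have i2: "set_integrable lebesgue S (\<lambda>x. q x * h x)" if "locally_integrable S q" for q
    by (rule locally_integrable_mult_test[OF that h])
  have lin: "(LINT x:S|lebesgue. (a * q x + c * q' x) * k x) =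
      a * (LINT x:S|lebesgue. q x * k x) + c * (LINT x:S|lebesgue. q' x * k x)"
    if "set_integrable lebesgue S (\<lambda>x. q x * k x)" "set_integrable lebesgue S (\<lambda>x. q' x * k x)" for q q' k
  proof -
    have "(LINT x:S|lebesgue. (a * q x + c * q' x) * k x) = (LINT x:S|lebesgue. a * (q x * k x) + c * (q' x * k x))"
      by (simp add: algebra_simps)
    also have "\<dots> = (LINT x:S|lebesgue. a * (q x * k x)) + (LINT x:S|lebesgue. c * (q' x * k x))"
      using that by (intro set_integral_add(2)) auto
    finally show ?thesis by simp
  qed
  show "(LINT x:S|lebesgue. (a * f x + c * f' x) * D \<alpha> x) =
      (- 1) ^ mi_order \<alpha> * (LINT x:S|lebesgue. (a * g x + c * g' x) * h x)"
    by (subst lin, (intro i i2 l)+, subst lin, (intro i i2 l)+)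
       (simp add: has_weak_derivD[OF f(1) h] has_weak_derivD[OF f(2) h] algebra_simps)
qed

lemma locally_integrable_subset: "locally_integrable S f \<Longrightarrow> U \<subseteq> S \<Longrightarrow> locally_integrable U f"
  unfolding locally_integrable_def by blast

text \<open>A test function for U is one for S. Its derivatives are supported in U as well, so both
  integrals over S reduce to integrals over U.\<close>

lemma has_weak_deriv_subset:
  fixes f :: "'a::euclidean_space \<Rightarrow> real"
  assumes f: "has_weak_deriv S \<alpha> f g" and U: "U \<subseteq> S" and \<alpha>: "\<alpha> \<in> multi_indices"
  shows "has_weak_deriv U \<alpha> f g"
  unfolding has_weak_deriv_def
proof (intro conjI allI impI)
  show "locally_integrable U f" "locally_integrable U g"
    using f U locally_integrable_subset by (auto simp: has_weak_deriv_def)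
  fix h D assume "smooth_partials UNIV h D \<and> compact (closure {x. h x \<noteq> 0}) \<and> closure {x. h x \<noteq> 0} \<subseteq> U"
  then have h: "smooth_partials UNIV h D" "compact (closure {x. h x \<noteq> 0})" "closure {x. h x \<noteq> 0} \<subseteq> U" by auto
  have *: "(LINT x:U|lebesgue. q x * k x) = (LINT x:S|lebesgue. q x * k x)"
    if "{x. k x \<noteq> 0} \<subseteq> U" for q k :: "'a \<Rightarrow> real"
    using that U unfolding set_lebesgue_integral_def
    by (intro Bochner_Integration.integral_cong) (auto simp: indicator_def subset_iff)
  have "{x. D \<alpha> x \<noteq> 0} \<subseteq> U" "{x. h x \<noteq> 0} \<subseteq> U"
    using h(3) smooth_partials_support[OF h(1) \<alpha>] closure_subset[of "{x. D \<alpha> x \<noteq> 0}"]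
      closure_subset[of "{x. h x \<noteq> 0}"] by blast+
  then show "(LINT x:U|lebesgue. f x * D \<alpha> x) = (- 1) ^ mi_order \<alpha> * (LINT x:U|lebesgue. g x * h x)"
    using has_weak_derivD[OF f h(1,2)] h(3) U by (simp add: *)
qed

lemma set_integrable_AE_cong:
  fixes f g :: "'a::euclidean_space \<Rightarrow> real"
  assumes "AE x in lebesgue. x \<in> S \<longrightarrow> f x = g x" "set_integrable lebesgue S f"
  shows "set_integrable lebesgue S g"
proof -
  have ae: "AE x in lebesgue. indicator S x *\<^sub>R f x = indicator S x *\<^sub>R g x"
    using assms(1) by eventually_elim (auto simp: indicator_def)
  have m: "(\<lambda>x. indicator S x *\<^sub>R f x) \<in> borel_measurable lebesgue"
    using assms(2) by (auto simp: set_integrable_def)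
  have "(\<lambda>x. indicator S x *\<^sub>R g x) \<in> borel_measurable lebesgue"
    by (rule borel_measurable_AE[OF m ae])
  then show ?thesis
    using assms(2) integrable_cong_AE[OF m _ ae] by (simp add: set_integrable_def)
qed

lemma has_weak_deriv_AE_cong:
  fixes f f' :: "'a::euclidean_space \<Rightarrow> real"
  assumes f: "has_weak_deriv S \<alpha> f g" and ae: "AE x in lebesgue. x \<in> S \<longrightarrow> f x = f' x"
    "AE x in lebesgue. x \<in> S \<longrightarrow> g x = g' x"
  shows "has_weak_deriv S \<alpha> f' g'"
proof -
  have *: "(LINT x:S|lebesgue. q x * k x) = (LINT x:S|lebesgue. q' x * k x)"
    if ae: "AE x in lebesgue. x \<in> S \<longrightarrow> q x = q' x" for q q' k :: "'a \<Rightarrow> real"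
  proof -
    have ae': "AE x in lebesgue. indicator S x *\<^sub>R (q x * k x) = indicator S x *\<^sub>R (q' x * k x)"
      using ae by eventually_elim (auto simp: indicator_def)
    show ?thesis
    proof (cases "(\<lambda>x. indicator S x *\<^sub>R (q x * k x)) \<in> borel_measurable lebesgue")
      case True
      then show ?thesis using borel_measurable_AE[OF True ae'] ae'
        unfolding set_lebesgue_integral_def by (intro integral_cong_AE)
    next
      \<comment> \<open>A product that is not measurable has integral 0 by default. Almost
        everywhere equality preserves measurability in a complete measure, so the other integral
        takes the default as well.\<close>
      case False
      moreover have "(\<lambda>x. indicator S x *\<^sub>R (q' x * k x)) \<notin> borel_measurable lebesgue"
      proof
        assume m: "(\<lambda>x. indicator S x *\<^sub>R (q' x * k x)) \<in> borel_measurable lebesgue"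
        have "(\<lambda>x. indicator S x *\<^sub>R (q x * k x)) \<in> borel_measurable lebesgue"
          by (rule borel_measurable_AE[OF m AE_symmetric[OF ae']])
        with False show False ..
      qed
      ultimately have "\<not> integrable lebesgue (\<lambda>x. indicator S x *\<^sub>R (q x * k x))"
        "\<not> integrable lebesgue (\<lambda>x. indicator S x *\<^sub>R (q' x * k x))"
        by (blast dest: borel_measurable_integrable)+
      then show ?thesis
        unfolding set_lebesgue_integral_def by (metis (no_types, lifting) not_integrable_integral_eq)
    qed
  qed
  have **: "locally_integrable S q'" if "locally_integrable S q" "AE x in lebesgue. x \<in> S \<longrightarrow> q x = q' x"
    for q q' :: "'a \<Rightarrow> real"
    unfolding locally_integrable_def
  proof (intro allI impI)
    fix K assume K: "compact K \<and> K \<subseteq> S"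
    show "set_integrable lebesgue K q'"
    proof (rule set_integrable_AE_cong[of _ q])
      show "AE x in lebesgue. x \<in> K \<longrightarrow> q x = q' x" using that(2) K by (auto elim!: eventually_mono)
      show "set_integrable lebesgue K q" using that(1) K by (simp add: locally_integrable_def)
    qed
  qed
  have "locally_integrable S f" "locally_integrable S g" using f by (auto simp: has_weak_deriv_def)
  from **[OF this(1) ae(1)] **[OF this(2) ae(2)] f show ?thesis
    unfolding has_weak_deriv_def by (simp add: *[OF ae(1)] *[OF ae(2)])
qed

subsection \<open>Rapidly decreasing kernels\<close>

definition rapid_kernel :: "(real \<Rightarrow> real) \<Rightarrow> bool" where
  "rapid_kernel \<kappa> \<longleftrightarrow> continuous_on {1..} \<kappa> \<and> (\<forall>N::nat. \<exists>C. \<forall>s\<ge>1. \<bar>\<kappa> s\<bar> * s ^ N \<le> C)"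

text \<open>The moment of order 0 is included, so a \<open>stein_kernel\<close>, whose integral is
  1, is not of this kind. The class is the one in which integration by parts can be repeated without
  end.\<close>

definition null_kernel :: "(real \<Rightarrow> real) \<Rightarrow> bool" where
  "null_kernel \<kappa> \<longleftrightarrow> rapid_kernel \<kappa> \<and> (\<forall>k::nat. (LINT s:{1..}|lborel. s ^ k * \<kappa> s) = 0)"

lemma rapid_kernel_bound:
  assumes "rapid_kernel \<kappa>"
  obtains C where "C \<ge> 0" "\<And>s. s \<ge> 1 \<Longrightarrow> \<bar>\<kappa> s\<bar> \<le> C / s ^ N"
proof -
  obtain C where C: "\<And>s. s \<ge> 1 \<Longrightarrow> \<bar>\<kappa> s\<bar> * s ^ N \<le> C"
    using assms by (meson rapid_kernel_def)
  have "\<bar>\<kappa> s\<bar> \<le> C / s ^ N" if "s \<ge> 1" for s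
    using C[OF that] that by (simp add: field_simps)
  moreover have "C \<ge> 0" using C[of 1] by simp
  ultimately show thesis using that by blast
qed

lemma nn_integral_inverse_square:
  assumes "a > 0"
  shows "(\<integral>\<^sup>+s. ennreal (1 / s\<^sup>2) * indicator {a..} s \<partial>lborel) = ennreal (1 / a)"
proof -
  have "(\<integral>\<^sup>+s. ennreal (1 / s\<^sup>2) * indicator {a..} s \<partial>lborel) = ennreal (0 - (- 1 / a))"
  proof (rule nn_integral_FTC_atLeast)
    show "((\<lambda>s. - 1 / s) has_real_derivative 1 / s\<^sup>2) (at s)" if "a \<le> s" for s
      using that assms by (auto intro!: derivative_eq_intros simp: power2_eq_square)
    show "((\<lambda>s::real. - 1 / s) \<longlongrightarrow> 0) at_top"
      by (intro tendsto_divide_0[OF tendsto_const] filterlim_at_top_imp_at_infinity filterlim_ident)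
  qed auto
  then show ?thesis by simp
qed

lemma set_integrable_inverse_square:
  assumes "a > 0"
  shows "set_integrable lborel {a..} (\<lambda>s::real. 1 / s\<^sup>2)"
proof -
  have *: "ennreal (norm (indicat_real {a..} s *\<^sub>R (1 / s\<^sup>2))) = ennreal (1 / s\<^sup>2) * indicator {a..} s" for s
    by (auto simp: indicator_def)
  show ?thesis
    unfolding set_integrable_def
    using nn_integral_inverse_square[OF assms]
    by (intro integrableI_bounded) (simp_all only: *, simp_all)
qed

lemma set_lborel_integral_inverse_square:
  fixes a :: real
  assumes "a > 0"
  shows "(LINT s:{a..}|lborel. 1 / s\<^sup>2) = 1 / a"
proof -
  have "(LINT s:{a..}|lborel. 1 / s\<^sup>2) = enn2real (\<integral>\<^sup>+s. ennreal (1 / s\<^sup>2) * indicator {a..} s \<partial>lborel)"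
    unfolding set_lebesgue_integral_def
    by (subst integral_eq_nn_integral)
       (auto intro!: arg_cong[where f = enn2real] nn_integral_cong simp: indicator_def)
  then show ?thesis using assms by (simp add: nn_integral_inverse_square)
qed

lemma set_borel_measurable_continuous_atLeast:
  fixes f :: "real \<Rightarrow> real"
  assumes "continuous_on {a..} f"
  shows "(\<lambda>s. indicator {a..} s *\<^sub>R f s) \<in> borel_measurable lborel"
  using borel_measurable_continuous_on_indicator[OF _ assms] by simp

lemma rapid_kernel_mult_bound:
  assumes \<kappa>: "rapid_kernel \<kappa>" and G: "\<And>s. s \<ge> 1 \<Longrightarrow> \<bar>G s\<bar> \<le> A * s ^ m"
  obtains C where "C \<ge> 0" "\<And>s. s \<ge> 1 \<Longrightarrow> \<bar>\<kappa> s * G s\<bar> \<le> C / s ^ N"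
proof -
  obtain C where C: "C \<ge> 0" "\<And>s. s \<ge> 1 \<Longrightarrow> \<bar>\<kappa> s\<bar> \<le> C / s ^ (N + m)"
    using rapid_kernel_bound[OF \<kappa>] by metis
  have "A \<ge> 0" using order_trans[OF abs_ge_zero G[of 1]] by simp
  have "\<bar>\<kappa> s * G s\<bar> \<le> (C * A) / s ^ N" if s: "s \<ge> 1" for s
  proof -
    have "\<bar>\<kappa> s * G s\<bar> \<le> C / s ^ (N + m) * (A * s ^ m)"
      unfolding abs_mult using C s G[OF s] by (intro mult_mono) auto
    also have "\<dots> = (C * A) / s ^ N" using s by (simp add: power_add field_simps)
    finally show ?thesis .
  qed
  with C \<open>A \<ge> 0\<close> show thesis by (intro that[of "C * A"]) auto
qed

lemma rapid_kernel_integrable: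
  assumes \<kappa>: "rapid_kernel \<kappa>" and G: "continuous_on {1..} G" "\<And>s. s \<ge> 1 \<Longrightarrow> \<bar>G s\<bar> \<le> A * s ^ m"
  shows "set_integrable lborel {1..} (\<lambda>s. \<kappa> s * G s)"
proof -
  obtain C where C: "C \<ge> 0" "\<And>s. s \<ge> 1 \<Longrightarrow> \<bar>\<kappa> s * G s\<bar> \<le> C / s ^ 2"
    using rapid_kernel_mult_bound[OF \<kappa> G(2), where N=2] by blast
  have "set_integrable lborel {1..} (\<lambda>s::real. C * (1 / s\<^sup>2))"
    using set_integrable_inverse_square[of 1] by (intro set_integrable_mult_right) auto
  then show ?thesis
    unfolding set_integrable_def
  proof (rule Bochner_Integration.integrable_bound)
    have "continuous_on {1..} (\<lambda>s. \<kappa> s * G s)"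
      using \<kappa> G by (intro continuous_on_mult) (auto simp: rapid_kernel_def)
    then show "(\<lambda>s. indicator {1..} s *\<^sub>R (\<kappa> s * G s)) \<in> borel_measurable lborel"
      by (rule set_borel_measurable_continuous_atLeast)
    show "AE s in lborel. norm (indicator {1..} s *\<^sub>R (\<kappa> s * G s)) \<le> norm (indicator {1..} s *\<^sub>R (C * (1 / s\<^sup>2)))"
      using C by (intro always_eventually) (auto simp: indicator_def)
  qed
qed

lemma rapid_kernel_times:
  assumes "rapid_kernel \<kappa>"
  shows "rapid_kernel (\<lambda>s. s * \<kappa> s)"
  unfolding rapid_kernel_def
proof (intro conjI allI)
  show "continuous_on {1..} (\<lambda>s. s * \<kappa> s)"
    using assms by (intro continuous_on_mult continuous_on_id) (auto simp: rapid_kernel_def)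
  fix N :: nat
  obtain C where C: "\<And>s. s \<ge> 1 \<Longrightarrow> \<bar>\<kappa> s\<bar> * s ^ Suc N \<le> C"
    using assms unfolding rapid_kernel_def by meson
  show "\<exists>C. \<forall>s\<ge>1. \<bar>s * \<kappa> s\<bar> * s ^ N \<le> C"
    using C by (intro exI[of _ C]) (auto simp: abs_mult mult_ac)
qed

lemma null_kernel_times:
  assumes "null_kernel \<kappa>"
  shows "null_kernel (\<lambda>s. s * \<kappa> s)"
  unfolding null_kernel_def
proof (intro conjI allI rapid_kernel_times)
  show "rapid_kernel \<kappa>" using assms by (simp add: null_kernel_def)
  fix k
  have "(LINT s:{1..}|lborel. s ^ Suc k * \<kappa> s) = 0" using assms unfolding null_kernel_def by blast
  then show "(LINT s:{1..}|lborel. s ^ k * (s * \<kappa> s)) = 0" by (simp add: mult_ac)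
qed

lemma stein_kernel_rapid:
  assumes "stein_kernel \<tau>" shows "rapid_kernel \<tau>"
  unfolding rapid_kernel_def
proof (intro conjI allI)
  show c: "continuous_on {1..} \<tau>" using assms by (simp add: stein_kernel_def)
  fix N :: nat
  \<comment> \<open>\<open>stein_kernel\<close> speaks about positive exponents only;
    \<open>Suc N\<close> is positive also for N = 0.\<close>
  have "\<tau> \<in> O[at_top](\<lambda>s. s powr - real (Suc N))"
    using assms unfolding stein_kernel_def by (metis of_nat_0_less_iff zero_less_Suc)
  then obtain c where "c > 0" "\<forall>\<^sub>F s in at_top. norm (\<tau> s) \<le> c * norm (s powr - real (Suc N))"
    by (elim landau_o.bigE)
  then obtain b where b: "\<And>s. s \<ge> b \<Longrightarrow> \<bar>\<tau> s\<bar> \<le> c * s powr - real (Suc N)"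
    by (auto simp: eventually_at_top_linorder)
  have far: "\<bar>\<tau> s\<bar> * s ^ N \<le> c" if "s \<ge> b" "s \<ge> 1" for s
  proof -
    have "\<bar>\<tau> s\<bar> * s ^ N \<le> c * s powr - real (Suc N) * s ^ N"
      using b[OF that(1)] that by (intro mult_right_mono) auto
    also have "\<dots> = c / s"
    proof -
      have "s powr - real (Suc N) = 1 / s ^ Suc N"
        using that by (subst powr_minus_divide, subst powr_realpow) auto
      then show ?thesis using that by simp
    qed
    also have "\<dots> \<le> c" using that \<open>c > 0\<close> by (simp add: field_simps)
    finally show ?thesis .
  qed
  have "compact ((\<lambda>s. \<bar>\<tau> s\<bar> * s ^ N) ` {1..b})"
    using c by (intro compact_continuous_image continuous_intros) (auto intro: continuous_on_subset)
  then have "bounded ((\<lambda>s. \<bar>\<tau> s\<bar> * s ^ N) ` {1..b})" by (rule compact_imp_bounded)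
  then obtain d where "\<forall>x\<in>(\<lambda>s. \<bar>\<tau> s\<bar> * s ^ N) ` {1..b}. norm x \<le> d" unfolding bounded_iff by blast
  then have d: "\<And>s. s \<in> {1..b} \<Longrightarrow> \<bar>\<tau> s\<bar> * s ^ N \<le> d" by (fastforce simp: abs_le_iff)
  show "\<exists>C. \<forall>s\<ge>1. \<bar>\<tau> s\<bar> * s ^ N \<le> C"
  proof (intro exI[of _ "max c d"] allI impI)
    fix s :: real assume "1 \<le> s"
    then show "\<bar>\<tau> s\<bar> * s ^ N \<le> max c d"
      using far[of s] d[of s] by (cases "s \<le> b") (auto simp: le_max_iff_disj)
  qed
qed

text \<open>The factor s shifts the moments by one and thereby removes the only nonzero one.\<close>

lemma stein_kernel_null:
  assumes "stein_kernel \<tau>" shows "null_kernel (\<lambda>s. s * \<tau> s)"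
  unfolding null_kernel_def
proof (intro conjI allI rapid_kernel_times stein_kernel_rapid assms)
  fix k :: nat
  have "(LINT s:{1..}|lborel. s ^ Suc k * \<tau> s) = 0" using assms unfolding stein_kernel_def by auto
  then show "(LINT s:{1..}|lborel. s ^ k * (s * \<tau> s)) = 0" by (simp add: mult_ac)
qed

text \<open>For a kernel with integral zero this is the tail integral over \<open>[s, \<infinity>)\<close>.\<close>

definition kernel_prim :: "(real \<Rightarrow> real) \<Rightarrow> real \<Rightarrow> real" where
  "kernel_prim \<kappa> s = - integral {1..s} \<kappa>"

lemma kernel_prim_has_derivative:
  assumes "rapid_kernel \<kappa>" "s \<in> {1..b}"
  shows "(kernel_prim \<kappa> has_real_derivative - \<kappa> s) (at s within {1..b})"
proof -
  have "continuous_on {1..b} \<kappa>"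
    by (rule continuous_on_subset[of "{1..}"]) (use assms in \<open>auto simp: rapid_kernel_def\<close>)
  from integral_has_vector_derivative[OF this assms(2)]
  show ?thesis unfolding kernel_prim_def has_real_derivative_iff_has_vector_derivative
    by (rule has_vector_derivative_minus)
qed

lemma continuous_on_kernel_prim:
  assumes "rapid_kernel \<kappa>" shows "continuous_on {1..} (kernel_prim \<kappa>)"
proof -
  have "continuous_on {1..b} (kernel_prim \<kappa>)" for b
    by (intro continuous_on_vector_derivative)
       (use kernel_prim_has_derivative[OF assms] in \<open>auto simp: has_real_derivative_iff_has_vector_derivative\<close>)
  moreover have "continuous (at s within {1..}) (kernel_prim \<kappa>)" 
    if "continuous_on {1..s+1} (kernel_prim \<kappa>)" "s \<ge> 1" for s
  proof -
    have "at s within {1..s+1} = at s within {1..}"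
      by (rule at_within_nhd[of _ "{..<s+1}"]) auto
    moreover have "continuous (at s within {1..s+1}) (kernel_prim \<kappa>)"
      using that unfolding continuous_on_eq_continuous_within by (meson atLeastAtMost_iff le_add_same_cancel1 zero_le_one)
    ultimately show ?thesis by metis
  qed
  ultimately show ?thesis by (simp add: continuous_on_eq_continuous_within)
qed

text \<open>The definition starting from 1 can be differentiated; the tail form is the one in which
  decay can be read off.\<close>

lemma kernel_prim_eq_tail:
  assumes \<kappa>: "rapid_kernel \<kappa>" and 0: "(LINT s:{1..}|lborel. \<kappa> s) = 0" and s: "s \<ge> 1"
  shows "kernel_prim \<kappa> s = (LINT t:{s..}|lborel. \<kappa> t)"
proof -
  have i: "set_integrable lborel {1..} \<kappa>"
    using rapid_kernel_integrable[OF \<kappa>, of "\<lambda>_. 1" 1 0] by simp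
  have i1: "set_integrable lborel {1..<s} \<kappa>" "set_integrable lborel {s..} \<kappa>"
    by (rule set_integrable_subset[OF i]; use s in auto)+
  have "{1..} = {1..<s} \<union> {s..}" using s by auto
  then have "(LINT s:{1..}|lborel. \<kappa> s) = (LINT t:{1..<s}|lborel. \<kappa> t) + (LINT t:{s..}|lborel. \<kappa> t)"
    using set_integral_Un[OF _ i1] by (auto simp: ivl_disj_int)
  moreover have "(LINT t:{1..<s}|lborel. \<kappa> t) = integral {1..<s} \<kappa>"
    by (rule set_borel_integral_eq_integral(2)[OF i1(1)])
  moreover have "integral {1..<s} \<kappa> = integral {1..s} \<kappa>"
  proof (rule integral_spike_set)
    have "{x \<in> {1..<s} - {1..s}. \<kappa> x \<noteq> 0} \<subseteq> {s}" "{x \<in> {1..s} - {1..<s}. \<kappa> x \<noteq> 0} \<subseteq> {s}" by auto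
    then show "negligible {x \<in> {1..<s} - {1..s}. \<kappa> x \<noteq> 0}" "negligible {x \<in> {1..s} - {1..<s}. \<kappa> x \<noteq> 0}"
      using negligible_subset negligible_sing by blast+
  qed
  ultimately show ?thesis using 0 by (simp add: kernel_prim_def)
qed

lemma rapid_kernel_prim:
  assumes \<kappa>: "rapid_kernel \<kappa>" and 0: "(LINT s:{1..}|lborel. \<kappa> s) = 0"
  shows "rapid_kernel (kernel_prim \<kappa>)"
  unfolding rapid_kernel_def
proof (intro conjI allI continuous_on_kernel_prim[OF \<kappa>])
  fix N :: nat
  \<comment> \<open>Two powers beyond N, since the tail of 1 / t^2 is to remain integrable after s^N
    has been taken out.\<close>
  obtain C where C: "C \<ge> 0" "\<And>s. s \<ge> 1 \<Longrightarrow> \<bar>\<kappa> s\<bar> \<le> C / s ^ (N + 2)"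
    using rapid_kernel_bound[OF \<kappa>] by metis
  have "\<bar>kernel_prim \<kappa> s\<bar> * s ^ N \<le> C" if s: "s \<ge> 1" for s
  proof -
    have i: "set_integrable lborel {1..} \<kappa>"
      using rapid_kernel_integrable[OF \<kappa>, of "\<lambda>_. 1" 1 0] by simp
    have i1: "set_integrable lborel {s..} \<kappa>"
      by (rule set_integrable_subset[OF i]) (use s in auto)
    have i2: "set_integrable lborel {s..} (\<lambda>t. C / s ^ N * (1 / t\<^sup>2))"
      using set_integrable_inverse_square[of s] s by (intro set_integrable_mult_right) auto
    have "\<bar>kernel_prim \<kappa> s\<bar> \<le> (LINT t:{s..}|lborel. C / s ^ N * (1 / t\<^sup>2))"
      unfolding kernel_prim_eq_tail[OF \<kappa> 0 s] set_lebesgue_integral_def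
      unfolding real_norm_def[symmetric]
    proof (rule Bochner_Integration.integral_norm_bound_integral)
      show "integrable lborel (\<lambda>t. indicator {s..} t *\<^sub>R \<kappa> t)"
        "integrable lborel (\<lambda>t. indicator {s..} t *\<^sub>R (C / s ^ N * (1 / t\<^sup>2)))"
        using i1 i2 by (simp_all add: set_integrable_def)
      fix t :: real
      have "\<bar>\<kappa> t\<bar> \<le> C / s ^ N * (1 / t\<^sup>2)" if t: "t \<ge> s"
      proof -
        have "\<bar>\<kappa> t\<bar> \<le> C / t ^ (N + 2)" using C(2)[of t] t s by simp
        also have "\<dots> \<le> C / (s ^ N * t\<^sup>2)"
          unfolding power_add using s t C(1)
          by (intro divide_left_mono mult_right_mono power_mono mult_pos_pos zero_less_power zero_le_power) auto
        finally show ?thesis by simp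
      qed
      then show "norm (indicator {s..} t *\<^sub>R \<kappa> t) \<le> indicator {s..} t *\<^sub>R (C / s ^ N * (1 / t\<^sup>2))"
        by (auto simp: indicator_def)
    qed
    also have "\<dots> = C / s ^ N * (1 / s)"
      using s by (subst set_integral_mult_right) (simp add: set_lborel_integral_inverse_square)
    also have "\<dots> \<le> C / s ^ N"
      using s C(1) by (intro mult_right_le_one_le) auto
    finally show ?thesis using s by (simp add: field_simps)
  qed
  then show "\<exists>C. \<forall>s\<ge>1. \<bar>kernel_prim \<kappa> s\<bar> * s ^ N \<le> C" by blast
qed

text \<open>The boundary terms vanish for two different reasons: at 1 because
  \<open>kernel_prim\<close> starts from 0 there, at infinity because it decays faster than the
  polynomial bound on G grows.\<close>

lemma kernel_by_parts:
  assumes \<kappa>: "rapid_kernel \<kappa>" and 0: "(LINT s:{1..}|lborel. \<kappa> s) = 0"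
    and der: "\<And>s. s \<ge> 1 \<Longrightarrow> (G has_real_derivative G' s) (at s)" and G': "continuous_on {1..} G'"
    and bd: "\<And>s. s \<ge> 1 \<Longrightarrow> \<bar>G s\<bar> \<le> A * s ^ m" "\<And>s. s \<ge> 1 \<Longrightarrow> \<bar>G' s\<bar> \<le> A * s ^ m"
  shows "(LINT s:{1..}|lborel. \<kappa> s * G s) = (LINT s:{1..}|lborel. kernel_prim \<kappa> s * G' s)"
proof -
  let ?K = "kernel_prim \<kappa>"
  have K: "rapid_kernel ?K" by (rule rapid_kernel_prim[OF \<kappa> 0])
  have G: "continuous_on {1..} G"
    using der by (meson DERIV_isCont atLeast_iff continuous_at_imp_continuous_on)
  have i: "set_integrable lborel {1..} (\<lambda>s. \<kappa> s * G s)" "set_integrable lborel {1..} (\<lambda>s. ?K s * G' s)"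
    using rapid_kernel_integrable[OF \<kappa> G bd(1)] rapid_kernel_integrable[OF K G' bd(2)] by auto
  let ?g = "\<lambda>s. ?K s * G' s - \<kappa> s * G s"
  have ig: "set_integrable lborel {1..} ?g" using set_integral_diff(1)[OF i(2,1)] .
  have cg: "continuous_on {1..} ?g"
    using \<kappa> K G G' by (intro continuous_on_diff continuous_on_mult) (auto simp: rapid_kernel_def)
  have FTC: "(LINT s:{1..real n}|lborel. ?g s) = ?K (real n) * G (real n)" if n: "n \<ge> 1" for n :: nat
  proof -
    have "(LINT s:{1..real n}|lborel. ?g s) = ?K (real n) * G (real n) - ?K 1 * G 1"
      unfolding set_lebesgue_integral_def
    proof (rule integral_FTC_atLeastAtMost)
      show "1 \<le> real n" using n by simp
      show "continuous_on {1..real n} ?g" by (rule continuous_on_subset[OF cg]) auto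
      fix s assume s: "1 \<le> s" "s \<le> real n"
      have "(?K has_real_derivative - \<kappa> s) (at s within {1..real n})"
        using s by (intro kernel_prim_has_derivative[OF \<kappa>]) auto
      moreover have "(G has_real_derivative G' s) (at s within {1..real n})"
        using der[OF s(1)] by (rule has_field_derivative_at_within)
      ultimately have "((\<lambda>s. ?K s * G s) has_real_derivative - \<kappa> s * G s + G' s * ?K s) (at s within {1..real n})"
        by (rule DERIV_mult)
      then show "((\<lambda>s. ?K s * G s) has_vector_derivative ?g s) (at s within {1..real n})"
        by (simp add: has_real_derivative_iff_has_vector_derivative algebra_simps)
    qed
    then show ?thesis by (simp add: kernel_prim_def)
  qed
  have "(\<lambda>n. LINT s:{1..real n}|lborel. ?g s) \<longlonglongrightarrow> (LINT s:{1..}|lborel. ?g s)"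
    unfolding set_lebesgue_integral_def
  proof (rule integral_dominated_convergence[where w = "\<lambda>s. norm (indicator {1..} s *\<^sub>R ?g s)"])
    show "(\<lambda>s. indicator {1..} s *\<^sub>R ?g s) \<in> borel_measurable lborel"
      by (rule set_borel_measurable_continuous_atLeast[OF cg])
    show "(\<lambda>s. indicator {1..real n} s *\<^sub>R ?g s) \<in> borel_measurable lborel" for n
    proof -
      have "continuous_on {1..real n} ?g" by (rule continuous_on_subset[OF cg]) auto
      from borel_measurable_continuous_on_indicator[OF _ this] show ?thesis by simp
    qed
    show "integrable lborel (\<lambda>s. norm (indicat_real {1..} s *\<^sub>R ?g s))"
      using ig unfolding set_integrable_def by (rule integrable_norm)
    show "AE s in lborel. (\<lambda>n. indicator {1..real n} s *\<^sub>R ?g s) \<longlonglongrightarrow> indicator {1..} s *\<^sub>R ?g s"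
    proof (intro always_eventually allI tendsto_scaleR tendsto_const)
      fix s
      have "\<forall>\<^sub>F n in sequentially. s \<le> real n"
        using filterlim_real_sequentially by (auto simp: filterlim_at_top)
      then have "\<forall>\<^sub>F n in sequentially. indicat_real {1..} s = indicat_real {1..real n} s"
        by eventually_elim (auto simp: indicator_def)
      then show "(\<lambda>n. indicat_real {1..real n} s) \<longlonglongrightarrow> indicat_real {1..} s"
        by (rule tendsto_eventually[OF eventually_mono]) simp
    qed
    show "AE s in lborel. norm (indicator {1..real n} s *\<^sub>R ?g s) \<le> norm (indicator {1..} s *\<^sub>R ?g s)" for n
      by (intro always_eventually) (auto simp: indicator_def)
  qed
  moreover have "(\<lambda>n. LINT s:{1..real n}|lborel. ?g s) \<longlonglongrightarrow> 0"
  proof -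
    obtain C where C: "C \<ge> 0" "\<And>s. s \<ge> 1 \<Longrightarrow> \<bar>?K s * G s\<bar> \<le> C / s ^ 1"
      using rapid_kernel_mult_bound[OF K bd(1)] by metis
    have "(\<lambda>n. ?K (real n) * G (real n)) \<longlonglongrightarrow> 0"
    proof (rule Lim_null_comparison)
      show "\<forall>\<^sub>F n in sequentially. norm (?K (real n) * G (real n)) \<le> C / real n"
        using C(2) by (intro eventually_sequentiallyI[of 1]) auto
      show "(\<lambda>n. C / real n) \<longlonglongrightarrow> 0" by (rule lim_const_over_n)
    qed
    then show ?thesis
      by (rule Lim_transform_eventually) (use FTC in \<open>auto intro!: eventually_sequentiallyI[of 1]\<close>)
  qed
  ultimately have "(LINT s:{1..}|lborel. ?g s) = 0" by (rule LIMSEQ_unique)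
  then show ?thesis using set_integral_diff(2)[OF i(2,1)] by simp
qed

text \<open>Integrating by parts against s^(k+1) / (k+1) identifies the k-th moment of the primitive
  with a multiple of a moment of \<kappa>. Hence the gain of a vertical derivative can be repeated
  at every further differentiation.\<close>

lemma null_kernel_prim:
  assumes "null_kernel \<kappa>" shows "null_kernel (kernel_prim \<kappa>)"
  unfolding null_kernel_def
proof (intro conjI allI)
  have \<kappa>: "rapid_kernel \<kappa>" and m: "\<And>k::nat. (LINT s:{1..}|lborel. s ^ k * \<kappa> s) = 0"
    using assms by (auto simp: null_kernel_def)
  have 0: "(LINT s:{1..}|lborel. \<kappa> s) = 0" using m[of 0] by simp
  show "rapid_kernel (kernel_prim \<kappa>)" by (rule rapid_kernel_prim[OF \<kappa> 0])
  fix k :: nat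
  have "(LINT s:{1..}|lborel. \<kappa> s * (s ^ Suc k / real (Suc k))) = (LINT s:{1..}|lborel. kernel_prim \<kappa> s * s ^ k)"
  proof (rule kernel_by_parts[OF \<kappa> 0, where A = 1 and m = "Suc k"])
    fix s :: real assume s: "1 \<le> s"
    show "((\<lambda>s. s ^ Suc k / real (Suc k)) has_real_derivative s ^ k) (at s)"
      by (auto intro!: derivative_eq_intros simp del: power_Suc)
    show "\<bar>s ^ Suc k / real (Suc k)\<bar> \<le> 1 * s ^ Suc k" "\<bar>s ^ k\<bar> \<le> 1 * s ^ Suc k"
      using s by (auto simp: field_simps abs_mult mult_le_cancel_right1)
  qed (intro continuous_intros)
  also have "(LINT s:{1..}|lborel. \<kappa> s * (s ^ Suc k / real (Suc k))) =
      (LINT s:{1..}|lborel. (s ^ Suc k * \<kappa> s) / real (Suc k))"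
    by (simp add: mult.commute)
  also have "\<dots> = (LINT s:{1..}|lborel. s ^ Suc k * \<kappa> s) / real (Suc k)" by (rule set_integral_divide_zero)
  also have "\<dots> = 0" using m[of "Suc k"] by simp
  finally show "(LINT s:{1..}|lborel. s ^ k * kernel_prim \<kappa> s) = 0" by (simp add: mult.commute)
qed

subsection \<open>Differentiation of the extension formula\<close>

text \<open>Only derivatives along the lines i and e are at hand, not a total derivative. The
  increment is split at p + t i: the first part is the derivative along i at p; the second is
  treated by the mean value theorem along e, and continuity of \<open>Ge\<close> lets its
  intermediate point tend to p.\<close>

lemma line_chain_rule:
  fixes p i e :: "'a::real_normed_vector" and G :: "'a \<Rightarrow> real"
  assumes \<Omega>: "open \<Omega>" "p \<in> \<Omega>"
    and di: "((\<lambda>t. G (p + t *\<^sub>R i)) has_real_derivative d) (at 0)"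
    and de: "\<And>q. q \<in> \<Omega> \<Longrightarrow> ((\<lambda>t. G (q + t *\<^sub>R e)) has_real_derivative Ge q) (at 0)"
    and Ge: "continuous_on \<Omega> Ge"
    and r: "r 0 = 0" "(r has_real_derivative r') (at 0)"
  shows "((\<lambda>t. G (p + t *\<^sub>R i + r t *\<^sub>R e)) has_real_derivative d + r' * Ge p) (at 0)"
proof -
  obtain \<epsilon> where \<epsilon>: "\<epsilon> > 0" "ball p \<epsilon> \<subseteq> \<Omega>" using \<Omega> openE by blast
  \<comment> \<open>M t bounds the distance from p of every point on the segment used by the mean
    value theorem, so M t < \<epsilon> keeps that segment in \<Omega>.\<close>
  define M where "M t = norm (t *\<^sub>R i) + \<bar>r t\<bar> * norm e" for t
  have r0: "(r \<longlongrightarrow> 0) (at 0)"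
    using DERIV_isCont[OF r(2)] r(1) by (simp add: isCont_def)
  have M0: "(M \<longlongrightarrow> 0) (at 0)"
  proof -
    have "((\<lambda>t. norm (t *\<^sub>R i) + \<bar>r t\<bar> * norm e) \<longlongrightarrow> norm (0 *\<^sub>R i) + \<bar>0\<bar> * norm e) (at 0)"
      by (intro tendsto_intros r0)
    then show ?thesis by (simp add: M_def[abs_def])
  qed
  have dist_le: "dist p (p + t *\<^sub>R i + (\<theta> * r t) *\<^sub>R e) \<le> M t" if "0 \<le> \<theta>" "\<theta> \<le> 1" for t \<theta>
  proof -
    have "\<bar>\<theta> * r t\<bar> \<le> \<bar>r t\<bar>" using that by (simp add: abs_mult mult_left_le_one_le)
    then have "norm ((\<theta> * r t) *\<^sub>R e) \<le> \<bar>r t\<bar> * norm e" by (simp add: mult_right_mono)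
    moreover have "dist p (p + t *\<^sub>R i + (\<theta> * r t) *\<^sub>R e) = norm (t *\<^sub>R i + (\<theta> * r t) *\<^sub>R e)"
      by (subst dist_commute) (simp add: dist_norm add.assoc)
    ultimately show ?thesis
      using norm_triangle_ineq[of "t *\<^sub>R i" "(\<theta> * r t) *\<^sub>R e"] by (simp add: M_def)
  qed
  have mvt: "\<exists>\<theta>. 0 \<le> \<theta> \<and> \<theta> \<le> 1 \<and> G (p + t *\<^sub>R i + r t *\<^sub>R e) - G (p + t *\<^sub>R i) =
      r t * Ge (p + t *\<^sub>R i + (\<theta> * r t) *\<^sub>R e)" if t: "M t < \<epsilon>" for t
  proof -
    have "\<exists>\<theta>>0. \<theta> < 1 \<and> G (p + t *\<^sub>R i + (1 * r t) *\<^sub>R e) - G (p + t *\<^sub>R i + (0 * r t) *\<^sub>R e) =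
        (1 - 0) * (Ge (p + t *\<^sub>R i + (\<theta> * r t) *\<^sub>R e) * r t)"
    proof (rule MVT2)
      fix \<theta> :: real assume \<theta>: "0 \<le> \<theta>" "\<theta> \<le> 1"
      have "p + t *\<^sub>R i + (\<theta> * r t) *\<^sub>R e \<in> \<Omega>"
        using dist_le[OF \<theta>, of t] t \<epsilon>(2) by (auto simp: subset_iff)
      then have "((\<lambda>s. G (p + t *\<^sub>R i + s *\<^sub>R e)) has_real_derivative
          Ge (p + t *\<^sub>R i + (\<theta> * r t) *\<^sub>R e)) (at (\<theta> * r t))"
        by (rule line_has_derivative_at[OF de])
      then show "((\<lambda>\<theta>. G (p + t *\<^sub>R i + (\<theta> * r t) *\<^sub>R e)) has_real_derivative
          Ge (p + t *\<^sub>R i + (\<theta> * r t) *\<^sub>R e) * r t) (at \<theta>)"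
        by (rule DERIV_chain2[where f = "\<lambda>s. G (p + t *\<^sub>R i + s *\<^sub>R e)"]) (auto intro!: derivative_eq_intros)
    qed simp
    then obtain \<theta> where "0 < \<theta>" "\<theta> < 1" "G (p + t *\<^sub>R i + r t *\<^sub>R e) - G (p + t *\<^sub>R i) =
        r t * Ge (p + t *\<^sub>R i + (\<theta> * r t) *\<^sub>R e)" by (auto simp: mult.commute)
    then show ?thesis by (intro exI[of _ \<theta>]) auto
  qed
  then obtain \<theta> where \<theta>: "\<And>t. M t < \<epsilon> \<Longrightarrow> 0 \<le> \<theta> t \<and> \<theta> t \<le> 1 \<and> G (p + t *\<^sub>R i + r t *\<^sub>R e) - G (p + t *\<^sub>R i) =
      r t * Ge (p + t *\<^sub>R i + (\<theta> t * r t) *\<^sub>R e)" by metis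
  have evM: "\<forall>\<^sub>F t in at 0. M t < \<epsilon>"
    using order_tendstoD(2)[OF M0] \<epsilon>(1) by simp
  have "((\<lambda>t. p + t *\<^sub>R i + (\<theta> t * r t) *\<^sub>R e) \<longlongrightarrow> p) (at 0)"
  proof (subst tendsto_dist_iff, rule tendsto_sandwich[OF _ _ tendsto_const M0])
    show "\<forall>\<^sub>F t in at 0. dist (p + t *\<^sub>R i + (\<theta> t * r t) *\<^sub>R e) p \<le> M t"
      using evM by eventually_elim (use \<theta> dist_le in \<open>auto simp: dist_commute\<close>)
  qed auto
  moreover have "isCont Ge p" using Ge \<Omega> by (simp add: continuous_on_eq_continuous_at)
  ultimately have "((\<lambda>t. Ge (p + t *\<^sub>R i + (\<theta> t * r t) *\<^sub>R e)) \<longlongrightarrow> Ge p) (at 0)"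
    by (rule isCont_tendsto_compose[rotated])
  moreover have "((\<lambda>t. r t / t) \<longlongrightarrow> r') (at 0)"
    using r by (simp add: has_field_derivative_iff)
  ultimately have "((\<lambda>t. r t / t * Ge (p + t *\<^sub>R i + (\<theta> t * r t) *\<^sub>R e)) \<longlongrightarrow> r' * Ge p) (at 0)"
    by (intro tendsto_mult)
  moreover have "((\<lambda>t. (G (p + t *\<^sub>R i) - G p) / t) \<longlongrightarrow> d) (at 0)"
    using di by (simp add: has_field_derivative_iff)
  ultimately have "((\<lambda>t. (G (p + t *\<^sub>R i) - G p) / t + r t / t * Ge (p + t *\<^sub>R i + (\<theta> t * r t) *\<^sub>R e))
      \<longlongrightarrow> d + r' * Ge p) (at 0)"
    by (intro tendsto_add)
  moreover have "\<forall>\<^sub>F t in at 0. (G (p + t *\<^sub>R i) - G p) / t + r t / t * Ge (p + t *\<^sub>R i + (\<theta> t * r t) *\<^sub>R e) =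
      (G (p + t *\<^sub>R i + r t *\<^sub>R e) - G p) / t"
    using evM
  proof eventually_elim
    case (elim t)
    have "r t * Ge (p + t *\<^sub>R i + (\<theta> t * r t) *\<^sub>R e) = G (p + t *\<^sub>R i + r t *\<^sub>R e) - G (p + t *\<^sub>R i)"
      using \<theta>[OF elim] by simp
    then show ?case by (simp add: add_divide_distrib[symmetric])
  qed
  ultimately have "((\<lambda>t. (G (p + t *\<^sub>R i + r t *\<^sub>R e) - G p) / t) \<longlongrightarrow> d + r' * Ge p) (at 0)"
    by (rule Lim_transform_eventually)
  then show ?thesis using r(1) by (simp add: has_field_derivative_iff)
qed

text \<open>The bound on the derivative is allowed to grow like s, because moving an evaluation
  point at height s \<open>\<delta>\<^sup>*\<close> produces a factor s. The decay of \<kappa>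
  absorbs it and gives the dominating function.\<close>

lemma kernel_integral_has_derivative:
  assumes \<kappa>: "rapid_kernel \<kappa>" and \<rho>: "\<rho> > 0"
    and der: "\<And>t s. \<bar>t\<bar> < \<rho> \<Longrightarrow> s \<ge> 1 \<Longrightarrow> ((\<lambda>t. h t s) has_real_derivative h' t s) (at t)"
    and h: "\<And>t. \<bar>t\<bar> < \<rho> \<Longrightarrow> continuous_on {1..} (h t)" and h': "continuous_on {1..} (h' 0)"
    and bd: "\<And>t s. \<bar>t\<bar> < \<rho> \<Longrightarrow> s \<ge> 1 \<Longrightarrow> \<bar>h t s\<bar> \<le> C"
      "\<And>t s. \<bar>t\<bar> < \<rho> \<Longrightarrow> s \<ge> 1 \<Longrightarrow> \<bar>h' t s\<bar> \<le> C * s"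
  shows "((\<lambda>t. LINT s:{1..}|lborel. \<kappa> s * h t s) has_real_derivative
    (LINT s:{1..}|lborel. \<kappa> s * h' 0 s)) (at 0)"
proof -
  have i: "set_integrable lborel {1..} (\<lambda>s. \<kappa> s * h t s)" if "\<bar>t\<bar> < \<rho>" for t
    by (rule rapid_kernel_integrable[OF \<kappa> h[OF that], of C 0]) (use bd(1) that in simp)
  have i': "set_integrable lborel {1..} (\<lambda>s. \<kappa> s * (C * s))"
    by (rule rapid_kernel_integrable[OF \<kappa>, of _ "\<bar>C\<bar>" 1]) (auto intro!: continuous_intros simp: abs_mult)
  have ck: "continuous_on {1..} \<kappa>" using \<kappa> by (simp add: rapid_kernel_def)
  have "((\<lambda>t. ((LINT s:{1..}|lborel. \<kappa> s * h t s) - (LINT s:{1..}|lborel. \<kappa> s * h 0 s)) / t) \<longlongrightarrow>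
    (LINT s:{1..}|lborel. \<kappa> s * h' 0 s)) (at 0)"
    unfolding tendsto_at_iff_sequentially comp_def
  proof (intro allI impI)
    fix X :: "nat \<Rightarrow> real" assume X: "\<forall>n. X n \<in> UNIV - {0}" "X \<longlonglongrightarrow> 0"
    have "\<forall>\<^sub>F n in sequentially. \<bar>X n\<bar> < \<rho>"
      using tendstoD[OF X(2) \<rho>] by (simp add: dist_real_def)
    then obtain n0 where n0: "\<And>n. n \<ge> n0 \<Longrightarrow> \<bar>X n\<bar> < \<rho>" by (auto simp: eventually_sequentially)
    \<comment> \<open>The sequence is shifted so that all its members lie in the interval where h is
      controlled.\<close>
    have "(\<lambda>n. LINT s:{1..}|lborel. \<kappa> s * ((h (X (n + n0)) s - h 0 s) / X (n + n0)))
        \<longlonglongrightarrow> (LINT s:{1..}|lborel. \<kappa> s * h' 0 s)"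
      unfolding set_lebesgue_integral_def
    proof (rule integral_dominated_convergence[where w = "\<lambda>s. norm (indicator {1..} s *\<^sub>R (\<kappa> s * (C * s)))"])
      show "(\<lambda>s. indicator {1..} s *\<^sub>R (\<kappa> s * h' 0 s)) \<in> borel_measurable lborel"
        by (intro set_borel_measurable_continuous_atLeast continuous_on_mult ck h')
      show "(\<lambda>s. indicator {1..} s *\<^sub>R (\<kappa> s * ((h (X (n + n0)) s - h 0 s) / X (n + n0)))) \<in> borel_measurable lborel" for n
      proof (rule set_borel_measurable_continuous_atLeast)
        have "X (n + n0) \<noteq> 0" using X(1) by auto
        then show "continuous_on {1..} (\<lambda>s. \<kappa> s * ((h (X (n + n0)) s - h 0 s) / X (n + n0)))"
          using n0[of "n + n0"] \<rho> by (intro continuous_on_mult continuous_on_divide continuous_on_diff ck h) auto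
      qed
      show "integrable lborel (\<lambda>s. norm (indicat_real {1..} s *\<^sub>R (\<kappa> s * (C * s))))"
        using i' unfolding set_integrable_def by (rule integrable_norm)
      show "AE s in lborel. (\<lambda>n. indicator {1..} s *\<^sub>R (\<kappa> s * ((h (X (n + n0)) s - h 0 s) / X (n + n0))))
          \<longlonglongrightarrow> indicator {1..} s *\<^sub>R (\<kappa> s * h' 0 s)"
      proof (intro always_eventually allI)
        fix s :: real
        show "(\<lambda>n. indicator {1..} s *\<^sub>R (\<kappa> s * ((h (X (n + n0)) s - h 0 s) / X (n + n0))))
          \<longlonglongrightarrow> indicator {1..} s *\<^sub>R (\<kappa> s * h' 0 s)"
        proof (cases "s \<ge> 1")
          case True
          have "((\<lambda>t. (h t s - h 0 s) / t) \<longlongrightarrow> h' 0 s) (at 0)"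
            using der[of 0 s] \<rho> True by (simp add: has_field_derivative_iff)
          then have "(\<lambda>n. (h (X n) s - h 0 s) / X n) \<longlonglongrightarrow> h' 0 s"
            using X unfolding tendsto_at_iff_sequentially comp_def by blast
          from LIMSEQ_ignore_initial_segment[OF this, of n0] show ?thesis
            by (intro tendsto_scaleR tendsto_mult tendsto_const)
        qed simp
      qed
      show "AE s in lborel. norm (indicator {1..} s *\<^sub>R (\<kappa> s * ((h (X (n + n0)) s - h 0 s) / X (n + n0))))
          \<le> norm (indicator {1..} s *\<^sub>R (\<kappa> s * (C * s)))" for n
      proof (intro always_eventually allI)
        fix s :: real
        let ?x = "X (n + n0)"
        have x: "?x \<noteq> 0" "\<bar>?x\<bar> < \<rho>" using X(1) n0[of "n + n0"] by auto
        show "norm (indicator {1..} s *\<^sub>R (\<kappa> s * ((h ?x s - h 0 s) / ?x)))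
          \<le> norm (indicator {1..} s *\<^sub>R (\<kappa> s * (C * s)))"
        proof (cases "s \<ge> 1")
          case True
          have "norm (h ?x s - h 0 s) \<le> (C * s) * norm (?x - 0)"
          proof (rule field_differentiable_bound[where S = "{-\<rho><..<\<rho>}" and f' = "\<lambda>t. h' t s" and f = "\<lambda>t. h t s"])
            show "((\<lambda>t. h t s) has_field_derivative h' t s) (at t within {-\<rho><..<\<rho>})" if "t \<in> {-\<rho><..<\<rho>}" for t
              by (rule has_field_derivative_at_within[OF der]) (use that True in auto)
            show "norm (h' t s) \<le> C * s" if "t \<in> {-\<rho><..<\<rho>}" for t
              using bd(2)[of t s] that True by auto
          qed (use x \<rho> in auto)
          then have "\<bar>(h ?x s - h 0 s) / ?x\<bar> \<le> C * s"
            using x by (simp add: field_simps)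
          then have "\<bar>\<kappa> s\<bar> * \<bar>(h ?x s - h 0 s) / ?x\<bar> \<le> \<bar>\<kappa> s\<bar> * \<bar>C * s\<bar>"
            by (intro mult_left_mono) auto
          then show ?thesis using True by (simp add: abs_mult)
        qed simp
      qed
    qed
    moreover have "(LINT s:{1..}|lborel. \<kappa> s * ((h (X (n + n0)) s - h 0 s) / X (n + n0))) =
        ((LINT s:{1..}|lborel. \<kappa> s * h (X (n + n0)) s) - (LINT s:{1..}|lborel. \<kappa> s * h 0 s)) / X (n + n0)" for n
    proof -
      have x: "\<bar>X (n + n0)\<bar> < \<rho>" using n0[of "n + n0"] by auto
      have "(LINT s:{1..}|lborel. \<kappa> s * ((h (X (n + n0)) s - h 0 s) / X (n + n0))) =
          (LINT s:{1..}|lborel. (\<kappa> s * h (X (n + n0)) s - \<kappa> s * h 0 s) / X (n + n0))"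
        by (simp add: right_diff_distrib)
      also have "\<dots> = (LINT s:{1..}|lborel. \<kappa> s * h (X (n + n0)) s - \<kappa> s * h 0 s) / X (n + n0)"
        by (rule set_integral_divide_zero)
      also have "(LINT s:{1..}|lborel. \<kappa> s * h (X (n + n0)) s - \<kappa> s * h 0 s) =
          (LINT s:{1..}|lborel. \<kappa> s * h (X (n + n0)) s) - (LINT s:{1..}|lborel. \<kappa> s * h 0 s)"
        using x \<rho> by (intro set_integral_diff(2) i) auto
      finally show ?thesis .
    qed
    ultimately have "(\<lambda>n. ((LINT s:{1..}|lborel. \<kappa> s * h (X (n + n0)) s) - (LINT s:{1..}|lborel. \<kappa> s * h 0 s)) / X (n + n0))
        \<longlonglongrightarrow> (LINT s:{1..}|lborel. \<kappa> s * h' 0 s)" by (simp only:)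
    from LIMSEQ_offset[OF this] show "(\<lambda>n. ((LINT s:{1..}|lborel. \<kappa> s * h (X n) s) - (LINT s:{1..}|lborel. \<kappa> s * h 0 s)) / X n)
        \<longlonglongrightarrow> (LINT s:{1..}|lborel. \<kappa> s * h' 0 s)" .
  qed
  then show ?thesis by (simp add: has_field_derivative_iff)
qed

lemma kernel_integral_continuous:
  fixes h :: "'a::metric_space \<Rightarrow> real \<Rightarrow> real"
  assumes \<kappa>: "rapid_kernel \<kappa>"
    and h: "\<And>x. x \<in> E \<Longrightarrow> continuous_on {1..} (h x)" "\<And>s. s \<ge> 1 \<Longrightarrow> continuous_on E (\<lambda>x. h x s)"
    and bd: "\<And>x s. x \<in> E \<Longrightarrow> s \<ge> 1 \<Longrightarrow> \<bar>h x s\<bar> \<le> C"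
  shows "continuous_on E (\<lambda>x. LINT s:{1..}|lborel. \<kappa> s * h x s)"
  unfolding continuous_on_sequentially comp_def
proof (intro ballI allI impI)
  fix X x assume x: "x \<in> E" and X: "(\<forall>n. X n \<in> E) \<and> X \<longlonglongrightarrow> x"
  have ck: "continuous_on {1..} \<kappa>" using \<kappa> by (simp add: rapid_kernel_def)
  have i': "set_integrable lborel {1..} (\<lambda>s. \<kappa> s * C)"
    by (rule rapid_kernel_integrable[OF \<kappa>, of _ "\<bar>C\<bar>" 0]) auto
  show "(\<lambda>n. LINT s:{1..}|lborel. \<kappa> s * h (X n) s) \<longlonglongrightarrow> (LINT s:{1..}|lborel. \<kappa> s * h x s)"
    unfolding set_lebesgue_integral_def
  proof (rule integral_dominated_convergence[where w = "\<lambda>s. norm (indicator {1..} s *\<^sub>R (\<kappa> s * C))"])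
    show "(\<lambda>s. indicator {1..} s *\<^sub>R (\<kappa> s * h x s)) \<in> borel_measurable lborel"
      by (intro set_borel_measurable_continuous_atLeast continuous_on_mult ck h x)
    show "(\<lambda>s. indicator {1..} s *\<^sub>R (\<kappa> s * h (X n) s)) \<in> borel_measurable lborel" for n
      using X by (intro set_borel_measurable_continuous_atLeast continuous_on_mult ck h) auto
    show "integrable lborel (\<lambda>s. norm (indicat_real {1..} s *\<^sub>R (\<kappa> s * C)))"
      using i' unfolding set_integrable_def by (rule integrable_norm)
    show "AE s in lborel. (\<lambda>n. indicator {1..} s *\<^sub>R (\<kappa> s * h (X n) s)) \<longlonglongrightarrow> indicator {1..} s *\<^sub>R (\<kappa> s * h x s)"
    proof (intro always_eventually allI)
      fix s :: real
      show "(\<lambda>n. indicator {1..} s *\<^sub>R (\<kappa> s * h (X n) s)) \<longlonglongrightarrow> indicator {1..} s *\<^sub>R (\<kappa> s * h x s)"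
      proof (cases "s \<ge> 1")
        case True
        have "(\<lambda>n. h (X n) s) \<longlonglongrightarrow> h x s"
          using h(2)[OF True] x X unfolding continuous_on_sequentially comp_def by blast
        then show ?thesis by (intro tendsto_scaleR tendsto_mult tendsto_const)
      qed simp
    qed
    show "AE s in lborel. norm (indicator {1..} s *\<^sub>R (\<kappa> s * h (X n) s)) \<le> norm (indicator {1..} s *\<^sub>R (\<kappa> s * C))" for n
    proof (intro always_eventually allI)
      fix s :: real
      show "norm (indicator {1..} s *\<^sub>R (\<kappa> s * h (X n) s)) \<le> norm (indicator {1..} s *\<^sub>R (\<kappa> s * C))"
      proof (cases "s \<ge> 1")
        case True
        then have "\<bar>\<kappa> s\<bar> * \<bar>h (X n) s\<bar> \<le> \<bar>\<kappa> s\<bar> * \<bar>C\<bar>"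
          using bd[of "X n" s] X by (intro mult_left_mono) auto
        then show ?thesis using True by (simp add: abs_mult)
      qed simp
    qed
  qed
qed

text \<open>The data of the extension formula below the graph: \<open>D\<close> are the derivatives of the regularized
  distance \<open>D 0\<close> on the open set \<open>E\<close>, and \<open>x + s c D\<^sub>0(x) e\<close> for \<open>s \<ge> 1\<close> are the points of \<open>\<Omega>\<close> at
  which the formula for \<open>x \<in> E\<close> evaluates its argument.\<close>

definition stein_geometry :: "'a::euclidean_space set \<Rightarrow> 'a set \<Rightarrow> 'a \<Rightarrow> real \<Rightarrow> (('a \<Rightarrow> nat) \<Rightarrow> real) \<Rightarrow>
    (('a \<Rightarrow> nat) \<Rightarrow> 'a \<Rightarrow> real) \<Rightarrow> bool" where
  "stein_geometry E \<Omega> e c bd D \<longleftrightarrow> open E \<and> open \<Omega> \<and> smooth_partials E (D (\<lambda>_. 0)) D \<and>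
     (\<forall>x\<in>E. D (\<lambda>_. 0) x > 0 \<and> (\<forall>s\<ge>1. x + (s * (c * D (\<lambda>_. 0) x)) *\<^sub>R e \<in> \<Omega>)) \<and>
     (\<forall>\<gamma>\<in>multi_indices. \<forall>i\<in>Basis. \<forall>x\<in>E.
        \<bar>D (\<lambda>_. 0) x ^ mi_order \<gamma> * D (\<gamma>(i := Suc (\<gamma> i))) x\<bar> \<le> bd (\<gamma>(i := Suc (\<gamma> i))))"

text \<open>The coefficients are functionals of \<open>D\<close>, so that their bounds do not depend on the domain.\<close>

inductive_set stein_coeffs :: "((('a::euclidean_space \<Rightarrow> nat) \<Rightarrow> 'a \<Rightarrow> real) \<Rightarrow> 'a \<Rightarrow> real) set" where
  const: "(\<lambda>D x. r) \<in> stein_coeffs"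
| deriv: "\<gamma> \<in> multi_indices \<Longrightarrow> i \<in> Basis \<Longrightarrow>
    (\<lambda>D x. D (\<lambda>_. 0) x ^ mi_order \<gamma> * D (\<gamma>(i := Suc (\<gamma> i))) x) \<in> stein_coeffs"
| add: "A \<in> stein_coeffs \<Longrightarrow> A' \<in> stein_coeffs \<Longrightarrow> (\<lambda>D x. A D x + A' D x) \<in> stein_coeffs"
| mult: "A \<in> stein_coeffs \<Longrightarrow> A' \<in> stein_coeffs \<Longrightarrow> (\<lambda>D x. A D x * A' D x) \<in> stein_coeffs"

lemma stein_coeffs_first_deriv:
  "i \<in> Basis \<Longrightarrow> (\<lambda>D x. D ((\<lambda>_. 0)(i := Suc 0)) x) \<in> stein_coeffs"
  using stein_coeffs.deriv[of "\<lambda>_. 0" i] by simp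

text \<open>The generators are scale invariant: a derivative of order k + 1 of the regularized
  distance is of size distance^(-k), and the power of \<open>D (\<lambda>_. 0)\<close> compensates
  for this. C is chosen before E, \<Omega> and D, which is where uniformity over the domains
  starts.\<close>

lemma stein_coeffs_bounded:
  assumes "A \<in> stein_coeffs"
  shows "\<exists>C\<ge>0. \<forall>E \<Omega> D x. stein_geometry E \<Omega> e c bd D \<longrightarrow> x \<in> E \<longrightarrow> \<bar>A D x\<bar> \<le> C"
  using assms
proof induction
  case (const r)
  then show ?case by (intro exI[of _ "\<bar>r\<bar>"]) auto
next
  case (deriv \<gamma> i)
  then show ?case
    by (intro exI[of _ "\<bar>bd (\<gamma>(i := Suc (\<gamma> i)))\<bar>"]) (force simp: stein_geometry_def simp del: fun_upd_apply)
next
  case (add A A')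
  then obtain C C' where C: "C \<ge> 0" "C' \<ge> 0" "\<And>E \<Omega> D x. stein_geometry E \<Omega> e c bd D \<Longrightarrow> x \<in> E \<Longrightarrow> \<bar>A D x\<bar> \<le> C"
    "\<And>E \<Omega> D x. stein_geometry E \<Omega> e c bd D \<Longrightarrow> x \<in> E \<Longrightarrow> \<bar>A' D x\<bar> \<le> C'" by blast
  then show ?case
    by (intro exI[of _ "C + C'"] conjI allI impI order_trans[OF abs_triangle_ineq] add_mono) auto
next
  case (mult A A')
  then obtain C C' where C: "C \<ge> 0" "C' \<ge> 0" "\<And>E \<Omega> D x. stein_geometry E \<Omega> e c bd D \<Longrightarrow> x \<in> E \<Longrightarrow> \<bar>A D x\<bar> \<le> C"
    "\<And>E \<Omega> D x. stein_geometry E \<Omega> e c bd D \<Longrightarrow> x \<in> E \<Longrightarrow> \<bar>A' D x\<bar> \<le> C'" by blast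
  then show ?case
    unfolding abs_mult by (intro exI[of _ "C * C'"] conjI allI impI mult_mono) auto
qed

lemma stein_coeffs_continuous:
  assumes "A \<in> stein_coeffs" "stein_geometry E \<Omega> e c bd D"
  shows "continuous_on E (A D)"
  using assms(1)
proof induction
  case (deriv \<gamma> i)
  have "smooth_partials E (D (\<lambda>_. 0)) D" using assms(2) by (simp add: stein_geometry_def)
  then show ?case
    using deriv by (intro continuous_on_mult continuous_on_power smooth_partials_continuous_on)
      (auto simp del: fun_upd_apply)
qed (auto intro: continuous_on_add continuous_on_mult)

text \<open>A derivative costs exactly one power of the distance; after multiplication by it one is
  back in the algebra. A' too is found before the geometry.\<close>

lemma stein_coeffs_deriv:
  fixes i :: "'a::euclidean_space"
  assumes "A \<in> stein_coeffs" and i: "i \<in> Basis"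
  shows "\<exists>A'\<in>stein_coeffs. \<forall>E \<Omega> e c bd D x. stein_geometry E \<Omega> e c bd D \<longrightarrow> x \<in> E \<longrightarrow>
    ((\<lambda>t. A D (x + t *\<^sub>R i)) has_real_derivative A' D x / D (\<lambda>_. 0) x) (at 0)"
  using assms(1)
proof induction
  case (const r)
  then show ?case by (intro bexI[of _ "\<lambda>D x. 0"] stein_coeffs.const) auto
next
  case (deriv \<gamma> j)
  let ?\<gamma> = "\<gamma>(j := Suc (\<gamma> j))"
  let ?n = "mi_order \<gamma>"
  \<comment> \<open>The product rule for \<Delta>^n times the derivative of order ?\<gamma>,
    multiplied by \<Delta>: the first summand regroups as n times the first derivative of \<Delta>
    times the old coefficient, the second is the generator of the next order.\<close>
  let ?A = "\<lambda>D x. (real ?n * D ((\<lambda>_. 0)(i := Suc 0)) x) * (D (\<lambda>_. 0) x ^ ?n * D ?\<gamma> x) +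
      D (\<lambda>_. 0) x ^ mi_order ?\<gamma> * D (?\<gamma>(i := Suc (?\<gamma> i))) x"
  have "?A \<in> stein_coeffs"
    using deriv i by (intro stein_coeffs.add stein_coeffs.mult stein_coeffs.const
        stein_coeffs_first_deriv stein_coeffs.deriv multi_index_upd_Suc)
  moreover have "((\<lambda>t. D (\<lambda>_. 0) (x + t *\<^sub>R i) ^ ?n * D ?\<gamma> (x + t *\<^sub>R i)) has_real_derivative
      ?A D x / D (\<lambda>_. 0) x) (at 0)"
    if g: "stein_geometry E \<Omega> e c bd D" and x: "x \<in> E" for E \<Omega> e c bd D x
  proof -
    have sm: "smooth_partials E (D (\<lambda>_. 0)) D" and pos: "D (\<lambda>_. 0) x > 0"
      using g x by (auto simp: stein_geometry_def)
    have d0: "((\<lambda>t. D (\<lambda>_. 0) (x + t *\<^sub>R i)) has_real_derivative D ((\<lambda>_. 0)(i := Suc 0)) x) (at 0)"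
      using smooth_partialsD(2)[OF sm x zero_multi_index i] by simp
    have d1: "((\<lambda>t. D ?\<gamma> (x + t *\<^sub>R i)) has_real_derivative D (?\<gamma>(i := Suc (?\<gamma> i))) x) (at 0)"
      by (rule smooth_partialsD(2)[OF sm x multi_index_upd_Suc[OF deriv] i])
    \<comment> \<open>For order 0 the exponent n - 1 is truncated to 0, which the factor n = 0 makes
      harmless.\<close>
    have eq: "real ?n * D (\<lambda>_. 0) x ^ (?n - 1) * D ((\<lambda>_. 0)(i := Suc 0)) x * D ?\<gamma> x +
        D (?\<gamma>(i := Suc (?\<gamma> i))) x * D (\<lambda>_. 0) x ^ ?n = ?A D x / D (\<lambda>_. 0) x"
    proof (cases ?n)
      case 0
      then show ?thesis using pos deriv(2) by (simp del: fun_upd_apply)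
    next
      case (Suc m)
      then show ?thesis using pos deriv(2)
        by (simp add: field_simps del: fun_upd_apply)
    qed
    have "((\<lambda>t. D (\<lambda>_. 0) (x + t *\<^sub>R i) ^ ?n * D ?\<gamma> (x + t *\<^sub>R i)) has_real_derivative
        real ?n * D (\<lambda>_. 0) x ^ (?n - 1) * D ((\<lambda>_. 0)(i := Suc 0)) x * D ?\<gamma> x +
        D (?\<gamma>(i := Suc (?\<gamma> i))) x * D (\<lambda>_. 0) x ^ ?n) (at 0)"
      using DERIV_mult[OF DERIV_power[OF d0, of ?n] d1] by (simp add: mult_ac del: fun_upd_apply)
    then show ?thesis unfolding eq .
  qed
  ultimately show ?case by (intro bexI[of _ ?A]) blast+
next
  case (add A1 A2)
  then obtain B1 B2 where B: "B1 \<in> stein_coeffs" "B2 \<in> stein_coeffs"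
    "\<forall>E \<Omega> e c bd D x. stein_geometry E \<Omega> e c bd D \<longrightarrow> x \<in> E \<longrightarrow>
      ((\<lambda>t. A1 D (x + t *\<^sub>R i)) has_real_derivative B1 D x / D (\<lambda>_. 0) x) (at 0)"
    "\<forall>E \<Omega> e c bd D x. stein_geometry E \<Omega> e c bd D \<longrightarrow> x \<in> E \<longrightarrow>
      ((\<lambda>t. A2 D (x + t *\<^sub>R i)) has_real_derivative B2 D x / D (\<lambda>_. 0) x) (at 0)" by blast
  show ?case
  proof (intro bexI[of _ "\<lambda>D x. B1 D x + B2 D x"] allI impI)
    fix E \<Omega> :: "'a set" and e c bd D x assume g: "stein_geometry E \<Omega> e c bd D" "x \<in> E"
    have "((\<lambda>t. A1 D (x + t *\<^sub>R i) + A2 D (x + t *\<^sub>R i)) has_real_derivative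
        B1 D x / D (\<lambda>_. 0) x + B2 D x / D (\<lambda>_. 0) x) (at 0)"
      by (rule DERIV_add[OF B(3)[rule_format, OF g] B(4)[rule_format, OF g]])
    then show "((\<lambda>t. A1 D (x + t *\<^sub>R i) + A2 D (x + t *\<^sub>R i)) has_real_derivative
        (B1 D x + B2 D x) / D (\<lambda>_. 0) x) (at 0)" by (simp only: add_divide_distrib)
  qed (intro stein_coeffs.add B)
next
  case (mult A1 A2)
  then obtain B1 B2 where B: "B1 \<in> stein_coeffs" "B2 \<in> stein_coeffs"
    "\<forall>E \<Omega> e c bd D x. stein_geometry E \<Omega> e c bd D \<longrightarrow> x \<in> E \<longrightarrow>
      ((\<lambda>t. A1 D (x + t *\<^sub>R i)) has_real_derivative B1 D x / D (\<lambda>_. 0) x) (at 0)"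
    "\<forall>E \<Omega> e c bd D x. stein_geometry E \<Omega> e c bd D \<longrightarrow> x \<in> E \<longrightarrow>
      ((\<lambda>t. A2 D (x + t *\<^sub>R i)) has_real_derivative B2 D x / D (\<lambda>_. 0) x) (at 0)" by blast
  show ?case
  proof (intro bexI[of _ "\<lambda>D x. B1 D x * A2 D x + B2 D x * A1 D x"] allI impI)
    fix E \<Omega> :: "'a set" and e c bd D x assume g: "stein_geometry E \<Omega> e c bd D" "x \<in> E"
    have "((\<lambda>t. A1 D (x + t *\<^sub>R i) * A2 D (x + t *\<^sub>R i)) has_real_derivative
        B1 D x / D (\<lambda>_. 0) x * A2 D (x + 0 *\<^sub>R i) + B2 D x / D (\<lambda>_. 0) x * A1 D (x + 0 *\<^sub>R i)) (at 0)"
      by (rule DERIV_mult[OF B(3)[rule_format, OF g] B(4)[rule_format, OF g]])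
    then show "((\<lambda>t. A1 D (x + t *\<^sub>R i) * A2 D (x + t *\<^sub>R i)) has_real_derivative
        (B1 D x * A2 D x + B2 D x * A1 D x) / D (\<lambda>_. 0) x) (at 0)" by (simp add: add_divide_distrib)
  qed (intro stein_coeffs.add stein_coeffs.mult B mult.hyps)
qed

text \<open>The family F is the primary object and its entry of order 0 is the function, so
  differentiation merely changes the index.\<close>

definition smooth_bounded :: "'a::euclidean_space set \<Rightarrow> (('a \<Rightarrow> nat) \<Rightarrow> 'a \<Rightarrow> real) \<Rightarrow> bool" where
  "smooth_bounded \<Omega> F \<longleftrightarrow> smooth_partials \<Omega> (F (\<lambda>_. 0)) F \<and> (\<forall>\<beta>\<in>multi_indices. bounded (F \<beta> ` \<Omega>))"

definition kernel_shift :: "'a::euclidean_space \<Rightarrow> real \<Rightarrow> (real \<Rightarrow> real) \<Rightarrow> ('a \<Rightarrow> real) \<Rightarrow> ('a \<Rightarrow> real) \<Rightarrow> 'a \<Rightarrow> real" where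
  "kernel_shift e c \<kappa> \<Delta> g x = (LINT s:{1..}|lborel. \<kappa> s * g (x + (s * (c * \<Delta> x)) *\<^sub>R e))"

lemma shifted_continuous:
  fixes e :: "'a::euclidean_space"
  assumes g: "stein_geometry E \<Omega> e c bd D" and G: "continuous_on \<Omega> G"
  shows "x \<in> E \<Longrightarrow> continuous_on {1..} (\<lambda>s. G (x + (s * (c * D (\<lambda>_. 0) x)) *\<^sub>R e))"
    and "s \<ge> 1 \<Longrightarrow> continuous_on E (\<lambda>x. G (x + (s * (c * D (\<lambda>_. 0) x)) *\<^sub>R e))"
proof -
  have sm: "smooth_partials E (D (\<lambda>_. 0)) D"
    and \<Omega>: "\<And>x s. x \<in> E \<Longrightarrow> s \<ge> 1 \<Longrightarrow> x + (s * (c * D (\<lambda>_. 0) x)) *\<^sub>R e \<in> \<Omega>"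
    using g by (auto simp: stein_geometry_def)
  show "continuous_on {1..} (\<lambda>s. G (x + (s * (c * D (\<lambda>_. 0) x)) *\<^sub>R e))" if "x \<in> E"
    by (rule continuous_on_compose2[OF G]) (use \<Omega> that in \<open>auto intro!: continuous_intros\<close>)
  show "continuous_on E (\<lambda>x. G (x + (s * (c * D (\<lambda>_. 0) x)) *\<^sub>R e))" if "s \<ge> 1"
    by (rule continuous_on_compose2[OF G])
       (use \<Omega> that smooth_partials_continuous_on[OF sm zero_multi_index] in \<open>auto intro!: continuous_intros\<close>)
qed

lemma kernel_shift_continuous:
  assumes g: "stein_geometry E \<Omega> e c bd D" and F: "smooth_bounded \<Omega> F" "\<beta> \<in> multi_indices"
    and \<kappa>: "rapid_kernel \<kappa>"
  shows "continuous_on E (kernel_shift e c \<kappa> (D (\<lambda>_. 0)) (F \<beta>))"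
proof -
  obtain C where C: "\<And>y. y \<in> \<Omega> \<Longrightarrow> \<bar>F \<beta> y\<bar> \<le> C"
    using F by (force simp: smooth_bounded_def bounded_iff)
  have "continuous_on \<Omega> (F \<beta>)"
    using F smooth_partials_continuous_on by (auto simp: smooth_bounded_def)
  note cont = shifted_continuous[OF g this]
  show ?thesis
    unfolding kernel_shift_def[abs_def]
  proof (rule kernel_integral_continuous[OF \<kappa> cont])
    show "\<bar>F \<beta> (x + (s * (c * D (\<lambda>_. 0) x)) *\<^sub>R e)\<bar> \<le> C" if "x \<in> E" "1 \<le> s" for x s
      using g that by (intro C) (auto simp: stein_geometry_def)
  qed
qed

text \<open>The evaluation point moves with velocity i + s c (\<partial>_i \<Delta>) e. Its factor s
  is put into the kernel, and this is how \<tau> turns into a kernel all of whose moments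
  vanish.\<close>

lemma kernel_shift_deriv:
  fixes e :: "'a::euclidean_space"
  assumes g: "stein_geometry E \<Omega> e c bd D" and F: "smooth_bounded \<Omega> F" "\<beta> \<in> multi_indices"
    and \<kappa>: "rapid_kernel \<kappa>" and e: "e \<in> Basis" and i: "i \<in> Basis" and x: "x \<in> E"
  shows "((\<lambda>t. kernel_shift e c \<kappa> (D (\<lambda>_. 0)) (F \<beta>) (x + t *\<^sub>R i)) has_real_derivative
      kernel_shift e c \<kappa> (D (\<lambda>_. 0)) (F (\<beta>(i := Suc (\<beta> i)))) x +
      c * D ((\<lambda>_. 0)(i := Suc 0)) x * kernel_shift e c (\<lambda>s. s * \<kappa> s) (D (\<lambda>_. 0)) (F (\<beta>(e := Suc (\<beta> e)))) x) (at 0)"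
proof -
  let ?\<Delta> = "D (\<lambda>_. 0)" and ?Fi = "F (\<beta>(i := Suc (\<beta> i)))" and ?Fe = "F (\<beta>(e := Suc (\<beta> e)))"
    and ?Di = "D ((\<lambda>_. 0)(i := Suc 0))"
  have E: "open E" and \<Omega>: "open \<Omega>" and sm: "smooth_partials E ?\<Delta> D"
    and in\<Omega>: "\<And>x s. x \<in> E \<Longrightarrow> s \<ge> 1 \<Longrightarrow> x + (s * (c * ?\<Delta> x)) *\<^sub>R e \<in> \<Omega>"
    using g by (auto simp: stein_geometry_def)
  have smF: "smooth_partials \<Omega> (F (\<lambda>_. 0)) F" using F by (simp add: smooth_bounded_def)
  have \<beta>: "\<beta>(i := Suc (\<beta> i)) \<in> multi_indices" "\<beta>(e := Suc (\<beta> e)) \<in> multi_indices"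
    using F(2) e i multi_index_upd_Suc by blast+
  have contF: "continuous_on \<Omega> (F \<gamma>)" if "\<gamma> \<in> multi_indices" for \<gamma>
    using smooth_partials_continuous_on[OF smF that] .
  have bF: "\<exists>C. \<forall>y\<in>\<Omega>. \<bar>F \<gamma> y\<bar> \<le> C" if "\<gamma> \<in> multi_indices" for \<gamma>
    using F(1) that by (force simp: smooth_bounded_def bounded_iff)
  obtain C0 Ci Ce where C0: "\<And>y. y \<in> \<Omega> \<Longrightarrow> \<bar>F \<beta> y\<bar> \<le> C0" and Ci: "\<And>y. y \<in> \<Omega> \<Longrightarrow> \<bar>?Fi y\<bar> \<le> Ci"
    and Ce: "\<And>y. y \<in> \<Omega> \<Longrightarrow> \<bar>?Fe y\<bar> \<le> Ce"
    using bF[OF F(2)] bF[OF \<beta>(1)] bF[OF \<beta>(2)] by metis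
  define b where "b = bd ((\<lambda>_. 0)(i := Suc 0))"
  \<comment> \<open>The case \<gamma> = 0 of the geometry: the first derivatives of the distance are
    bounded without a weight.\<close>
  have Di: "\<bar>?Di y\<bar> \<le> b" if y: "y \<in> E" for y
  proof -
    have "\<forall>\<gamma>\<in>multi_indices. \<forall>i\<in>Basis. \<forall>x\<in>E.
        \<bar>D (\<lambda>_. 0) x ^ mi_order \<gamma> * D (\<gamma>(i := Suc (\<gamma> i))) x\<bar> \<le> bd (\<gamma>(i := Suc (\<gamma> i)))"
      using g by (simp add: stein_geometry_def del: fun_upd_apply)
    from this[rule_format, OF zero_multi_index i y] show ?thesis by (simp add: b_def)
  qed
  obtain T where T: "open T" "0 \<in> T" "\<forall>t\<in>T. x + t *\<^sub>R i \<in> E"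
    using eventually_line_in_open[OF E x, of i] by blast
  obtain \<rho> where \<rho>: "\<rho> > 0" "\<And>t. \<bar>t\<bar> < \<rho> \<Longrightarrow> t \<in> T"
  proof -
    obtain \<rho> where "\<rho> > 0" "ball 0 \<rho> \<subseteq> T" using T(1,2) openE by blast
    then show thesis by (intro that[of \<rho>]) (auto simp: subset_iff dist_real_def)
  qed
  have xt: "x + t *\<^sub>R i \<in> E" if "\<bar>t\<bar> < \<rho>" for t using \<rho>(2)[OF that] T(3) by blast
  define P where "P s y = y + (s * (c * ?\<Delta> y)) *\<^sub>R e" for s y
  define G where "G s y = ?Fi (P s y) + (s * (c * ?Di y)) * ?Fe (P s y)" for s y
  have der: "((\<lambda>t. F \<beta> (P s (y + t *\<^sub>R i))) has_real_derivative G s y) (at 0)"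
    if y: "y \<in> E" and s: "s \<ge> 1" for y s
  proof -
    have dD: "((\<lambda>t. ?\<Delta> (y + t *\<^sub>R i)) has_real_derivative ?Di y) (at 0)"
      using smooth_partialsD(2)[OF sm y zero_multi_index i] by simp
    have "((\<lambda>t. F \<beta> (P s y + t *\<^sub>R i + (s * (c * ?\<Delta> (y + t *\<^sub>R i)) - s * (c * ?\<Delta> y)) *\<^sub>R e)) has_real_derivative
        ?Fi (P s y) + (s * (c * ?Di y)) * ?Fe (P s y)) (at 0)"
    proof (rule line_chain_rule[OF \<Omega>, where r = "\<lambda>t. s * (c * ?\<Delta> (y + t *\<^sub>R i)) - s * (c * ?\<Delta> y)"])
      show "P s y \<in> \<Omega>" unfolding P_def by (rule in\<Omega>[OF y s])
      then show "((\<lambda>t. F \<beta> (P s y + t *\<^sub>R i)) has_real_derivative ?Fi (P s y)) (at 0)"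
        by (rule smooth_partialsD(2)[OF smF _ F(2) i])
      show "((\<lambda>t. F \<beta> (q + t *\<^sub>R e)) has_real_derivative ?Fe q) (at 0)" if "q \<in> \<Omega>" for q
        by (rule smooth_partialsD(2)[OF smF that F(2) e])
      show "continuous_on \<Omega> ?Fe" by (rule contF[OF \<beta>(2)])
      show "((\<lambda>t. s * (c * ?\<Delta> (y + t *\<^sub>R i)) - s * (c * ?\<Delta> y)) has_real_derivative s * (c * ?Di y)) (at 0)"
        using DERIV_diff[OF DERIV_cmult[OF DERIV_cmult[OF dD, of c], of s] DERIV_const] by (simp del: fun_upd_apply)
    qed simp
    moreover have "P s y + t *\<^sub>R i + (s * (c * ?\<Delta> (y + t *\<^sub>R i)) - s * (c * ?\<Delta> y)) *\<^sub>R e = P s (y + t *\<^sub>R i)" for t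
      by (simp add: P_def algebra_simps)
    ultimately show ?thesis by (simp only: G_def)
  qed
  have "((\<lambda>t. LINT s:{1..}|lborel. \<kappa> s * F \<beta> (P s (x + t *\<^sub>R i))) has_real_derivative
      (LINT s:{1..}|lborel. \<kappa> s * G s (x + 0 *\<^sub>R i))) (at 0)"
  proof (rule kernel_integral_has_derivative[OF \<kappa> \<rho>(1), where h' = "\<lambda>t s. G s (x + t *\<^sub>R i)"
      and C = "\<bar>C0\<bar> + \<bar>Ci\<bar> + \<bar>c\<bar> * \<bar>b\<bar> * \<bar>Ce\<bar>"])
    fix t assume t: "\<bar>t\<bar> < \<rho>"
    show "continuous_on {1..} (\<lambda>s. F \<beta> (P s (x + t *\<^sub>R i)))"
      unfolding P_def by (rule shifted_continuous(1)[OF g contF[OF F(2)] xt[OF t]])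
    fix s :: real assume s: "1 \<le> s"
    show "((\<lambda>t. F \<beta> (P s (x + t *\<^sub>R i))) has_real_derivative G s (x + t *\<^sub>R i)) (at t)"
      by (rule line_has_derivative_at[where v = "\<lambda>y. F \<beta> (P s y)", OF der[OF xt[OF t] s]])
    have p: "P s (x + t *\<^sub>R i) \<in> \<Omega>" unfolding P_def by (rule in\<Omega>[OF xt[OF t] s])
    have nn: "0 \<le> \<bar>c\<bar> * \<bar>b\<bar> * \<bar>Ce\<bar>" by simp
    show "\<bar>F \<beta> (P s (x + t *\<^sub>R i))\<bar> \<le> \<bar>C0\<bar> + \<bar>Ci\<bar> + \<bar>c\<bar> * \<bar>b\<bar> * \<bar>Ce\<bar>"
      using C0[OF p] nn by linarith
    have "\<bar>G s (x + t *\<^sub>R i)\<bar> \<le> \<bar>?Fi (P s (x + t *\<^sub>R i))\<bar> + \<bar>(s * (c * ?Di (x + t *\<^sub>R i))) * ?Fe (P s (x + t *\<^sub>R i))\<bar>"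
      unfolding G_def by (rule abs_triangle_ineq)
    also have "\<dots> \<le> \<bar>Ci\<bar> + (s * (\<bar>c\<bar> * \<bar>b\<bar>)) * \<bar>Ce\<bar>"
      unfolding abs_mult using Ci[OF p] Ce[OF p] Di[OF xt[OF t]] s
      by (intro add_mono mult_mono) auto
    also have "\<dots> \<le> \<bar>Ci\<bar> * s + (s * (\<bar>c\<bar> * \<bar>b\<bar>)) * \<bar>Ce\<bar> + \<bar>C0\<bar> * s"
    proof -
      have "\<bar>Ci\<bar> * 1 \<le> \<bar>Ci\<bar> * s" by (rule mult_left_mono[OF s]) simp
      moreover have "0 \<le> \<bar>C0\<bar> * s" using s by simp
      ultimately show ?thesis by linarith
    qed
    also have "\<dots> = (\<bar>C0\<bar> + \<bar>Ci\<bar> + \<bar>c\<bar> * \<bar>b\<bar> * \<bar>Ce\<bar>) * s" by (simp add: algebra_simps)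
    finally show "\<bar>G s (x + t *\<^sub>R i)\<bar> \<le> (\<bar>C0\<bar> + \<bar>Ci\<bar> + \<bar>c\<bar> * \<bar>b\<bar> * \<bar>Ce\<bar>) * s" .
  next
    show "continuous_on {1..} (\<lambda>s. G s (x + 0 *\<^sub>R i))"
      unfolding G_def P_def using x
      by (simp del: fun_upd_apply)
         (intro continuous_on_add continuous_on_mult continuous_on_id continuous_on_const
          shifted_continuous(1)[OF g contF[OF \<beta>(1)]] shifted_continuous(1)[OF g contF[OF \<beta>(2)]])
  qed
  moreover have "(LINT s:{1..}|lborel. \<kappa> s * G s (x + 0 *\<^sub>R i)) =
      kernel_shift e c \<kappa> ?\<Delta> ?Fi x + c * ?Di x * kernel_shift e c (\<lambda>s. s * \<kappa> s) ?\<Delta> ?Fe x"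
  proof -
    have 1: "set_integrable lborel {1..} (\<lambda>s. \<kappa> s * ?Fi (P s x))"
      by (rule rapid_kernel_integrable[OF \<kappa>, of _ Ci 0])
         (use in\<Omega>[OF x] Ci shifted_continuous(1)[OF g contF[OF \<beta>(1)] x] in \<open>auto simp: P_def\<close>)
    have 2: "set_integrable lborel {1..} (\<lambda>s. (s * \<kappa> s) * ?Fe (P s x))"
      by (rule rapid_kernel_integrable[OF rapid_kernel_times[OF \<kappa>], of _ Ce 0])
         (use in\<Omega>[OF x] Ce shifted_continuous(1)[OF g contF[OF \<beta>(2)] x] in \<open>auto simp: P_def\<close>)
    have "(LINT s:{1..}|lborel. \<kappa> s * G s (x + 0 *\<^sub>R i)) =
        (LINT s:{1..}|lborel. \<kappa> s * ?Fi (P s x) + (c * ?Di x) * ((s * \<kappa> s) * ?Fe (P s x)))"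
      by (simp add: G_def algebra_simps del: fun_upd_apply)
    also have "\<dots> = (LINT s:{1..}|lborel. \<kappa> s * ?Fi (P s x)) + (LINT s:{1..}|lborel. (c * ?Di x) * ((s * \<kappa> s) * ?Fe (P s x)))"
      by (rule set_integral_add(2)[OF 1 set_integrable_mult_right[OF 2]])
    also have "(LINT s:{1..}|lborel. (c * ?Di x) * ((s * \<kappa> s) * ?Fe (P s x))) =
        (c * ?Di x) * (LINT s:{1..}|lborel. (s * \<kappa> s) * ?Fe (P s x))"
      by (rule set_integral_mult_right)
    finally show ?thesis by (simp only: kernel_shift_def P_def)
  qed
  ultimately show ?thesis by (simp only: kernel_shift_def[symmetric] P_def)
qed

text \<open>Integration by parts in the kernel variable trades one order of decay of the coefficient for a
  vertical derivative.\<close>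

lemma kernel_shift_raise:
  fixes e :: "'a::euclidean_space"
  assumes g: "stein_geometry E \<Omega> e c bd D" and F: "smooth_bounded \<Omega> F" "\<beta> \<in> multi_indices"
    and \<kappa>: "null_kernel \<kappa>" and e: "e \<in> Basis" and x: "x \<in> E"
  shows "kernel_shift e c \<kappa> (D (\<lambda>_. 0)) (F \<beta>) x =
    c * D (\<lambda>_. 0) x * kernel_shift e c (kernel_prim \<kappa>) (D (\<lambda>_. 0)) (F (\<beta>(e := Suc (\<beta> e)))) x"
proof -
  let ?\<Delta> = "D (\<lambda>_. 0)" and ?Fe = "F (\<beta>(e := Suc (\<beta> e)))"
  have in\<Omega>: "\<And>s. s \<ge> 1 \<Longrightarrow> x + (s * (c * ?\<Delta> x)) *\<^sub>R e \<in> \<Omega>"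
    using g x by (auto simp: stein_geometry_def)
  have smF: "smooth_partials \<Omega> (F (\<lambda>_. 0)) F" using F by (simp add: smooth_bounded_def)
  have \<beta>: "\<beta>(e := Suc (\<beta> e)) \<in> multi_indices" using F(2) e multi_index_upd_Suc by blast
  have bF: "\<exists>C. \<forall>y\<in>\<Omega>. \<bar>F \<gamma> y\<bar> \<le> C" if "\<gamma> \<in> multi_indices" for \<gamma>
    using F(1) that by (force simp: smooth_bounded_def bounded_iff)
  obtain C0 Ce where C0: "\<And>y. y \<in> \<Omega> \<Longrightarrow> \<bar>F \<beta> y\<bar> \<le> C0" and Ce: "\<And>y. y \<in> \<Omega> \<Longrightarrow> \<bar>?Fe y\<bar> \<le> Ce"
    using bF[OF F(2)] bF[OF \<beta>] by metis
  have rk: "rapid_kernel \<kappa>" and k0: "(LINT s:{1..}|lborel. \<kappa> s) = 0"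
    using \<kappa> by (auto simp: null_kernel_def dest: spec[of _ 0])
  have "(LINT s:{1..}|lborel. \<kappa> s * F \<beta> (x + (s * (c * ?\<Delta> x)) *\<^sub>R e)) =
      (LINT s:{1..}|lborel. kernel_prim \<kappa> s * ((c * ?\<Delta> x) * ?Fe (x + (s * (c * ?\<Delta> x)) *\<^sub>R e)))"
  proof (rule kernel_by_parts[OF rk k0, where A = "\<bar>C0\<bar> + \<bar>c * ?\<Delta> x\<bar> * \<bar>Ce\<bar>" and m = 0])
    show "continuous_on {1..} (\<lambda>s. (c * ?\<Delta> x) * ?Fe (x + (s * (c * ?\<Delta> x)) *\<^sub>R e))"
      by (intro continuous_on_mult continuous_on_const
          shifted_continuous(1)[OF g smooth_partials_continuous_on[OF smF \<beta>] x])
    fix s :: real assume s: "s \<ge> 1"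
    have "((\<lambda>t. F \<beta> (x + t *\<^sub>R e)) has_real_derivative ?Fe (x + (s * (c * ?\<Delta> x)) *\<^sub>R e)) (at (s * (c * ?\<Delta> x)))"
      by (rule line_has_derivative_at[OF smooth_partialsD(2)[OF smF in\<Omega>[OF s] F(2) e]])
    then have "((\<lambda>s. F \<beta> (x + (s * (c * ?\<Delta> x)) *\<^sub>R e)) has_real_derivative
        ?Fe (x + (s * (c * ?\<Delta> x)) *\<^sub>R e) * (c * ?\<Delta> x)) (at s)"
      by (rule DERIV_chain2[where f = "\<lambda>t. F \<beta> (x + t *\<^sub>R e)"]) (auto intro!: derivative_eq_intros)
    then show "((\<lambda>s. F \<beta> (x + (s * (c * ?\<Delta> x)) *\<^sub>R e)) has_real_derivative
        (c * ?\<Delta> x) * ?Fe (x + (s * (c * ?\<Delta> x)) *\<^sub>R e)) (at s)" by (simp only: mult.commute)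
    have nn: "0 \<le> \<bar>c * ?\<Delta> x\<bar> * \<bar>Ce\<bar>" by simp
    show "\<bar>F \<beta> (x + (s * (c * ?\<Delta> x)) *\<^sub>R e)\<bar> \<le> (\<bar>C0\<bar> + \<bar>c * ?\<Delta> x\<bar> * \<bar>Ce\<bar>) * s ^ 0"
      using C0[OF in\<Omega>[OF s]] nn abs_ge_self[of C0] unfolding power_0 mult_1_right by linarith
    have "\<bar>(c * ?\<Delta> x) * ?Fe (x + (s * (c * ?\<Delta> x)) *\<^sub>R e)\<bar> \<le> \<bar>c * ?\<Delta> x\<bar> * \<bar>Ce\<bar>"
      unfolding abs_mult[of "c * ?\<Delta> x" "?Fe (x + (s * (c * ?\<Delta> x)) *\<^sub>R e)"]
      using order_trans[OF Ce[OF in\<Omega>[OF s]] abs_ge_self] by (intro mult_left_mono) simp_all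
    then show "\<bar>(c * ?\<Delta> x) * ?Fe (x + (s * (c * ?\<Delta> x)) *\<^sub>R e)\<bar> \<le> (\<bar>C0\<bar> + \<bar>c * ?\<Delta> x\<bar> * \<bar>Ce\<bar>) * s ^ 0"
      by simp
  qed
  also have "\<dots> = (LINT s:{1..}|lborel. (c * ?\<Delta> x) * (kernel_prim \<kappa> s * ?Fe (x + (s * (c * ?\<Delta> x)) *\<^sub>R e)))"
    by (simp only: mult.left_commute)
  also have "\<dots> = (c * ?\<Delta> x) * (LINT s:{1..}|lborel. kernel_prim \<kappa> s * ?Fe (x + (s * (c * ?\<Delta> x)) *\<^sub>R e))"
    by (rule set_integral_mult_right)
  finally show ?thesis by (simp only: kernel_shift_def)
qed

section \<open>Symbolic terms of the differentiated extension formula\<close>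

type_synonym 'a stein_term =
  "((('a \<Rightarrow> nat) \<Rightarrow> 'a \<Rightarrow> real) \<Rightarrow> 'a \<Rightarrow> real) \<times> (real \<Rightarrow> real) \<times> ('a \<Rightarrow> nat)"

text \<open>The disjunction is the invariant of repeated differentiation. A coefficient that varies
  occurs only with a null kernel, against which one can integrate by parts; \<tau> itself occurs
  only with a constant coefficient, whose derivative produces no term.\<close>

definition stein_terms :: "(real \<Rightarrow> real) \<Rightarrow> nat \<Rightarrow> 'a::euclidean_space stein_term set" where
  "stein_terms \<tau> k = {(A, \<kappa>, \<beta>). A \<in> stein_coeffs \<and> \<beta> \<in> multi_indices \<and> mi_order \<beta> = k \<and>
     (null_kernel \<kappa> \<or> \<kappa> = \<tau> \<and> (\<exists>r. A = (\<lambda>D x. r)))}"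

definition term_value :: "'a::euclidean_space \<Rightarrow> real \<Rightarrow> (('a \<Rightarrow> nat) \<Rightarrow> 'a \<Rightarrow> real) \<Rightarrow>
    (('a \<Rightarrow> nat) \<Rightarrow> 'a \<Rightarrow> real) \<Rightarrow> 'a \<Rightarrow> 'a stein_term \<Rightarrow> real" where
  "term_value e c D F x = (\<lambda>(A, \<kappa>, \<beta>). A D x * kernel_shift e c \<kappa> (D (\<lambda>_. 0)) (F \<beta>) x)"

lemma stein_terms_rapid: "rapid_kernel \<tau> \<Longrightarrow> (A, \<kappa>, \<beta>) \<in> stein_terms \<tau> k \<Longrightarrow> rapid_kernel \<kappa>"
  by (auto simp: stein_terms_def null_kernel_def)

lemma term_value_continuous:
  assumes "stein_geometry E \<Omega> e c bd D" "smooth_bounded \<Omega> F" "rapid_kernel \<tau>" "T \<in> stein_terms \<tau> k"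
  shows "continuous_on E (\<lambda>x. term_value e c D F x T)"
proof -
  obtain A \<kappa> \<beta> where T: "T = (A, \<kappa>, \<beta>)" by (cases T)
  show ?thesis
    unfolding T term_value_def case_prod_conv
  proof (intro continuous_on_mult)
    have T': "(A, \<kappa>, \<beta>) \<in> stein_terms \<tau> k" using assms(4) T by simp
    then have "A \<in> stein_coeffs" "\<beta> \<in> multi_indices" by (auto simp: stein_terms_def)
    with stein_terms_rapid[OF assms(3) T']
    show "continuous_on E (A D)" "continuous_on E (kernel_shift e c \<kappa> (D (\<lambda>_. 0)) (F \<beta>))"
      by (intro stein_coeffs_continuous[OF _ assms(1)] kernel_shift_continuous[OF assms(1,2)]; simp)+
  qed
qed

text \<open>The product rule gives at most three terms of the next order. The list is found before
  the geometry and the function, so the number of terms and their bounds are uniform.\<close>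

lemma term_value_deriv:
  fixes e :: "'a::euclidean_space"
  assumes \<tau>: "rapid_kernel \<tau>" "null_kernel (\<lambda>s. s * \<tau> s)" and T: "T \<in> stein_terms \<tau> k"
    and e: "e \<in> Basis" and i: "i \<in> Basis"
  shows "\<exists>L. set L \<subseteq> stein_terms \<tau> (Suc k) \<and> (\<forall>E \<Omega> bd D F x. stein_geometry E \<Omega> e c bd D \<longrightarrow>
    smooth_bounded \<Omega> F \<longrightarrow> x \<in> E \<longrightarrow>
    ((\<lambda>t. term_value e c D F (x + t *\<^sub>R i) T) has_real_derivative (\<Sum>T\<leftarrow>L. term_value e c D F x T)) (at 0))"
proof -
  obtain A \<kappa> \<beta> where T_eq: "T = (A, \<kappa>, \<beta>)" by (cases T)
  have A: "A \<in> stein_coeffs" and \<beta>: "\<beta> \<in> multi_indices" "mi_order \<beta> = k"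
    and \<kappa>: "null_kernel \<kappa> \<or> \<kappa> = \<tau> \<and> (\<exists>r. A = (\<lambda>D x. r))" and rk: "rapid_kernel \<kappa>"
    using T stein_terms_rapid[OF \<tau>(1), of A \<kappa> \<beta> k] unfolding T_eq by (simp_all add: stein_terms_def)
  have s\<kappa>: "null_kernel (\<lambda>s. s * \<kappa> s)" using \<kappa> \<tau>(2) null_kernel_times by blast
  let ?i = "\<beta>(i := Suc (\<beta> i))" and ?e = "\<beta>(e := Suc (\<beta> e))"
  have \<beta>': "?i \<in> multi_indices" "?e \<in> multi_indices" "mi_order ?i = Suc k" "mi_order ?e = Suc k"
    using \<beta> e i multi_index_upd_Suc mi_order_upd_Suc by metis+
  \<comment> \<open>\<open>?T1\<close> differentiates F along i. \<open>?T2\<close> comes from the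
    moving evaluation point; its factor s makes the kernel null whichever kind \<kappa> was.\<close>
  let ?T1 = "(A, \<kappa>, ?i)" and ?T2 = "((\<lambda>D x. A D x * (c * D ((\<lambda>_. 0)(i := Suc 0)) x)), (\<lambda>s. s * \<kappa> s), ?e)"
  have T12: "?T1 \<in> stein_terms \<tau> (Suc k)" "?T2 \<in> stein_terms \<tau> (Suc k)"
    using A \<beta>' \<kappa> s\<kappa> stein_coeffs_first_deriv[OF i]
    by (auto simp: stein_terms_def intro!: stein_coeffs.mult stein_coeffs.const)
  obtain A' where A': "A' \<in> stein_coeffs" "\<forall>E \<Omega> e c bd D x. stein_geometry E \<Omega> e c bd D \<longrightarrow> x \<in> E \<longrightarrow>
      ((\<lambda>t. A D (x + t *\<^sub>R i)) has_real_derivative A' D x / D (\<lambda>_. 0) x) (at 0)"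
    using stein_coeffs_deriv[OF A i] by blast
  have der: "((\<lambda>t. term_value e c D F (x + t *\<^sub>R i) T) has_real_derivative
      d * kernel_shift e c \<kappa> (D (\<lambda>_. 0)) (F \<beta>) x + term_value e c D F x ?T1 + term_value e c D F x ?T2) (at 0)"
    if g: "stein_geometry E \<Omega> e c bd D" and F: "smooth_bounded \<Omega> F" and x: "x \<in> E"
      and d: "((\<lambda>t. A D (x + t *\<^sub>R i)) has_real_derivative d) (at 0)" for E \<Omega> bd D F x d
    using DERIV_mult[OF d kernel_shift_deriv[OF g F \<beta>(1) rk e i x]]
    by (simp add: term_value_def T_eq algebra_simps del: fun_upd_apply)
  show ?thesis
  proof (cases "null_kernel \<kappa>")
    case True
    \<comment> \<open>The derivative of the coefficient is A' / \<Delta>. Raising the order by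
      \<open>kernel_shift_raise\<close> supplies c \<Delta> together with a vertical derivative, so
      the singular factor cancels.\<close>
    let ?T0 = "((\<lambda>D x. A' D x * c), kernel_prim \<kappa>, ?e)"
    have T0: "?T0 \<in> stein_terms \<tau> (Suc k)"
      using A' \<beta>' null_kernel_prim[OF True]
      by (auto simp: stein_terms_def intro!: stein_coeffs.mult stein_coeffs.const)
    show ?thesis
    proof (intro exI[of _ "[?T0, ?T1, ?T2]"] conjI allI impI)
      show "set [?T0, ?T1, ?T2] \<subseteq> stein_terms \<tau> (Suc k)" using T0 T12 by simp
      fix E \<Omega> bd D F x assume g: "stein_geometry E \<Omega> e c bd D" and F: "smooth_bounded \<Omega> F" and x: "x \<in> E"
      have pos: "D (\<lambda>_. 0) x > 0" using g x by (simp add: stein_geometry_def)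
      have "A' D x / D (\<lambda>_. 0) x * kernel_shift e c \<kappa> (D (\<lambda>_. 0)) (F \<beta>) x = term_value e c D F x ?T0"
        unfolding kernel_shift_raise[OF g F \<beta>(1) True e x] term_value_def using pos by simp
      with der[OF g F x A'(2)[rule_format, OF g x]]
      show "((\<lambda>t. term_value e c D F (x + t *\<^sub>R i) T) has_real_derivative
          (\<Sum>T\<leftarrow>[?T0, ?T1, ?T2]. term_value e c D F x T)) (at 0)" by (simp add: add.assoc del: fun_upd_apply)
    qed
  next
    case False
    \<comment> \<open>The remaining case is \<tau> with a constant coefficient, and there is nothing
      to compensate.\<close>
    then obtain r where r: "A = (\<lambda>D x. r)" using \<kappa> by blast
    show ?thesis
    proof (intro exI[of _ "[?T1, ?T2]"] conjI allI impI)
      show "set [?T1, ?T2] \<subseteq> stein_terms \<tau> (Suc k)" using T12 by simp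
      fix E \<Omega> bd D F x assume g: "stein_geometry E \<Omega> e c bd D" and F: "smooth_bounded \<Omega> F" and x: "x \<in> E"
      have "((\<lambda>t. A D (x + t *\<^sub>R i)) has_real_derivative 0) (at 0)" unfolding r by simp
      from der[OF g F x this]
      show "((\<lambda>t. term_value e c D F (x + t *\<^sub>R i) T) has_real_derivative
          (\<Sum>T\<leftarrow>[?T1, ?T2]. term_value e c D F x T)) (at 0)" by (simp add: add.assoc del: fun_upd_apply)
    qed
  qed
qed

lemma has_real_derivative_sum_list:
  assumes "\<And>T. T \<in> set L \<Longrightarrow> ((\<lambda>t. f t T) has_real_derivative f' T) (at a)"
  shows "((\<lambda>t. \<Sum>T\<leftarrow>L. f t T) has_real_derivative (\<Sum>T\<leftarrow>L. f' T)) (at a)"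
  using assms by (induction L) (auto intro!: DERIV_add)

lemma continuous_on_sum_list:
  fixes f :: "'a::topological_space \<Rightarrow> 'b \<Rightarrow> real"
  assumes "\<And>T. T \<in> set L \<Longrightarrow> continuous_on E (\<lambda>x. f x T)"
  shows "continuous_on E (\<lambda>x. \<Sum>T\<leftarrow>L. f x T)"
  using assms by (induction L) (auto intro!: continuous_on_add)

lemma sum_list_concat_map: "(\<Sum>T\<leftarrow>concat (map g L). f T) = (\<Sum>T\<leftarrow>L. \<Sum>T'\<leftarrow>g T. (f T' :: real))"
  by (induction L) auto

text \<open>One list serves all geometries and all F. The terms are continuous, so each classical
  derivative is also a weak one and no family of all derivatives has to be assembled.\<close>

lemma kernel_shift_weak_deriv:
  fixes e :: "'a::euclidean_space"
  assumes \<tau>: "rapid_kernel \<tau>" "null_kernel (\<lambda>s. s * \<tau> s)" and e: "e \<in> Basis" and \<alpha>: "\<alpha> \<in> multi_indices"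
  shows "\<exists>L. set L \<subseteq> stein_terms \<tau> (mi_order \<alpha>) \<and> (\<forall>E \<Omega> bd D F. stein_geometry E \<Omega> e c bd D \<longrightarrow>
    smooth_bounded \<Omega> F \<longrightarrow>
    has_weak_deriv E \<alpha> (kernel_shift e c \<tau> (D (\<lambda>_. 0)) (F (\<lambda>_. 0))) (\<lambda>x. \<Sum>T\<leftarrow>L. term_value e c D F x T))"
  using \<alpha>
proof (induction rule: multi_index_induct)
  case zero
  let ?T = "((\<lambda>D x. 1), \<tau>, (\<lambda>_. 0)) :: 'a stein_term"
  have T: "?T \<in> stein_terms \<tau> 0" by (auto simp: stein_terms_def intro: stein_coeffs.const)
  show ?case
  proof (intro exI[of _ "[?T]"] conjI allI impI)
    show "set [?T] \<subseteq> stein_terms \<tau> (mi_order (\<lambda>_::'a. 0))" using T by simp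
    fix E \<Omega> bd D F assume g: "stein_geometry E \<Omega> e c bd D" and F: "smooth_bounded \<Omega> F"
    have "locally_integrable E (kernel_shift e c \<tau> (D (\<lambda>_. 0)) (F (\<lambda>_. 0)))"
      by (intro continuous_imp_locally_integrable kernel_shift_continuous[OF g F zero_multi_index \<tau>(1)])
    from has_weak_deriv_0[OF this]
    show "has_weak_deriv E (\<lambda>_. 0) (kernel_shift e c \<tau> (D (\<lambda>_. 0)) (F (\<lambda>_. 0))) (\<lambda>x. \<Sum>T\<leftarrow>[?T]. term_value e c D F x T)"
      by (simp add: term_value_def)
  qed
next
  case (Suc \<alpha> i)
  then obtain L where L: "set L \<subseteq> stein_terms \<tau> (mi_order \<alpha>)"
    "\<forall>E \<Omega> bd D F. stein_geometry E \<Omega> e c bd D \<longrightarrow> smooth_bounded \<Omega> F \<longrightarrow>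
      has_weak_deriv E \<alpha> (kernel_shift e c \<tau> (D (\<lambda>_. 0)) (F (\<lambda>_. 0))) (\<lambda>x. \<Sum>T\<leftarrow>L. term_value e c D F x T)"
    by blast
  have "\<forall>T\<in>stein_terms \<tau> (mi_order \<alpha>). \<exists>L'. set L' \<subseteq> stein_terms \<tau> (Suc (mi_order \<alpha>)) \<and>
    (\<forall>E \<Omega> bd D F x. stein_geometry E \<Omega> e c bd D \<longrightarrow> smooth_bounded \<Omega> F \<longrightarrow> x \<in> E \<longrightarrow>
    ((\<lambda>t. term_value e c D F (x + t *\<^sub>R i) T) has_real_derivative (\<Sum>T\<leftarrow>L'. term_value e c D F x T)) (at 0))"
    using term_value_deriv[OF \<tau> _ e Suc(2)] by blast
  then obtain \<Phi> where \<Phi>: "\<And>T. T \<in> stein_terms \<tau> (mi_order \<alpha>) \<Longrightarrow> set (\<Phi> T) \<subseteq> stein_terms \<tau> (Suc (mi_order \<alpha>))"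
    "\<And>T E \<Omega> bd D F x. T \<in> stein_terms \<tau> (mi_order \<alpha>) \<Longrightarrow> stein_geometry E \<Omega> e c bd D \<Longrightarrow> smooth_bounded \<Omega> F \<Longrightarrow> x \<in> E \<Longrightarrow>
    ((\<lambda>t. term_value e c D F (x + t *\<^sub>R i) T) has_real_derivative (\<Sum>T\<leftarrow>\<Phi> T. term_value e c D F x T)) (at 0)"
    by metis
  let ?L = "concat (map \<Phi> L)"
  show ?case
  proof (intro exI[of _ ?L] conjI allI impI)
    show sub: "set ?L \<subseteq> stein_terms \<tau> (mi_order (\<alpha>(i := Suc (\<alpha> i))))"
      unfolding mi_order_upd_Suc[OF Suc(2)] using L(1) \<Phi>(1) by (simp only: set_concat set_map) blast
    fix E \<Omega> bd D F assume g: "stein_geometry E \<Omega> e c bd D" and F: "smooth_bounded \<Omega> F"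
    show "has_weak_deriv E (\<alpha>(i := Suc (\<alpha> i))) (kernel_shift e c \<tau> (D (\<lambda>_. 0)) (F (\<lambda>_. 0)))
        (\<lambda>x. \<Sum>T\<leftarrow>?L. term_value e c D F x T)"
    proof (rule has_weak_deriv_Suc[OF _ Suc(1,2) L(2)[rule_format, OF g F]])
      show "open E" using g by (simp add: stein_geometry_def)
      show "continuous_on E (\<lambda>x. \<Sum>T\<leftarrow>L. term_value e c D F x T)"
        using L(1) by (intro continuous_on_sum_list term_value_continuous[OF g F \<tau>(1)]) blast
      show "continuous_on E (\<lambda>x. \<Sum>T\<leftarrow>?L. term_value e c D F x T)"
        using sub by (intro continuous_on_sum_list term_value_continuous[OF g F \<tau>(1)]) blast
      fix x assume x: "x \<in> E"
      show "((\<lambda>t. \<Sum>T\<leftarrow>L. term_value e c D F (x + t *\<^sub>R i) T) has_real_derivative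
          (\<Sum>T\<leftarrow>?L. term_value e c D F x T)) (at 0)"
        unfolding sum_list_concat_map
        using L(1) by (intro has_real_derivative_sum_list \<Phi>(2)[OF _ g F x]) blast
    qed
  qed
qed

subsection \<open>Integral inequalities\<close>

text \<open>Convexity: the tangent of h^p at m stays below the graph. The proof is Young's
  inequality with weights 1/p and 1 - 1/p.\<close>

lemma powr_tangent:
  fixes h m p :: real
  assumes "p \<ge> 1" "h \<ge> 0" "m > 0"
  shows "p * m powr (p - 1) * h \<le> h powr p + (p - 1) * m powr p"
proof (cases "h = 0")
  case False
  have "(h powr p) powr (1 / p) * (m powr p) powr (1 - 1 / p) \<le> (1 / p) * h powr p + (1 - 1 / p) * m powr p"
    using assms False by (intro Youngs_inequality_0) (auto simp: field_simps)
  moreover have "(h powr p) powr (1 / p) = h" "(m powr p) powr (1 - 1 / p) = m powr (p - 1)"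
    using assms by (auto simp: powr_powr right_diff_distrib)
  ultimately have "h * m powr (p - 1) \<le> (1 / p) * h powr p + (1 - 1 / p) * m powr p" by simp
  then have "p * (h * m powr (p - 1)) \<le> p * ((1 / p) * h powr p + (1 - 1 / p) * m powr p)"
    using assms by (intro mult_left_mono) auto
  also have "\<dots> = h powr p + (p - 1) * m powr p" using assms by (simp add: field_simps)
  finally show ?thesis by (simp add: mult_ac)
qed (use assms in simp)

text \<open>The tangent inequality at m is integrated against w. A mass below 1 is allowed because
  (p - 1) m^p is nonnegative, and m may lie below the mean, which admits averages that are not known
  to be finite.\<close>

lemma jensen_powr:
  fixes h w :: "'a \<Rightarrow> real"
  assumes p: "p \<ge> 1" and h: "h \<in> borel_measurable M" "\<And>x. x \<in> space M \<Longrightarrow> h x \<ge> 0"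
    and w: "w \<in> borel_measurable M" "\<And>x. x \<in> space M \<Longrightarrow> w x \<ge> 0" "(\<integral>\<^sup>+x. ennreal (w x) \<partial>M) \<le> 1"
    and m: "m \<ge> 0" "ennreal m \<le> (\<integral>\<^sup>+x. ennreal (h x * w x) \<partial>M)"
  shows "ennreal (m powr p) \<le> (\<integral>\<^sup>+x. ennreal (h x powr p * w x) \<partial>M)"
proof (cases "m = 0")
  case False
  with m have m0: "m > 0" by simp
  note [measurable] = h(1) w(1)
  have "ennreal (p * m powr (p - 1)) * ennreal m \<le> ennreal (p * m powr (p - 1)) * (\<integral>\<^sup>+x. ennreal (h x * w x) \<partial>M)"
    using m by (intro mult_left_mono) auto
  also have "\<dots> = (\<integral>\<^sup>+x. ennreal (p * m powr (p - 1)) * ennreal (h x * w x) \<partial>M)"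
    by (rule nn_integral_cmult[symmetric]) measurable
  also have "\<dots> \<le> (\<integral>\<^sup>+x. ennreal (h x powr p * w x) + ennreal ((p - 1) * m powr p) * ennreal (w x) \<partial>M)"
  proof (rule nn_integral_mono)
    fix x assume x: "x \<in> space M"
    have "p * m powr (p - 1) * h x * w x \<le> (h x powr p + (p - 1) * m powr p) * w x"
      using powr_tangent[OF p h(2)[OF x] m0] w(2)[OF x] by (rule mult_right_mono)
    then have "ennreal (p * m powr (p - 1) * (h x * w x)) \<le> ennreal (h x powr p * w x + ((p - 1) * m powr p) * w x)"
      by (intro ennreal_leI) (simp add: algebra_simps)
    then show "ennreal (p * m powr (p - 1)) * ennreal (h x * w x) \<le>
        ennreal (h x powr p * w x) + ennreal ((p - 1) * m powr p) * ennreal (w x)"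
      using p h(2)[OF x] w(2)[OF x] by (simp add: ennreal_mult[symmetric] ennreal_plus[symmetric] del: ennreal_plus)
  qed
  also have "\<dots> = (\<integral>\<^sup>+x. ennreal (h x powr p * w x) \<partial>M) + ennreal ((p - 1) * m powr p) * (\<integral>\<^sup>+x. ennreal (w x) \<partial>M)"
    by (simp add: nn_integral_add nn_integral_cmult)
  also have "\<dots> \<le> (\<integral>\<^sup>+x. ennreal (h x powr p * w x) \<partial>M) + ennreal ((p - 1) * m powr p) * 1"
    by (intro add_left_mono mult_left_mono w(3)) auto
  finally have *: "ennreal (p * m powr p) \<le> (\<integral>\<^sup>+x. ennreal (h x powr p * w x) \<partial>M) + ennreal ((p - 1) * m powr p)"
    using p m0 by (simp add: ennreal_mult[symmetric] powr_diff)
  \<comment> \<open>Unless the right-hand side is infinite, (p - 1) m^p can be subtracted on both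
    sides.\<close>
  show ?thesis
  proof (cases "(\<integral>\<^sup>+x. ennreal (h x powr p * w x) \<partial>M)")
    case (real r)
    then have "p * m powr p \<le> r + (p - 1) * m powr p"
      using * p by (simp add: ennreal_plus[symmetric] del: ennreal_plus)
    then show ?thesis unfolding real(2) using real(1) by (intro ennreal_leI) (simp add: algebra_simps)
  qed simp
qed (use p in simp)

text \<open>The sum is at most card B times its maximum. The resulting constant is not sharp, but
  its p-th root is independent of p.\<close>

lemma powr_sum_le:
  fixes v :: "'b \<Rightarrow> real"
  assumes "finite B" "p \<ge> 1" "\<And>b. b \<in> B \<Longrightarrow> v b \<ge> 0"
  shows "(\<Sum>b\<in>B. v b) powr p \<le> real (card B) powr p * (\<Sum>b\<in>B. v b powr p)"
proof (cases "B = {}")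
  case False
  define m where "m = Max (v ` B)"
  have m: "m \<in> v ` B" "\<And>b. b \<in> B \<Longrightarrow> v b \<le> m" using assms(1) False by (auto simp: m_def)
  then have m0: "m \<ge> 0" using assms(3) by auto
  have "(\<Sum>b\<in>B. v b) \<le> real (card B) * m" using sum_bounded_above[of B v m] m by simp
  then have "(\<Sum>b\<in>B. v b) powr p \<le> (real (card B) * m) powr p"
    using assms by (intro powr_mono2 sum_nonneg) auto
  also have "\<dots> = real (card B) powr p * m powr p" by (rule powr_mult)
  also have "m powr p \<le> (\<Sum>b\<in>B. v b powr p)"
  proof -
    obtain b where "b \<in> B" "m = v b" using m(1) by blast
    then show ?thesis using member_le_sum[of b B "\<lambda>b. v b powr p"] assms(1) by auto
  qed
  finally show ?thesis by (simp add: mult_left_mono)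
qed simp

text \<open>A grid of cubes of side r / n is used. A cell lies in the ball of radius r around any of
  its own points, so for a cell that meets \<Omega> the centre can be taken in \<Omega>. The centre
  x of the large ball may lie outside \<Omega>.\<close>

lemma ball_cover_integral:
  fixes g :: "'a::euclidean_space \<Rightarrow> ennreal" and \<kappa> :: real
  assumes g: "g \<in> borel_measurable borel" and \<Omega>: "\<Omega> \<in> sets borel" and r: "r > 0" and \<kappa>: "\<kappa> \<ge> 1"
    and Q: "\<And>z. z \<in> \<Omega> \<Longrightarrow> (\<integral>\<^sup>+y. indicator (ball z r \<inter> \<Omega>) y * g y \<partial>lborel) \<le> Q"
  shows "(\<integral>\<^sup>+y. indicator (ball x (\<kappa> * r) \<inter> \<Omega>) y * g y \<partial>lborel) \<le> ennreal ((4 * DIM('a) * \<kappa>) ^ DIM('a)) * Q"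
proof -
  define n where "n = DIM('a)"
  have n: "n \<ge> 1" unfolding n_def using DIM_positive[where 'a='a] by linarith
  \<comment> \<open>Two points of a cell differ by less than s in each of the n coordinates, hence
    by less than r in norm.\<close>
  define s where "s = r / n"
  have s: "s > 0" using r n by (simp add: s_def)
  define idx where "idx y = (\<lambda>b\<in>Basis. \<lfloor>(y \<bullet> b) / s\<rfloor>)" for y :: 'a
  define R where "R = \<kappa> * r"
  define J where "J b = {\<lfloor>(x \<bullet> b - R) / s\<rfloor>..\<lfloor>(x \<bullet> b + R) / s\<rfloor>}" for b :: 'a
  define I where "I = (PiE Basis J :: ('a \<Rightarrow> int) set)"
  \<comment> \<open>Cells without points of \<Omega> contribute nothing and have no admissible
    centre.\<close>
  define I' where "I' = {i \<in> I. \<exists>z\<in>\<Omega>. idx z = i}"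
  have finI: "finite I" unfolding I_def J_def by (intro finite_PiE) auto
  then have finI': "finite I'" unfolding I'_def by simp
  have cardJ: "real (card (J b)) \<le> 4 * n * \<kappa>" for b
  proof -
    have "real_of_int (\<lfloor>(x \<bullet> b + R) / s\<rfloor> - \<lfloor>(x \<bullet> b - R) / s\<rfloor>) \<le> (x \<bullet> b + R) / s - ((x \<bullet> b - R) / s - 1)"
      by linarith
    also have "\<dots> = 2 * \<kappa> * n + 1" using r n by (simp add: s_def R_def field_simps)
    finally have *: "real_of_int (\<lfloor>(x \<bullet> b + R) / s\<rfloor> - \<lfloor>(x \<bullet> b - R) / s\<rfloor>) \<le> 2 * \<kappa> * n + 1" .
    \<comment> \<open>There are at most 2 \<kappa> n + 2 cells per direction, and 2 \<le> 2 \<kappa>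
      n.\<close>
    have "1 * 1 \<le> \<kappa> * real n" using \<kappa> n by (intro mult_mono) auto
    with * have **: "real_of_int (\<lfloor>(x \<bullet> b + R) / s\<rfloor> - \<lfloor>(x \<bullet> b - R) / s\<rfloor> + 1) \<le> 4 * n * \<kappa>"
      by (simp add: mult_ac)
    have nn: "0 \<le> real (4 * n) * \<kappa>" using \<kappa> by simp
    have nat_le: "real (nat k) \<le> c" if "real_of_int k \<le> c" "0 \<le> c" for k c
      using that by (cases "k \<ge> 0") auto
    show ?thesis unfolding J_def card_atLeastAtMost_int by (rule nat_le[OF ** nn])
  qed
  have "real (card I') \<le> real (card I)" using finI by (auto simp: I'_def intro!: card_mono)
  also have "\<dots> = (\<Prod>b\<in>Basis. real (card (J b)))" by (simp add: I_def card_PiE)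
  also have "\<dots> \<le> (\<Prod>b\<in>(Basis :: 'a set). 4 * n * \<kappa>)" using cardJ by (intro prod_mono) auto
  finally have cardI: "real (card I') \<le> (4 * n * \<kappa>) ^ n" by (simp add: n_def)
  have "\<forall>i\<in>I'. \<exists>z. z \<in> \<Omega> \<and> idx z = i" unfolding I'_def by blast
  from bchoice[OF this] obtain z where z: "\<And>i. i \<in> I' \<Longrightarrow> z i \<in> \<Omega> \<and> idx (z i) = i" by blast
  have near: "y \<in> ball z' r" if "idx y = idx z'" for y z'
  proof -
    have lt: "\<bar>(z' - y) \<bullet> b\<bar> < s" if b: "b \<in> Basis" for b
    proof -
      have "\<lfloor>(y \<bullet> b) / s\<rfloor> = \<lfloor>(z' \<bullet> b) / s\<rfloor>" using \<open>idx y = idx z'\<close> b unfolding idx_def by (metis restrict_apply')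
      then have "\<bar>(z' \<bullet> b) / s - (y \<bullet> b) / s\<bar> < 1" by linarith
      then show ?thesis using s by (simp add: inner_diff_left diff_divide_distrib[symmetric] field_simps)
    qed
    have "norm (z' - y) \<le> (\<Sum>b\<in>Basis. \<bar>(z' - y) \<bullet> b\<bar>)" by (rule norm_le_l1)
    also have "\<dots> < (\<Sum>b\<in>(Basis::'a set). s)" using lt by (intro sum_strict_mono) auto
    also have "\<dots> = r" using n by (simp add: s_def n_def)
    finally show ?thesis by (simp add: dist_norm)
  qed
  have meas: "(\<lambda>y. indicator (ball (z i) r \<inter> \<Omega>) y * g y) \<in> borel_measurable lborel" for i
    using g \<Omega> by (intro borel_measurable_times_ennreal borel_measurable_indicator) auto
  have "(\<integral>\<^sup>+y. indicator (ball x (\<kappa> * r) \<inter> \<Omega>) y * g y \<partial>lborel) \<le>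
      (\<integral>\<^sup>+y. (\<Sum>i\<in>I'. indicator (ball (z i) r \<inter> \<Omega>) y * g y) \<partial>lborel)"
  proof (rule nn_integral_mono)
    fix y
    show "indicator (ball x (\<kappa> * r) \<inter> \<Omega>) y * g y \<le> (\<Sum>i\<in>I'. indicator (ball (z i) r \<inter> \<Omega>) y * g y)"
    proof (cases "y \<in> ball x (\<kappa> * r) \<inter> \<Omega>")
      case True
      have "idx y \<in> I" unfolding I_def
      proof (rule PiE_I)
        fix b :: 'a assume b: "b \<in> Basis"
        have "\<bar>(y - x) \<bullet> b\<bar> \<le> norm (y - x)" using b by (rule Basis_le_norm)
        then have "\<bar>(y - x) \<bullet> b\<bar> \<le> R" using True by (simp add: R_def dist_norm norm_minus_commute)
        then have "x \<bullet> b - R \<le> y \<bullet> b" "y \<bullet> b \<le> x \<bullet> b + R" by (auto simp: inner_diff_left)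
        then show "idx y b \<in> J b" using s b by (auto simp: idx_def J_def intro!: floor_mono divide_right_mono)
      qed (simp add: idx_def)
      then have i: "idx y \<in> I'" using True by (auto simp: I'_def)
      then have "y \<in> ball (z (idx y)) r" using z near by metis
      then have "indicator (ball x (\<kappa> * r) \<inter> \<Omega>) y * g y = indicator (ball (z (idx y)) r \<inter> \<Omega>) y * g y"
        using True by simp
      also have "\<dots> \<le> (\<Sum>i\<in>I'. indicator (ball (z i) r \<inter> \<Omega>) y * g y)"
        using i finI' by (intro member_le_sum) auto
      finally show ?thesis .
    qed simp
  qed
  also have "\<dots> = (\<Sum>i\<in>I'. \<integral>\<^sup>+y. indicator (ball (z i) r \<inter> \<Omega>) y * g y \<partial>lborel)"
    by (rule nn_integral_sum[OF meas])
  also have "\<dots> \<le> (\<Sum>i\<in>I'. Q)" using z by (intro sum_mono Q) blast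
  also have "\<dots> = ennreal (real (card I')) * Q" by (simp add: ennreal_of_nat_eq_real_of_nat)
  also have "\<dots> \<le> ennreal ((4 * n * \<kappa>) ^ n) * Q" by (intro mult_right_mono ennreal_leI cardI) simp
  finally show ?thesis by (simp add: n_def)
qed

subsection \<open>Reflection across the graph\<close>

text \<open>For s = 1 this is the vertical mirror image; larger s also stretches the height above
  the graph. For every s > 0 points below the graph are mapped into the domain.\<close>

definition reflect_graph :: "(real^'m \<Rightarrow> real) \<Rightarrow> real \<Rightarrow> (real^'m) \<times> real \<Rightarrow> (real^'m) \<times> real" where
  "reflect_graph \<psi> s = (\<lambda>(x, y). (x, \<psi> x + s * (\<psi> x - y)))"

definition below_graph :: "(real^'m \<Rightarrow> real) \<Rightarrow> ((real^'m) \<times> real) set" where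
  "below_graph \<psi> = {(x, y). y < \<psi> x}"

lemma lipschitz_UNIV_continuous:
  "M-lipschitz_on UNIV \<psi> \<Longrightarrow> continuous_on S (\<psi> :: 'a::metric_space \<Rightarrow> 'b::metric_space)"
  by (meson continuous_on_subset lipschitz_on_continuous_on subset_UNIV)

lemma open_special_domain:
  fixes \<psi> :: "real^'m \<Rightarrow> real"
  assumes "continuous_on UNIV \<psi>" shows "open (special_domain \<psi>)"
proof -
  have "special_domain \<psi> = {z. \<psi> (fst z) < snd z}" by (auto simp: special_domain_def)
  then show ?thesis
    using assms by (simp add: open_Collect_less continuous_intros continuous_on_compose2[OF assms])
qed

lemma open_below_graph:
  fixes \<psi> :: "real^'m \<Rightarrow> real"
  assumes "continuous_on UNIV \<psi>" shows "open (below_graph \<psi>)"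
proof -
  have "below_graph \<psi> = {z. snd z < \<psi> (fst z)}" by (auto simp: below_graph_def)
  then show ?thesis
    using assms by (simp add: open_Collect_less continuous_intros continuous_on_compose2[OF assms])
qed

lemma continuous_on_reflect_graph:
  fixes \<psi> :: "real^'m \<Rightarrow> real"
  assumes "continuous_on UNIV \<psi>"
  shows "continuous_on UNIV (\<lambda>(z, s). reflect_graph \<psi> s z)" "continuous_on UNIV (reflect_graph \<psi> s)"
  unfolding reflect_graph_def case_prod_beta'
  by (intro continuous_intros continuous_on_compose2[OF assms]; simp)+

text \<open>\<psi> enters with weight 1 + s and y with weight s; since 1 + s \<le> 2 s, the constant
  is linear in s.\<close>

lemma reflect_graph_dist:
  fixes \<psi> :: "real^'m \<Rightarrow> real"
  assumes \<psi>: "M-lipschitz_on UNIV \<psi>" and s: "s \<ge> 1"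
  shows "dist (reflect_graph \<psi> s z) (reflect_graph \<psi> s z') \<le> (2 + 2 * M) * s * dist z z'"
proof -
  obtain x y x' y' where z: "z = (x, y)" "z' = (x', y')" by (cases z, cases z') auto
  have M: "M \<ge> 0" "\<bar>\<psi> x - \<psi> x'\<bar> \<le> M * dist x x'"
    using \<psi> lipschitz_onD[OF \<psi>, of x x'] lipschitz_on_nonneg by (auto simp: dist_real_def)
  have d: "dist x x' \<le> dist z z'" "\<bar>y - y'\<bar> \<le> dist z z'"
    using dist_fst_le[of z z'] dist_snd_le[of z z'] z by (auto simp: dist_real_def)
  have "dist (reflect_graph \<psi> s z) (reflect_graph \<psi> s z') \<le>
      dist x x' + \<bar>(1 + s) * (\<psi> x - \<psi> x') - s * (y - y')\<bar>"
    using sqrt_sum_squares_le_sum_abs[of "dist x x'" "(1 + s) * (\<psi> x - \<psi> x') - s * (y - y')"]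
    by (simp add: z reflect_graph_def dist_Pair_Pair dist_real_def algebra_simps)
  also have "\<dots> \<le> dist x x' + ((1 + s) * \<bar>\<psi> x - \<psi> x'\<bar> + s * \<bar>y - y'\<bar>)"
    using abs_triangle_ineq4[of "(1 + s) * (\<psi> x - \<psi> x')" "s * (y - y')"] s by (simp add: abs_mult)
  also have "\<dots> \<le> dist z z' + ((1 + s) * (M * dist z z') + s * dist z z')"
    using M d s order_trans[OF M(2) mult_left_mono[OF d(1) M(1)]] by (intro add_mono mult_left_mono) auto
  also have "\<dots> = (1 + s) * (1 + M) * dist z z'" by (simp add: algebra_simps)
  also have "\<dots> \<le> (2 * s) * (1 + M) * dist z z'" using s M by (intro mult_right_mono) auto
  finally show ?thesis by (simp add: algebra_simps)
qed

text \<open>In the vertical variable the reflection is affine with slope \<open>- s\<close>.\<close>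

lemma reflect_graph_nn_integral_le:
  fixes \<psi> :: "real^'m \<Rightarrow> real" and g :: "(real^'m) \<times> real \<Rightarrow> ennreal"
  assumes \<psi>: "continuous_on UNIV \<psi>" and g: "g \<in> borel_measurable borel" and s: "s \<ge> 1"
  shows "(\<integral>\<^sup>+z. g (reflect_graph \<psi> s z) \<partial>lborel) \<le> (\<integral>\<^sup>+z. g z \<partial>lborel)"
proof -
  note [measurable] = borel_measurable_continuous_onI[OF \<psi>] g
  have [measurable]: "reflect_graph \<psi> s \<in> borel_measurable borel"
    by (intro borel_measurable_continuous_onI continuous_on_reflect_graph \<psi>)
  have mp: "g \<in> borel_measurable (lborel \<Otimes>\<^sub>M lborel)" "(\<lambda>z. g (reflect_graph \<psi> s z)) \<in> borel_measurable (lborel \<Otimes>\<^sub>M lborel)"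
    by (simp_all add: lborel_prod)
  have "(\<integral>\<^sup>+z. g (reflect_graph \<psi> s z) \<partial>lborel) = (\<integral>\<^sup>+z. g (reflect_graph \<psi> s z) \<partial>(lborel \<Otimes>\<^sub>M lborel))"
    by (simp add: lborel_prod)
  also have "\<dots> = (\<integral>\<^sup>+x. \<integral>\<^sup>+y. g (reflect_graph \<psi> s (x, y)) \<partial>lborel \<partial>lborel)"
    by (rule lborel.nn_integral_fst[symmetric, OF mp(2)])
  also have "\<dots> \<le> (\<integral>\<^sup>+x. \<integral>\<^sup>+y. g (x, y) \<partial>lborel \<partial>lborel)"
  proof (rule nn_integral_mono)
    fix x
    have gx: "(\<lambda>y. g (x, y)) \<in> borel_measurable borel" by measurable
    have "(\<integral>\<^sup>+y. g (reflect_graph \<psi> s (x, y)) \<partial>lborel) = (\<integral>\<^sup>+y. g (x, (\<psi> x + s * \<psi> x) + (- s) * y) \<partial>lborel)"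
      by (simp add: reflect_graph_def algebra_simps)
    also have "\<dots> = ennreal 1 * \<dots>" by simp
    also have "\<dots> \<le> ennreal \<bar>- s\<bar> * (\<integral>\<^sup>+y. g (x, (\<psi> x + s * \<psi> x) + (- s) * y) \<partial>lborel)"
      using s by (intro mult_right_mono ennreal_leI) auto
    also have "\<dots> = (\<integral>\<^sup>+y. g (x, y) \<partial>lborel)"
      using s by (intro nn_integral_real_affine[OF gx, symmetric]) auto
    finally show "(\<integral>\<^sup>+y. g (reflect_graph \<psi> s (x, y)) \<partial>lborel) \<le> (\<integral>\<^sup>+y. g (x, y) \<partial>lborel)" .
  qed
  also have "\<dots> = (\<integral>\<^sup>+z. g z \<partial>(lborel \<Otimes>\<^sub>M lborel))" by (rule lborel.nn_integral_fst[OF mp(1)])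
  finally show ?thesis by (simp add: lborel_prod)
qed

text \<open>By Tonelli s may be fixed. The ball is reflected into one of radius (2 + 2 M) s r,
  covered by O(s^n) balls of radius r, and the substitution costs nothing because its slope has
  modulus at least 1. Of the weight s^(-n-2) there remains s^(-2), whose integral over [1,
  \<infinity>) is 1.\<close>

lemma reflected_average_ball_le:
  fixes \<psi> :: "real^'m \<Rightarrow> real" and g :: "(real^'m) \<times> real \<Rightarrow> ennreal" and M :: real
  assumes \<psi>: "M-lipschitz_on UNIV \<psi>" and g: "g \<in> borel_measurable borel" and r: "r > 0"
    and Q: "\<And>z. z \<in> special_domain \<psi> \<Longrightarrow> (\<integral>\<^sup>+y. indicator (ball z r \<inter> special_domain \<psi>) y * g y \<partial>lborel) \<le> Q"
    and N: "N = DIM((real^'m) \<times> real) + 2"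
  shows "(\<integral>\<^sup>+z. indicator (ball X r \<inter> below_graph \<psi>) z *
      (\<integral>\<^sup>+s. indicator {1..} s * (ennreal (1 / s ^ N) * g (reflect_graph \<psi> s z)) \<partial>lborel) \<partial>lborel)
    \<le> ennreal ((4 * DIM((real^'m) \<times> real) * (2 + 2 * M)) ^ DIM((real^'m) \<times> real)) * Q"
proof -
  define n where "n = DIM((real^'m) \<times> real)"
  have c\<psi>: "continuous_on UNIV \<psi>" by (rule lipschitz_UNIV_continuous[OF \<psi>])
  note [measurable] = borel_measurable_continuous_onI[OF c\<psi>] g
  have M: "M \<ge> 0" using \<psi> by (rule lipschitz_on_nonneg)
  have \<Omega>[measurable]: "special_domain \<psi> \<in> sets borel" "below_graph \<psi> \<in> sets borel"
    using open_special_domain[OF c\<psi>] open_below_graph[OF c\<psi>] by auto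
  have Phi[measurable]: "(\<lambda>(z, s). reflect_graph \<psi> s z) \<in> borel_measurable (borel \<Otimes>\<^sub>M borel)"
    unfolding borel_prod by (intro borel_measurable_continuous_onI continuous_on_reflect_graph c\<psi>)
  have Phi'[measurable]: "reflect_graph \<psi> s \<in> borel_measurable borel" for s
    by (intro borel_measurable_continuous_onI continuous_on_reflect_graph c\<psi>)
  let ?B = "ball X r \<inter> below_graph \<psi>" and ?\<Omega> = "special_domain \<psi>"
  let ?f = "\<lambda>z s. indicator ?B z * (indicator {1..} s * (ennreal (1 / s ^ N) * g (reflect_graph \<psi> s z)))"
  have B[measurable]: "?B \<in> sets borel" by auto
  have meas: "(\<lambda>(z, s). ?f z s) \<in> borel_measurable (lborel \<Otimes>\<^sub>M lborel)"
  proof -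
    have "(\<lambda>x. g (reflect_graph \<psi> (snd x) (fst x))) \<in> borel_measurable (borel \<Otimes>\<^sub>M borel)"
      using measurable_compose[OF Phi g] by (simp add: case_prod_beta')
    then have "(\<lambda>x. indicator ?B (fst x) * (indicator {1..} (snd x) * (ennreal (1 / snd x ^ N) *
        g (reflect_graph \<psi> (snd x) (fst x))))) \<in> borel_measurable (borel \<Otimes>\<^sub>M borel)"
      by (intro borel_measurable_times_ennreal measurable_compose[OF measurable_fst borel_measurable_indicator[OF B]]
          measurable_compose[OF measurable_snd borel_measurable_indicator]
          measurable_compose[OF _ measurable_ennreal]) measurable
    then have "(\<lambda>x. ?f (fst x) (snd x)) \<in> borel_measurable (lborel \<Otimes>\<^sub>M lborel)"
      using measurable_cong_sets[OF sets_pair_measure_cong[OF sets_lborel sets_lborel] refl] by blast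
    then show ?thesis by (simp add: case_prod_beta')
  qed
  have "(\<integral>\<^sup>+z. indicator ?B z * (\<integral>\<^sup>+s. indicator {1..} s * (ennreal (1 / s ^ N) * g (reflect_graph \<psi> s z)) \<partial>lborel) \<partial>lborel) =
      (\<integral>\<^sup>+z. \<integral>\<^sup>+s. ?f z s \<partial>lborel \<partial>lborel)"
    by (subst nn_integral_cmult) auto
  also have "\<dots> = (\<integral>\<^sup>+s. \<integral>\<^sup>+z. ?f z s \<partial>lborel \<partial>lborel)"
    by (rule lborel_pair.Fubini'[OF meas, symmetric])
  also have "\<dots> \<le> (\<integral>\<^sup>+s. ennreal (1 / s\<^sup>2) * indicator {1..} s * (ennreal ((4 * n * (2 + 2 * M)) ^ n) * Q) \<partial>lborel)"
  proof (rule nn_integral_mono)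
    fix s :: real
    show "(\<integral>\<^sup>+z. ?f z s \<partial>lborel) \<le> ennreal (1 / s\<^sup>2) * indicator {1..} s * (ennreal ((4 * n * (2 + 2 * M)) ^ n) * Q)"
    proof (cases "s \<ge> 1")
      case True
      have \<kappa>: "(2 + 2 * M) * s \<ge> 1" using True M mult_mono[of 1 "2 + 2 * M" 1 s] by simp
      \<comment> \<open>The centre is the image of X, which need not belong to the domain; the
        covering lemma admits this.\<close>
      let ?h = "\<lambda>z. indicator (ball (reflect_graph \<psi> s X) ((2 + 2 * M) * s * r) \<inter> ?\<Omega>) z * g z"
      have hm: "?h \<in> borel_measurable borel"
        by (intro borel_measurable_times_ennreal g borel_measurable_indicator) auto
      have "(\<integral>\<^sup>+z. ?f z s \<partial>lborel) \<le> (\<integral>\<^sup>+z. ennreal (1 / s ^ N) * ?h (reflect_graph \<psi> s z) \<partial>lborel)"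
      proof (rule nn_integral_mono)
        fix z
        show "?f z s \<le> ennreal (1 / s ^ N) * ?h (reflect_graph \<psi> s z)"
        proof (cases "z \<in> ?B")
          case True
          have "dist (reflect_graph \<psi> s X) (reflect_graph \<psi> s z) \<le> (2 + 2 * M) * s * dist X z"
            by (rule reflect_graph_dist[OF \<psi> \<open>s \<ge> 1\<close>])
          also have "\<dots> < (2 + 2 * M) * s * r" using \<kappa> True by (intro mult_strict_left_mono) auto
          finally have 1: "reflect_graph \<psi> s z \<in> ball (reflect_graph \<psi> s X) ((2 + 2 * M) * s * r)" by simp
          have 2: "reflect_graph \<psi> s z \<in> ?\<Omega>"
            using True \<open>s \<ge> 1\<close> by (auto simp: special_domain_def below_graph_def reflect_graph_def)
          show ?thesis using 1 2 \<open>s \<ge> 1\<close> True by simp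
        qed simp
      qed
      also have "\<dots> = ennreal (1 / s ^ N) * (\<integral>\<^sup>+z. ?h (reflect_graph \<psi> s z) \<partial>lborel)"
        using measurable_compose[OF Phi' hm] by (intro nn_integral_cmult) simp
      also have "\<dots> \<le> ennreal (1 / s ^ N) * (\<integral>\<^sup>+z. ?h z \<partial>lborel)"
        by (intro mult_left_mono reflect_graph_nn_integral_le[OF c\<psi> hm True]) simp
      also have "\<dots> \<le> ennreal (1 / s ^ N) * (ennreal ((4 * n * ((2 + 2 * M) * s)) ^ n) * Q)"
        unfolding n_def by (intro mult_left_mono ball_cover_integral[OF g \<Omega>(1) r \<kappa> Q]) auto
      also have "\<dots> = ennreal (1 / s ^ N * (4 * n * ((2 + 2 * M) * s)) ^ n) * Q"
        using True M by (simp add: ennreal_mult[symmetric] mult.assoc[symmetric])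
      also have "1 / s ^ N * (4 * n * ((2 + 2 * M) * s)) ^ n = 1 / s\<^sup>2 * (4 * n * (2 + 2 * M)) ^ n"
      proof -
        have "1 / s ^ (k + 2) * (c * s) ^ k = 1 / s\<^sup>2 * c ^ k" for c :: real and k
          using True by (simp add: power_add power_mult_distrib power2_eq_square)
        from this[of n "4 * n * (2 + 2 * M)"] show ?thesis
          by (simp only: N n_def[symmetric] mult.assoc)
      qed
      also have "ennreal (1 / s\<^sup>2 * (4 * n * (2 + 2 * M)) ^ n) * Q =
          ennreal (1 / s\<^sup>2) * indicator {1..} s * (ennreal ((4 * n * (2 + 2 * M)) ^ n) * Q)"
      proof -
        have "0 \<le> (4 * n * (2 + 2 * M)) ^ n" using M by simp
        from ennreal_mult[OF _ this, of "1 / s\<^sup>2"] show ?thesis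
          using True by (simp add: mult.assoc[of "ennreal (1 / s\<^sup>2)"])
      qed
      finally show ?thesis .
    qed simp
  qed
  also have "\<dots> = (\<integral>\<^sup>+s. ennreal (1 / s\<^sup>2) * indicator {1..} s \<partial>lborel) * (ennreal ((4 * n * (2 + 2 * M)) ^ n) * Q)"
    by (rule nn_integral_multc) measurable
  also have "\<dots> = ennreal ((4 * n * (2 + 2 * M)) ^ n) * Q"
    by (subst nn_integral_inverse_square) auto
  finally show ?thesis by (simp add: n_def)
qed

text \<open>The substitution \<open>\<sigma> = s \<delta> / z - 1\<close> removes the regularized distance from the average.\<close>

lemma vertical_substitution:
  fixes h :: "real \<Rightarrow> ennreal"
  assumes h: "h \<in> borel_measurable borel" and z: "z > 0" and \<delta>: "2 * z \<le> \<delta>" "\<delta> \<le> a * z"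
  shows "(\<integral>\<^sup>+s. indicator {1..} s * (ennreal (1 / s ^ N) * h (y + s * \<delta>)) \<partial>lborel) \<le>
    ennreal (a ^ N) * (\<integral>\<^sup>+s. indicator {1..} s * (ennreal (1 / s ^ N) * h (y + z + s * z)) \<partial>lborel)"
proof -
  define q where "q = \<delta> / z"
  have q: "2 \<le> q" "q \<le> a" "\<delta> = q * z" using z \<delta> by (auto simp: q_def field_simps)
  note [measurable] = h
  have meas: "(\<lambda>s. indicator {1..} s * (ennreal (1 / s ^ N) * h (y + z + s * z))) \<in> borel_measurable borel"
    by measurable
  have "(\<integral>\<^sup>+s. indicator {1..} s * (ennreal (1 / s ^ N) * h (y + s * \<delta>)) \<partial>lborel) \<le>
      (\<integral>\<^sup>+s. ennreal (a ^ N) * (indicator {1..} (- 1 + q * s) * (ennreal (1 / (- 1 + q * s) ^ N) * h (y + z + (- 1 + q * s) * z))) \<partial>lborel)"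
  proof (rule nn_integral_mono)
    fix s :: real
    show "indicator {1..} s * (ennreal (1 / s ^ N) * h (y + s * \<delta>)) \<le>
      ennreal (a ^ N) * (indicator {1..} (- 1 + q * s) * (ennreal (1 / (- 1 + q * s) ^ N) * h (y + z + (- 1 + q * s) * z)))"
    proof (cases "s \<ge> 1")
      case True
      \<comment> \<open>This is the purpose of the factor 2 in \<open>\<delta>\<^sup>*\<close>: q
        \<ge> 2 keeps the new variable -1 + q s in [1, \<infinity>).\<close>
      have "2 * 1 \<le> q * s" using True q by (intro mult_mono) auto
      then have 1: "- 1 + q * s \<ge> 1" by simp
      \<comment> \<open>The new variable is at most a s, so the old weight is at most a^N times the
        new one.\<close>
      have "q * s \<le> a * s" using True by (intro mult_right_mono q) simp
      then have "- 1 + q * s \<le> a * s" by linarith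
      then have "(- 1 + q * s) ^ N \<le> (a * s) ^ N" using 1 by (intro power_mono) auto
      then have "1 / (a * s) ^ N \<le> 1 / (- 1 + q * s) ^ N"
        using 1 \<open>- 1 + q * s \<le> a * s\<close> q(1,2) True
        by (intro divide_left_mono mult_pos_pos zero_less_power) linarith+
      then have "a ^ N * (1 / (a * s) ^ N) \<le> a ^ N * (1 / (- 1 + q * s) ^ N)" using q by (intro mult_left_mono) auto
      then have "1 / s ^ N \<le> a ^ N * (1 / (- 1 + q * s) ^ N)" using q by (simp add: power_mult_distrib)
      then have "ennreal (1 / s ^ N) * h (y + s * \<delta>) \<le> ennreal (a ^ N * (1 / (- 1 + q * s) ^ N)) * h (y + s * \<delta>)"
        by (intro mult_right_mono ennreal_leI) auto
      moreover have "y + z + (- 1 + q * s) * z = y + s * \<delta>" using q(3) by (simp add: algebra_simps)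
      moreover have "ennreal (a ^ N * (1 / (- 1 + q * s) ^ N)) = ennreal (a ^ N) * ennreal (1 / (- 1 + q * s) ^ N)"
        using q 1 by (intro ennreal_mult) auto
      ultimately have "ennreal (1 / s ^ N) * h (y + s * \<delta>) \<le>
          ennreal (a ^ N) * (ennreal (1 / (- 1 + q * s) ^ N) * h (y + z + (- 1 + q * s) * z))"
        by (simp only: mult.assoc)
      then show ?thesis using True 1 by simp
    qed simp
  qed
  also have "\<dots> = ennreal (a ^ N) * (\<integral>\<^sup>+s. indicator {1..} (- 1 + q * s) * (ennreal (1 / (- 1 + q * s) ^ N) * h (y + z + (- 1 + q * s) * z)) \<partial>lborel)"
    by (rule nn_integral_cmult) measurable
  also have "\<dots> \<le> ennreal (a ^ N) * (ennreal \<bar>q\<bar> * (\<integral>\<^sup>+s. indicator {1..} (- 1 + q * s) * (ennreal (1 / (- 1 + q * s) ^ N) * h (y + z + (- 1 + q * s) * z)) \<partial>lborel))"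
  proof -
    \<comment> \<open>The Jacobian q of the affine substitution is at least 2 and may be inserted as
      a factor.\<close>
    have "1 * I \<le> ennreal \<bar>q\<bar> * I" for I :: ennreal
      using q by (intro mult_right_mono) (auto simp: ennreal_1[symmetric] simp del: ennreal_1 intro!: ennreal_leI)
    then show ?thesis by (intro mult_left_mono) auto
  qed
  also have "ennreal \<bar>q\<bar> * (\<integral>\<^sup>+s. indicator {1..} (- 1 + q * s) * (ennreal (1 / (- 1 + q * s) ^ N) * h (y + z + (- 1 + q * s) * z)) \<partial>lborel) =
      (\<integral>\<^sup>+s. indicator {1..} s * (ennreal (1 / s ^ N) * h (y + z + s * z)) \<partial>lborel)"
    using q by (intro nn_integral_real_affine[OF meas, symmetric]) auto
  finally show ?thesis .
qed

lemma kernel_shift_bound: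
  fixes e :: "'a::euclidean_space"
  assumes g: "stein_geometry E \<Omega> e c bd D" and G: "continuous_on \<Omega> G" and x: "x \<in> E"
    and \<kappa>: "\<And>s. s \<ge> 1 \<Longrightarrow> \<bar>\<kappa> s\<bar> \<le> K / s ^ N" and K: "K \<ge> 0"
  shows "ennreal \<bar>kernel_shift e c \<kappa> (D (\<lambda>_. 0)) G x\<bar> \<le>
    ennreal K * (\<integral>\<^sup>+s. indicator {1..} s * (ennreal (1 / s ^ N) * ennreal \<bar>G (x + (s * (c * D (\<lambda>_. 0) x)) *\<^sub>R e)\<bar>) \<partial>lborel)"
proof -
  let ?p = "\<lambda>s. x + (s * (c * D (\<lambda>_. 0) x)) *\<^sub>R e"
  have cont: "continuous_on {1..} (\<lambda>s. G (?p s))" by (rule shifted_continuous(1)[OF g G x])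
  have meas: "(\<lambda>s. indicator {1..} s *\<^sub>R \<bar>G (?p s)\<bar>) \<in> borel_measurable lborel"
    using cont by (intro set_borel_measurable_continuous_atLeast continuous_intros)
  have eq: "indicator {1..} s * (ennreal (1 / s ^ N) * ennreal \<bar>G (?p s)\<bar>) =
      ennreal (1 / s ^ N) * ennreal (indicator {1..} s *\<^sub>R \<bar>G (?p s)\<bar>)" for s
    by (auto simp: indicator_def)
  have "ennreal \<bar>kernel_shift e c \<kappa> (D (\<lambda>_. 0)) G x\<bar> \<le> (\<integral>\<^sup>+s. ennreal \<bar>indicator {1..} s *\<^sub>R (\<kappa> s * G (?p s))\<bar> \<partial>lborel)"
  proof (cases "integrable lborel (\<lambda>s. indicator {1..} s *\<^sub>R (\<kappa> s * G (?p s)))")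
    case True
    from integral_norm_bound_ennreal[OF True] show ?thesis
      by (simp add: kernel_shift_def set_lebesgue_integral_def)
  next
    \<comment> \<open>The integral has the default value 0.\<close>
    case False
    then have "kernel_shift e c \<kappa> (D (\<lambda>_. 0)) G x = 0"
      unfolding kernel_shift_def set_lebesgue_integral_def by (rule not_integrable_integral_eq)
    then show ?thesis by simp
  qed
  also have "\<dots> \<le> (\<integral>\<^sup>+s. ennreal K * (indicator {1..} s * (ennreal (1 / s ^ N) * ennreal \<bar>G (?p s)\<bar>)) \<partial>lborel)"
  proof (rule nn_integral_mono)
    fix s :: real
    show "ennreal \<bar>indicator {1..} s *\<^sub>R (\<kappa> s * G (?p s))\<bar> \<le>
        ennreal K * (indicator {1..} s * (ennreal (1 / s ^ N) * ennreal \<bar>G (?p s)\<bar>))"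
    proof (cases "s \<ge> 1")
      case True
      have "\<bar>\<kappa> s * G (?p s)\<bar> \<le> K / s ^ N * \<bar>G (?p s)\<bar>"
        unfolding abs_mult using \<kappa>[OF True] by (intro mult_right_mono) auto
      then have "ennreal \<bar>\<kappa> s * G (?p s)\<bar> \<le> ennreal (K * (1 / s ^ N * \<bar>G (?p s)\<bar>))"
        by (intro ennreal_leI) simp
      also have "\<dots> = ennreal K * (ennreal (1 / s ^ N) * ennreal \<bar>G (?p s)\<bar>)"
        using K True by (simp only: ennreal_mult'' ennreal_mult' abs_ge_zero mult_nonneg_nonneg zero_le_divide_1_iff zero_le_power order_trans[OF zero_le_one])
      finally show ?thesis using True by simp
    qed simp
  qed
  also have "\<dots> = ennreal K * (\<integral>\<^sup>+s. indicator {1..} s * (ennreal (1 / s ^ N) * ennreal \<bar>G (?p s)\<bar>) \<partial>lborel)"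
    unfolding eq
    by (intro nn_integral_cmult borel_measurable_times_ennreal measurable_compose[OF meas measurable_ennreal]) measurable
  finally show ?thesis .
qed

subsection \<open>Continuity of translations in \<open>L\<^sup>p\<close>\<close>

text \<open>The p-th power of the norm, without the root: disjoint sets contribute additively and
  constants appear as p-th powers. Nonnegative integrals over \<open>lborel\<close> and its
  completion agree, so this also measures Lebesgue measurable functions.\<close>

definition lp_int :: "real \<Rightarrow> 'a::euclidean_space set \<Rightarrow> ('a \<Rightarrow> real) \<Rightarrow> ennreal" where
  "lp_int p S f = (\<integral>\<^sup>+x. indicator S x * ennreal (\<bar>f x\<bar> powr p) \<partial>lborel)"

lemma powr_abs_add_le:
  fixes a b p :: real
  assumes "p \<ge> 0"
  shows "\<bar>a + b\<bar> powr p \<le> 2 powr p * (\<bar>a\<bar> powr p + \<bar>b\<bar> powr p)"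
proof -
  have "\<bar>a + b\<bar> \<le> 2 * max \<bar>a\<bar> \<bar>b\<bar>" by linarith
  then have "\<bar>a + b\<bar> powr p \<le> (2 * max \<bar>a\<bar> \<bar>b\<bar>) powr p" using assms by (intro powr_mono2) auto
  also have "\<dots> = 2 powr p * max \<bar>a\<bar> \<bar>b\<bar> powr p" by (rule powr_mult)
  also have "max \<bar>a\<bar> \<bar>b\<bar> powr p \<le> \<bar>a\<bar> powr p + \<bar>b\<bar> powr p" by (auto simp: max_def)
  finally show ?thesis by (simp add: mult_left_mono)
qed

lemma lp_int_add:
  assumes [measurable]: "f \<in> borel_measurable borel" "g \<in> borel_measurable borel" "S \<in> sets borel" and p: "p \<ge> 0"
  shows "lp_int p S (\<lambda>x. f x + g x) \<le> ennreal (2 powr p) * (lp_int p S f + lp_int p S g)"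
proof -
  have "lp_int p S (\<lambda>x. f x + g x) \<le> (\<integral>\<^sup>+x. ennreal (2 powr p) * (indicator S x * ennreal (\<bar>f x\<bar> powr p) + indicator S x * ennreal (\<bar>g x\<bar> powr p)) \<partial>lborel)"
    unfolding lp_int_def
  proof (rule nn_integral_mono)
    fix x
    have "ennreal (\<bar>f x + g x\<bar> powr p) \<le> ennreal (2 powr p * (\<bar>f x\<bar> powr p + \<bar>g x\<bar> powr p))"
      by (intro ennreal_leI powr_abs_add_le p)
    then show "indicator S x * ennreal (\<bar>f x + g x\<bar> powr p) \<le>
        ennreal (2 powr p) * (indicator S x * ennreal (\<bar>f x\<bar> powr p) + indicator S x * ennreal (\<bar>g x\<bar> powr p))"
      by (auto simp: indicator_def ennreal_mult)
  qed
  also have "\<dots> = ennreal (2 powr p) * (\<integral>\<^sup>+x. indicator S x * ennreal (\<bar>f x\<bar> powr p) + indicator S x * ennreal (\<bar>g x\<bar> powr p) \<partial>lborel)"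
    by (rule nn_integral_cmult) measurable
  also have "\<dots> = ennreal (2 powr p) * (lp_int p S f + lp_int p S g)"
    unfolding lp_int_def by (subst nn_integral_add) auto
  finally show ?thesis .
qed

lemma lp_int_uminus: "lp_int p S (\<lambda>x. f x - g x) = lp_int p S (\<lambda>x. g x - f x)"
  by (simp add: lp_int_def abs_minus_commute)

lemma nn_integral_translate:
  fixes f :: "'a::euclidean_space \<Rightarrow> ennreal"
  assumes "f \<in> borel_measurable borel"
  shows "(\<integral>\<^sup>+x. f (c + x) \<partial>lborel) = (\<integral>\<^sup>+x. f x \<partial>lborel)"
proof -
  have "(\<integral>\<^sup>+x. f x \<partial>lborel) = (\<integral>\<^sup>+x. f x \<partial>distr lborel borel ((+) c))" by (simp only: lborel_distr_plus)
  also have "\<dots> = (\<integral>\<^sup>+x. f (c + x) \<partial>lborel)" using assms by (subst nn_integral_distr) auto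
  finally show ?thesis by simp
qed

lemma lp_int_translate:
  assumes [measurable]: "f \<in> borel_measurable borel"
  shows "lp_int p UNIV (\<lambda>x. f (x - h)) = lp_int p UNIV f"
  unfolding lp_int_def using nn_integral_translate[of "\<lambda>x. ennreal (\<bar>f x\<bar> powr p)" "- h"] by simp

lemma lp_int_dominated:
  fixes f :: "nat \<Rightarrow> 'a::euclidean_space \<Rightarrow> real"
  assumes [measurable]: "\<And>n. f n \<in> borel_measurable borel" "w \<in> borel_measurable borel" and p: "p > 0"
    and bd: "\<And>n x. \<bar>f n x\<bar> \<le> w x" and w: "lp_int p UNIV w < \<infinity>"
    and lim: "AE x in lborel. (\<lambda>n. f n x) \<longlonglongrightarrow> 0"
  shows "(\<lambda>n. lp_int p UNIV (f n)) \<longlonglongrightarrow> 0"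
proof -
  have "(\<lambda>n. \<integral>\<^sup>+x. ennreal (\<bar>f n x\<bar> powr p) \<partial>lborel) \<longlonglongrightarrow> (\<integral>\<^sup>+x. 0 \<partial>(lborel :: 'a measure))"
  proof (rule nn_integral_dominated_convergence[where w = "\<lambda>x. ennreal (\<bar>w x\<bar> powr p)"])
    show "AE x in lborel. ennreal (\<bar>f n x\<bar> powr p) \<le> ennreal (\<bar>w x\<bar> powr p)" for n
      using p order_trans[OF bd abs_ge_self] by (intro always_eventually allI ennreal_leI powr_mono2) auto
    show "(\<integral>\<^sup>+x. ennreal (\<bar>w x\<bar> powr p) \<partial>lborel) < \<infinity>" using w by (simp add: lp_int_def)
    show "AE x in lborel. (\<lambda>n. ennreal (\<bar>f n x\<bar> powr p)) \<longlonglongrightarrow> 0"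
      using lim
    proof eventually_elim
      case (elim x)
      have "(\<lambda>n. \<bar>f n x\<bar> powr p) \<longlonglongrightarrow> \<bar>0\<bar> powr p"
        using elim p by (intro tendsto_powr2 tendsto_rabs tendsto_const) (auto intro: always_eventually)
      from tendsto_ennrealI[OF this] show ?case using p by simp
    qed
  qed measurable
  then show ?thesis by (simp add: lp_int_def)
qed

lemma ennreal_LIMSEQ_0_le:
  fixes f :: "nat \<Rightarrow> ennreal"
  assumes "f \<longlonglongrightarrow> 0" "e > (0::real)"
  shows "\<exists>n. f n \<le> ennreal e"
proof -
  have "\<forall>\<^sub>F n in sequentially. f n < ennreal e"
    using assms by (intro order_tendstoD(2)) (auto simp: ennreal_less_zero_iff)
  then show ?thesis using eventually_happens'[OF sequentially_bot] less_imp_le by blast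
qed

text \<open>The function is first truncated in size and in support. A measurable function is almost
  everywhere a limit of continuous ones; clamping these and cutting them off supplies a dominating
  function for the second limit.\<close>

lemma lp_approx_continuous:
  fixes g :: "'a::euclidean_space \<Rightarrow> real"
  assumes g[measurable]: "g \<in> borel_measurable borel" and p: "p \<ge> 1" and fin: "lp_int p UNIV g < \<infinity>" and e: "e > 0"
  shows "\<exists>u R. continuous_on UNIV u \<and> (\<forall>x. x \<notin> cball 0 R \<longrightarrow> u x = 0) \<and> lp_int p UNIV (\<lambda>x. g x - u x) \<le> ennreal e"
proof -
  \<comment> \<open>Half of e for each approximation, divided by the constant 2^p of the
    quasi-triangle inequality.\<close>
  define e' where "e' = e / (2 * 2 powr p)"
  have e': "e' > 0" using e by (simp add: e'_def)
  define gk where "gk k x = indicator (cball 0 (real k)) x * max (- real k) (min (real k) (g x))" for k x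
  have gk_meas[measurable]: "gk k \<in> borel_measurable borel" for k
    unfolding gk_def by (intro borel_measurable_times borel_measurable_indicator borel_measurable_max
        borel_measurable_min borel_measurable_const g) auto
  have "(\<lambda>k. lp_int p UNIV (\<lambda>x. g x - gk k x)) \<longlonglongrightarrow> 0"
  proof (rule lp_int_dominated[where w = "\<lambda>x. \<bar>g x\<bar>"])
    show "\<bar>g x - gk k x\<bar> \<le> \<bar>g x\<bar>" for k x by (auto simp: gk_def indicator_def)
    show "lp_int p UNIV (\<lambda>x. \<bar>g x\<bar>) < \<infinity>" using fin by (simp add: lp_int_def)
    show "AE x in lborel. (\<lambda>k. g x - gk k x) \<longlonglongrightarrow> 0"
    proof (intro always_eventually allI)
      fix x
      obtain k0 :: nat where k0: "norm x + \<bar>g x\<bar> \<le> real k0" using real_arch_simple by blast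
      have "g x - gk k x = 0" if "k \<ge> k0" for k
      proof -
        have "norm x + \<bar>g x\<bar> \<le> real k" using k0 that by linarith
        then have "norm x \<le> real k" "\<bar>g x\<bar> \<le> real k" using norm_ge_zero[of x] by linarith+
        then show ?thesis by (auto simp: gk_def)
      qed
      then show "(\<lambda>k. g x - gk k x) \<longlonglongrightarrow> 0"
        by (intro tendsto_eventually eventually_sequentiallyI)
    qed
  qed (use p in auto)
  from ennreal_LIMSEQ_0_le[OF this e'] obtain k where k: "lp_int p UNIV (\<lambda>x. g x - gk k x) \<le> ennreal e'" by blast
  have "gk k measurable_on UNIV"
    using gk_meas[of k] by (intro lebesgue_measurable_imp_measurable_on_real) (auto simp: measurable_completion)
  then obtain N G where N: "negligible N" and G: "\<And>n. continuous_on UNIV (G n)"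
    and lim: "\<And>x. x \<notin> N \<Longrightarrow> (\<lambda>n. G n x) \<longlonglongrightarrow> gk k x"
    unfolding measurable_on_def by auto
  define \<theta> where "\<theta> x = max 0 (min 1 (real k + 1 - norm x))" for x :: 'a
  have \<theta>: "0 \<le> \<theta> x" "\<theta> x \<le> 1" "x \<in> cball 0 (real k) \<Longrightarrow> \<theta> x = 1" "x \<notin> cball 0 (real k + 1) \<Longrightarrow> \<theta> x = 0" for x
    by (auto simp: \<theta>_def)
  define u where "u n x = \<theta> x * max (- real k) (min (real k) (G n x))" for n x
  have cu: "continuous_on UNIV (u n)" for n
    unfolding u_def \<theta>_def by (intro continuous_intros G)
  have [measurable]: "u n \<in> borel_measurable borel" for n by (rule borel_measurable_continuous_onI[OF cu])
  \<comment> \<open>The truncated function is unchanged by cutting off and clamping, so the modified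
    continuous functions still converge to it.\<close>
  have gk_eq: "\<theta> x * max (- real k) (min (real k) (gk k x)) = gk k x" for x
    by (cases "x \<in> cball 0 (real k)") (auto simp: gk_def \<theta>(3))
  have "(\<lambda>n. lp_int p UNIV (\<lambda>x. gk k x - u n x)) \<longlonglongrightarrow> 0"
  proof (rule lp_int_dominated[where w = "\<lambda>x. 2 * real k * indicator (cball 0 (real k + 1)) x"])
    show "\<bar>gk k x - u n x\<bar> \<le> 2 * real k * indicator (cball 0 (real k + 1)) x" for n x
    proof (cases "x \<in> cball 0 (real k + 1)")
      case True
      have "\<bar>gk k x\<bar> \<le> real k" by (auto simp: gk_def indicator_def)
      moreover have "\<bar>u n x\<bar> \<le> 1 * real k"
        unfolding u_def abs_mult using \<theta>(1,2)[of x] by (intro mult_mono) auto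
      ultimately show ?thesis using True by simp
    next
      case False
      then have "x \<notin> cball 0 (real k)" by auto
      with False \<theta>(4)[OF False] show ?thesis by (simp add: gk_def u_def)
    qed
    have "lp_int p UNIV (\<lambda>x::'a. 2 * real k * indicator (cball 0 (real k + 1)) x) =
        (\<integral>\<^sup>+x. ennreal ((2 * real k) powr p) * indicator (cball (0::'a) (real k + 1)) x \<partial>lborel)"
      unfolding lp_int_def using p by (intro nn_integral_cong) (auto simp: indicator_def)
    also have "\<dots> = ennreal ((2 * real k) powr p) * emeasure lborel (cball (0::'a) (real k + 1))"
      by (rule nn_integral_cmult_indicator) simp
    also have "\<dots> < \<infinity>"
      using emeasure_bounded_finite[OF bounded_cball, of "0::'a" "real k + 1"] by (simp add: ennreal_mult_less_top)
    finally show "lp_int p UNIV (\<lambda>x::'a. 2 * real k * indicator (cball 0 (real k + 1)) x) < \<infinity>" .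
    show "AE x in lborel. (\<lambda>n. gk k x - u n x) \<longlonglongrightarrow> 0"
    proof -
      have "AE x in lebesgue. x \<notin> N" using N by (simp add: AE_not_in negligible_iff_null_sets)
      then have "AE x in lborel. x \<notin> N" by (simp add: AE_completion_iff)
      then show ?thesis
      proof eventually_elim
        case (elim x)
        have "(\<lambda>n. gk k x - u n x) \<longlonglongrightarrow> gk k x - \<theta> x * max (- real k) (min (real k) (gk k x))"
          unfolding u_def by (intro tendsto_intros tendsto_max tendsto_min lim elim)
        then show ?case by (simp only: gk_eq diff_self)
      qed
    qed
    show "(\<lambda>x::'a. 2 * real k * indicator (cball 0 (real k + 1)) x) \<in> borel_measurable borel"
      by (intro borel_measurable_times borel_measurable_const borel_measurable_indicator) auto
  qed (use p in auto)
  from ennreal_LIMSEQ_0_le[OF this e'] obtain n where n: "lp_int p UNIV (\<lambda>x. gk k x - u n x) \<le> ennreal e'" by blast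
  have "lp_int p UNIV (\<lambda>x. g x - u n x) = lp_int p UNIV (\<lambda>x. (g x - gk k x) + (gk k x - u n x))" by simp
  also have "\<dots> \<le> ennreal (2 powr p) * (lp_int p UNIV (\<lambda>x. g x - gk k x) + lp_int p UNIV (\<lambda>x. gk k x - u n x))"
    using p by (intro lp_int_add) auto
  also have "\<dots> \<le> ennreal (2 powr p) * (ennreal e' + ennreal e')"
    by (intro mult_left_mono add_mono k n) auto
  also have "\<dots> = ennreal e"
    using e' by (simp add: ennreal_plus[symmetric] ennreal_mult[symmetric] del: ennreal_plus) (simp add: e'_def)
  finally show ?thesis using cu[of n] \<theta>(4) by (intro exI[of _ "u n"] exI[of _ "real k + 1"]) (auto simp: u_def)
qed

lemma lp_translation_continuous_compact:
  fixes u :: "'a::euclidean_space \<Rightarrow> real"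
  assumes u: "continuous_on UNIV u" "\<And>x. x \<notin> cball 0 R \<Longrightarrow> u x = 0" and p: "p \<ge> 1" and e: "e > 0"
  shows "\<exists>d>0. \<forall>h. norm h < d \<longrightarrow> lp_int p UNIV (\<lambda>x. u (x - h) - u x) \<le> ennreal e"
proof -
  define V where "V = measure lborel (cball (0::'a) (\<bar>R\<bar> + 1))"
  have V: "emeasure lborel (cball (0::'a) (\<bar>R\<bar> + 1)) = ennreal V" "V \<ge> 0"
    unfolding V_def using emeasure_bounded_finite[OF bounded_cball, of "0::'a" "\<bar>R\<bar> + 1"]
    by (simp_all add: emeasure_eq_ennreal_measure less_top)
  \<comment> \<open>e' \<le> 1 gives e'^p \<le> e', and e' V \<le> e accounts for the ball of
    measure V that contains the support of the difference.\<close>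
  define e' where "e' = min 1 (e / (V + 1))"
  have e': "e' > 0" "e' \<le> 1" "e' * V \<le> e"
  proof -
    have "e' * V \<le> e / (V + 1) * V" using V by (intro mult_right_mono) (auto simp: e'_def)
    also have "\<dots> \<le> e" using V e by (simp add: field_simps)
    finally show "e' * V \<le> e" .
  qed (use e V in \<open>auto simp: e'_def\<close>)
  have "uniformly_continuous_on (cball 0 (\<bar>R\<bar> + 2)) u"
    by (intro compact_uniformly_continuous continuous_on_subset[OF u(1)]) auto
  then obtain d where d: "d > 0" "\<And>x y. x \<in> cball 0 (\<bar>R\<bar> + 2) \<Longrightarrow> y \<in> cball 0 (\<bar>R\<bar> + 2) \<Longrightarrow> dist y x < d \<Longrightarrow> dist (u y) (u x) < e'"
    using e'(1) unfolding uniformly_continuous_on_def by metis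
  have "lp_int p UNIV (\<lambda>x. u (x - h) - u x) \<le> ennreal e" if h: "norm h < min d 1" for h
  proof -
    have "lp_int p UNIV (\<lambda>x. u (x - h) - u x) \<le> (\<integral>\<^sup>+x. ennreal e' * indicator (cball (0::'a) (\<bar>R\<bar> + 1)) x \<partial>lborel)"
      unfolding lp_int_def
    proof (rule nn_integral_mono)
      fix x :: 'a
      show "indicator UNIV x * ennreal (\<bar>u (x - h) - u x\<bar> powr p) \<le> ennreal e' * indicator (cball (0::'a) (\<bar>R\<bar> + 1)) x"
      proof (cases "x \<in> cball 0 (\<bar>R\<bar> + 1)")
        case True
        have "norm (x - h) \<le> \<bar>R\<bar> + 2" using True h norm_triangle_ineq4[of x h] by simp
        then have "dist (u (x - h)) (u x) < e'" using True h by (intro d(2)) (auto simp: dist_norm norm_minus_commute)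
        then have "\<bar>u (x - h) - u x\<bar> powr p \<le> e' powr p" using p by (intro powr_mono2) (auto simp: dist_real_def)
        also have "\<dots> \<le> e' powr 1" using e' p by (intro powr_mono') auto
        finally show ?thesis using True e' by (simp add: ennreal_leI)
      next
        case False
        then have x: "norm x > \<bar>R\<bar> + 1" by simp
        then have "norm (x - h) > \<bar>R\<bar>" using h norm_triangle_ineq2[of x h] by simp
        then have "u (x - h) = 0" "u x = 0" using x by (auto intro!: u(2))
        then show ?thesis using p by simp
      qed
    qed
    also have "\<dots> = ennreal e' * emeasure lborel (cball (0::'a) (\<bar>R\<bar> + 1))"
      by (rule nn_integral_cmult_indicator) simp
    also have "\<dots> = ennreal (e' * V)" using V e' by (simp add: ennreal_mult)
    also have "\<dots> \<le> ennreal e" by (rule ennreal_leI[OF e'(3)])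
    finally show ?thesis .
  qed
  then show ?thesis using d(1) by (intro exI[of _ "min d 1"]) auto
qed

lemma lp_translation_continuous:
  fixes g :: "'a::euclidean_space \<Rightarrow> real"
  assumes g[measurable]: "g \<in> borel_measurable borel" and p: "p \<ge> 1" and fin: "lp_int p UNIV g < \<infinity>" and e: "e > 0"
  shows "\<exists>d>0. \<forall>h. norm h < d \<longrightarrow> lp_int p UNIV (\<lambda>x. g (x - h) - g x) \<le> ennreal e"
proof -
  define c where "c = (2::real) powr p"
  have c: "c > 0" by (simp add: c_def)
  \<comment> \<open>The solution of c (e' + c (e' + e')) = e, the total of two quasi-triangle
    inequalities.\<close>
  define e' where "e' = e / (c * (1 + 2 * c))"
  have e': "e' > 0" using e c by (simp add: e'_def)
  obtain u R where u: "continuous_on UNIV u" "\<And>x. x \<notin> cball 0 R \<Longrightarrow> u x = 0" "lp_int p UNIV (\<lambda>x. g x - u x) \<le> ennreal e'"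
    using lp_approx_continuous[OF g p fin e'] by blast
  have [measurable]: "u \<in> borel_measurable borel" by (rule borel_measurable_continuous_onI[OF u(1)])
  obtain d where d: "d > 0" "\<And>h. norm h < d \<Longrightarrow> lp_int p UNIV (\<lambda>x. u (x - h) - u x) \<le> ennreal e'"
    using lp_translation_continuous_compact[OF u(1,2) p e'] by blast
  have "lp_int p UNIV (\<lambda>x. g (x - h) - g x) \<le> ennreal e" if h: "norm h < d" for h
  proof -
    have 1: "lp_int p UNIV (\<lambda>x. g (x - h) - u (x - h)) \<le> ennreal e'"
      using lp_int_translate[of "\<lambda>x. g x - u x" p h] u(3) by simp
    have 2: "lp_int p UNIV (\<lambda>x. u x - g x) \<le> ennreal e'" using u(3) lp_int_uminus[of p UNIV u g] by simp
    have "lp_int p UNIV (\<lambda>x. g (x - h) - g x) =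
        lp_int p UNIV (\<lambda>x. (u (x - h) - u x) + ((g (x - h) - u (x - h)) + (u x - g x)))" by simp
    also have "\<dots> \<le> ennreal c * (lp_int p UNIV (\<lambda>x. u (x - h) - u x) +
        lp_int p UNIV (\<lambda>x. (g (x - h) - u (x - h)) + (u x - g x)))"
      unfolding c_def using p by (intro lp_int_add) auto
    also have "\<dots> \<le> ennreal c * (ennreal e' + ennreal c * (ennreal e' + ennreal e'))"
    proof (intro mult_left_mono add_mono d(2)[OF h])
      have "lp_int p UNIV (\<lambda>x. (g (x - h) - u (x - h)) + (u x - g x)) \<le>
          ennreal c * (lp_int p UNIV (\<lambda>x. g (x - h) - u (x - h)) + lp_int p UNIV (\<lambda>x. u x - g x))"
        unfolding c_def using p by (intro lp_int_add) auto
      also have "\<dots> \<le> ennreal c * (ennreal e' + ennreal e')" by (intro mult_left_mono add_mono 1 2) auto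
      finally show "lp_int p UNIV (\<lambda>x. (g (x - h) - u (x - h)) + (u x - g x)) \<le> ennreal c * (ennreal e' + ennreal e')" .
    qed auto
    also have "\<dots> = ennreal (c * (e' + c * (e' + e')))"
      using c e' by (simp only: ennreal_mult ennreal_plus add_nonneg_nonneg mult_nonneg_nonneg less_imp_le)
    also have "c * (e' + c * (e' + e')) = e"
    proof -
      have "c * (e' + c * (e' + e')) = (c * (1 + 2 * c)) * e'" by (simp add: algebra_simps)
      also have "(c * (1 + 2 * c)) * e' = e"
      proof -
        have "c * (1 + 2 * c) \<noteq> 0" using c by simp
        then show ?thesis
          unfolding e'_def times_divide_eq_right by (rule nonzero_mult_div_cancel_left)
      qed
      finally show ?thesis .
    qed
    finally show ?thesis .
  qed
  then show ?thesis using d(1) by blast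
qed

subsection \<open>Mollification\<close>

definition mollify :: "('a::euclidean_space \<Rightarrow> real) \<Rightarrow> ('a \<Rightarrow> real) \<Rightarrow> 'a \<Rightarrow> real" where
  "mollify \<eta> g x = (LINT y|lborel. \<eta> (x - y) * g y)"

lemma nn_integral_reflect:
  fixes f :: "'a::euclidean_space \<Rightarrow> ennreal"
  assumes [measurable]: "f \<in> borel_measurable borel"
  shows "(\<integral>\<^sup>+y. f (x - y) \<partial>lborel) = (\<integral>\<^sup>+y. f y \<partial>lborel)"
proof -
  have "(\<integral>\<^sup>+y. f (x - y) \<partial>lborel) = (\<integral>\<^sup>+y. f (x + y) \<partial>distr lborel borel uminus)"
    by (subst nn_integral_distr) auto
  also have "\<dots> = (\<integral>\<^sup>+y. f (x + y) \<partial>lborel)"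
    using lborel_affine[of "-1" "0::'a"] by (simp add: density_1 cong: distr_cong)
  also have "\<dots> = (\<integral>\<^sup>+y. f y \<partial>lborel)" by (rule nn_integral_translate) simp
  finally show ?thesis .
qed

text \<open>The elementary bound |g| \<le> 1 + |g|^p takes the place of Holder's inequality. What
  counts is that the result is independent of the centre x.\<close>

lemma lp_int_local_integrable:
  fixes g :: "'a::euclidean_space \<Rightarrow> real"
  assumes [measurable]: "g \<in> borel_measurable borel" and p: "p \<ge> 1"
  shows "(\<integral>\<^sup>+y. indicator (cball x R) y * ennreal \<bar>g y\<bar> \<partial>lborel) \<le> emeasure lborel (cball (0::'a) R) + lp_int p UNIV g"
proof -
  have "(\<integral>\<^sup>+y. indicator (cball x R) y * ennreal \<bar>g y\<bar> \<partial>lborel) \<le>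
      (\<integral>\<^sup>+y. indicator (cball x R) y + indicator UNIV y * ennreal (\<bar>g y\<bar> powr p) \<partial>lborel)"
  proof (rule nn_integral_mono)
    fix y
    have "\<bar>g y\<bar> \<le> 1 + \<bar>g y\<bar> powr p"
    proof (cases "\<bar>g y\<bar> \<le> 1")
      case False
      then have "\<bar>g y\<bar> powr 1 \<le> \<bar>g y\<bar> powr p" using p by (intro powr_mono) auto
      then show ?thesis using False by simp
    qed (simp add: add_increasing2)
    then have "ennreal \<bar>g y\<bar> \<le> ennreal (1 + \<bar>g y\<bar> powr p)" by (rule ennreal_leI)
    then show "indicator (cball x R) y * ennreal \<bar>g y\<bar> \<le> indicator (cball x R) y + indicator UNIV y * ennreal (\<bar>g y\<bar> powr p)"
      by (auto simp: indicator_def)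
  qed
  also have "\<dots> = emeasure lborel (cball x R) + lp_int p UNIV g"
    unfolding lp_int_def by (subst nn_integral_add) (auto intro!: borel_measurable_indicator)
  also have "emeasure lborel (cball x R) = emeasure lborel (cball (0::'a) R)"
  proof -
    have "emeasure lborel (cball x R) = (\<integral>\<^sup>+y. indicator (cball 0 R) (- x + y) \<partial>lborel)"
      by (subst nn_integral_indicator[symmetric], simp, intro nn_integral_cong)
         (auto simp: indicator_def dist_norm norm_minus_commute)
    also have "\<dots> = emeasure lborel (cball (0::'a) R)" by (subst nn_integral_translate) (auto intro!: borel_measurable_indicator)
    finally show ?thesis .
  qed
  finally show ?thesis .
qed

lemma local_integrable_cball:
  fixes g :: "'a::euclidean_space \<Rightarrow> real"
  assumes g[measurable]: "g \<in> borel_measurable borel" and p: "p \<ge> 1" and fin: "lp_int p UNIV g < \<infinity>"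
  shows "integrable lborel (\<lambda>y. indicator (cball x R) y * g y)"
proof (rule integrableI_bounded)
  show "(\<lambda>y. indicator (cball x R) y * g y) \<in> borel_measurable lborel"
    by (intro borel_measurable_times borel_measurable_indicator) auto
  have "(\<integral>\<^sup>+y. ennreal (norm (indicator (cball x R) y * g y)) \<partial>lborel) =
      (\<integral>\<^sup>+y. indicator (cball x R) y * ennreal \<bar>g y\<bar> \<partial>lborel)"
    by (intro nn_integral_cong) (auto simp: indicator_def)
  also have "\<dots> \<le> emeasure lborel (cball (0::'a) R) + lp_int p UNIV g" by (rule lp_int_local_integrable[OF g p])
  also have "\<dots> < \<infinity>" using fin emeasure_bounded_finite[OF bounded_cball, of "0::'a" R] by (simp add: less_top[symmetric])
  finally show "(\<integral>\<^sup>+y. ennreal (norm (indicator (cball x R) y * g y)) \<partial>lborel) < \<infinity>" .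
qed

lemma mollify_integrable:
  fixes g k :: "'a::euclidean_space \<Rightarrow> real"
  assumes g[measurable]: "g \<in> borel_measurable borel" and p: "p \<ge> 1" and fin: "lp_int p UNIV g < \<infinity>"
    and k: "k \<in> borel_measurable borel" "\<And>x. \<bar>k x\<bar> \<le> C" "\<And>x. x \<notin> cball 0 R \<Longrightarrow> k x = 0"
  shows "integrable lborel (\<lambda>y. k (x - y) * g y)"
proof (rule Bochner_Integration.integrable_bound)
  note [measurable] = k(1)
  show "integrable lborel (\<lambda>y. C * (indicator (cball x R) y * g y))"
    by (intro integrable_mult_right local_integrable_cball[OF g p fin])
  show "(\<lambda>y. k (x - y) * g y) \<in> borel_measurable lborel" by measurable
  show "AE y in lborel. norm (k (x - y) * g y) \<le> norm (C * (indicator (cball x R) y * g y))"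
  proof (intro always_eventually allI)
    fix y
    show "norm (k (x - y) * g y) \<le> norm (C * (indicator (cball x R) y * g y))"
    proof (cases "y \<in> cball x R")
      case True
      have "\<bar>k (x - y)\<bar> * \<bar>g y\<bar> \<le> \<bar>C\<bar> * \<bar>g y\<bar>"
        using order_trans[OF k(2) abs_ge_self] by (intro mult_right_mono) auto
      then show ?thesis using True by (simp add: abs_mult)
    next
      case False
      then show ?thesis using k(3)[of "x - y"] by (simp add: dist_norm norm_minus_commute)
    qed
  qed
qed

lemma mollify_continuous:
  fixes g k :: "'a::euclidean_space \<Rightarrow> real"
  assumes g[measurable]: "g \<in> borel_measurable borel" and p: "p \<ge> 1" and fin: "lp_int p UNIV g < \<infinity>"
    and k: "continuous_on UNIV k" "\<And>x. \<bar>k x\<bar> \<le> C" "\<And>x. x \<notin> cball 0 R \<Longrightarrow> k x = 0"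
  shows "continuous_on UNIV (mollify k g)"
  unfolding continuous_on_sequentially comp_def
proof (intro ballI allI impI)
  fix X :: "nat \<Rightarrow> 'a" and x assume X: "(\<forall>n. X n \<in> UNIV) \<and> X \<longlonglongrightarrow> x"
  have [measurable]: "k \<in> borel_measurable borel" by (rule borel_measurable_continuous_onI[OF k(1)])
  have "\<forall>\<^sub>F n in sequentially. dist (X n) x < 1" using X tendstoD[of X x sequentially 1] by simp
  then obtain n0 where n0: "\<And>n. n \<ge> n0 \<Longrightarrow> dist (X n) x < 1" by (auto simp: eventually_sequentially)
  have "(\<lambda>n. mollify k g (X (n + n0))) \<longlonglongrightarrow> mollify k g x"
    unfolding mollify_def
  proof (rule integral_dominated_convergence[where w = "\<lambda>y. \<bar>C\<bar> * norm (indicator (cball x (R + 1)) y * g y)"])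
    show "(\<lambda>y. k (x - y) * g y) \<in> borel_measurable lborel" by measurable
    show "(\<lambda>y. k (X (n + n0) - y) * g y) \<in> borel_measurable lborel" for n by measurable
    show "integrable lborel (\<lambda>y. \<bar>C\<bar> * norm (indicator (cball x (R + 1)) y * g y))"
      by (intro integrable_mult_right integrable_norm local_integrable_cball[OF g p fin])
    show "AE y in lborel. (\<lambda>n. k (X (n + n0) - y) * g y) \<longlonglongrightarrow> k (x - y) * g y"
    proof (intro always_eventually allI tendsto_mult tendsto_const)
      fix y
      have "isCont k (x - y)" using k(1) by (simp add: continuous_on_eq_continuous_at)
      moreover have "(\<lambda>n. X (n + n0) - y) \<longlonglongrightarrow> x - y"
        using X by (intro tendsto_diff tendsto_const LIMSEQ_ignore_initial_segment) auto
      ultimately show "(\<lambda>n. k (X (n + n0) - y)) \<longlonglongrightarrow> k (x - y)" by (rule isCont_tendsto_compose)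
    qed
    show "AE y in lborel. norm (k (X (n + n0) - y) * g y) \<le> \<bar>C\<bar> * norm (indicator (cball x (R + 1)) y * g y)" for n
    proof (intro always_eventually allI)
      fix y
      show "norm (k (X (n + n0) - y) * g y) \<le> \<bar>C\<bar> * norm (indicator (cball x (R + 1)) y * g y)"
      proof (cases "y \<in> cball x (R + 1)")
        case True
        have "\<bar>k (X (n + n0) - y)\<bar> * \<bar>g y\<bar> \<le> \<bar>C\<bar> * \<bar>g y\<bar>"
          using order_trans[OF k(2) abs_ge_self] by (intro mult_right_mono) auto
        then show ?thesis using True by (simp add: abs_mult)
      next
        case False
        have "dist x y \<le> dist (X (n + n0)) x + dist (X (n + n0)) y"
          using dist_triangle[of x y "X (n + n0)"] by (simp add: dist_commute)
        then have "dist (X (n + n0)) y > R" using False n0[of "n + n0"] by simp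
        then have "k (X (n + n0) - y) = 0" by (intro k(3)) (simp add: dist_norm norm_minus_commute)
        then show ?thesis by simp
      qed
    qed
  qed
  from LIMSEQ_offset[OF this] show "(\<lambda>n. mollify k g (X n)) \<longlonglongrightarrow> mollify k g x" .
qed

text \<open>The integral of |g| over a ball of radius R is bounded independently of its
  centre.\<close>

lemma mollify_bounded:
  fixes g k :: "'a::euclidean_space \<Rightarrow> real"
  assumes g[measurable]: "g \<in> borel_measurable borel" and p: "p \<ge> 1" and fin: "lp_int p UNIV g < \<infinity>"
    and k: "continuous_on UNIV k" "\<And>x. \<bar>k x\<bar> \<le> C" "\<And>x. x \<notin> cball 0 R \<Longrightarrow> k x = 0"
  shows "bounded (range (mollify k g))"
proof -
  have [measurable]: "k \<in> borel_measurable borel" by (rule borel_measurable_continuous_onI[OF k(1)])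
  have C: "C \<ge> 0" using order_trans[OF abs_ge_zero k(2)[of 0]] .
  define B where "B = ennreal C * (emeasure lborel (cball (0::'a) R) + lp_int p UNIV g)"
  have B: "B < \<infinity>" using fin emeasure_bounded_finite[OF bounded_cball, of "0::'a" R]
    by (auto simp: B_def less_top[symmetric] ennreal_mult_eq_top_iff)
  have "ennreal \<bar>mollify k g x\<bar> \<le> B" for x
  proof -
    have "ennreal \<bar>mollify k g x\<bar> \<le> (\<integral>\<^sup>+y. ennreal (norm (k (x - y) * g y)) \<partial>lborel)"
    proof -
      have "integrable lborel (\<lambda>y. k (x - y) * g y)"
        by (rule mollify_integrable[OF g p fin _ k(2,3)]) measurable
      from integral_norm_bound_ennreal[OF this] show ?thesis by (simp add: mollify_def)
    qed
    also have "\<dots> \<le> (\<integral>\<^sup>+y. ennreal C * (indicator (cball x R) y * ennreal \<bar>g y\<bar>) \<partial>lborel)"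
    proof (rule nn_integral_mono)
      fix y
      show "ennreal (norm (k (x - y) * g y)) \<le> ennreal C * (indicator (cball x R) y * ennreal \<bar>g y\<bar>)"
      proof (cases "y \<in> cball x R")
        case True
        have "norm (k (x - y) * g y) \<le> C * \<bar>g y\<bar>"
          unfolding real_norm_def abs_mult by (intro mult_right_mono k(2)) auto
        from ennreal_leI[OF this] show ?thesis using True C by (simp add: ennreal_mult)
      next
        case False
        then show ?thesis using k(3)[of "x - y"] by (simp add: dist_norm norm_minus_commute)
      qed
    qed
    also have "\<dots> = ennreal C * (\<integral>\<^sup>+y. indicator (cball x R) y * ennreal \<bar>g y\<bar> \<partial>lborel)"
      by (intro nn_integral_cmult borel_measurable_times_ennreal borel_measurable_indicator) auto
    also have "\<dots> \<le> B" unfolding B_def by (intro mult_left_mono lp_int_local_integrable[OF g p]) simp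
    finally show ?thesis .
  qed
  then have "\<bar>mollify k g x\<bar> \<le> enn2real B" for x
    using B by (metis abs_ge_zero enn2real_ennreal enn2real_mono infinity_ennreal_def)
  then show ?thesis by (auto simp: bounded_iff)
qed

text \<open>The derivative falls on the kernel. Its difference quotients are bounded by the mean
  value theorem and supported in a ball enlarged by \<open>norm b\<close>, so local integrability of
  g dominates them.\<close>

lemma mollify_deriv:
  fixes g k k' :: "'a::euclidean_space \<Rightarrow> real"
  assumes g[measurable]: "g \<in> borel_measurable borel" and p: "p \<ge> 1" and fin: "lp_int p UNIV g < \<infinity>"
    and k: "continuous_on UNIV k" "\<And>x. \<bar>k x\<bar> \<le> C" "\<And>x. x \<notin> cball 0 R \<Longrightarrow> k x = 0"
    and k': "continuous_on UNIV k'" "\<And>x. \<bar>k' x\<bar> \<le> C'"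
    and der: "\<And>x. ((\<lambda>t. k (x + t *\<^sub>R b)) has_real_derivative k' x) (at 0)"
  shows "((\<lambda>t. mollify k g (x + t *\<^sub>R b)) has_real_derivative mollify k' g x) (at 0)"
proof -
  have [measurable]: "k \<in> borel_measurable borel" "k' \<in> borel_measurable borel"
    using k k' by (auto intro: borel_measurable_continuous_onI)
  have "((\<lambda>t. (mollify k g (x + t *\<^sub>R b) - mollify k g x) / t) \<longlongrightarrow> mollify k' g x) (at 0)"
    unfolding tendsto_at_iff_sequentially comp_def
  proof (intro allI impI)
    fix X :: "nat \<Rightarrow> real" assume X: "\<forall>n. X n \<in> UNIV - {0}" "X \<longlonglongrightarrow> 0"
    have "\<forall>\<^sub>F n in sequentially. \<bar>X n\<bar> < 1"
      using tendstoD[OF X(2), of 1] by (simp add: dist_real_def)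
    then obtain n0 where n0: "\<And>n. n \<ge> n0 \<Longrightarrow> \<bar>X n\<bar> < 1" by (auto simp: eventually_sequentially)
    define q where "q n y = (k ((x - y) + X (n + n0) *\<^sub>R b) - k (x - y)) / X (n + n0) * g y" for n y
    have "(\<lambda>n. LINT y|lborel. q n y) \<longlonglongrightarrow> mollify k' g x"
      unfolding mollify_def
    proof (rule integral_dominated_convergence[where w = "\<lambda>y. \<bar>C'\<bar> * norm (indicator (cball x (R + norm b)) y * g y)"])
      show "(\<lambda>y. k' (x - y) * g y) \<in> borel_measurable lborel" by measurable
      show "q n \<in> borel_measurable lborel" for n unfolding q_def by measurable
      show "integrable lborel (\<lambda>y. \<bar>C'\<bar> * norm (indicator (cball x (R + norm b)) y * g y))"
        by (intro integrable_mult_right integrable_norm local_integrable_cball[OF g p fin])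
      show "AE y in lborel. (\<lambda>n. q n y) \<longlonglongrightarrow> k' (x - y) * g y"
        unfolding q_def
      proof (intro always_eventually allI tendsto_mult tendsto_const)
        fix y
        have "((\<lambda>t. (k ((x - y) + t *\<^sub>R b) - k (x - y)) / t) \<longlongrightarrow> k' (x - y)) (at 0)"
          using der[of "x - y"] by (simp add: has_field_derivative_iff)
        then have "(\<lambda>n. (k ((x - y) + X n *\<^sub>R b) - k (x - y)) / X n) \<longlonglongrightarrow> k' (x - y)"
          using X unfolding tendsto_at_iff_sequentially comp_def by blast
        from LIMSEQ_ignore_initial_segment[OF this, of n0]
        show "(\<lambda>n. (k ((x - y) + X (n + n0) *\<^sub>R b) - k (x - y)) / X (n + n0)) \<longlonglongrightarrow> k' (x - y)" .
      qed
      show "AE y in lborel. norm (q n y) \<le> \<bar>C'\<bar> * norm (indicator (cball x (R + norm b)) y * g y)" for n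
      proof (intro always_eventually allI)
        fix y
        let ?t = "X (n + n0)"
        have t: "?t \<noteq> 0" "\<bar>?t\<bar> < 1" using X(1) n0[of "n + n0"] by auto
        show "norm (q n y) \<le> \<bar>C'\<bar> * norm (indicator (cball x (R + norm b)) y * g y)"
        proof (cases "y \<in> cball x (R + norm b)")
          case True
          have "norm (k ((x - y) + ?t *\<^sub>R b) - k ((x - y) + 0 *\<^sub>R b)) \<le> \<bar>C'\<bar> * norm (?t - 0)"
          proof (rule field_differentiable_bound[where S = UNIV and f = "\<lambda>t. k ((x - y) + t *\<^sub>R b)" and f' = "\<lambda>t. k' ((x - y) + t *\<^sub>R b)"])
            show "((\<lambda>t. k ((x - y) + t *\<^sub>R b)) has_field_derivative k' ((x - y) + t *\<^sub>R b)) (at t within UNIV)" for t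
              by (rule line_has_derivative_at[OF der])
            show "norm (k' ((x - y) + t *\<^sub>R b)) \<le> \<bar>C'\<bar>" for t
              using order_trans[OF k'(2) abs_ge_self] by simp
          qed auto
          then have "\<bar>(k ((x - y) + ?t *\<^sub>R b) - k (x - y)) / ?t\<bar> \<le> \<bar>C'\<bar>"
            using t by (simp add: field_simps)
          then have "\<bar>(k ((x - y) + ?t *\<^sub>R b) - k (x - y)) / ?t\<bar> * \<bar>g y\<bar> \<le> \<bar>C'\<bar> * \<bar>g y\<bar>"
            by (intro mult_right_mono) auto
          then show ?thesis using True by (simp add: q_def abs_mult)
        next
          case False
          then have y: "norm (x - y) > R + norm b" by (simp add: dist_norm)
          have "norm (?t *\<^sub>R b) \<le> norm b" using t by (simp add: mult_left_le_one_le)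
          then have "norm ((x - y) + ?t *\<^sub>R b) > R"
            using y norm_triangle_ineq4[of "(x - y) + ?t *\<^sub>R b" "?t *\<^sub>R b"] by simp
          moreover have "norm (x - y) > R" using y norm_ge_zero[of b] by linarith
          ultimately have "k ((x - y) + ?t *\<^sub>R b) = 0" "k (x - y) = 0" by (intro k(3); simp)+
          then show ?thesis by (simp add: q_def)
        qed
      qed
    qed
    moreover have "(LINT y|lborel. q n y) = (mollify k g (x + X (n + n0) *\<^sub>R b) - mollify k g x) / X (n + n0)" for n
    proof -
      have i: "integrable lborel (\<lambda>y. k (x' - y) * g y)" for x'
        by (rule mollify_integrable[OF g p fin _ k(2,3)]) measurable
      have "q n = (\<lambda>y. (k ((x + X (n + n0) *\<^sub>R b) - y) * g y - k (x - y) * g y) / X (n + n0))"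
        by (simp add: q_def fun_eq_iff left_diff_distrib add_diff_eq diff_add_eq)
      then have "(LINT y|lborel. q n y) = (LINT y|lborel. k ((x + X (n + n0) *\<^sub>R b) - y) * g y - k (x - y) * g y) / X (n + n0)"
        by simp
      also have "(LINT y|lborel. k ((x + X (n + n0) *\<^sub>R b) - y) * g y - k (x - y) * g y) =
          mollify k g (x + X (n + n0) *\<^sub>R b) - mollify k g x"
        unfolding mollify_def by (rule Bochner_Integration.integral_diff[OF i i])
      finally show ?thesis .
    qed
    ultimately have "(\<lambda>n. (mollify k g (x + X (n + n0) *\<^sub>R b) - mollify k g x) / X (n + n0)) \<longlonglongrightarrow> mollify k' g x"
      by (simp only:)
    from LIMSEQ_offset[OF this] show "(\<lambda>n. (mollify k g (x + X n *\<^sub>R b) - mollify k g x) / X n) \<longlonglongrightarrow> mollify k' g x" .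
  qed
  then show ?thesis by (simp add: has_field_derivative_iff)
qed

definition mollifier :: "('a::euclidean_space \<Rightarrow> real) \<Rightarrow> (('a \<Rightarrow> nat) \<Rightarrow> 'a \<Rightarrow> real) \<Rightarrow> 'a set \<Rightarrow> bool" where
  "mollifier \<eta> D K \<longleftrightarrow> smooth_partials UNIV \<eta> D \<and> (\<forall>x. \<eta> x \<ge> 0) \<and> (\<integral>\<^sup>+x. ennreal (\<eta> x) \<partial>lborel) = 1 \<and>
     compact K \<and> (\<forall>x. x \<notin> K \<longrightarrow> \<eta> x = 0)"

lemma mollifier_deriv_bound:
  assumes \<eta>: "mollifier \<eta> D K" and \<beta>: "\<beta> \<in> multi_indices"
  obtains C R where "K \<subseteq> cball 0 R" "\<And>x. x \<notin> cball 0 R \<Longrightarrow> D \<beta> x = 0" "\<And>x. \<bar>D \<beta> x\<bar> \<le> C"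
    "\<And>x. x \<notin> K \<Longrightarrow> D \<beta> x = 0"
proof -
  have sm: "smooth_partials UNIV \<eta> D" and K: "compact K" "\<And>x. x \<notin> K \<Longrightarrow> \<eta> x = 0"
    using \<eta> by (auto simp: mollifier_def)
  have 0: "D \<beta> x = 0" if "x \<notin> K" for x
    by (rule smooth_partials_eq_0[OF sm _ _ _ \<beta>, of "- K"]) (use that K in \<open>auto simp: open_Compl compact_imp_closed\<close>)
  have "bounded (D \<beta> ` K)"
    using smooth_partials_continuous_on[OF sm \<beta>] K(1)
    by (intro compact_imp_bounded compact_continuous_image) (auto intro: continuous_on_subset)
  then obtain C where "\<forall>y\<in>D \<beta> ` K. norm y \<le> C" unfolding bounded_iff by blast
  then have "\<bar>D \<beta> x\<bar> \<le> \<bar>C\<bar>" for x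
    using 0[of x] by (cases "x \<in> K") force+
  moreover obtain R where "K \<subseteq> cball 0 R"
    using bounded_subset_ballD[OF compact_imp_bounded[OF K(1)], of 0] ball_subset_cball by blast
  ultimately show thesis using 0 that by (metis subsetD)
qed

lemma mollify_smooth:
  assumes \<eta>: "mollifier \<eta> D K" and g: "g \<in> borel_measurable borel" and p: "p \<ge> 1" and fin: "lp_int p UNIV g < \<infinity>"
  shows "smooth_partials UNIV (mollify \<eta> g) (\<lambda>\<beta>. mollify (D \<beta>) g)"
    and "\<beta> \<in> multi_indices \<Longrightarrow> bounded (range (mollify (D \<beta>) g))"
proof -
  have sm: "smooth_partials UNIV \<eta> D" using \<eta> by (simp add: mollifier_def)
  have D0: "D (\<lambda>_. 0) = \<eta>" using smooth_partialsD(1)[OF sm] by auto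
  show "bounded (range (mollify (D \<beta>) g))" if \<beta>: "\<beta> \<in> multi_indices" for \<beta>
    by (rule mollifier_deriv_bound[OF \<eta> \<beta>])
       (rule mollify_bounded[OF g p fin smooth_partials_continuous_on[OF sm \<beta>]])
  show "smooth_partials UNIV (mollify \<eta> g) (\<lambda>\<beta>. mollify (D \<beta>) g)"
    unfolding smooth_partials_def
  proof (intro conjI ballI)
    fix \<beta> :: "'a \<Rightarrow> nat" assume \<beta>: "\<beta> \<in> multi_indices"
    obtain C R where C: "\<And>x. x \<notin> cball 0 R \<Longrightarrow> D \<beta> x = 0" "\<And>x. \<bar>D \<beta> x\<bar> \<le> C"
      using mollifier_deriv_bound[OF \<eta> \<beta>] by metis
    show "continuous_on UNIV (mollify (D \<beta>) g)"
      by (rule mollify_continuous[OF g p fin smooth_partials_continuous_on[OF sm \<beta>] C(2,1)])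
    fix b x :: 'a assume b: "b \<in> Basis"
    have \<beta>': "\<beta>(b := Suc (\<beta> b)) \<in> multi_indices" by (rule multi_index_upd_Suc[OF \<beta> b])
    obtain C' where C': "\<And>x. \<bar>D (\<beta>(b := Suc (\<beta> b))) x\<bar> \<le> C'"
      using mollifier_deriv_bound[OF \<eta> \<beta>'] by metis
    show "((\<lambda>t. mollify (D \<beta>) g (x + t *\<^sub>R b)) has_real_derivative mollify (D (\<beta>(b := Suc (\<beta> b)))) g x) (at 0)"
      by (rule mollify_deriv[OF g p fin smooth_partials_continuous_on[OF sm \<beta>] C(2,1)
            smooth_partials_continuous_on[OF sm \<beta>'] C' smooth_partialsD(2)[OF sm UNIV_I \<beta> b]])
  qed (simp add: D0)
qed

lemma mollifier_measurable: "mollifier \<eta> D K \<Longrightarrow> \<eta> \<in> borel_measurable borel"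
  by (auto simp: mollifier_def intro: borel_measurable_continuous_onI smooth_partials_continuous)

text \<open>\<eta> is a probability density, so this is Jensen's inequality; if the product is not
  integrable, the left-hand side is 0.\<close>

lemma mollify_pointwise:
  fixes k :: "'a::euclidean_space \<Rightarrow> real"
  assumes \<eta>: "mollifier \<eta> D K" and k[measurable]: "k \<in> borel_measurable borel" and p: "p \<ge> 1"
  shows "ennreal (\<bar>LINT y|lborel. \<eta> y * k y\<bar> powr p) \<le> (\<integral>\<^sup>+y. ennreal (\<eta> y) * ennreal (\<bar>k y\<bar> powr p) \<partial>lborel)"
proof -
  have nn: "\<eta> x \<ge> 0" for x using \<eta> by (simp add: mollifier_def)
  note [measurable] = mollifier_measurable[OF \<eta>]
  have "ennreal \<bar>LINT y|lborel. \<eta> y * k y\<bar> \<le> (\<integral>\<^sup>+y. ennreal (\<bar>k y\<bar> * \<eta> y) \<partial>lborel)"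
  proof (cases "integrable lborel (\<lambda>y. \<eta> y * k y)")
    case True
    from integral_norm_bound_ennreal[OF this] show ?thesis using nn by (simp add: abs_mult mult.commute)
  qed (simp add: not_integrable_integral_eq)
  then have "ennreal (\<bar>LINT y|lborel. \<eta> y * k y\<bar> powr p) \<le> (\<integral>\<^sup>+y. ennreal (\<bar>k y\<bar> powr p * \<eta> y) \<partial>lborel)"
    using \<eta> nn by (intro jensen_powr[OF p]) (auto simp: mollifier_def)
  also have "\<dots> = (\<integral>\<^sup>+y. ennreal (\<eta> y) * ennreal (\<bar>k y\<bar> powr p) \<partial>lborel)"
    using nn by (intro nn_integral_cong) (simp add: ennreal_mult mult.commute)
  finally show ?thesis .
qed

lemma integral_lborel_reflect:
  fixes f :: "'a::euclidean_space \<Rightarrow> real"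
  assumes [measurable]: "f \<in> borel_measurable borel"
  shows "(LINT y|lborel. f (x - y)) = (LINT y|lborel. f y)"
proof -
  have "(LINT y|lborel. f (x - y)) = (LINT y|distr lborel borel uminus. f (x + y))"
    by (subst integral_distr) auto
  also have "\<dots> = (LINT y|lborel. f (x + y))"
    using lborel_affine[of "-1" "0::'a"] by (simp add: density_1 cong: distr_cong)
  also have "\<dots> = (LINT y|lborel. f y)" by (rule integral_lborel_translate) simp
  finally show ?thesis .
qed

lemma mollify_eq:
  assumes \<eta>: "mollifier \<eta> D K" and [measurable]: "g \<in> borel_measurable borel"
  shows "mollify \<eta> g x = (LINT y|lborel. \<eta> y * g (x - y))"
proof -
  note [measurable] = mollifier_measurable[OF \<eta>]
  show ?thesis unfolding mollify_def
    using integral_lborel_reflect[of "\<lambda>y. \<eta> y * g (x - y)" x] by simp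
qed

text \<open>Tonelli after a pointwise Jensen bound. The kernel is kept general because both g (x -
  y) and g (x - y) - g x will be inserted.\<close>

lemma lp_int_average:
  fixes \<eta> :: "'a::euclidean_space \<Rightarrow> real"
  assumes \<eta>: "mollifier \<eta> D K" and S[measurable]: "S \<in> sets borel"
    and k[measurable]: "(\<lambda>(x, y). k x y) \<in> borel_measurable (borel \<Otimes>\<^sub>M borel)"
    and le: "\<And>x. ennreal (\<bar>f x\<bar> powr p) \<le> (\<integral>\<^sup>+y. ennreal (\<eta> y) * ennreal (\<bar>k x y\<bar> powr p) \<partial>lborel)"
  shows "lp_int p S f \<le> (\<integral>\<^sup>+y. ennreal (\<eta> y) * lp_int p S (\<lambda>x. k x y) \<partial>lborel)"
proof -
  note [measurable] = mollifier_measurable[OF \<eta>]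
  have kx[measurable]: "(\<lambda>y. k x y) \<in> borel_measurable borel" "(\<lambda>x. k x y) \<in> borel_measurable borel" for x y
    using measurable_compose[OF measurable_Pair1' k, of x] measurable_compose[OF measurable_Pair2' k, of y] by auto
  have "lp_int p S f \<le> (\<integral>\<^sup>+x. indicator S x * (\<integral>\<^sup>+y. ennreal (\<eta> y) * ennreal (\<bar>k x y\<bar> powr p) \<partial>lborel) \<partial>lborel)"
    unfolding lp_int_def by (intro nn_integral_mono mult_left_mono le) auto
  also have "\<dots> = (\<integral>\<^sup>+x. \<integral>\<^sup>+y. indicator S x * (ennreal (\<eta> y) * ennreal (\<bar>k x y\<bar> powr p)) \<partial>lborel \<partial>lborel)"
    by (subst nn_integral_cmult) auto
  also have "\<dots> = (\<integral>\<^sup>+y. \<integral>\<^sup>+x. indicator S x * (ennreal (\<eta> y) * ennreal (\<bar>k x y\<bar> powr p)) \<partial>lborel \<partial>lborel)"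
  proof (rule lborel_pair.Fubini'[symmetric])
    have "(\<lambda>z. k (fst z) (snd z)) \<in> borel_measurable (borel \<Otimes>\<^sub>M borel)" using k by (simp add: case_prod_beta')
    then have "(\<lambda>z. indicator S (fst z) * (ennreal (\<eta> (snd z)) * ennreal (\<bar>k (fst z) (snd z)\<bar> powr p))) \<in> borel_measurable (borel \<Otimes>\<^sub>M borel)"
      by measurable
    then have "(\<lambda>z. indicator S (fst z) * (ennreal (\<eta> (snd z)) * ennreal (\<bar>k (fst z) (snd z)\<bar> powr p))) \<in> borel_measurable (lborel \<Otimes>\<^sub>M lborel)"
      using measurable_cong_sets[OF sets_pair_measure_cong[OF sets_lborel sets_lborel] refl] by blast
    then show "(\<lambda>(x, y). indicator S x * (ennreal (\<eta> y) * ennreal (\<bar>k x y\<bar> powr p))) \<in> borel_measurable (lborel \<Otimes>\<^sub>M lborel)"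
      by (simp add: case_prod_beta')
  qed
  also have "\<dots> = (\<integral>\<^sup>+y. ennreal (\<eta> y) * lp_int p S (\<lambda>x. k x y) \<partial>lborel)"
    unfolding lp_int_def by (subst nn_integral_cmult[symmetric]) (auto simp: ac_simps)
  finally show ?thesis .
qed

lemma mollifier_average_le:
  assumes \<eta>: "mollifier \<eta> D K" and le: "\<And>y. y \<in> K \<Longrightarrow> h y \<le> Q"
  shows "(\<integral>\<^sup>+y. ennreal (\<eta> y) * h y \<partial>lborel) \<le> Q"
proof -
  note [measurable] = mollifier_measurable[OF \<eta>]
  have "(\<integral>\<^sup>+y. ennreal (\<eta> y) * h y \<partial>lborel) \<le> (\<integral>\<^sup>+y. ennreal (\<eta> y) * Q \<partial>lborel)"
  proof (rule nn_integral_mono)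
    fix y show "ennreal (\<eta> y) * h y \<le> ennreal (\<eta> y) * Q"
      using \<eta> le[of y] by (cases "y \<in> K") (auto simp: mollifier_def intro: mult_left_mono)
  qed
  also have "\<dots> = (\<integral>\<^sup>+y. ennreal (\<eta> y) \<partial>lborel) * Q" by (rule nn_integral_multc) simp
  also have "\<dots> = Q" using \<eta> by (simp add: mollifier_def)
  finally show ?thesis .
qed

lemma lp_int_mollify_le:
  assumes \<eta>: "mollifier \<eta> D K" and g[measurable]: "g \<in> borel_measurable borel" and p: "p \<ge> 1"
    and S[measurable]: "S \<in> sets borel" and le: "\<And>y. y \<in> K \<Longrightarrow> lp_int p S (\<lambda>x. g (x - y)) \<le> Q"
  shows "lp_int p S (mollify \<eta> g) \<le> Q"
proof -
  have "lp_int p S (mollify \<eta> g) \<le> (\<integral>\<^sup>+y. ennreal (\<eta> y) * lp_int p S (\<lambda>x. g (x - y)) \<partial>lborel)"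
    unfolding mollify_eq[OF \<eta> g, abs_def]
    by (rule lp_int_average[OF \<eta> S _ mollify_pointwise[OF \<eta> _ p]]) measurable
  also have "\<dots> \<le> Q" by (rule mollifier_average_le[OF \<eta> le])
  finally show ?thesis .
qed

text \<open>As \<eta> has integral 1, the error is an average of the translation errors g (x - y) -
  g x over y in K.\<close>

lemma lp_int_mollify_diff_le:
  assumes \<eta>: "mollifier \<eta> D K" and g[measurable]: "g \<in> borel_measurable borel" and p: "p \<ge> 1" and fin: "lp_int p UNIV g < \<infinity>"
    and le: "\<And>y. y \<in> K \<Longrightarrow> lp_int p UNIV (\<lambda>x. g (x - y) - g x) \<le> Q"
  shows "lp_int p UNIV (\<lambda>x. mollify \<eta> g x - g x) \<le> Q"
proof -
  note [measurable] = mollifier_measurable[OF \<eta>]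
  have sm: "smooth_partials UNIV \<eta> D" using \<eta> by (simp add: mollifier_def)
  have D0: "D (\<lambda>_. 0) = \<eta>" using smooth_partialsD(1)[OF sm] by auto
  have nn: "\<eta> x \<ge> 0" for x using \<eta> by (simp add: mollifier_def)
  obtain C R where C: "\<And>x. x \<notin> cball 0 R \<Longrightarrow> \<eta> x = 0" "\<And>x. \<bar>\<eta> x\<bar> \<le> C"
    using mollifier_deriv_bound[OF \<eta> zero_multi_index] unfolding D0 by metis
  have i\<eta>: "integrable lborel \<eta>"
    using \<eta> nn by (intro integrableI_bounded) (auto simp: mollifier_def)
  have I1: "(LINT y|lborel. \<eta> y) = 1"
    using \<eta> nn by (subst integral_eq_nn_integral) (auto simp: mollifier_def)
  have i1: "integrable lborel (\<lambda>y. \<eta> y * g (x - y))" for x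
  proof -
    have "integrable lborel (\<lambda>y. \<eta> (x - y) * g y)" by (rule mollify_integrable[OF g p fin _ C(2,1)]) measurable
    then have "integrable (distr lborel borel (\<lambda>y. x - y)) (\<lambda>y. \<eta> y * g (x - y))"
      by (subst integrable_distr_eq) auto
    moreover have "distr lborel borel (\<lambda>y. x - y) = lborel"
    proof (rule measure_eqI)
      fix A :: "'a set" assume "A \<in> sets (distr lborel borel (\<lambda>y. x - y))"
      then have A[measurable]: "A \<in> sets borel" by simp
      have "emeasure (distr lborel borel (\<lambda>y. x - y)) A = (\<integral>\<^sup>+y. indicator A (x - y) \<partial>lborel)"
        by (subst nn_integral_indicator[symmetric], simp, subst nn_integral_distr) auto
      also have "\<dots> = emeasure lborel A" by (subst nn_integral_reflect) auto
      finally show "emeasure (distr lborel borel (\<lambda>y. x - y)) A = emeasure lborel A" .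
    qed simp
    ultimately show ?thesis by simp
  qed
  have eq: "mollify \<eta> g x - g x = (LINT y|lborel. \<eta> y * (g (x - y) - g x))" for x
  proof -
    have "(LINT y|lborel. \<eta> y * (g (x - y) - g x)) = (LINT y|lborel. \<eta> y * g (x - y) - \<eta> y * g x)"
      by (simp add: right_diff_distrib)
    also have "\<dots> = (LINT y|lborel. \<eta> y * g (x - y)) - (LINT y|lborel. \<eta> y * g x)"
      by (intro Bochner_Integration.integral_diff i1 integrable_mult_left i\<eta>)
    also have "(LINT y|lborel. \<eta> y * g x) = g x" using I1 by simp
    finally show ?thesis by (simp add: mollify_eq[OF \<eta> g])
  qed
  have "lp_int p UNIV (\<lambda>x. mollify \<eta> g x - g x) \<le> (\<integral>\<^sup>+y. ennreal (\<eta> y) * lp_int p UNIV (\<lambda>x. g (x - y) - g x) \<partial>lborel)"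
    unfolding eq by (rule lp_int_average[OF \<eta> _ _ mollify_pointwise[OF \<eta> _ p]]) measurable
  also have "\<dots> \<le> Q" by (rule mollifier_average_le[OF \<eta> le])
  finally show ?thesis .
qed

lemma smooth_partials_reflect:
  assumes sm: "smooth_partials UNIV \<eta> D"
  shows "smooth_partials UNIV (\<lambda>z. \<eta> (x - z)) (\<lambda>\<gamma> z. (- 1) ^ mi_order \<gamma> * D \<gamma> (x - z))"
  unfolding smooth_partials_def
proof (intro conjI ballI)
  fix \<gamma> :: "'a \<Rightarrow> nat" assume \<gamma>: "\<gamma> \<in> multi_indices"
  show "continuous_on UNIV (\<lambda>z. (- 1) ^ mi_order \<gamma> * D \<gamma> (x - z))"
    by (intro continuous_intros continuous_on_compose2[OF smooth_partials_continuous_on[OF sm \<gamma>]]) auto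
  fix b z :: 'a assume b: "b \<in> Basis"
  have "((\<lambda>t. D \<gamma> ((x - z) + t *\<^sub>R b)) has_real_derivative D (\<gamma>(b := Suc (\<gamma> b))) (x - z)) (at (- 0))"
    using smooth_partialsD(2)[OF sm UNIV_I \<gamma> b, of "x - z"] by simp
  then have "((\<lambda>t. D \<gamma> ((x - z) + (- t) *\<^sub>R b)) has_real_derivative D (\<gamma>(b := Suc (\<gamma> b))) (x - z) * (- 1)) (at 0)"
    by (rule DERIV_chain2[where f = "\<lambda>t. D \<gamma> ((x - z) + t *\<^sub>R b)"]) (auto intro!: derivative_eq_intros)
  then have "((\<lambda>t. (- 1) ^ mi_order \<gamma> * D \<gamma> ((x - z) + (- t) *\<^sub>R b)) has_real_derivative
      (- 1) ^ mi_order \<gamma> * (D (\<gamma>(b := Suc (\<gamma> b))) (x - z) * (- 1))) (at 0)"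
    by (rule DERIV_cmult)
  moreover have "x - z + - t *\<^sub>R b = x - (z + t *\<^sub>R b)" for t by simp
  ultimately show "((\<lambda>t. (- 1) ^ mi_order \<gamma> * D \<gamma> (x - (z + t *\<^sub>R b))) has_real_derivative
      (- 1) ^ mi_order (\<gamma>(b := Suc (\<gamma> b))) * D (\<gamma>(b := Suc (\<gamma> b))) (x - z)) (at 0)"
    unfolding mi_order_upd_Suc[OF b] by (simp add: diff_diff_eq)
qed (simp add: smooth_partialsD(1)[OF sm])

text \<open>Test functions \<open>z \<mapsto> \<eta> (x - z)\<close> supported in \<open>\<Omega>\<close> move the derivative onto \<open>f\<close>.\<close>

lemma mollify_weak_deriv:
  fixes f g :: "'a::euclidean_space \<Rightarrow> real"
  assumes \<eta>: "mollifier \<eta> D K" and w: "has_weak_deriv \<Omega> \<beta> f g" and \<beta>: "\<beta> \<in> multi_indices"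
    and f0: "f0 \<in> borel_measurable borel" "AE z in lebesgue. f0 z = indicator \<Omega> z * f z"
    and g0: "g0 \<in> borel_measurable borel" "AE z in lebesgue. g0 z = indicator \<Omega> z * g z"
    and x: "\<And>y. y \<in> K \<Longrightarrow> x - y \<in> \<Omega>"
  shows "mollify (D \<beta>) f0 x = mollify \<eta> g0 x"
proof -
  have sm: "smooth_partials UNIV \<eta> D" and K: "compact K" "\<And>x. x \<notin> K \<Longrightarrow> \<eta> x = 0"
    using \<eta> by (auto simp: mollifier_def)
  let ?h = "\<lambda>z. \<eta> (x - z)"
  let ?L = "(\<lambda>y. x - y) ` K"
  have L: "compact ?L" using K(1) by (intro compact_continuous_image continuous_intros)
  have "{z. ?h z \<noteq> 0} \<subseteq> ?L"
  proof
    fix z assume "z \<in> {z. ?h z \<noteq> 0}"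
    then have "x - z \<in> K" using K(2) by auto
    then show "z \<in> ?L" by (intro image_eqI[of _ _ "x - z"]) auto
  qed
  then have cl: "closure {z. ?h z \<noteq> 0} \<subseteq> ?L" by (intro closure_minimal compact_imp_closed[OF L])
  then have "compact (closure {z. ?h z \<noteq> 0})"
    using compact_Int_closed[OF L closed_closure[of "{z. ?h z \<noteq> 0}"]] by (simp add: Int_absorb1)
  from has_weak_derivD[OF w smooth_partials_reflect[OF sm, of x] this] cl x
  have "(LINT z:\<Omega>|lebesgue. f z * ((- 1) ^ mi_order \<beta> * D \<beta> (x - z))) =
      (- 1) ^ mi_order \<beta> * (LINT z:\<Omega>|lebesgue. g z * ?h z)" by auto
  also have "(LINT z:\<Omega>|lebesgue. f z * ((- 1) ^ mi_order \<beta> * D \<beta> (x - z))) =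
      (- 1) ^ mi_order \<beta> * (LINT z:\<Omega>|lebesgue. f z * D \<beta> (x - z))"
    by (subst set_integral_mult_right[symmetric]) (simp add: mult.left_commute)
  finally have eq: "(LINT z:\<Omega>|lebesgue. f z * D \<beta> (x - z)) = (LINT z:\<Omega>|lebesgue. g z * ?h z)" by simp
  \<comment> \<open>Functions on \<Omega> are replaced by Borel representatives extended by zero,
    for which \<open>mollify\<close> integrates over the whole space.\<close>
  have conv: "(LINT z:\<Omega>|lebesgue. q z * k (x - z)) = mollify k q0 x"
    if q0: "q0 \<in> borel_measurable borel" "AE z in lebesgue. q0 z = indicator \<Omega> z * q z"
      and k: "k \<in> borel_measurable borel" for q q0 k :: "'a \<Rightarrow> real"
  proof -
    note [measurable] = q0(1) k
    have m: "(\<lambda>z. k (x - z) * q0 z) \<in> borel_measurable lborel" by measurable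
    have ae: "AE z in lebesgue. k (x - z) * q0 z = indicator \<Omega> z *\<^sub>R (q z * k (x - z))"
      using q0(2) by eventually_elim auto
    have m': "(\<lambda>z. k (x - z) * q0 z) \<in> borel_measurable lebesgue" using m by (rule measurable_completion)
    have "(LINT z:\<Omega>|lebesgue. q z * k (x - z)) = (LINT z|lebesgue. k (x - z) * q0 z)"
      unfolding set_lebesgue_integral_def
      by (rule integral_cong_AE[symmetric, OF m' borel_measurable_AE[OF m' ae] ae])
    also have "\<dots> = mollify k q0 x" unfolding mollify_def by (rule integral_completion[OF m])
    finally show ?thesis .
  qed
  have "D \<beta> \<in> borel_measurable borel"
    by (rule borel_measurable_continuous_onI[OF smooth_partials_continuous_on[OF sm \<beta>]])
  from conv[OF f0 this] conv[OF g0 mollifier_measurable[OF \<eta>]] eq show ?thesis by simp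
qed

section \<open>Lebesgue and Sobolev spaces, and smooth approximation inside the cone\<close>

lemma Lp_norm_eq: "Lp_norm p S f = ennreal_powr (lp_int p S f) (1 / p)"
  by (simp add: Lp_norm_def lp_int_def nn_integral_completion mult.commute)

lemma ennreal_powr_less_top_iff: "ennreal_powr x a < \<infinity> \<longleftrightarrow> x < \<infinity>"
  by (auto simp: ennreal_powr_def less_top[symmetric])

lemma lp_int_AE_cong:
  assumes "AE x in lebesgue. x \<in> S \<longrightarrow> f x = g x"
  shows "lp_int p S f = lp_int p S g"
proof -
  have "(\<integral>\<^sup>+x. indicator S x * ennreal (\<bar>f x\<bar> powr p) \<partial>lebesgue) = (\<integral>\<^sup>+x. indicator S x * ennreal (\<bar>g x\<bar> powr p) \<partial>lebesgue)"
    by (rule nn_integral_cong_AE) (use assms in \<open>eventually_elim, auto simp: indicator_def\<close>)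
  then show ?thesis by (simp add: lp_int_def nn_integral_completion)
qed

lemma lp_int_mono_set: "S \<subseteq> S' \<Longrightarrow> lp_int p S f \<le> lp_int p S' f"
  unfolding lp_int_def by (intro nn_integral_mono) (auto simp: indicator_def)

text \<open>Weak derivatives are only Lebesgue measurable; Borel representatives reduce their sum to
  \<open>lp_int_add\<close>.\<close>

lemma lp_int_add_lebesgue:
  fixes f g :: "'a::euclidean_space \<Rightarrow> real"
  assumes f: "f \<in> borel_measurable lebesgue" and g: "g \<in> borel_measurable lebesgue" and S: "S \<in> sets borel" and p: "p \<ge> 0"
  shows "lp_int p S (\<lambda>x. f x + g x) \<le> ennreal (2 powr p) * (lp_int p S f + lp_int p S g)"
proof -
  obtain f' where f': "f' \<in> borel_measurable lborel" "AE x in lborel. f x = f' x"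
    using completion_ex_borel_measurable_real[OF f] by blast
  obtain g' where g': "g' \<in> borel_measurable lborel" "AE x in lborel. g x = g' x"
    using completion_ex_borel_measurable_real[OF g] by blast
  have ae: "AE x in lebesgue. f x = f' x" "AE x in lebesgue. g x = g' x"
    using f'(2) g'(2) by (auto intro: AE_completion)
  have "lp_int p S f = lp_int p S f'"
    by (rule lp_int_AE_cong) (use ae(1) in \<open>eventually_elim, simp\<close>)
  moreover have "lp_int p S g = lp_int p S g'"
    by (rule lp_int_AE_cong) (use ae(2) in \<open>eventually_elim, simp\<close>)
  moreover have "lp_int p S (\<lambda>x. f x + g x) = lp_int p S (\<lambda>x. f' x + g' x)"
    by (rule lp_int_AE_cong) (use ae in \<open>eventually_elim, simp\<close>)
  moreover have "lp_int p S (\<lambda>x. f' x + g' x) \<le> ennreal (2 powr p) * (lp_int p S f' + lp_int p S g')"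
    by (rule lp_int_add) (use f' g' S p in simp_all)
  ultimately show ?thesis by simp
qed

lemma Lp_space_iff:
  "f \<in> Lp_space p S \<longleftrightarrow> f \<in> borel_measurable (lebesgue_on S) \<and> lp_int p S f < \<infinity>"
  unfolding Lp_space_def Lp_norm_eq by (simp add: ennreal_powr_less_top_iff[unfolded infinity_ennreal_def])

lemma Lp_space_borelI:
  fixes f :: "'a::euclidean_space \<Rightarrow> real"
  assumes "f \<in> borel_measurable borel" "lp_int p S f < \<infinity>"
  shows "f \<in> Lp_space p S"
  using assms by (auto simp: Lp_space_iff measurable_completion intro!: measurable_restrict_space1)

lemma weak_deriv_has_weak_deriv: "has_weak_deriv S \<alpha> f g \<Longrightarrow> has_weak_deriv S \<alpha> f (weak_deriv S \<alpha> f)"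
  unfolding weak_deriv_def by (rule someI[of "has_weak_deriv S \<alpha> f"])

text \<open>The choice made by \<open>weak_deriv\<close> is not tied to the integrable function from
  the definition of the Sobolev space; uniqueness identifies the two almost everywhere and transfers
  measurability and finiteness.\<close>

lemma sobolev_weak_deriv:
  fixes f :: "'a::euclidean_space \<Rightarrow> real"
  assumes f: "f \<in> sobolev l p S" and S: "open S" and \<alpha>: "\<alpha> \<in> multi_indices" "mi_order \<alpha> \<le> l"
  shows "has_weak_deriv S \<alpha> f (weak_deriv S \<alpha> f)" "lp_int p S (weak_deriv S \<alpha> f) < \<infinity>"
    "(\<lambda>x. indicator S x * weak_deriv S \<alpha> f x) \<in> borel_measurable lebesgue"
proof -
  obtain g where g: "g \<in> Lp_space p S" "has_weak_deriv S \<alpha> f g"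
    using f \<alpha> by (auto simp: sobolev_def)
  show 1: "has_weak_deriv S \<alpha> f (weak_deriv S \<alpha> f)" by (rule weak_deriv_has_weak_deriv[OF g(2)])
  have ae: "AE x in lebesgue. x \<in> S \<longrightarrow> g x = weak_deriv S \<alpha> f x" by (rule has_weak_deriv_unique[OF S g(2) 1])
  show "lp_int p S (weak_deriv S \<alpha> f) < \<infinity>"
    using g(1) lp_int_AE_cong[OF ae] by (simp add: Lp_space_iff)
  have "(\<lambda>x. indicator S x *\<^sub>R g x) \<in> borel_measurable lebesgue"
    using g(1) S by (subst borel_measurable_restrict_space_iff[symmetric]) (auto simp: Lp_space_iff)
  moreover have "AE x in lebesgue. indicator S x *\<^sub>R g x = indicator S x * weak_deriv S \<alpha> f x"
    using ae by eventually_elim (auto simp: indicator_def)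
  ultimately show "(\<lambda>x. indicator S x * weak_deriv S \<alpha> f x) \<in> borel_measurable lebesgue"
    by (rule borel_measurable_AE)
qed

lemma smooth_partials_subset:
  fixes S :: "'a::euclidean_space set"
  assumes "smooth_partials S f D" "U \<subseteq> S" shows "smooth_partials U f D"
  unfolding smooth_partials_def
proof (intro conjI ballI)
  fix \<alpha> :: "'a \<Rightarrow> nat" assume \<alpha>: "\<alpha> \<in> multi_indices"
  show "continuous_on U (D \<alpha>)"
    using smooth_partials_continuous_on[OF assms(1) \<alpha>] assms(2) by (rule continuous_on_subset)
  fix b x :: 'a assume "b \<in> Basis" "x \<in> U"
  then show "((\<lambda>t. D \<alpha> (x + t *\<^sub>R b)) has_real_derivative D (\<alpha>(b := Suc (\<alpha> b))) x) (at 0)"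
    using assms(2) by (intro smooth_partialsD(2)[OF assms(1) _ \<alpha>]) auto
qed (use assms smooth_partialsD(1)[OF assms(1)] in blast)

lemma mollifier_exists:
  fixes a b :: "'a::euclidean_space"
  assumes "box a b \<noteq> {}"
  shows "\<exists>\<eta> D. mollifier \<eta> D (cbox a b)"
proof -
  obtain D where D: "smooth_partials UNIV (box_bump a b 1) D" using box_bump_smooth by blast
  define I where "I = (\<integral>\<^sup>+x. ennreal (box_bump a b 1 x) \<partial>lborel)"
  have m[measurable]: "box_bump a b 1 \<in> borel_measurable borel"
    by (rule borel_measurable_continuous_onI[OF smooth_partials_continuous[OF D]])
  have "I \<noteq> 0"
  proof
    assume "I = 0"
    then have "AE x in lborel. ennreal (box_bump a b 1 x) = 0"
      unfolding I_def using m by (subst (asm) nn_integral_0_iff_AE) (simp_all del: One_nat_def)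
    then have "AE x in lborel. x \<notin> box a b"
      by eventually_elim (use box_bump_pos[of _ a b 1] in \<open>force simp: ennreal_eq_0_iff\<close>)
    then have "emeasure lborel (box a b) = 0" by (subst (asm) AE_iff_measurable[OF _ refl]) auto
    then show False using emeasure_lborel_box_eq[of a b] assms
      by (auto simp: box_ne_empty prod_ennreal[symmetric] inner_diff_left split: if_splits intro!: prod_pos)
  qed
  have "I \<le> (\<integral>\<^sup>+x. indicator (cbox a b) x \<partial>lborel)"
    unfolding I_def
  proof (rule nn_integral_mono)
    fix x
    show "ennreal (box_bump a b 1 x) \<le> indicator (cbox a b) x"
    proof (cases "x \<in> box a b")
      case True
      then have "x \<in> cbox a b" using box_subset_cbox by blast
      then show ?thesis using box_bump_le_1[of a b 1 x] by simp
    qed (simp add: box_bump_eq_0)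
  qed
  also have "\<dots> < \<infinity>" by (simp add: emeasure_lborel_cbox_eq)
  finally have "I < \<infinity>" .
  then obtain i where i: "I = ennreal i" "i > 0"
    using \<open>I \<noteq> 0\<close> by (cases I) (auto simp: less_le)
  have sm: "smooth_partials UNIV (\<lambda>x. box_bump a b 1 x / i) (\<lambda>\<beta> x. D \<beta> x / i)"
    using D i(2) unfolding smooth_partials_def
    by (auto intro!: continuous_intros DERIV_cdivide simp del: fun_upd_apply)
  have "(\<integral>\<^sup>+x. ennreal (box_bump a b 1 x / i) \<partial>lborel) = (\<integral>\<^sup>+x. ennreal (1 / i) * ennreal (box_bump a b 1 x) \<partial>lborel)"
    using i(2) box_bump_nonneg[of a b 1] by (intro nn_integral_cong) (simp add: ennreal_mult[symmetric])
  also have "\<dots> = ennreal (1 / i) * I" unfolding I_def by (rule nn_integral_cmult) measurable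
  also have "\<dots> = 1" using i by (simp add: ennreal_mult[symmetric])
  finally have "mollifier (\<lambda>x. box_bump a b 1 x / i) (\<lambda>\<beta> x. D \<beta> x / i) (cbox a b)"
    using sm i(2) box_bump_nonneg[of a b 1] box_bump_eq_0[of _ a b 1] box_subset_cbox[of a b]
    by (auto simp: mollifier_def)
  then show ?thesis by blast
qed

lemma closure_special_domain:
  fixes \<psi> :: "real^'m \<Rightarrow> real"
  assumes \<psi>: "continuous_on UNIV \<psi>"
  shows "closure (special_domain \<psi>) = {(x, y). \<psi> x \<le> y}"
proof (intro equalityI subsetI)
  have eq: "{(x, y). \<psi> x \<le> y} = - below_graph \<psi>" by (auto simp: below_graph_def)
  have "closed {(x, y). \<psi> x \<le> y}" unfolding eq by (rule closed_Compl[OF open_below_graph[OF \<psi>]])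
  then show "z \<in> closure (special_domain \<psi>) \<Longrightarrow> z \<in> {(x, y). \<psi> x \<le> y}" for z
    using closure_minimal[of "special_domain \<psi>" "{(x, y). \<psi> x \<le> y}"] by (force simp: special_domain_def)
  fix z assume "z \<in> {(x, y). \<psi> x \<le> y}"
  then obtain x y where z: "z = (x, y)" "\<psi> x \<le> y" by auto
  have "(\<lambda>n. (x, y + inverse (real (Suc n)))) \<longlonglongrightarrow> (x, y + 0)"
    by (intro tendsto_intros LIMSEQ_inverse_real_of_nat)
  moreover have "(x, y + inverse (real (Suc n))) \<in> special_domain \<psi>" for n
    using z(2) by (simp add: special_domain_def add_strict_increasing2 le_less_trans[OF z(2)])
  ultimately show "z \<in> closure (special_domain \<psi>)" unfolding closure_sequential z
    by (intro exI[of _ "\<lambda>n. (x, y + inverse (real (Suc n)))"]) (simp del: of_nat_Suc)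
qed

text \<open>The box lies in the downward cone of the Lipschitz bound, near its vertex. Subtracting
  such a y raises a point by more than \<psi> can rise over the horizontal displacement, so the
  closed domain moves into the open one.\<close>

lemma cone_box:
  fixes \<psi> :: "real^'m \<Rightarrow> real" and M :: real
  assumes \<psi>: "M-lipschitz_on UNIV \<psi>" and \<rho>: "\<rho> > 0"
  shows "\<exists>a b. box a b \<noteq> {} \<and> (\<forall>y\<in>cbox a b. norm y < \<rho> \<and>
    (\<forall>x\<in>closure (special_domain \<psi>). x - y \<in> special_domain \<psi>))"
proof -
  have M: "M \<ge> 0" using \<psi> by (rule lipschitz_on_nonneg)
  define m where "m = real CARD('m)"
  have m: "m \<ge> 1" unfolding m_def by (simp add: Suc_leI)
  \<comment> \<open>In the box the horizontal part has norm at most m \<epsilon>, so \<psi> rises by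
    at most M m \<epsilon>, which is less than A \<epsilon>, the least vertical descent.\<close>
  define A where "A = M * m + 1"
  have A: "A \<ge> 1" using M m by (simp add: A_def)
  \<comment> \<open>Norms in the box are at most (m + 2 A) \<epsilon>; the extra 1 in the
    denominator makes the comparison with \<rho> strict.\<close>
  define \<epsilon> where "\<epsilon> = \<rho> / (m + 2 * A + 1)"
  have \<epsilon>: "\<epsilon> > 0" "(m + 2 * A) * \<epsilon> < \<rho>" using \<rho> m A by (auto simp: \<epsilon>_def field_simps)
  define a :: "(real^'m) \<times> real" where "a = ((\<chi> i. - \<epsilon>), - (2 * A * \<epsilon>))"
  define b :: "(real^'m) \<times> real" where "b = ((\<chi> i. \<epsilon>), - (A * \<epsilon>))"
  have "((\<chi> i. 0), - (3 / 2 * A * \<epsilon>)) \<in> box a b"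
    using \<epsilon>(1) A by (auto simp: a_def b_def mem_box Basis_prod_def Basis_vec_def inner_axis)
  moreover have "norm w < \<rho> \<and> (\<forall>z\<in>closure (special_domain \<psi>). z - w \<in> special_domain \<psi>)" if w: "w \<in> cbox a b" for w
  proof -
    obtain w1 w2 where w12: "w = (w1, w2)" by (cases w)
    have w1: "\<bar>w1 $ i\<bar> \<le> \<epsilon>" for i
      using w by (auto simp: w12 a_def b_def cbox_Pair_eq mem_box_cart abs_le_iff minus_le_iff)
    have w2: "- (2 * A * \<epsilon>) \<le> w2" "w2 \<le> - (A * \<epsilon>)"
      using w by (auto simp: w12 a_def b_def cbox_Pair_eq)
    have "norm w1 \<le> (\<Sum>i\<in>UNIV. \<bar>w1 $ i\<bar>)" by (rule norm_le_l1_cart)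
    also have "\<dots> \<le> (\<Sum>i\<in>(UNIV :: 'm set). \<epsilon>)" by (intro sum_mono w1)
    finally have nw1: "norm w1 \<le> m * \<epsilon>" by (simp add: m_def)
    have "norm w \<le> norm w1 + norm w2" unfolding w12 by (rule norm_Pair_le)
    also have "\<dots> \<le> m * \<epsilon> + 2 * A * \<epsilon>" using nw1 w2 \<epsilon>(1) A
      by (intro add_mono) (auto simp: abs_le_iff intro: order_trans[of _ "0::real"] order_trans[OF w2(2)])
    also have "\<dots> < \<rho>" using \<epsilon>(2) by (simp add: algebra_simps)
    finally have "norm w < \<rho>" .
    moreover have "z - w \<in> special_domain \<psi>" if z': "z \<in> closure (special_domain \<psi>)" for z
    proof -
      obtain x y where z: "z = (x, y)" "\<psi> x \<le> y"
        using z' unfolding closure_special_domain[OF lipschitz_UNIV_continuous[OF \<psi>]] by auto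
      have "\<psi> (x - w1) - \<psi> x \<le> M * norm w1"
        using lipschitz_onD[OF \<psi>, of "x - w1" x] by (simp add: dist_norm)
      also have "\<dots> \<le> M * (m * \<epsilon>)" using nw1 M by (rule mult_left_mono)
      also have "\<dots> < A * \<epsilon>" using \<epsilon>(1) by (simp add: A_def algebra_simps)
      finally have "\<psi> (x - w1) < y - w2" using z(2) w2 by linarith
      then show ?thesis by (simp add: z w12 special_domain_def)
    qed
    ultimately show ?thesis by blast
  qed
  ultimately show ?thesis by blast
qed

text \<open>One mollifier, with a box so small that all translation errors up to order l are below
  e, serves every \<beta>. Bounds on balls survive for all r and Q simultaneously, because
  translation by y in the box moves the part of the domain in a ball around z into the part in the
  ball around z - y, and z - y is again in the domain.\<close>

lemma sobolev_approx:
  fixes \<psi> :: "real^'m \<Rightarrow> real" and M p :: real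
  assumes \<psi>: "M-lipschitz_on UNIV \<psi>" and p: "p \<ge> 1" and f: "f \<in> sobolev l p (special_domain \<psi>)" and e: "e > 0"
  shows "\<exists>h H. h \<in> Cb_infty_closure (special_domain \<psi>) \<inter> sobolev l p (special_domain \<psi>) \<and>
    smooth_bounded (special_domain \<psi>) H \<and> smooth_partials (special_domain \<psi>) h H \<and>
    (\<forall>\<beta>\<in>multi_indices. mi_order \<beta> \<le> l \<longrightarrow>
      lp_int p (special_domain \<psi>) (\<lambda>x. H \<beta> x - weak_deriv (special_domain \<psi>) \<beta> f x) \<le> ennreal e \<and>
      (\<forall>r Q. (\<forall>z\<in>special_domain \<psi>. lp_int p (ball z r \<inter> special_domain \<psi>) (weak_deriv (special_domain \<psi>) \<beta> f) \<le> Q) \<longrightarrow>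
        (\<forall>z\<in>special_domain \<psi>. lp_int p (ball z r \<inter> special_domain \<psi>) (H \<beta>) \<le> Q)))"
proof -
  let ?\<Omega> = "special_domain \<psi>" and ?I = "{\<beta> \<in> multi_indices. mi_order \<beta> \<le> l} :: ((real^'m) \<times> real \<Rightarrow> nat) set"
  define w where "w \<beta> = weak_deriv ?\<Omega> \<beta> f" for \<beta>
  have \<Omega>: "open ?\<Omega>" by (rule open_special_domain[OF lipschitz_UNIV_continuous[OF \<psi>]])
  then have \<Omega>b[measurable]: "?\<Omega> \<in> sets borel" by simp
  have w: "has_weak_deriv ?\<Omega> \<beta> f (w \<beta>)" "lp_int p ?\<Omega> (w \<beta>) < \<infinity>" "(\<lambda>x. indicator ?\<Omega> x * w \<beta> x) \<in> borel_measurable lebesgue"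
    if "\<beta> \<in> ?I" for \<beta> using sobolev_weak_deriv[OF f \<Omega>, of \<beta>] that by (auto simp: w_def)
  \<comment> \<open>Borel representatives of the weak derivatives, zero outside the domain, which
    can be translated and convolved on the whole space.\<close>
  have "\<forall>\<beta>\<in>?I. \<exists>g. g \<in> borel_measurable borel \<and> (AE x in lebesgue. g x = indicator ?\<Omega> x * w \<beta> x) \<and> (\<forall>x. x \<notin> ?\<Omega> \<longrightarrow> g x = 0)"
  proof
    fix \<beta> assume \<beta>: "\<beta> \<in> ?I"
    obtain g where g: "g \<in> borel_measurable lborel" "AE x in lborel. indicator ?\<Omega> x * w \<beta> x = g x"
      using completion_ex_borel_measurable_real[OF w(3)[OF \<beta>]] by blast
    have "AE x in lebesgue. indicator ?\<Omega> x * g x = indicator ?\<Omega> x * w \<beta> x"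
      using AE_completion[OF g(2)] by eventually_elim (auto simp: indicator_def)
    moreover have "(\<lambda>x. indicator ?\<Omega> x * g x) \<in> borel_measurable borel"
      using g(1) by (intro borel_measurable_times borel_measurable_indicator) auto
    ultimately show "\<exists>g. g \<in> borel_measurable borel \<and> (AE x in lebesgue. g x = indicator ?\<Omega> x * w \<beta> x) \<and> (\<forall>x. x \<notin> ?\<Omega> \<longrightarrow> g x = 0)"
      by (intro exI[of _ "\<lambda>x. indicator ?\<Omega> x * g x"]) simp
  qed
  from bchoice[OF this] obtain g where g: "\<And>\<beta>. \<beta> \<in> ?I \<Longrightarrow> g \<beta> \<in> borel_measurable borel"
    "\<And>\<beta>. \<beta> \<in> ?I \<Longrightarrow> AE x in lebesgue. g \<beta> x = indicator ?\<Omega> x * w \<beta> x" "\<And>\<beta> x. \<beta> \<in> ?I \<Longrightarrow> x \<notin> ?\<Omega> \<Longrightarrow> g \<beta> x = 0"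
    by blast
  have gw: "AE x in lebesgue. x \<in> ?\<Omega> \<longrightarrow> g \<beta> x = w \<beta> x" if "\<beta> \<in> ?I" for \<beta>
    using g(2)[OF that] by eventually_elim auto
  have gfin: "lp_int p UNIV (g \<beta>) < \<infinity>" if "\<beta> \<in> ?I" for \<beta>
  proof -
    have "lp_int p UNIV (g \<beta>) = lp_int p ?\<Omega> (g \<beta>)"
      unfolding lp_int_def using g(3)[OF that] p by (intro nn_integral_cong) (auto simp: indicator_def)
    also have "\<dots> = lp_int p ?\<Omega> (w \<beta>)" by (rule lp_int_AE_cong[OF gw[OF that]])
    finally show ?thesis using w(2)[OF that] by simp
  qed
  have 0: "(\<lambda>_. 0) \<in> ?I" by simp
  define f0 where "f0 = g (\<lambda>_. 0)"
  have f0m: "f0 \<in> borel_measurable borel" and f0fin: "lp_int p UNIV f0 < \<infinity>"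
    using g(1)[OF 0] gfin[OF 0] by (auto simp: f0_def)
  \<comment> \<open>The weak derivative of order 0 is a choice as well; uniqueness makes it
    f.\<close>
  have f0: "AE x in lebesgue. f0 x = indicator ?\<Omega> x * f x"
  proof -
    have "has_weak_deriv ?\<Omega> (\<lambda>_. 0) f f" using w(1)[OF 0] by (intro has_weak_deriv_0) (simp add: has_weak_deriv_def)
    from g(2)[OF 0] has_weak_deriv_unique[OF \<Omega> w(1)[OF 0] this] show ?thesis
      unfolding f0_def by eventually_elim (auto simp: indicator_def)
  qed
  have "\<forall>\<beta>\<in>?I. \<exists>d>0. \<forall>h. norm h < d \<longrightarrow> lp_int p UNIV (\<lambda>x. g \<beta> (x - h) - g \<beta> x) \<le> ennreal e"
    by (rule ballI, rule lp_translation_continuous[OF g(1) p gfin e])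
  from bchoice[OF this] obtain d where d: "\<And>\<beta>. \<beta> \<in> ?I \<Longrightarrow> d \<beta> > 0"
    "\<And>\<beta> h. \<beta> \<in> ?I \<Longrightarrow> norm h < d \<beta> \<Longrightarrow> lp_int p UNIV (\<lambda>x. g \<beta> (x - h) - g \<beta> x) \<le> ennreal e" by blast
  have finI: "finite ?I" by (rule finite_multi_indices_le)
  define \<rho> where "\<rho> = Min (d ` ?I)"
  have "\<rho> \<in> d ` ?I"
    unfolding \<rho>_def using finI 0 by (intro Min_in finite_imageI) blast+
  then have \<rho>: "\<rho> > 0" "\<And>\<beta>. \<beta> \<in> ?I \<Longrightarrow> \<rho> \<le> d \<beta>"
    using d(1) finI by (auto simp: \<rho>_def)
  obtain a b where ab: "box a b \<noteq> {}" "\<And>y. y \<in> cbox a b \<Longrightarrow> norm y < \<rho>"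
    "\<And>x y. y \<in> cbox a b \<Longrightarrow> x \<in> closure ?\<Omega> \<Longrightarrow> x - y \<in> ?\<Omega>"
    using cone_box[OF \<psi> \<rho>(1)] by blast
  obtain \<eta> D where \<eta>: "mollifier \<eta> D (cbox a b)" using mollifier_exists[OF ab(1)] by blast
  define h where "h = mollify \<eta> f0"
  \<comment> \<open>The derivatives are put on \<eta>, so H exists and is bounded in every order,
    also above l, where f need not have weak derivatives.\<close>
  define H where "H \<beta> = mollify (D \<beta>) f0" for \<beta>
  have smU: "smooth_partials UNIV h H" and bd: "\<And>\<beta>. \<beta> \<in> multi_indices \<Longrightarrow> bounded (range (H \<beta>))"
    using mollify_smooth[OF \<eta> f0m p f0fin] unfolding h_def H_def by auto
  have sm: "smooth_partials ?\<Omega> h H"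
    by (rule smooth_partials_subset[OF smU]) simp
  \<comment> \<open>Up to order l they can be moved over to f, since x - y stays in the domain even
    for x on its boundary.\<close>
  have H_eq: "H \<beta> x = mollify \<eta> (g \<beta>) x" if "\<beta> \<in> ?I" "x \<in> closure ?\<Omega>" for \<beta> x
    unfolding H_def using that ab(3)
    by (intro mollify_weak_deriv[OF \<eta> w(1) _ f0m f0 g(1,2)]) auto
  have Hm: "H \<beta> \<in> borel_measurable borel" if "\<beta> \<in> multi_indices" for \<beta>
    by (rule borel_measurable_continuous_onI[OF smooth_partials_continuous_on[OF smU that]])
  have lp_H: "lp_int p S (H \<beta>) = lp_int p S (mollify \<eta> (g \<beta>))" if "\<beta> \<in> ?I" "S \<subseteq> ?\<Omega>" for \<beta> S
    unfolding lp_int_def using H_eq[OF that(1)] that(2) closure_subset[of ?\<Omega>]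
    by (intro nn_integral_cong) (auto simp: indicator_def subset_iff)
  have Hfin: "lp_int p ?\<Omega> (H \<beta>) < \<infinity>" if "\<beta> \<in> ?I" for \<beta>
  proof -
    have "lp_int p ?\<Omega> (H \<beta>) \<le> lp_int p UNIV (mollify \<eta> (g \<beta>))"
      unfolding lp_H[OF that order_refl] by (rule lp_int_mono_set) simp
    also have "\<dots> \<le> lp_int p UNIV (g \<beta>)"
      by (rule lp_int_mollify_le[OF \<eta> g(1)[OF that] p]) (simp_all add: lp_int_translate[OF g(1)[OF that]])
    finally show ?thesis using gfin[OF that] by (simp add: le_less_trans)
  qed
  have h0: "H (\<lambda>_. 0) = h" using smooth_partialsD(1)[OF smU] by auto
  have 1: "h \<in> Cb_infty_closure ?\<Omega>"
    unfolding Cb_infty_closure_def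
  proof (intro CollectI exI conjI ballI)
    show "smooth_partials ?\<Omega> h H" by (rule sm)
    fix \<alpha> :: "(real^'m) \<times> real \<Rightarrow> nat" assume \<alpha>: "\<alpha> \<in> multi_indices"
    show "continuous_on (closure ?\<Omega>) (H \<alpha>)"
      by (rule continuous_on_subset[OF smooth_partials_continuous_on[OF smU \<alpha>]]) simp
    show "bounded (H \<alpha> ` closure ?\<Omega>)" by (rule bounded_subset[OF bd[OF \<alpha>]]) auto
  qed (simp add: h0)
  have 2: "h \<in> sobolev l p ?\<Omega>"
    unfolding sobolev_def
  proof (intro CollectI conjI ballI impI)
    show "h \<in> Lp_space p ?\<Omega>"
      using Hm[of "\<lambda>_. 0"] Hfin[OF 0] by (intro Lp_space_borelI) (simp_all add: h0)
    fix \<alpha> :: "(real^'m) \<times> real \<Rightarrow> nat" assume \<alpha>: "\<alpha> \<in> multi_indices" "mi_order \<alpha> \<le> l"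
    show "\<exists>g\<in>Lp_space p ?\<Omega>. has_weak_deriv ?\<Omega> \<alpha> h g"
      using \<alpha> Hm Hfin smooth_partials_imp_has_weak_deriv[OF \<Omega> sm]
      by (intro bexI[of _ "H \<alpha>"] Lp_space_borelI) auto
  qed
  have 3: "smooth_bounded ?\<Omega> H"
    unfolding smooth_bounded_def h0 using sm bd by (auto intro: bounded_subset)
  have 4: "lp_int p ?\<Omega> (\<lambda>x. H \<beta> x - w \<beta> x) \<le> ennreal e" if \<beta>: "\<beta> \<in> ?I" for \<beta>
  proof -
    have "lp_int p ?\<Omega> (\<lambda>x. H \<beta> x - w \<beta> x) = lp_int p ?\<Omega> (\<lambda>x. mollify \<eta> (g \<beta>) x - g \<beta> x)"
    proof (rule lp_int_AE_cong)
      show "AE x in lebesgue. x \<in> ?\<Omega> \<longrightarrow> H \<beta> x - w \<beta> x = mollify \<eta> (g \<beta>) x - g \<beta> x"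
        using gw[OF \<beta>] by eventually_elim (use H_eq[OF \<beta>] closure_subset[of ?\<Omega>] in auto)
    qed
    also have "\<dots> \<le> lp_int p UNIV (\<lambda>x. mollify \<eta> (g \<beta>) x - g \<beta> x)" by (rule lp_int_mono_set) simp
    also have "\<dots> \<le> ennreal e"
      using ab(2) \<rho>(2)[OF \<beta>] d(2)[OF \<beta>]
      by (intro lp_int_mollify_diff_le[OF \<eta> g(1)[OF \<beta>] p gfin[OF \<beta>]]) (meson less_le_trans)
    finally show ?thesis .
  qed
  have 5: "lp_int p (ball z r \<inter> ?\<Omega>) (H \<beta>) \<le> Q"
    if \<beta>: "\<beta> \<in> ?I" and Q: "\<And>z. z \<in> ?\<Omega> \<Longrightarrow> lp_int p (ball z r \<inter> ?\<Omega>) (w \<beta>) \<le> Q" and z: "z \<in> ?\<Omega>" for \<beta> r Q z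
  proof -
    have "lp_int p (ball z r \<inter> ?\<Omega>) (mollify \<eta> (g \<beta>)) \<le> Q"
    proof (rule lp_int_mollify_le[OF \<eta> g(1)[OF \<beta>] p])
      fix y assume y: "y \<in> cbox a b"
      have [measurable]: "g \<beta> \<in> borel_measurable borel" by (rule g(1)[OF \<beta>])
      have sh: "x - y \<in> ?\<Omega>" if "x \<in> ?\<Omega>" for x using ab(3)[OF y, of x] that closure_subset[of ?\<Omega>] by blast
      let ?k = "\<lambda>x. indicator (ball (z - y) r \<inter> ?\<Omega>) x * ennreal (\<bar>g \<beta> x\<bar> powr p)"
      have km: "?k \<in> borel_measurable borel"
        by (intro borel_measurable_times_ennreal borel_measurable_indicator) auto
      have "lp_int p (ball z r \<inter> ?\<Omega>) (\<lambda>x. g \<beta> (x - y)) \<le> (\<integral>\<^sup>+x. ?k (- y + x) \<partial>lborel)"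
        unfolding lp_int_def
      proof (rule nn_integral_mono)
        fix x
        show "indicator (ball z r \<inter> ?\<Omega>) x * ennreal (\<bar>g \<beta> (x - y)\<bar> powr p) \<le> ?k (- y + x)"
          using sh[of x] by (auto simp: indicator_def dist_norm)
      qed
      also have "\<dots> = lp_int p (ball (z - y) r \<inter> ?\<Omega>) (g \<beta>)"
        unfolding lp_int_def by (rule nn_integral_translate[OF km])
      also have "\<dots> = lp_int p (ball (z - y) r \<inter> ?\<Omega>) (w \<beta>)"
        by (rule lp_int_AE_cong) (use gw[OF \<beta>] in \<open>eventually_elim, auto\<close>)
      also have "\<dots> \<le> Q" by (rule Q[OF sh[OF z]])
      finally show "lp_int p (ball z r \<inter> ?\<Omega>) (\<lambda>x. g \<beta> (x - y)) \<le> Q" .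
    qed auto
    then show ?thesis using lp_H[OF \<beta>, of "ball z r \<inter> ?\<Omega>"] by simp
  qed
  show ?thesis
    using 1 2 3 sm 4 5 unfolding w_def by (intro exI[of _ h] exI[of _ H] conjI ballI impI allI IntI) auto
qed

subsection \<open>The estimate for smooth functions\<close>

text \<open>Every vertical line meets the graph in a single point.\<close>

lemma graph_null:
  fixes \<psi> :: "real^'m \<Rightarrow> real"
  assumes \<psi>: "continuous_on UNIV \<psi>"
  shows "AE z in lebesgue. z \<in> special_domain \<psi> \<or> z \<in> below_graph \<psi>"
proof (rule AE_completion)
  let ?G = "- (special_domain \<psi> \<union> below_graph \<psi>)"
  have G: "?G \<in> sets borel"
    using open_special_domain[OF \<psi>] open_below_graph[OF \<psi>] by (intro borel_comp sets.Un) auto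
  have G_eq: "(x, y) \<in> ?G \<longleftrightarrow> y = \<psi> x" for x y by (auto simp: special_domain_def below_graph_def)
  have m: "indicator ?G \<in> borel_measurable (lborel \<Otimes>\<^sub>M lborel :: ((real^'m) \<times> real) measure)"
    using G by (simp add: lborel_prod)
  have "emeasure lborel ?G = (\<integral>\<^sup>+z. indicator ?G z \<partial>(lborel \<Otimes>\<^sub>M lborel))"
    using G by (simp add: lborel_prod)
  also have "\<dots> = (\<integral>\<^sup>+x. \<integral>\<^sup>+y. indicator ?G (x, y) \<partial>lborel \<partial>lborel)"
    by (rule lborel.nn_integral_fst[symmetric, OF m])
  also have "(\<lambda>x. \<integral>\<^sup>+y. indicator ?G (x, y) \<partial>lborel) = (\<lambda>x. \<integral>\<^sup>+y. indicator {\<psi> x} y \<partial>lborel)"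
    by (intro ext nn_integral_cong) (simp only: indicator_def G_eq singleton_iff)
  finally have "emeasure lborel ?G = 0" by simp
  then show "AE z in lborel. z \<in> special_domain \<psi> \<or> z \<in> below_graph \<psi>"
    using G by (intro AE_I[of _ _ ?G]) auto
qed

lemma compl_closure_special_domain:
  fixes \<psi> :: "real^'m \<Rightarrow> real"
  assumes "continuous_on UNIV \<psi>"
  shows "- closure (special_domain \<psi>) = below_graph \<psi>"
  unfolding closure_special_domain[OF assms] by (auto simp: below_graph_def)

text \<open>The vertical distance to the graph dominates the distance to the domain, which bounds
  \<Delta> from above; the bound from below is the property of c3. In the bounds on derivatives, the
  power of c2 arises from replacing \<Delta> by the distance, whose powers then cancel.\<close>

lemma stein_geometry_special_domain:
  fixes \<psi> :: "real^'m \<Rightarrow> real" and \<Delta> :: "(real^'m) \<times> real \<Rightarrow> real" and c1 c2 c3 :: real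
  assumes \<psi>: "continuous_on UNIV \<psi>" and c: "c1 > 0" "c2 > 0" "c3 > 0"
    and \<Delta>: "regularized_distance c1 c2 B (special_domain \<psi>) \<Delta>"
    and c3: "\<forall>x y. (x, y) \<notin> closure (special_domain \<psi>) \<longrightarrow> c3 * \<Delta> (x, y) \<ge> \<psi> x - y"
  shows "\<exists>D. stein_geometry (below_graph \<psi>) (special_domain \<psi>) (0, 1) (2 * c3) (\<lambda>\<gamma>. c2 ^ (mi_order \<gamma> - 1) * B \<gamma>) D \<and>
    (\<forall>z\<in>below_graph \<psi>. D (\<lambda>_. 0) z = \<Delta> z) \<and>
    (\<forall>x y. y < \<psi> x \<longrightarrow> 2 * (\<psi> x - y) \<le> 2 * c3 * \<Delta> (x, y) \<and> 2 * c3 * \<Delta> (x, y) \<le> (2 * c3 * c2) * (\<psi> x - y))"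
proof -
  let ?\<Omega> = "special_domain \<psi>" and ?E = "below_graph \<psi>"
  note compl = compl_closure_special_domain[OF \<psi>]
  have notin: "z \<notin> closure ?\<Omega> \<longleftrightarrow> z \<in> ?E" for z using compl by blast
  have \<Delta>1: "c1 * infdist z (closure ?\<Omega>) \<le> \<Delta> z" "\<Delta> z \<le> c2 * infdist z (closure ?\<Omega>)" if "z \<in> ?E" for z
    using \<Delta> that by (cases z; auto simp: regularized_distance_def notin)+
  obtain D where D: "smooth_partials ?E \<Delta> D"
    "\<And>\<alpha> z. \<alpha> \<in> multi_indices \<Longrightarrow> z \<in> ?E \<Longrightarrow> \<bar>D \<alpha> z\<bar> \<le> B \<alpha> * infdist z (closure ?\<Omega>) powi (1 - int (mi_order \<alpha>))"
    using \<Delta> unfolding regularized_distance_def compl notin by blast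
  have D0: "D (\<lambda>_. 0) z = \<Delta> z" if "z \<in> ?E" for z by (rule smooth_partialsD(1)[OF D(1) that])
  \<comment> \<open>\<open>infdist\<close> from the empty set is 0 by convention, so its positivity
    requires a point of the domain.\<close>
  have "(0, \<psi> 0 + 1) \<in> ?\<Omega>" by (simp add: special_domain_def)
  then have ne: "closure ?\<Omega> \<noteq> {}" using closure_subset[of ?\<Omega>] by blast
  have pos: "infdist z (closure ?\<Omega>) > 0" if "z \<in> ?E" for z
    using that notin[of z] by (intro infdist_pos_not_in_closed ne) auto
  have \<Delta>pos: "\<Delta> z > 0" if "z \<in> ?E" for z
    using \<Delta>1(1)[OF that] mult_pos_pos[OF c(1) pos[OF that]] by linarith
  have lower: "\<psi> x - y \<le> c3 * \<Delta> (x, y)" if "y < \<psi> x" for x y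
    using c3 that notin[of "(x, y)"] by (auto simp: below_graph_def)
  have upper: "\<Delta> (x, y) \<le> c2 * (\<psi> x - y)" if xy: "y < \<psi> x" for x y
  proof -
    have "(x, \<psi> x) \<in> closure ?\<Omega>" by (simp add: closure_special_domain[OF \<psi>])
    from infdist_le[OF this, of "(x, y)"] have "infdist (x, y) (closure ?\<Omega>) \<le> \<psi> x - y"
      using xy by (simp add: dist_Pair_Pair dist_real_def)
    then have "c2 * infdist (x, y) (closure ?\<Omega>) \<le> c2 * (\<psi> x - y)" using c(2) by simp
    with \<Delta>1(2)[of "(x, y)"] xy show ?thesis by (simp add: below_graph_def)
  qed
  have smD: "smooth_partials ?E (D (\<lambda>_. 0)) D" using D(1) by (simp add: smooth_partials_def)
  have "stein_geometry ?E ?\<Omega> (0, 1) (2 * c3) (\<lambda>\<gamma>. c2 ^ (mi_order \<gamma> - 1) * B \<gamma>) D"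
    unfolding stein_geometry_def
  proof (intro conjI ballI allI impI smD open_below_graph[OF \<psi>] open_special_domain[OF \<psi>])
    fix z assume z: "z \<in> ?E"
    show "0 < D (\<lambda>_. 0) z" using D0[OF z] \<Delta>pos[OF z] by simp
    fix s :: real assume s: "1 \<le> s"
    obtain x y where xy: "z = (x, y)" "y < \<psi> x" using z by (auto simp: below_graph_def)
    have "1 * (\<psi> x - y) \<le> s * (c3 * \<Delta> (x, y))"
      using lower[OF xy(2)] s xy(2) by (intro mult_mono) auto
    moreover have "0 < s * (c3 * \<Delta> (x, y))" using s c(3) \<Delta>pos[OF z] xy by simp
    ultimately show "z + (s * (2 * c3 * D (\<lambda>_. 0) z)) *\<^sub>R (0, 1) \<in> ?\<Omega>"
      unfolding D0[OF z] by (simp add: xy special_domain_def)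
  next
    fix \<gamma> and i z :: "(real^'m) \<times> real" assume \<gamma>: "\<gamma> \<in> (multi_indices :: ((real^'m) \<times> real \<Rightarrow> nat) set)" and i: "i \<in> Basis" and z: "z \<in> ?E"
    let ?d = "infdist z (closure ?\<Omega>)" and ?n = "mi_order \<gamma>" and ?\<gamma> = "\<gamma>(i := Suc (\<gamma> i))"
    have "\<bar>D ?\<gamma> z\<bar> \<le> B ?\<gamma> * ?d powi (1 - int (mi_order ?\<gamma>))"
      by (rule D(2)[OF multi_index_upd_Suc[OF \<gamma> i] z])
    also have "?d powi (1 - int (mi_order ?\<gamma>)) = 1 / ?d ^ ?n"
      unfolding mi_order_upd_Suc[OF i] using pos[OF z] by (simp add: power_int_minus divide_inverse)
    finally have *: "\<bar>D ?\<gamma> z\<bar> \<le> B ?\<gamma> * (1 / ?d ^ ?n)" .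
    have "\<bar>D (\<lambda>_. 0) z ^ ?n * D ?\<gamma> z\<bar> \<le> (c2 * ?d) ^ ?n * (B ?\<gamma> * (1 / ?d ^ ?n))"
      unfolding abs_mult power_abs D0[OF z]
      using * \<Delta>1(2)[OF z] \<Delta>pos[OF z] pos[OF z] c(2) by (intro mult_mono power_mono) auto
    also have "\<dots> = c2 ^ ?n * B ?\<gamma>" using pos[OF z] by (simp add: power_mult_distrib)
    finally show "\<bar>D (\<lambda>_. 0) z ^ ?n * D ?\<gamma> z\<bar> \<le> c2 ^ (mi_order ?\<gamma> - 1) * B ?\<gamma>"
      unfolding mi_order_upd_Suc[OF i] by simp
  qed
  moreover have "2 * (\<psi> x - y) \<le> 2 * c3 * \<Delta> (x, y) \<and> 2 * c3 * \<Delta> (x, y) \<le> (2 * c3 * c2) * (\<psi> x - y)"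
    if "y < \<psi> x" for x y
    using lower[OF that] mult_left_mono[OF upper[OF that], of "2 * c3"] c(3) by (simp add: mult.assoc)
  ultimately show ?thesis using D0 by (intro exI[of _ D]) blast
qed

definition shifted_average :: "'a::euclidean_space \<Rightarrow> nat \<Rightarrow> ('a \<Rightarrow> real) \<Rightarrow> ('a \<Rightarrow> real) \<Rightarrow> 'a \<Rightarrow> ennreal" where
  "shifted_average e N \<delta> G x =
     (\<integral>\<^sup>+s. indicator {1..} s * (ennreal (1 / s ^ N) * ennreal \<bar>G (x + (s * \<delta> x) *\<^sub>R e)\<bar>) \<partial>lborel)"

text \<open>A coefficient is bounded and a kernel decays at least like s^(-N), so each term is a
  constant times one shifted average. Summing over all \<beta> of order k makes the right-hand side
  the same for every term. The constant depends on bd, but on no particular geometry.\<close>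

lemma term_values_bound:
  fixes e :: "'a::euclidean_space"
  assumes \<tau>: "rapid_kernel \<tau>" and L: "set L \<subseteq> stein_terms \<tau> k"
  shows "\<exists>C\<ge>0. \<forall>E \<Omega> D F x. stein_geometry E \<Omega> e c bd D \<longrightarrow> smooth_bounded \<Omega> F \<longrightarrow> x \<in> E \<longrightarrow>
    ennreal \<bar>\<Sum>T\<leftarrow>L. term_value e c D F x T\<bar> \<le>
      ennreal C * (\<Sum>\<beta> | \<beta> \<in> multi_indices \<and> mi_order \<beta> = k. shifted_average e N (\<lambda>x. c * D (\<lambda>_. 0) x) (F \<beta>) x)"
  using L
proof (induction L)
  case Nil
  then show ?case by (intro exI[of _ 0]) simp
next
  case (Cons T L)
  then obtain C where C: "C \<ge> 0" "\<And>E \<Omega> D F x. stein_geometry E \<Omega> e c bd D \<Longrightarrow> smooth_bounded \<Omega> F \<Longrightarrow> x \<in> E \<Longrightarrow>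
    ennreal \<bar>\<Sum>T\<leftarrow>L. term_value e c D F x T\<bar> \<le>
      ennreal C * (\<Sum>\<beta> | \<beta> \<in> multi_indices \<and> mi_order \<beta> = k. shifted_average e N (\<lambda>x. c * D (\<lambda>_. 0) x) (F \<beta>) x)"
    by auto
  obtain A \<kappa> \<beta> where T: "T = (A, \<kappa>, \<beta>)" by (cases T)
  have T': "(A, \<kappa>, \<beta>) \<in> stein_terms \<tau> k" using Cons.prems T by simp
  then have A: "A \<in> stein_coeffs" and \<beta>: "\<beta> \<in> multi_indices" "mi_order \<beta> = k" by (auto simp: stein_terms_def)
  obtain CA where CA: "CA \<ge> 0" "\<And>E \<Omega> D x. stein_geometry E \<Omega> e c bd D \<Longrightarrow> x \<in> E \<Longrightarrow> \<bar>A D x\<bar> \<le> CA"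
    using stein_coeffs_bounded[OF A, of e c bd] by blast
  obtain K where K: "K \<ge> 0" "\<And>s. s \<ge> 1 \<Longrightarrow> \<bar>\<kappa> s\<bar> \<le> K / s ^ N"
    using rapid_kernel_bound[OF stein_terms_rapid[OF \<tau> T'], of N] by blast
  show ?case
  proof (intro exI[of _ "CA * K + C"] conjI allI impI)
    show "0 \<le> CA * K + C" using CA(1) K(1) C(1) by simp
    fix E \<Omega> D F x assume g: "stein_geometry E \<Omega> e c bd D" and F: "smooth_bounded \<Omega> F" and x: "x \<in> E"
    let ?a = "\<lambda>\<beta>. shifted_average e N (\<lambda>x. c * D (\<lambda>_. 0) x) (F \<beta>) x"
    let ?S = "\<Sum>\<beta> | \<beta> \<in> multi_indices \<and> mi_order \<beta> = k. ?a \<beta>"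
    have cF: "continuous_on \<Omega> (F \<beta>)"
      using F smooth_partials_continuous_on[OF _ \<beta>(1)] by (auto simp: smooth_bounded_def)
    have "ennreal \<bar>term_value e c D F x T\<bar> = ennreal \<bar>A D x\<bar> * ennreal \<bar>kernel_shift e c \<kappa> (D (\<lambda>_. 0)) (F \<beta>) x\<bar>"
      by (simp add: T term_value_def abs_mult ennreal_mult)
    also have "\<dots> \<le> ennreal CA * (ennreal K * ?a \<beta>)"
      unfolding shifted_average_def
      by (intro mult_mono ennreal_leI CA(2)[OF g x] kernel_shift_bound[OF g cF x K(2,1)]) auto
    also have "\<dots> \<le> ennreal CA * (ennreal K * ?S)"
      using \<beta> by (intro mult_left_mono member_le_sum) (auto intro: finite_multi_indices_eq)
    finally have 1: "ennreal \<bar>term_value e c D F x T\<bar> \<le> ennreal (CA * K) * ?S"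
      using CA(1) K(1) by (simp add: ennreal_mult mult.assoc)
    have "ennreal \<bar>\<Sum>T\<leftarrow>T # L. term_value e c D F x T\<bar> \<le>
        ennreal (\<bar>term_value e c D F x T\<bar> + \<bar>\<Sum>T\<leftarrow>L. term_value e c D F x T\<bar>)"
      by (intro ennreal_leI) (simp add: abs_triangle_ineq)
    also have "\<dots> = ennreal \<bar>term_value e c D F x T\<bar> + ennreal \<bar>\<Sum>T\<leftarrow>L. term_value e c D F x T\<bar>"
      by (rule ennreal_plus) auto
    also have "\<dots> \<le> ennreal (CA * K) * ?S + ennreal C * ?S" by (intro add_mono 1 C(2)[OF g F x])
    also have "\<dots> = ennreal (CA * K + C) * ?S"
      using CA(1) K(1) C(1) by (simp add: distrib_right)
    finally show "ennreal \<bar>\<Sum>T\<leftarrow>T # L. term_value e c D F x T\<bar> \<le> ennreal (CA * K + C) * ?S" .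
  qed
qed

lemma nn_integral_weight_le_1:
  assumes "N \<ge> 2"
  shows "(\<integral>\<^sup>+s. ennreal (indicator {1..} s * (1 / s ^ N)) \<partial>lborel) \<le> 1"
proof -
  have "(\<integral>\<^sup>+s. ennreal (indicator {1..} s * (1 / s ^ N)) \<partial>lborel) \<le> (\<integral>\<^sup>+s. ennreal (1 / s\<^sup>2) * indicator {1::real..} s \<partial>lborel)"
  proof (rule nn_integral_mono)
    fix s :: real
    show "ennreal (indicator {1..} s * (1 / s ^ N)) \<le> ennreal (1 / s\<^sup>2) * indicator {1..} s"
    proof (cases "s \<ge> 1")
      case True
      then have "1 / s ^ N \<le> 1 / s\<^sup>2" using power_increasing[OF assms True] by (intro divide_left_mono) auto
      then show ?thesis using True by (simp add: ennreal_leI)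
    qed simp
  qed
  also have "\<dots> = 1" by (subst nn_integral_inverse_square) auto
  finally show ?thesis .
qed

text \<open>Jensen is applied to each average separately and \<open>powr_sum_le\<close> to their
  sum. The bounds b ensure that the averages are finite and can be treated as real numbers; their
  size does not enter the constant.\<close>

lemma weighted_average_powr:
  fixes u :: "'b \<Rightarrow> real \<Rightarrow> real"
  assumes I: "finite I" and u: "\<And>\<beta>. \<beta> \<in> I \<Longrightarrow> u \<beta> \<in> borel_measurable borel"
    "\<And>\<beta> s. \<beta> \<in> I \<Longrightarrow> 0 \<le> u \<beta> s" "\<And>\<beta> s. \<beta> \<in> I \<Longrightarrow> u \<beta> s \<le> b \<beta>"
    and N: "N \<ge> 2" and p: "p \<ge> 1" and v: "v \<ge> 0" "C \<ge> 0"
    and le: "ennreal v \<le> ennreal C * (\<Sum>\<beta>\<in>I. \<integral>\<^sup>+s. indicator {1..} s * (ennreal (1 / s ^ N) * ennreal (u \<beta> s)) \<partial>lborel)"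
  shows "ennreal (v powr p) \<le> ennreal ((C * real (card I)) powr p) *
    (\<Sum>\<beta>\<in>I. \<integral>\<^sup>+s. indicator {1..} s * (ennreal (1 / s ^ N) * ennreal (u \<beta> s powr p)) \<partial>lborel)"
proof -
  define w where "w s = indicator {1..} s * (1 / s ^ N)" for s :: real
  have w0: "w s \<ge> 0" for s by (auto simp: w_def indicator_def)
  have wm[measurable]: "w \<in> borel_measurable borel"
    unfolding w_def by (intro borel_measurable_times borel_measurable_indicator) auto
  have w1: "(\<integral>\<^sup>+s. ennreal (w s) \<partial>lborel) \<le> 1" unfolding w_def by (rule nn_integral_weight_le_1[OF N])
  have conv: "indicator {1..} s * (ennreal (1 / s ^ N) * ennreal y) = ennreal (y * w s)" if "y \<ge> 0" for s y
    using that by (auto simp: w_def indicator_def ennreal_mult[symmetric])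
  define J where "J \<beta> = (\<integral>\<^sup>+s. ennreal (u \<beta> s * w s) \<partial>lborel)" for \<beta>
  define K where "K \<beta> = (\<integral>\<^sup>+s. ennreal (u \<beta> s powr p * w s) \<partial>lborel)" for \<beta>
  have Jfin: "J \<beta> < \<infinity>" if "\<beta> \<in> I" for \<beta>
  proof -
    have "J \<beta> \<le> (\<integral>\<^sup>+s. ennreal \<bar>b \<beta>\<bar> * ennreal (w s) \<partial>lborel)"
      unfolding J_def using u(3)[OF that] w0
      by (intro nn_integral_mono) (auto simp: ennreal_mult[symmetric] intro!: ennreal_leI mult_right_mono order_trans[OF _ abs_ge_self])
    also have "\<dots> = ennreal \<bar>b \<beta>\<bar> * (\<integral>\<^sup>+s. ennreal (w s) \<partial>lborel)" by (rule nn_integral_cmult) measurable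
    also have "\<dots> \<le> ennreal \<bar>b \<beta>\<bar> * 1" by (intro mult_left_mono w1) simp
    finally have "J \<beta> \<le> ennreal \<bar>b \<beta>\<bar>" by simp
    then show ?thesis unfolding infinity_ennreal_def by (rule le_less_trans[OF _ ennreal_less_top])
  qed
  define j where "j \<beta> = enn2real (J \<beta>)" for \<beta>
  have j: "J \<beta> = ennreal (j \<beta>)" "j \<beta> \<ge> 0" if "\<beta> \<in> I" for \<beta>
    using Jfin[OF that] by (auto simp: j_def)
  have jK: "ennreal (j \<beta> powr p) \<le> K \<beta>" if \<beta>: "\<beta> \<in> I" for \<beta>
    unfolding K_def using u[OF \<beta>] w0 w1 j[OF \<beta>] by (intro jensen_powr[OF p]) (auto simp: J_def)
  have "ennreal v \<le> ennreal C * (\<Sum>\<beta>\<in>I. J \<beta>)"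
    using le u(2) by (simp add: conv J_def cong: sum.cong)
  also have "(\<Sum>\<beta>\<in>I. J \<beta>) = ennreal (\<Sum>\<beta>\<in>I. j \<beta>)" using j by (simp add: sum_ennreal)
  also have "ennreal C * ennreal (\<Sum>\<beta>\<in>I. j \<beta>) = ennreal (C * (\<Sum>\<beta>\<in>I. j \<beta>))"
    using v(2) j by (intro ennreal_mult[symmetric] sum_nonneg) auto
  finally have "v \<le> C * (\<Sum>\<beta>\<in>I. j \<beta>)" using v(2) j by (subst (asm) ennreal_le_iff) (auto intro!: mult_nonneg_nonneg sum_nonneg)
  then have "v powr p \<le> (C * (\<Sum>\<beta>\<in>I. j \<beta>)) powr p" using v p by (intro powr_mono2) auto
  also have "\<dots> = C powr p * (\<Sum>\<beta>\<in>I. j \<beta>) powr p" by (rule powr_mult)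
  also have "\<dots> \<le> C powr p * (real (card I) powr p * (\<Sum>\<beta>\<in>I. j \<beta> powr p))"
    using j by (intro mult_left_mono powr_sum_le I p) auto
  also have "\<dots> = (C * real (card I)) powr p * (\<Sum>\<beta>\<in>I. j \<beta> powr p)" by (simp add: powr_mult mult.assoc)
  finally have "ennreal (v powr p) \<le> ennreal ((C * real (card I)) powr p * (\<Sum>\<beta>\<in>I. j \<beta> powr p))" by (rule ennreal_leI)
  also have "\<dots> = ennreal ((C * real (card I)) powr p) * (\<Sum>\<beta>\<in>I. ennreal (j \<beta> powr p))"
    by (simp add: ennreal_mult sum_nonneg)
  also have "\<dots> \<le> ennreal ((C * real (card I)) powr p) * (\<Sum>\<beta>\<in>I. K \<beta>)"
    by (intro mult_left_mono sum_mono jK) auto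
  also have "(\<Sum>\<beta>\<in>I. K \<beta>) = (\<Sum>\<beta>\<in>I. \<integral>\<^sup>+s. indicator {1..} s * (ennreal (1 / s ^ N) * ennreal (u \<beta> s powr p)) \<partial>lborel)"
    by (simp add: conv K_def)
  finally show ?thesis .
qed

text \<open>The points in the average depend on the regularized distance; after the comparison they
  depend on \<psi> alone, through a map with explicit distortion.\<close>

lemma shifted_average_le_reflected:
  fixes \<psi> :: "real^'m \<Rightarrow> real" and F :: "(real^'m) \<times> real \<Rightarrow> real"
  assumes F: "continuous_on (special_domain \<psi>) F" and \<psi>: "continuous_on UNIV \<psi>"
    and z: "z = (x, y)" "y < \<psi> x" and \<delta>: "2 * (\<psi> x - y) \<le> \<delta> z" "\<delta> z \<le> a * (\<psi> x - y)"
  shows "shifted_average (0, 1) N \<delta> F z \<le> ennreal (a ^ N) *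
    (\<integral>\<^sup>+s. indicator {1..} s * (ennreal (1 / s ^ N) *
      ennreal (indicator (special_domain \<psi>) (reflect_graph \<psi> s z) * \<bar>F (reflect_graph \<psi> s z)\<bar>)) \<partial>lborel)"
proof -
  let ?\<Omega> = "special_domain \<psi>"
  \<comment> \<open>F is uncontrolled outside the domain; its absolute value extended by zero is
    Borel measurable everywhere.\<close>
  define G where "G w = indicator ?\<Omega> w *\<^sub>R \<bar>F w\<bar>" for w
  have G: "G \<in> borel_measurable borel" unfolding G_def
    using open_special_domain[OF \<psi>] F by (intro borel_measurable_continuous_on_indicator continuous_on_rabs) auto
  define h where "h t = ennreal (G (x, t))" for t
  have "(\<lambda>t. G (x, t)) \<in> borel_measurable borel"
    by (rule measurable_compose[OF _ G]) (intro borel_measurable_continuous_onI continuous_intros)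
  then have h: "h \<in> borel_measurable borel" unfolding h_def by measurable
  have d: "0 < \<psi> x - y" using z by simp
  have "shifted_average (0, 1) N \<delta> F z = (\<integral>\<^sup>+s. indicator {1..} s * (ennreal (1 / s ^ N) * h (y + s * \<delta> z)) \<partial>lborel)"
    unfolding shifted_average_def
  proof (rule nn_integral_cong)
    fix s :: real
    show "indicator {1..} s * (ennreal (1 / s ^ N) * ennreal \<bar>F (z + (s * \<delta> z) *\<^sub>R (0, 1))\<bar>) =
        indicator {1..} s * (ennreal (1 / s ^ N) * h (y + s * \<delta> z))"
    proof (cases "s \<ge> 1")
      case True
      have "1 * (2 * (\<psi> x - y)) \<le> s * \<delta> z" using True \<delta>(1) d by (intro mult_mono) auto
      then have "(x, y + s * \<delta> z) \<in> ?\<Omega>" using d by (simp add: special_domain_def)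
      then show ?thesis by (simp add: h_def G_def z)
    qed simp
  qed
  also have "\<dots> \<le> ennreal (a ^ N) * (\<integral>\<^sup>+s. indicator {1..} s * (ennreal (1 / s ^ N) * h (y + (\<psi> x - y) + s * (\<psi> x - y))) \<partial>lborel)"
    by (rule vertical_substitution[OF h d \<delta>])
  also have "(\<lambda>s. h (y + (\<psi> x - y) + s * (\<psi> x - y))) =
      (\<lambda>s. ennreal (indicator ?\<Omega> (reflect_graph \<psi> s z) * \<bar>F (reflect_graph \<psi> s z)\<bar>))"
    by (auto simp: h_def G_def reflect_graph_def z)
  finally show ?thesis by simp
qed

lemma reflected_average_measurable:
  fixes \<psi> :: "real^'m \<Rightarrow> real" and g :: "(real^'m) \<times> real \<Rightarrow> ennreal"
  assumes \<psi>: "continuous_on UNIV \<psi>" and g: "g \<in> borel_measurable borel"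
  shows "(\<lambda>z. \<integral>\<^sup>+s. indicator {1..} s * (ennreal (1 / s ^ N) * g (reflect_graph \<psi> s z)) \<partial>lborel) \<in> borel_measurable borel"
proof -
  have Phi: "(\<lambda>(z, s). reflect_graph \<psi> s z) \<in> borel_measurable (borel \<Otimes>\<^sub>M borel)"
    unfolding borel_prod by (intro borel_measurable_continuous_onI continuous_on_reflect_graph \<psi>)
  have "(\<lambda>x. g (reflect_graph \<psi> (snd x) (fst x))) \<in> borel_measurable (borel \<Otimes>\<^sub>M borel)"
    using measurable_compose[OF Phi g] by (simp add: case_prod_beta')
  then have "(\<lambda>x. indicator {1..} (snd x) * (ennreal (1 / snd x ^ N) * g (reflect_graph \<psi> (snd x) (fst x))))
      \<in> borel_measurable (borel \<Otimes>\<^sub>M borel)"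
    by (intro borel_measurable_times_ennreal measurable_compose[OF measurable_snd borel_measurable_indicator]
        measurable_compose[OF _ measurable_ennreal]) measurable
  then have "(\<lambda>(z, s). indicator {1..} s * (ennreal (1 / s ^ N) * g (reflect_graph \<psi> s z))) \<in> borel_measurable (borel \<Otimes>\<^sub>M lborel)"
    using measurable_cong_sets[OF sets_pair_measure_cong[OF refl sets_lborel] refl] by (simp add: case_prod_beta')
  then show ?thesis by (rule lborel.borel_measurable_nn_integral)
qed

lemma lp_int_split:
  fixes f :: "'a::euclidean_space \<Rightarrow> real"
  assumes f: "f \<in> borel_measurable lebesgue" and S: "S \<in> sets borel" "A \<in> sets borel" "B \<in> sets borel"
    and ae: "AE z in lebesgue. z \<in> A \<or> z \<in> B"
  shows "lp_int p S f \<le> lp_int p (S \<inter> A) f + lp_int p (S \<inter> B) f"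
proof -
  have S': "S \<inter> A \<in> sets lebesgue" "S \<inter> B \<in> sets lebesgue" using S by auto
  have fp: "(\<lambda>z. \<bar>f z\<bar> powr p) \<in> borel_measurable lebesgue"
    by (rule measurable_abs_powr[OF f])
  have "(\<integral>\<^sup>+z. indicator S z * ennreal (\<bar>f z\<bar> powr p) \<partial>lebesgue) \<le>
      (\<integral>\<^sup>+z. indicator (S \<inter> A) z * ennreal (\<bar>f z\<bar> powr p) + indicator (S \<inter> B) z * ennreal (\<bar>f z\<bar> powr p) \<partial>lebesgue)"
    by (rule nn_integral_mono_AE) (use ae in \<open>eventually_elim, auto simp: indicator_def\<close>)
  also have "\<dots> = (\<integral>\<^sup>+z. indicator (S \<inter> A) z * ennreal (\<bar>f z\<bar> powr p) \<partial>lebesgue) +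
      (\<integral>\<^sup>+z. indicator (S \<inter> B) z * ennreal (\<bar>f z\<bar> powr p) \<partial>lebesgue)"
    by (intro nn_integral_add borel_measurable_times_ennreal borel_measurable_indicator S'
        measurable_compose[OF fp measurable_ennreal])
  finally show ?thesis by (simp add: lp_int_def nn_integral_completion)
qed

text \<open>A bound with the power p on one factor only becomes the p-th power of a number
  independent of p. All numbers are first enlarged to at least 1, where the p-th power only
  increases them.\<close>

lemma powr_const_le:
  fixes x y d p :: real
  assumes "x \<ge> 0" "y \<ge> 0" "d \<ge> 0" "p \<ge> 1"
  shows "x powr p * y + d \<le> (2 * (x + 1) * (y + d + 1)) powr p"
proof -
  define X where "X = (x + 1) powr p"
  define Y where "Y = y + d + 1"
  have X: "x powr p \<le> X" "1 \<le> X" using assms by (auto simp: X_def intro: powr_mono2 ge_one_powr_ge_zero)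
  have ge: "c \<le> c powr p" if "c \<ge> 1" for c :: real
    using powr_mono[of 1 p c] that assms(4) by simp
  have Y: "y \<le> Y" "d \<le> Y" "Y \<ge> 1" using assms by (auto simp: Y_def)
  have "x powr p * y + d \<le> X * Y + X * Y"
  proof (intro add_mono)
    show "x powr p * y \<le> X * Y" using X Y assms by (intro mult_mono) auto
    have "1 * d \<le> X * Y" using X Y assms by (intro mult_mono) auto
    then show "d \<le> X * Y" by simp
  qed
  also have "\<dots> = 2 * X * Y" by simp
  also have "\<dots> \<le> 2 powr p * X * Y powr p"
    using X Y ge[of 2] ge[OF Y(3)] by (intro mult_mono) auto
  also have "\<dots> = (2 * (x + 1) * (y + d + 1)) powr p" by (simp only: X_def Y_def powr_mult)
  finally show ?thesis .
qed

text \<open>C is fixed before p, the domain and the function. W is any measurable weak derivative on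
  the whole space: uniqueness computes it on the domain and below the graph separately, and between
  these two open sets there is only a null set.\<close>

lemma smooth_ball_estimate:
  fixes \<alpha> :: "(real^'m) \<times> real \<Rightarrow> nat" and M c1 c2 c3 :: real and \<tau> :: "real \<Rightarrow> real"
  assumes \<tau>: "stein_kernel \<tau>" and c: "c1 > 0" "c2 > 0" "c3 > 0" and \<alpha>: "\<alpha> \<in> multi_indices"
  shows "\<exists>C\<ge>1. \<forall>p \<psi> \<Delta> f F W Q X r. 1 \<le> p \<longrightarrow> M-lipschitz_on UNIV \<psi> \<longrightarrow>
    regularized_distance c1 c2 B (special_domain \<psi>) \<Delta> \<longrightarrow>
    (\<forall>x y. (x, y) \<notin> closure (special_domain \<psi>) \<longrightarrow> c3 * \<Delta> (x, y) \<ge> \<psi> x - y) \<longrightarrow>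
    smooth_partials (special_domain \<psi>) f F \<longrightarrow> smooth_bounded (special_domain \<psi>) F \<longrightarrow>
    has_weak_deriv UNIV \<alpha> (stein_formula \<psi> (\<lambda>z. 2 * c3 * \<Delta> z) \<tau> f) W \<longrightarrow> W \<in> borel_measurable lebesgue \<longrightarrow>
    0 < r \<longrightarrow> (\<forall>\<beta>\<in>multi_indices. mi_order \<beta> = mi_order \<alpha> \<longrightarrow>
      (\<forall>z\<in>special_domain \<psi>. lp_int p (ball z r \<inter> special_domain \<psi>) (F \<beta>) \<le> Q)) \<longrightarrow>
    lp_int p (ball X r) W \<le> ennreal (C powr p) * Q"
proof -
  define n where "n = DIM((real^'m) \<times> real)"
  define N where "N = n + 2"
  define I where "I = {\<beta> :: (real^'m) \<times> real \<Rightarrow> nat. \<beta> \<in> multi_indices \<and> mi_order \<beta> = mi_order \<alpha>}"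
  have finI: "finite I" unfolding I_def by (rule finite_multi_indices_eq)
  define bd where "bd = (\<lambda>\<gamma>. c2 ^ (mi_order \<gamma> - 1) * B \<gamma>)"
  have e: "((0, 1) :: (real^'m) \<times> real) \<in> Basis" by (simp add: Basis_prod_def)
  have rk: "rapid_kernel \<tau>" by (rule stein_kernel_rapid[OF \<tau>])
  \<comment> \<open>The list of terms and its constant are obtained before any domain is
    mentioned.\<close>
  obtain L where L: "set L \<subseteq> stein_terms \<tau> (mi_order \<alpha>)" "\<And>E \<Omega> bd D F.
      stein_geometry E \<Omega> ((0, 1) :: (real^'m) \<times> real) (2 * c3) bd D \<Longrightarrow> smooth_bounded \<Omega> F \<Longrightarrow>
      has_weak_deriv E \<alpha> (kernel_shift (0, 1) (2 * c3) \<tau> (D (\<lambda>_. 0)) (F (\<lambda>_. 0))) (\<lambda>x. \<Sum>T\<leftarrow>L. term_value (0, 1) (2 * c3) D F x T)"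
    using kernel_shift_weak_deriv[OF rk stein_kernel_null[OF \<tau>] e \<alpha>, of "2 * c3"] by blast
  obtain CL where CL: "CL \<ge> 0" "\<And>E \<Omega> D F x.
      stein_geometry E \<Omega> ((0, 1) :: (real^'m) \<times> real) (2 * c3) bd D \<Longrightarrow> smooth_bounded \<Omega> F \<Longrightarrow> x \<in> E \<Longrightarrow>
      ennreal \<bar>\<Sum>T\<leftarrow>L. term_value (0, 1) (2 * c3) D F x T\<bar> \<le>
        ennreal CL * (\<Sum>\<beta>\<in>I. shifted_average (0, 1) N (\<lambda>x. 2 * c3 * D (\<lambda>_. 0) x) (F \<beta>) x)"
    using term_values_bound[OF rk L(1), of "(0, 1)" "2 * c3" bd N] unfolding I_def by blast
  define a where "a = 2 * c3 * c2"
  have a: "a > 0" using c by (simp add: a_def)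
  \<comment> \<open>M \<ge> 0 is known only once \<psi> is given, hence the absolute value in a
    constant that is chosen earlier.\<close>
  define cN where "cN = (4 * n * (2 + 2 * \<bar>M\<bar>)) ^ n"
  define dn where "dn = (4 * real n * 1) ^ n"
  \<comment> \<open>x0 is the pointwise constant, which sits inside the p-th power; y0 and dn count
    covering balls for the reflected part and for the part in the domain.\<close>
  define x0 where "x0 = CL * a ^ N * real (card I)"
  define y0 where "y0 = real (card I) * cN"
  have nn: "x0 \<ge> 0" "y0 \<ge> 0" "dn \<ge> 0" "cN \<ge> 0"
    using CL(1) a by (auto simp: x0_def y0_def dn_def cN_def)
  define C where "C = 2 * (x0 + 1) * (y0 + dn + 1)"
  have "1 * 1 \<le> (x0 + 1) * (y0 + dn + 1)" using nn by (intro mult_mono) auto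
  moreover have "C = 2 * ((x0 + 1) * (y0 + dn + 1))" by (simp only: C_def mult.assoc)
  ultimately have C1: "C \<ge> 1" by linarith
  have main: "lp_int p (ball X r) W \<le> ennreal (C powr p) * Q"
    if p: "1 \<le> p" and \<psi>: "M-lipschitz_on UNIV \<psi>" and \<Delta>: "regularized_distance c1 c2 B (special_domain \<psi>) \<Delta>"
      and c3: "\<forall>x y. (x, y) \<notin> closure (special_domain \<psi>) \<longrightarrow> c3 * \<Delta> (x, y) \<ge> \<psi> x - y"
      and sm: "smooth_partials (special_domain \<psi>) f F" and F: "smooth_bounded (special_domain \<psi>) F"
      and W: "has_weak_deriv UNIV \<alpha> (stein_formula \<psi> (\<lambda>z. 2 * c3 * \<Delta> z) \<tau> f) W" "W \<in> borel_measurable lebesgue"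
      and r: "0 < r" and Q: "\<And>\<beta> z. \<beta> \<in> I \<Longrightarrow> z \<in> special_domain \<psi> \<Longrightarrow> lp_int p (ball z r \<inter> special_domain \<psi>) (F \<beta>) \<le> Q"
    for p \<psi> \<Delta> f F W Q X r
  proof -
    let ?\<Omega> = "special_domain \<psi>" and ?E = "below_graph \<psi>" and ?st = "stein_formula \<psi> (\<lambda>z. 2 * c3 * \<Delta> z) \<tau> f"
    have c\<psi>: "continuous_on UNIV \<psi>" by (rule lipschitz_UNIV_continuous[OF \<psi>])
    have \<Omega>: "open ?\<Omega>" and E: "open ?E" using open_special_domain[OF c\<psi>] open_below_graph[OF c\<psi>] by auto
    then have sets: "?\<Omega> \<in> sets borel" "?E \<in> sets borel" by auto
    have M0: "M \<ge> 0" using \<psi> by (rule lipschitz_on_nonneg)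
    obtain D where D: "stein_geometry ?E ?\<Omega> (0, 1) (2 * c3) bd D" "\<And>z. z \<in> ?E \<Longrightarrow> D (\<lambda>_. 0) z = \<Delta> z"
      "\<And>x y. y < \<psi> x \<Longrightarrow> 2 * (\<psi> x - y) \<le> 2 * c3 * \<Delta> (x, y)" "\<And>x y. y < \<psi> x \<Longrightarrow> 2 * c3 * \<Delta> (x, y) \<le> a * (\<psi> x - y)"
      using stein_geometry_special_domain[OF c\<psi> c \<Delta> c3] unfolding bd_def a_def by blast
    have f_eq: "F (\<lambda>_. 0) z = f z" if "z \<in> ?\<Omega>" for z by (rule smooth_partialsD(1)[OF sm that])
    have cF: "continuous_on ?\<Omega> (F \<beta>)" if "\<beta> \<in> I" for \<beta>
      using that smooth_partials_continuous_on[OF sm] by (auto simp: I_def)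
    have WO: "AE z in lebesgue. z \<in> ?\<Omega> \<longrightarrow> W z = F \<alpha> z"
    proof (rule has_weak_deriv_unique[OF \<Omega> has_weak_deriv_subset[OF W(1) subset_UNIV \<alpha>]])
      show "has_weak_deriv ?\<Omega> \<alpha> ?st (F \<alpha>)"
        by (rule has_weak_deriv_AE_cong[OF smooth_partials_imp_has_weak_deriv[OF \<Omega> sm \<alpha>]])
           (auto simp: stein_formula_def special_domain_def)
    qed
    let ?S = "\<lambda>x. \<Sum>T\<leftarrow>L. term_value (0, 1) (2 * c3) D F x T"
    have WE: "AE z in lebesgue. z \<in> ?E \<longrightarrow> W z = ?S z"
    proof (rule has_weak_deriv_unique[OF E has_weak_deriv_subset[OF W(1) subset_UNIV \<alpha>]])
      have eq: "kernel_shift (0, 1) (2 * c3) \<tau> (D (\<lambda>_. 0)) (F (\<lambda>_. 0)) z = ?st z" if z: "z \<in> ?E" for z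
      proof -
        obtain x y where xy: "z = (x, y)" "y < \<psi> x" using z by (auto simp: below_graph_def)
        have "(LINT s:{1..}|lborel. \<tau> s * F (\<lambda>_. 0) (z + (s * (2 * c3 * D (\<lambda>_. 0) z)) *\<^sub>R (0, 1))) =
            (LINT s:{1..}|lborel. f (x, y + s * (2 * c3 * \<Delta> (x, y))) * \<tau> s)"
        proof (rule set_lebesgue_integral_cong)
          show "\<forall>s. s \<in> {1..} \<longrightarrow> \<tau> s * F (\<lambda>_. 0) (z + (s * (2 * c3 * D (\<lambda>_. 0) z)) *\<^sub>R (0, 1)) =
              f (x, y + s * (2 * c3 * \<Delta> (x, y))) * \<tau> s"
          proof (intro allI impI)
            fix s :: real assume "s \<in> {1..}"
            then have "z + (s * (2 * c3 * D (\<lambda>_. 0) z)) *\<^sub>R (0, 1) \<in> ?\<Omega>"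
              using D(1) z by (auto simp: stein_geometry_def)
            from f_eq[OF this] show "\<tau> s * F (\<lambda>_. 0) (z + (s * (2 * c3 * D (\<lambda>_. 0) z)) *\<^sub>R (0, 1)) =
                f (x, y + s * (2 * c3 * \<Delta> (x, y))) * \<tau> s"
              unfolding D(2)[OF z] by (simp add: xy(1))
          qed
        qed simp
        then show ?thesis using xy by (simp add: kernel_shift_def stein_formula_def)
      qed
      show "has_weak_deriv ?E \<alpha> ?st ?S"
        by (rule has_weak_deriv_AE_cong[OF L(2)[OF D(1) F]]) (auto simp: eq)
    qed
    define G where "G \<beta> z = indicator ?\<Omega> z *\<^sub>R \<bar>F \<beta> z\<bar>" for \<beta> z
    have Gm: "G \<beta> \<in> borel_measurable borel" if "\<beta> \<in> I" for \<beta>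
      unfolding G_def using sets cF[OF that] by (intro borel_measurable_continuous_on_indicator continuous_on_rabs)
    have G0: "G \<beta> z \<ge> 0" for \<beta> z by (simp add: G_def)
    define g where "g \<beta> z = ennreal (G \<beta> z powr p)" for \<beta> z
    have gm: "g \<beta> \<in> borel_measurable borel" if "\<beta> \<in> I" for \<beta>
      unfolding g_def using Gm[OF that] by measurable
    have gQ: "(\<integral>\<^sup>+y. indicator (ball z r \<inter> ?\<Omega>) y * g \<beta> y \<partial>lborel) \<le> Q" if "\<beta> \<in> I" "z \<in> ?\<Omega>" for \<beta> z
    proof -
      have "(\<integral>\<^sup>+y. indicator (ball z r \<inter> ?\<Omega>) y * g \<beta> y \<partial>lborel) = lp_int p (ball z r \<inter> ?\<Omega>) (F \<beta>)"
        unfolding lp_int_def g_def G_def by (intro nn_integral_cong) (auto simp: indicator_def)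
      with Q[OF that] show ?thesis by simp
    qed
    have \<alpha>I: "\<alpha> \<in> I" using \<alpha> by (simp add: I_def)
    \<comment> \<open>Even this part requires the cover, because the centre X need not lie in the
      domain.\<close>
    have part1: "lp_int p (ball X r \<inter> ?\<Omega>) W \<le> ennreal dn * Q"
    proof -
      have "lp_int p (ball X r \<inter> ?\<Omega>) W = lp_int p (ball X r \<inter> ?\<Omega>) (F \<alpha>)"
        by (rule lp_int_AE_cong) (use WO in \<open>eventually_elim, auto\<close>)
      also have "\<dots> = (\<integral>\<^sup>+y. indicator (ball X (1 * r) \<inter> ?\<Omega>) y * g \<alpha> y \<partial>lborel)"
        unfolding lp_int_def g_def G_def by (intro nn_integral_cong) (auto simp: indicator_def)
      also have "\<dots> \<le> ennreal ((4 * DIM((real^'m) \<times> real) * (1::real)) ^ DIM((real^'m) \<times> real)) * Q"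
        by (rule ball_cover_integral[OF gm[OF \<alpha>I] sets(1) r order_refl gQ[OF \<alpha>I]])
      finally show ?thesis by (simp add: dn_def n_def)
    qed
    define A where "A \<beta> z = (\<integral>\<^sup>+s. indicator {1..} s * (ennreal (1 / s ^ N) * g \<beta> (reflect_graph \<psi> s z)) \<partial>lborel)" for \<beta> z
    have Am: "A \<beta> \<in> borel_measurable borel" if "\<beta> \<in> I" for \<beta>
      unfolding A_def by (rule reflected_average_measurable[OF c\<psi> gm[OF that]])
    have pw: "ennreal (\<bar>?S z\<bar> powr p) \<le> ennreal (x0 powr p) * (\<Sum>\<beta>\<in>I. A \<beta> z)" if z: "z \<in> ?E" for z
    proof -
      obtain x y where xy: "z = (x, y)" "y < \<psi> x" using z by (auto simp: below_graph_def)
      have "\<forall>\<beta>\<in>I. \<exists>b. \<forall>w\<in>?\<Omega>. \<bar>F \<beta> w\<bar> \<le> b"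
        using F by (auto simp: smooth_bounded_def I_def bounded_iff)
      from bchoice[OF this] obtain b where b: "\<And>\<beta> w. \<beta> \<in> I \<Longrightarrow> w \<in> ?\<Omega> \<Longrightarrow> \<bar>F \<beta> w\<bar> \<le> b \<beta>" by blast
      let ?R = "\<lambda>\<beta>. \<integral>\<^sup>+s. indicator {1..} s * (ennreal (1 / s ^ N) * ennreal (G \<beta> (reflect_graph \<psi> s z))) \<partial>lborel"
      have "ennreal \<bar>?S z\<bar> \<le> ennreal CL * (\<Sum>\<beta>\<in>I. shifted_average (0, 1) N (\<lambda>x. 2 * c3 * D (\<lambda>_. 0) x) (F \<beta>) z)"
        by (rule CL(2)[OF D(1) F z])
      also have "\<dots> \<le> ennreal CL * (\<Sum>\<beta>\<in>I. ennreal (a ^ N) * ?R \<beta>)"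
      proof (intro mult_left_mono sum_mono)
        fix \<beta> assume \<beta>: "\<beta> \<in> I"
        show "shifted_average (0, 1) N (\<lambda>x. 2 * c3 * D (\<lambda>_. 0) x) (F \<beta>) z \<le> ennreal (a ^ N) * ?R \<beta>"
          unfolding G_def real_scaleR_def
          by (rule shifted_average_le_reflected[OF cF[OF \<beta>] c\<psi> xy]) (use D(2)[OF z] D(3,4)[OF xy(2)] xy(1) in auto)
      qed simp
      also have "\<dots> = ennreal (CL * a ^ N) * (\<Sum>\<beta>\<in>I. ?R \<beta>)"
        using CL(1) a by (simp add: sum_distrib_left[symmetric] ennreal_mult mult.assoc)
      finally have le: "ennreal \<bar>?S z\<bar> \<le> ennreal (CL * a ^ N) * (\<Sum>\<beta>\<in>I. ?R \<beta>)" .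
      have "ennreal (\<bar>?S z\<bar> powr p) \<le> ennreal ((CL * a ^ N * real (card I)) powr p) *
          (\<Sum>\<beta>\<in>I. \<integral>\<^sup>+s. indicator {1..} s * (ennreal (1 / s ^ N) * ennreal (G \<beta> (reflect_graph \<psi> s z) powr p)) \<partial>lborel)"
      proof (rule weighted_average_powr[OF finI, where u = "\<lambda>\<beta> s. G \<beta> (reflect_graph \<psi> s z)" and b = "\<lambda>\<beta>. \<bar>b \<beta>\<bar>", OF _ _ _ _ p _ _ le])
        fix \<beta> s assume \<beta>: "\<beta> \<in> I"
        have "continuous_on UNIV (\<lambda>s. reflect_graph \<psi> s z)"
          unfolding reflect_graph_def xy(1) case_prod_conv by (intro continuous_intros)
        from measurable_compose[OF borel_measurable_continuous_onI[OF this] Gm[OF \<beta>]]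
        show "(\<lambda>s. G \<beta> (reflect_graph \<psi> s z)) \<in> borel_measurable borel" .
        show "G \<beta> (reflect_graph \<psi> s z) \<le> \<bar>b \<beta>\<bar>"
          using order_trans[OF b[OF \<beta>] abs_ge_self] by (auto simp: G_def indicator_def)
      qed (use G0 CL(1) a in \<open>auto simp: N_def\<close>)
      then show ?thesis by (simp add: x0_def A_def g_def)
    qed
    have part2: "lp_int p (ball X r \<inter> ?E) W \<le> ennreal (x0 powr p * y0) * Q"
    proof -
      let ?B = "ball X r \<inter> ?E"
      have B: "?B \<in> sets borel" using sets by auto
      have "lp_int p ?B W = lp_int p ?B ?S"
        by (rule lp_int_AE_cong) (use WE in \<open>eventually_elim, auto\<close>)
      also have "\<dots> \<le> (\<integral>\<^sup>+z. ennreal (x0 powr p) * (\<Sum>\<beta>\<in>I. indicator ?B z * A \<beta> z) \<partial>lborel)"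
        unfolding lp_int_def
      proof (rule nn_integral_mono)
        fix z
        show "indicator ?B z * ennreal (\<bar>?S z\<bar> powr p) \<le> ennreal (x0 powr p) * (\<Sum>\<beta>\<in>I. indicator ?B z * A \<beta> z)"
          using pw[of z] by (cases "z \<in> ?B") auto
      qed
      also have "\<dots> = ennreal (x0 powr p) * (\<integral>\<^sup>+z. (\<Sum>\<beta>\<in>I. indicator ?B z * A \<beta> z) \<partial>lborel)"
        using B Am by (intro nn_integral_cmult borel_measurable_sum borel_measurable_times_ennreal borel_measurable_indicator) auto
      also have "(\<integral>\<^sup>+z. (\<Sum>\<beta>\<in>I. indicator ?B z * A \<beta> z) \<partial>lborel) = (\<Sum>\<beta>\<in>I. \<integral>\<^sup>+z. indicator ?B z * A \<beta> z \<partial>lborel)"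
        using B Am by (intro nn_integral_sum borel_measurable_times_ennreal borel_measurable_indicator) auto
      also have "ennreal (x0 powr p) * \<dots> \<le> ennreal (x0 powr p) * (\<Sum>\<beta>\<in>I. ennreal cN * Q)"
      proof (intro mult_left_mono sum_mono)
        fix \<beta> assume \<beta>: "\<beta> \<in> I"
        have "(\<integral>\<^sup>+z. indicator ?B z * A \<beta> z \<partial>lborel) \<le> ennreal ((4 * DIM((real^'m) \<times> real) * (2 + 2 * M)) ^ DIM((real^'m) \<times> real)) * Q"
          unfolding A_def by (rule reflected_average_ball_le[OF \<psi> gm[OF \<beta>] r gQ[OF \<beta>]]) (simp_all add: N_def n_def)
        then show "(\<integral>\<^sup>+z. indicator ?B z * A \<beta> z \<partial>lborel) \<le> ennreal cN * Q"
          using M0 by (simp add: cN_def n_def)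
      qed simp
      also have "(\<Sum>\<beta>\<in>I. ennreal cN * Q) = ennreal y0 * Q"
        using nn(4) by (simp add: y0_def ennreal_mult ennreal_of_nat_eq_real_of_nat mult.assoc)
      also have "ennreal (x0 powr p) * (ennreal y0 * Q) = ennreal (x0 powr p * y0) * Q"
        using nn by (simp add: ennreal_mult mult.assoc)
      finally show ?thesis .
    qed
    have "lp_int p (ball X r) W \<le> lp_int p (ball X r \<inter> ?\<Omega>) W + lp_int p (ball X r \<inter> ?E) W"
      by (rule lp_int_split[OF W(2) _ sets graph_null[OF c\<psi>]]) simp
    also have "\<dots> \<le> ennreal dn * Q + ennreal (x0 powr p * y0) * Q" by (rule add_mono[OF part1 part2])
    also have "\<dots> = ennreal (x0 powr p * y0 + dn) * Q"
      using nn by (simp add: distrib_right add.commute)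
    also have "\<dots> \<le> ennreal (C powr p) * Q"
      unfolding C_def by (intro mult_right_mono ennreal_leI powr_const_le nn p) simp
    finally show ?thesis .
  qed
  show ?thesis
  proof (intro exI[of _ C] conjI allI impI C1, goal_cases)
    case (1 p \<psi> \<Delta> f F W Q X r)
    show ?case by (rule main[OF 1(1-9)]) (use 1(10) in \<open>auto simp: I_def\<close>)
  qed
qed

subsection \<open>Passage to the Sobolev space\<close>

text \<open>Bounds on the rooted expression in the Morrey norm are traded for bounds on plain
  integrals; at a fixed radius \<phi> is then just a positive number.\<close>

lemma ennreal_powr_le_iff:
  assumes "\<phi> > 0" "s \<ge> 0" "p \<ge> 1"
  shows "ennreal_powr (ennreal (1 / \<phi>) * I) (1 / p) \<le> ennreal s \<longleftrightarrow> I \<le> ennreal (\<phi> * s powr p)"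
proof (cases I)
  case (real i)
  have "ennreal_powr (ennreal (1 / \<phi>) * I) (1 / p) = ennreal ((i / \<phi>) powr (1 / p))"
    using real assms by (simp add: ennreal_powr_def ennreal_mult[symmetric])
  moreover have "(i / \<phi>) powr (1 / p) \<le> s \<longleftrightarrow> i / \<phi> \<le> s powr p"
  proof
    assume "(i / \<phi>) powr (1 / p) \<le> s"
    then have "((i / \<phi>) powr (1 / p)) powr p \<le> s powr p" using assms by (intro powr_mono2) auto
    then show "i / \<phi> \<le> s powr p" using real assms by (simp add: powr_powr)
  next
    assume "i / \<phi> \<le> s powr p"
    then have "(i / \<phi>) powr (1 / p) \<le> (s powr p) powr (1 / p)" using real assms by (intro powr_mono2) auto
    then show "(i / \<phi>) powr (1 / p) \<le> s" using assms by (simp add: powr_powr)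
  qed
  moreover have "i / \<phi> \<le> s powr p \<longleftrightarrow> i \<le> \<phi> * s powr p" using assms by (simp add: field_simps)
  ultimately show ?thesis using real assms by simp
next
  case top
  have "ennreal (1 / \<phi>) * I = top" using assms top by (simp add: ennreal_mult_eq_top_iff ennreal_eq_0_iff)
  then show ?thesis using top by (simp add: ennreal_powr_def top_unique)
qed

lemma Lp_norm_le_iff: "s \<ge> 0 \<Longrightarrow> p \<ge> 1 \<Longrightarrow> Lp_norm p S f \<le> ennreal s \<longleftrightarrow> lp_int p S f \<le> ennreal (s powr p)"
  unfolding Lp_norm_eq using ennreal_powr_le_iff[of 1 s p "lp_int p S f"] by simp

lemma morrey_norm_eq:
  "morrey_norm \<phi> \<delta> p S f = (SUP (x, r) \<in> S \<times> {0<..<\<delta>}.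
     ennreal_powr (ennreal (1 / \<phi> r) * lp_int p (ball x r \<inter> S) f) (1 / p))"
  unfolding morrey_norm_def lp_int_def by (simp add: nn_integral_completion mult.commute)

text \<open>The difference is written as a linear combination in the form used by the linearity
  clause of \<open>stein_operator\<close>.\<close>

lemma sobolev_diff:
  fixes f g :: "'a::euclidean_space \<Rightarrow> real"
  assumes f: "f \<in> sobolev l p S" "g \<in> sobolev l p S" and S: "open S" and p: "p \<ge> 1"
  shows "(\<lambda>z. 1 * f z + (- 1) * g z) \<in> sobolev l p S"
proof -
  have lin: "(\<lambda>z. 1 * u z + (- 1) * v z) \<in> Lp_space p S" if "u \<in> Lp_space p S" "v \<in> Lp_space p S" for u v
  proof -
    have Sb: "S \<in> sets borel" using S by simp
    have m: "(\<lambda>x. indicator S x *\<^sub>R q x) \<in> borel_measurable lebesgue" if "q \<in> Lp_space p S" for q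
      using that S by (subst borel_measurable_restrict_space_iff[symmetric]) (auto simp: Lp_space_iff)
    have eq: "lp_int p S q = lp_int p S (\<lambda>x. indicator S x *\<^sub>R q x)" for q
      unfolding lp_int_def by (intro nn_integral_cong) (auto simp: indicator_def)
    have mv: "(\<lambda>x. indicator S x *\<^sub>R (- v x)) \<in> borel_measurable lebesgue" using borel_measurable_uminus[OF m[OF that(2)]] by simp
    have vfin: "lp_int p S (\<lambda>x. - v x) < \<infinity>" using that(2) by (simp add: Lp_space_iff lp_int_def)
    have "lp_int p S (\<lambda>z. 1 * u z + (- 1) * v z) = lp_int p S (\<lambda>x. indicator S x *\<^sub>R u x + indicator S x *\<^sub>R (- v x))"
      by (subst eq) (simp add: algebra_simps)
    also have "\<dots> \<le> ennreal (2 powr p) * (lp_int p S (\<lambda>x. indicator S x *\<^sub>R u x) + lp_int p S (\<lambda>x. indicator S x *\<^sub>R (- v x)))"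
      using p by (intro lp_int_add_lebesgue m that mv Sb) simp
    also have "\<dots> < \<infinity>"
    proof -
      have "lp_int p S (\<lambda>x. indicator S x *\<^sub>R u x) < \<infinity>" "lp_int p S (\<lambda>x. indicator S x *\<^sub>R (- v x)) < \<infinity>"
        unfolding eq[symmetric] using that(1) vfin by (simp_all add: Lp_space_iff)
      then show ?thesis by (simp add: ennreal_mult_less_top del: real_scaleR_def)
    qed
    finally have "lp_int p S (\<lambda>z. 1 * u z + (- 1) * v z) < \<infinity>" .
    moreover have "(\<lambda>z. 1 * u z + (- 1) * v z) \<in> borel_measurable (lebesgue_on S)"
      using that by (auto simp: Lp_space_iff)
    ultimately show ?thesis by (simp add: Lp_space_iff)
  qed
  show ?thesis
    unfolding sobolev_def
  proof (intro CollectI conjI ballI impI)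
    show "(\<lambda>z. 1 * f z + (- 1) * g z) \<in> Lp_space p S" using f by (intro lin) (auto simp: sobolev_def)
    fix \<alpha> :: "'a \<Rightarrow> nat" assume \<alpha>: "\<alpha> \<in> multi_indices" "mi_order \<alpha> \<le> l"
    obtain u v where "u \<in> Lp_space p S" "has_weak_deriv S \<alpha> f u" "v \<in> Lp_space p S" "has_weak_deriv S \<alpha> g v"
      using f \<alpha> unfolding sobolev_def by blast
    then show "\<exists>h\<in>Lp_space p S. has_weak_deriv S \<alpha> (\<lambda>z. 1 * f z + (- 1) * g z) h"
      by (intro bexI[of _ "\<lambda>z. 1 * u z + (- 1) * v z"] has_weak_deriv_lin lin \<alpha>)
  qed
qed

text \<open>h is required to be the difference only almost everywhere, because T is linear only in
  that sense.\<close>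

lemma weak_deriv_diff_AE:
  fixes f g :: "'a::euclidean_space \<Rightarrow> real"
  assumes S: "open S" and \<alpha>: "\<alpha> \<in> multi_indices" and u: "has_weak_deriv S \<alpha> f u" and v: "has_weak_deriv S \<alpha> g v"
    and h: "AE z in lebesgue. z \<in> S \<longrightarrow> h z = 1 * f z + (- 1) * g z"
  shows "AE z in lebesgue. z \<in> S \<longrightarrow> weak_deriv S \<alpha> h z = u z - v z"
proof -
  have "has_weak_deriv S \<alpha> h (\<lambda>z. 1 * u z + (- 1) * v z)"
    by (rule has_weak_deriv_AE_cong[OF has_weak_deriv_lin[OF u v \<alpha>, of 1 "- 1"]]) (use h in \<open>eventually_elim, auto\<close>)
  from has_weak_deriv_unique[OF S weak_deriv_has_weak_deriv[OF this] this]
  show ?thesis by eventually_elim simp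
qed

text \<open>Boundedness of T is applied to h - f. K may depend on T and p: it multiplies an error
  that can be made arbitrarily small and so never reaches the final constant.\<close>

lemma stein_operator_limit:
  fixes \<psi> :: "real^'m \<Rightarrow> real" and M p :: real
  assumes \<psi>: "M-lipschitz_on UNIV \<psi>" and p: "p \<ge> 1" and T: "stein_operator l p \<psi> \<delta>s \<tau> T"
    and f: "f \<in> sobolev l p (special_domain \<psi>)" and \<alpha>: "\<alpha> \<in> multi_indices" "mi_order \<alpha> \<le> l"
  shows "\<exists>K\<ge>0. \<forall>e>0. \<forall>h H. h \<in> sobolev l p (special_domain \<psi>) \<longrightarrow> smooth_partials (special_domain \<psi>) h H \<longrightarrow>
    (\<forall>\<beta>\<in>multi_indices. mi_order \<beta> \<le> l \<longrightarrow>
      lp_int p (special_domain \<psi>) (\<lambda>x. H \<beta> x - weak_deriv (special_domain \<psi>) \<beta> f x) \<le> ennreal (e powr p)) \<longrightarrow>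
    lp_int p UNIV (\<lambda>z. weak_deriv UNIV \<alpha> (T h) z - weak_deriv UNIV \<alpha> (T f) z) \<le> ennreal ((K * e) powr p)"
proof -
  let ?\<Omega> = "special_domain \<psi>" and ?I = "{\<beta>. \<beta> \<in> multi_indices \<and> mi_order \<beta> \<le> l} :: ((real^'m) \<times> real \<Rightarrow> nat) set"
  have \<Omega>: "open ?\<Omega>" by (rule open_special_domain[OF lipschitz_UNIV_continuous[OF \<psi>]])
  obtain K where K: "\<And>f. f \<in> sobolev l p ?\<Omega> \<Longrightarrow> sobolev_norm l p UNIV (T f) \<le> ennreal K * sobolev_norm l p ?\<Omega> f"
    using T unfolding stein_operator_def Let_def by blast
  have Tsob: "\<And>f. f \<in> sobolev l p ?\<Omega> \<Longrightarrow> T f \<in> sobolev l p UNIV"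
    and Tlin: "\<And>f g a b. f \<in> sobolev l p ?\<Omega> \<Longrightarrow> g \<in> sobolev l p ?\<Omega> \<Longrightarrow>
      AE z in lebesgue. T (\<lambda>z. a * f z + b * g z) z = a * T f z + b * T g z"
    using T unfolding stein_operator_def Let_def by blast+
  have finI: "finite ?I" using finite_multi_indices_le[of l] by simp
  \<comment> \<open>Each of the finitely many derivatives contributes at most e to the Sobolev norm;
    the sign of K is unknown.\<close>
  let ?K = "\<bar>K\<bar> * real (card ?I)"
  have "lp_int p UNIV (\<lambda>z. weak_deriv UNIV \<alpha> (T h) z - weak_deriv UNIV \<alpha> (T f) z) \<le> ennreal ((?K * e) powr p)"
    if e: "e > 0" and h: "h \<in> sobolev l p ?\<Omega>" and H: "smooth_partials ?\<Omega> h H"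
      and le: "\<And>\<beta>. \<beta> \<in> ?I \<Longrightarrow> lp_int p ?\<Omega> (\<lambda>x. H \<beta> x - weak_deriv ?\<Omega> \<beta> f x) \<le> ennreal (e powr p)" for e h H
  proof -
    let ?d = "\<lambda>z. 1 * h z + (- 1) * f z"
    have d: "?d \<in> sobolev l p ?\<Omega>" by (rule sobolev_diff[OF h f \<Omega> p])
    have "Lp_norm p ?\<Omega> (weak_deriv ?\<Omega> \<beta> ?d) \<le> ennreal e" if \<beta>: "\<beta> \<in> ?I" for \<beta>
    proof -
      have b: "\<beta> \<in> multi_indices" "mi_order \<beta> \<le> l" using \<beta> by auto
      have "lp_int p ?\<Omega> (weak_deriv ?\<Omega> \<beta> ?d) = lp_int p ?\<Omega> (\<lambda>x. H \<beta> x - weak_deriv ?\<Omega> \<beta> f x)"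
        by (rule lp_int_AE_cong, rule weak_deriv_diff_AE[OF \<Omega> b(1) smooth_partials_imp_has_weak_deriv[OF \<Omega> H b(1)]
              sobolev_weak_deriv(1)[OF f \<Omega> b]]) simp
      with le[OF \<beta>] show ?thesis using e p by (subst Lp_norm_le_iff) auto
    qed
    then have "sobolev_norm l p ?\<Omega> ?d \<le> (\<Sum>\<beta>\<in>?I. ennreal e)"
      unfolding sobolev_norm_def by (intro sum_mono) blast
    also have "\<dots> = ennreal (real (card ?I) * e)"
      using e by (simp add: ennreal_mult ennreal_of_nat_eq_real_of_nat)
    finally have "ennreal K * sobolev_norm l p ?\<Omega> ?d \<le> ennreal \<bar>K\<bar> * ennreal (real (card ?I) * e)"
      by (intro mult_mono ennreal_leI) auto
    also have "\<dots> = ennreal (?K * e)" using e by (simp add: ennreal_mult[symmetric] mult.assoc)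
    finally have "sobolev_norm l p UNIV (T ?d) \<le> ennreal (?K * e)" using K[OF d] by (rule order_trans[rotated])
    moreover have "Lp_norm p UNIV (weak_deriv UNIV \<alpha> (T ?d)) \<le> sobolev_norm l p UNIV (T ?d)"
      unfolding sobolev_norm_def using \<alpha> finI by (intro member_le_sum) auto
    ultimately have "Lp_norm p UNIV (weak_deriv UNIV \<alpha> (T ?d)) \<le> ennreal (?K * e)" by simp
    then have "lp_int p UNIV (weak_deriv UNIV \<alpha> (T ?d)) \<le> ennreal ((?K * e) powr p)"
      using e p by (subst (asm) Lp_norm_le_iff) auto
    also have "lp_int p UNIV (weak_deriv UNIV \<alpha> (T ?d)) =
        lp_int p UNIV (\<lambda>z. weak_deriv UNIV \<alpha> (T h) z - weak_deriv UNIV \<alpha> (T f) z)"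
    proof (rule lp_int_AE_cong, rule weak_deriv_diff_AE[OF open_UNIV \<alpha>(1)])
      show "has_weak_deriv UNIV \<alpha> (T h) (weak_deriv UNIV \<alpha> (T h))" "has_weak_deriv UNIV \<alpha> (T f) (weak_deriv UNIV \<alpha> (T f))"
        using sobolev_weak_deriv(1)[OF Tsob open_UNIV \<alpha>] h f by auto
      show "AE z in lebesgue. z \<in> UNIV \<longrightarrow> T ?d z = 1 * T h z + (- 1) * T f z"
        using Tlin[OF h f, of 1 "- 1"] by eventually_elim simp
    qed
    finally show ?thesis .
  qed
  then show ?thesis by (intro exI[of _ ?K]) auto
qed

text \<open>The estimate passes from smooth h to f up to an arbitrary \<epsilon>. The factor 2 in 2
  C is the price of |a + b|^p \<le> 2^p (|a|^p + |b|^p).\<close>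

lemma stein_ball_estimate:
  fixes \<psi> :: "real^'m \<Rightarrow> real" and M p q C :: real
  assumes \<psi>: "M-lipschitz_on UNIV \<psi>" and p: "p \<ge> 1" and T: "stein_operator l p \<psi> \<delta>s \<tau> T"
    and f: "f \<in> sobolev l p (special_domain \<psi>)" and \<alpha>: "\<alpha> \<in> multi_indices" "mi_order \<alpha> \<le> l"
    and q: "q \<ge> 0" "C \<ge> 0"
    and est: "\<And>h H W. smooth_partials (special_domain \<psi>) h H \<Longrightarrow> smooth_bounded (special_domain \<psi>) H \<Longrightarrow>
      has_weak_deriv UNIV \<alpha> (stein_formula \<psi> \<delta>s \<tau> h) W \<Longrightarrow> W \<in> borel_measurable lebesgue \<Longrightarrow>
      (\<And>\<beta> z. \<beta> \<in> multi_indices \<Longrightarrow> mi_order \<beta> = mi_order \<alpha> \<Longrightarrow> z \<in> special_domain \<psi> \<Longrightarrow>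
        lp_int p (ball z r \<inter> special_domain \<psi>) (H \<beta>) \<le> ennreal q) \<Longrightarrow>
      lp_int p (ball x r) W \<le> ennreal (C powr p) * ennreal q"
    and Q: "\<And>\<beta> z. \<beta> \<in> multi_indices \<Longrightarrow> mi_order \<beta> = mi_order \<alpha> \<Longrightarrow> z \<in> special_domain \<psi> \<Longrightarrow>
      lp_int p (ball z r \<inter> special_domain \<psi>) (weak_deriv (special_domain \<psi>) \<beta> f) \<le> ennreal q"
  shows "lp_int p (ball x r) (weak_deriv UNIV \<alpha> (T f)) \<le> ennreal ((2 * C) powr p * q)"
proof (rule ennreal_le_epsilon)
  let ?\<Omega> = "special_domain \<psi>" and ?W = "\<lambda>h. weak_deriv UNIV \<alpha> (T h)"
  have Tsob: "\<And>f. f \<in> sobolev l p ?\<Omega> \<Longrightarrow> T f \<in> sobolev l p UNIV"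
    and Tst: "\<And>f. f \<in> Cb_infty_closure ?\<Omega> \<inter> sobolev l p ?\<Omega> \<Longrightarrow> AE z in lebesgue. T f z = stein_formula \<psi> \<delta>s \<tau> f z"
    using T unfolding stein_operator_def Let_def by blast+
  have W: "has_weak_deriv UNIV \<alpha> (T h) (?W h)" "?W h \<in> borel_measurable lebesgue" if "h \<in> sobolev l p ?\<Omega>" for h
    using sobolev_weak_deriv(1,3)[OF Tsob[OF that] open_UNIV \<alpha>] by simp_all
  obtain K where K: "K \<ge> 0" "\<And>e h H. e > 0 \<Longrightarrow> h \<in> sobolev l p ?\<Omega> \<Longrightarrow> smooth_partials ?\<Omega> h H \<Longrightarrow>
    (\<forall>\<beta>\<in>multi_indices. mi_order \<beta> \<le> l \<longrightarrow>
      lp_int p ?\<Omega> (\<lambda>x. H \<beta> x - weak_deriv ?\<Omega> \<beta> f x) \<le> ennreal (e powr p)) \<Longrightarrow>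
    lp_int p UNIV (\<lambda>z. ?W h z - ?W f z) \<le> ennreal ((K * e) powr p)"
    using stein_operator_limit[OF \<psi> p T f \<alpha>] by blast
  fix \<epsilon> :: real assume \<epsilon>: "\<epsilon> > 0"
  \<comment> \<open>Chosen so that 2^p (K e)^p \<le> \<epsilon>; division by K + 1 covers the case K
    = 0.\<close>
  define e where "e = (\<epsilon> / 2 powr p) powr (1 / p) / (K + 1)"
  have e: "e > 0" using \<epsilon> K(1) by (simp add: e_def)
  have "(K * e) powr p \<le> ((K + 1) * e) powr p" using K(1) e p by (intro powr_mono2) auto
  also have "(K + 1) * e = (\<epsilon> / 2 powr p) powr (1 / p)" using K(1) by (simp add: e_def)
  also have "\<dots> powr p = \<epsilon> / 2 powr p" using \<epsilon> p by (simp add: powr_powr)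
  finally have Ke: "2 powr p * (K * e) powr p \<le> \<epsilon>" by (simp add: field_simps)
  have "e powr p > 0" using e by simp
  from sobolev_approx[OF \<psi> p f this] obtain h H where
    h: "h \<in> Cb_infty_closure ?\<Omega> \<inter> sobolev l p ?\<Omega>" "smooth_bounded ?\<Omega> H" "smooth_partials ?\<Omega> h H"
    and hH: "\<forall>\<beta>\<in>multi_indices. mi_order \<beta> \<le> l \<longrightarrow>
      lp_int p ?\<Omega> (\<lambda>x. H \<beta> x - weak_deriv ?\<Omega> \<beta> f x) \<le> ennreal (e powr p) \<and>
      (\<forall>r Q. (\<forall>z\<in>?\<Omega>. lp_int p (ball z r \<inter> ?\<Omega>) (weak_deriv ?\<Omega> \<beta> f) \<le> Q) \<longrightarrow>
        (\<forall>z\<in>?\<Omega>. lp_int p (ball z r \<inter> ?\<Omega>) (H \<beta>) \<le> Q))"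
    by blast
  have hs: "h \<in> sobolev l p ?\<Omega>" using h(1) by simp
  have 1: "lp_int p (ball x r) (?W h) \<le> ennreal (C powr p) * ennreal q"
  proof (rule est[OF h(3,2) _ W(2)[OF hs]])
    show "has_weak_deriv UNIV \<alpha> (stein_formula \<psi> \<delta>s \<tau> h) (?W h)"
      by (rule has_weak_deriv_AE_cong[OF W(1)[OF hs]]) (use Tst[OF h(1)] in simp_all)
    fix \<beta> :: "(real^'m) \<times> real \<Rightarrow> nat" and z :: "(real^'m) \<times> real"
    assume \<beta>: "\<beta> \<in> multi_indices" "mi_order \<beta> = mi_order \<alpha>" and z: "z \<in> ?\<Omega>"
    have "mi_order \<beta> \<le> l" using \<beta>(2) \<alpha>(2) by simp
    then show "lp_int p (ball z r \<inter> ?\<Omega>) (H \<beta>) \<le> ennreal q"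
      using hH \<beta>(1) Q[OF \<beta>] z by blast
  qed
  have "lp_int p (ball x r) (\<lambda>z. ?W f z - ?W h z) \<le> lp_int p UNIV (\<lambda>z. ?W f z - ?W h z)"
    by (rule lp_int_mono_set) simp
  also have "\<dots> = lp_int p UNIV (\<lambda>z. ?W h z - ?W f z)" by (rule lp_int_uminus)
  also have "\<dots> \<le> ennreal ((K * e) powr p)" using hH by (intro K(2)[OF e hs h(3)]) blast
  finally have 2: "lp_int p (ball x r) (\<lambda>z. ?W f z - ?W h z) \<le> ennreal ((K * e) powr p)" .
  have "lp_int p (ball x r) (?W f) = lp_int p (ball x r) (\<lambda>z. ?W h z + (?W f z - ?W h z))" by simp
  also have "\<dots> \<le> ennreal (2 powr p) * (lp_int p (ball x r) (?W h) + lp_int p (ball x r) (\<lambda>z. ?W f z - ?W h z))"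
    using p by (intro lp_int_add_lebesgue W(2) hs borel_measurable_diff f) auto
  also have "\<dots> \<le> ennreal (2 powr p) * (ennreal (C powr p) * ennreal q + ennreal ((K * e) powr p))"
    by (intro mult_left_mono add_mono 1 2) simp
  also have "\<dots> = ennreal (2 powr p * (C powr p * q + (K * e) powr p))"
    using q by (simp add: ennreal_mult)
  also have "2 powr p * (C powr p * q + (K * e) powr p) = (2 * C) powr p * q + 2 powr p * (K * e) powr p"
    by (simp add: powr_mult algebra_simps)
  also have "ennreal \<dots> \<le> ennreal ((2 * C) powr p * q + \<epsilon>)" by (intro ennreal_leI add_left_mono Ke)
  also have "\<dots> = ennreal ((2 * C) powr p * q) + ennreal \<epsilon>" using q \<epsilon> by simp
  finally show "lp_int p (ball x r) (?W f) \<le> ennreal ((2 * C) powr p * q) + ennreal \<epsilon>" .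
qed

text \<open>c1, c2, c3, B and \<tau> are fixed data and the dimension is part of the type, so
  dependence on n, l and M only means that C precedes the quantifiers over p, \<phi>, \<psi>,
  \<Delta> and T. The Morrey norms are compared one ball at a time.\<close>

theorem theorem2:
  fixes l :: nat and M c1 c2 c3 :: real and \<tau> :: "real \<Rightarrow> real"
    and B :: "((real^'m::finite) \<times> real \<Rightarrow> nat) \<Rightarrow> real"
  assumes "l \<ge> 1"
    and "c1 > 0" and "c2 > 0" and "c3 > 0" and "\<forall>\<alpha>\<in>multi_indices. B \<alpha> > 0"
    and "stein_kernel \<tau>"
  shows "\<exists>C>0. \<forall>(p::real) (\<phi>::real \<Rightarrow> real) (\<psi>::real^'m \<Rightarrow> real)
      (\<Delta>::(real^'m) \<times> real \<Rightarrow> real) T.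
    1 \<le> p \<longrightarrow>
    (\<forall>r>0. \<phi> r > 0) \<longrightarrow>
    M-lipschitz_on UNIV \<psi> \<longrightarrow>
    regularized_distance c1 c2 B (special_domain \<psi>) \<Delta> \<longrightarrow>
    (\<forall>x y. (x, y) \<notin> closure (special_domain \<psi>) \<longrightarrow> c3 * \<Delta> (x, y) \<ge> \<psi> x - y) \<longrightarrow>
    stein_operator l p \<psi> (\<lambda>z. 2 * c3 * \<Delta> z) \<tau> T \<longrightarrow>
    (\<forall>f \<in> sobolev l p (special_domain \<psi>). \<forall>\<delta>>0. \<forall>\<alpha>\<in>multi_indices. mi_order \<alpha> \<le> l \<longrightarrow>
       morrey_norm \<phi> \<delta> p UNIV (weak_deriv UNIV \<alpha> (T f)) \<le>
       ennreal C * (\<Sum>\<beta> | \<beta> \<in> multi_indices \<and> mi_order \<beta> = mi_order \<alpha>.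
         morrey_norm \<phi> \<delta> p (special_domain \<psi>) (weak_deriv (special_domain \<psi>) \<beta> f)))"
proof -
  let ?I = "{\<alpha> \<in> multi_indices. mi_order \<alpha> \<le> l} :: ((real^'m) \<times> real \<Rightarrow> nat) set"
  have finI: "finite ?I" by (rule finite_multi_indices_le)
  have 0: "(\<lambda>_. 0) \<in> ?I" by simp
  \<comment> \<open>P names the conclusion of \<open>smooth_ball_estimate\<close>, so that a
    constant can be chosen for each \<alpha>.\<close>
  define P where "P \<alpha> C \<longleftrightarrow> (\<forall>p \<psi> \<Delta> f F W Q X r. 1 \<le> p \<longrightarrow> M-lipschitz_on UNIV \<psi> \<longrightarrow>
    regularized_distance c1 c2 B (special_domain \<psi>) \<Delta> \<longrightarrow>
    (\<forall>x y. (x, y) \<notin> closure (special_domain \<psi>) \<longrightarrow> c3 * \<Delta> (x, y) \<ge> \<psi> x - y) \<longrightarrow>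
    smooth_partials (special_domain \<psi>) f F \<longrightarrow> smooth_bounded (special_domain \<psi>) F \<longrightarrow>
    has_weak_deriv UNIV \<alpha> (stein_formula \<psi> (\<lambda>z. 2 * c3 * \<Delta> z) \<tau> f) W \<longrightarrow> W \<in> borel_measurable lebesgue \<longrightarrow>
    0 < r \<longrightarrow> (\<forall>\<beta>\<in>multi_indices. mi_order \<beta> = mi_order \<alpha> \<longrightarrow>
      (\<forall>z\<in>special_domain \<psi>. lp_int p (ball z r \<inter> special_domain \<psi>) (F \<beta>) \<le> Q)) \<longrightarrow>
    lp_int p (ball X r) W \<le> ennreal (C powr p) * Q)" for \<alpha> C
  have "\<forall>\<alpha>\<in>?I. \<exists>C. C \<ge> 1 \<and> P \<alpha> C"
    unfolding P_def by (rule ballI, rule smooth_ball_estimate[OF assms(6,2,3,4)]) simp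
  from bchoice[OF this] obtain Cf where Cf1: "\<And>\<alpha>. \<alpha> \<in> ?I \<Longrightarrow> Cf \<alpha> \<ge> 1" and Cf: "\<And>\<alpha>. \<alpha> \<in> ?I \<Longrightarrow> P \<alpha> (Cf \<alpha>)"
    by blast
  \<comment> \<open>A sum over the finitely many \<alpha> in place of a maximum; the factor 2 is the
    loss in passing from smooth functions to f.\<close>
  define C where "C = (\<Sum>\<alpha>\<in>?I. 2 * Cf \<alpha>)"
  have C_ge: "2 * Cf \<alpha> \<le> C" if "\<alpha> \<in> ?I" for \<alpha>
    unfolding C_def using that finI order_trans[OF zero_le_one Cf1] by (intro member_le_sum) auto
  have C0: "C > 0" using C_ge[OF 0] Cf1[OF 0] by linarith
  have main: "morrey_norm \<phi> \<delta> p UNIV (weak_deriv UNIV \<alpha> (T f)) \<le>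
       ennreal C * (\<Sum>\<beta> | \<beta> \<in> multi_indices \<and> mi_order \<beta> = mi_order \<alpha>.
         morrey_norm \<phi> \<delta> p (special_domain \<psi>) (weak_deriv (special_domain \<psi>) \<beta> f))"
    if p: "1 \<le> p" and \<phi>: "\<forall>r>0. \<phi> r > 0" and \<psi>: "M-lipschitz_on UNIV \<psi>"
      and \<Delta>: "regularized_distance c1 c2 B (special_domain \<psi>) \<Delta>"
      and c3: "\<forall>x y. (x, y) \<notin> closure (special_domain \<psi>) \<longrightarrow> c3 * \<Delta> (x, y) \<ge> \<psi> x - y"
      and T: "stein_operator l p \<psi> (\<lambda>z. 2 * c3 * \<Delta> z) \<tau> T"
      and f: "f \<in> sobolev l p (special_domain \<psi>)" and \<alpha>: "\<alpha> \<in> multi_indices" "mi_order \<alpha> \<le> l"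
    for p \<phi> \<psi> \<Delta> T f \<delta> \<alpha>
  proof -
    let ?\<Omega> = "special_domain \<psi>" and ?J = "{\<beta>. \<beta> \<in> multi_indices \<and> mi_order \<beta> = mi_order \<alpha>}"
    define S where "S = (\<Sum>\<beta>\<in>?J. morrey_norm \<phi> \<delta> p ?\<Omega> (weak_deriv ?\<Omega> \<beta> f))"
    have \<alpha>I: "\<alpha> \<in> ?I" using \<alpha> by simp
    show ?thesis
    proof (cases S)
      \<comment> \<open>C > 0 makes the right-hand side infinite here.\<close>
      case top
      then show ?thesis using C0 by (simp add: S_def[symmetric] ennreal_mult_top)
    next
      case (real s)
      have "morrey_norm \<phi> \<delta> p UNIV (weak_deriv UNIV \<alpha> (T f)) \<le> ennreal (C * s)"
        unfolding morrey_norm_eq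
      proof (rule SUP_least, clarify)
        fix x :: "real^'m" and y r :: real assume r: "r \<in> {0<..<\<delta>}"
        then have r0: "r > 0" and \<phi>r: "\<phi> r > 0" using \<phi> by auto
        \<comment> \<open>The bound s on the Morrey norms, rewritten as a bound on integrals over
          balls of this one radius; \<phi> enters through this number only.\<close>
        define q where "q = \<phi> r * s powr p"
        have q: "q \<ge> 0" using \<phi>r by (simp add: q_def)
        have Q: "lp_int p (ball z r \<inter> ?\<Omega>) (weak_deriv ?\<Omega> \<beta> f) \<le> ennreal q"
          if \<beta>: "\<beta> \<in> multi_indices" "mi_order \<beta> = mi_order \<alpha>" and z: "z \<in> ?\<Omega>" for \<beta> z
        proof -
          have "ennreal_powr (ennreal (1 / \<phi> r) * lp_int p (ball z r \<inter> ?\<Omega>) (weak_deriv ?\<Omega> \<beta> f)) (1 / p) \<le>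
              morrey_norm \<phi> \<delta> p ?\<Omega> (weak_deriv ?\<Omega> \<beta> f)"
            unfolding morrey_norm_eq by (rule SUP_upper2[of "(z, r)"]) (use z r in auto)
          also have "\<dots> \<le> S"
            unfolding S_def using \<beta> finite_multi_indices_eq by (intro member_le_sum) auto
          finally show ?thesis
            unfolding real(2) q_def by (subst (asm) ennreal_powr_le_iff[OF \<phi>r real(1) p])
        qed
        have "lp_int p (ball (x, y) r) (weak_deriv UNIV \<alpha> (T f)) \<le> ennreal ((2 * Cf \<alpha>) powr p * q)"
        proof (rule stein_ball_estimate[OF \<psi> p T f \<alpha> q _ _ Q])
          show "0 \<le> Cf \<alpha>" using Cf1[OF \<alpha>I] by simp
          fix h H W
          assume h: "smooth_partials ?\<Omega> h H" "smooth_bounded ?\<Omega> H"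
            "has_weak_deriv UNIV \<alpha> (stein_formula \<psi> (\<lambda>z. 2 * c3 * \<Delta> z) \<tau> h) W" "W \<in> borel_measurable lebesgue"
            and hQ: "\<And>\<beta> z. \<beta> \<in> multi_indices \<Longrightarrow> mi_order \<beta> = mi_order \<alpha> \<Longrightarrow> z \<in> ?\<Omega> \<Longrightarrow>
              lp_int p (ball z r \<inter> ?\<Omega>) (H \<beta>) \<le> ennreal q"
          have "\<forall>\<beta>\<in>multi_indices. mi_order \<beta> = mi_order \<alpha> \<longrightarrow>
              (\<forall>z\<in>?\<Omega>. lp_int p (ball z r \<inter> ?\<Omega>) (H \<beta>) \<le> ennreal q)" using hQ by blast
          then show "lp_int p (ball (x, y) r) W \<le> ennreal (Cf \<alpha> powr p) * ennreal q"
            using Cf[OF \<alpha>I] p \<psi> \<Delta> c3 h r0 unfolding P_def by simp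
        qed
        also have "\<dots> \<le> ennreal (\<phi> r * (C * s) powr p)"
        proof (rule ennreal_leI)
          have "(2 * Cf \<alpha>) powr p \<le> C powr p" using C_ge[OF \<alpha>I] Cf1[OF \<alpha>I] p by (intro powr_mono2) auto
          then have "(2 * Cf \<alpha>) powr p * q \<le> C powr p * q" using q by (rule mult_right_mono)
          also have "\<dots> = \<phi> r * (C * s) powr p" by (simp add: q_def powr_mult)
          finally show "(2 * Cf \<alpha>) powr p * q \<le> \<phi> r * (C * s) powr p" .
        qed
        finally show "ennreal_powr (ennreal (1 / \<phi> r) * lp_int p (ball (x, y) r \<inter> UNIV) (weak_deriv UNIV \<alpha> (T f))) (1 / p)
            \<le> ennreal (C * s)"
          using C0 real(1) by (subst ennreal_powr_le_iff[OF \<phi>r _ p]) auto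
      qed
      also have "\<dots> = ennreal C * S" using C0 real by (simp add: ennreal_mult)
      finally show ?thesis by (simp add: S_def)
    qed
  qed
  show ?thesis
    by (intro exI[of _ C] conjI allI impI ballI C0) (rule main)
qed

end
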